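(* Let $\Omega$, $D_0$, $\mathbb{C}^i$, $\mathbb{C}^e$, the vector field $\mathcal{U}$, $\Phi_t=\mathrm{Id}+t\,\mathcal{U}$ and $D_t=\Phi_t(D_0)$ be as in the context. Let $f\in H^{1/2}(\partial\Omega)$ and, for $t\in[0,1]$, let $u_t\in H^1(\Omega)$ be the weak solution of $\mathrm{div}(\mathbb{C}^{D_t}\nabla u_t)=0$ in $\Omega$, $u_t=f$ on $\partial\Omega$. Then the material derivative $$\dot u_0=\lim_{t\to0}\frac{u_t\circ\Phi_t-u_0}{t}\in H^1_0(\Omega)$$ exists (limit in the $H^1(\Omega)$-topology) and, for every $\psi\in H^1_0(\Omega)$, $$\int_\Omega\mathbb{C}^{D_0}\nabla\dot u_0\cdot\nabla\psi=-\int_\Omega\Big\{\big(\mathbb{C}^{D_0}\nabla u_0\big)\big((\mathrm{div}\,\mathcal{U})I_3-(D\mathcal{U})^T\big)-\mathbb{C}^{D_0}\big(\nabla u_0\,D\mathcal{U}\big)\Big\}\cdot\nabla\psi .$$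
   Context: Constants $r_0>0$, $M_0\ge1$, $M_1>1$, $\theta_0\in(0,\pi/2)$ are given. $\Omega\subset\mathbb{R}^3$ is a bounded domain with $\mathrm{diam}(\Omega)\le M_1r_0$. Lipschitz regularity: a portion $S$ of the boundary of a bounded domain $U\subset\mathbb{R}^3$ is of Lipschitz class with constants $r_0,M_0$ if for every $P\in S$ there is a rigid change of coordinates in which $P=0$ and $U\cap R=\{x\in R: x_3>g(x_1,x_2)\}$, where $R=[-r_0,r_0]^2\times[-2M_0r_0,2M_0r_0]$, $g(0)=0$, $\|g\|_{L^\infty}+r_0\,\mathrm{Lip}(g)\le M_0r_0$ (analogously in the plane). A polyhedron is a closed set $D\subset\mathbb{R}^3$ homeomorphic to a closed ball with $\partial D$ a finite union of faces (closed simply connected plane polygonal regions) with pairwise disjoint relative interiors; edges are nondegenerate segments that are intersections of two faces, vertices are nonempty intersections of two edges. The class $\mathcal{P}$ consists of polyhedra $D\subset\Omega$ such that: $\mathrm{dist}(D,\partial\Omega)\ge r_0$; every dihedral angle at an edge and every internal angle of a face lies in $(\theta_0,\pi-\theta_0)\cup(\pi+\theta_0,2\pi-\theta_0)$; every edge has length $\ge r_0$; $\Omega\setminus D$ has Lipschitz boundary with constants $r_0,M_0$, and each face has Lipschitz boundary with constants $r_0,M_0$ in its plane. Elasticity: $\mathbb{C}^sA=2\mu^s\widehat A+\lambda^s(\mathrm{tr}A)I_3$, $\widehat A=\frac12(A+A^T)$, $\mu^s\ge\alpha_0>0$, $2\mu^s+3\lambda^s\ge\gamma_0>0$, $0\le\frac{\lambda^s}{2(\lambda^s+\mu^s)}<\frac12$,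 $s\in\{i,e\}$, and $(\lambda^i-\lambda^e)^2+(\mu^i-\mu^e)^2\ge\eta_0>0$. $\mathbb{C}^{D}=\mathbb{C}^i\chi_D+\mathbb{C}^e\chi_{\Omega\setminus D}$, so $\mathbb{C}^{D_t}(x)=\mathbb{C}^{D_0}(\Phi_t^{-1}(x))$. Vector field: $D_0,D_1\in\mathcal{P}$ and $d_H=d_H(\partial D_0,\partial D_1)$ (Hausdorff distance) satisfies $d_H\le\delta r_0$ with $\delta$ a sufficiently small constant depending only on $M_0,M_1,\theta_0$, so that $D_0,D_1$ have the same number $N$ of vertices, suitably ordered. $\mathcal{U}\in W^{1,\infty}(\mathbb{R}^3,\mathbb{R}^3)$ is a fixed field such that $\mathcal{U}(V_i^{D_0})=V_i^{D_1}-V_i^{D_0}$ for all $i$; $\mathrm{supp}\,\mathcal{U}\subset\{\mathrm{dist}(x,D_0)\le r_0/4\}$; $\|\mathcal{U}\|_\infty+r_0\|D\mathcal{U}\|_\infty\le\widetilde Cd_H$ with $\widetilde C$ depending only on $\theta_0,M_1$; $d_H\le r_0/(3\widetilde C)$ (so $\|D\mathcal{U}\|_\infty\le\frac13$); each $\Phi_t=\mathrm{Id}+t\,\mathcal{U}$, $t\in[0,1]$, is an invertible bi-Lipschitz map of $\Omega$ onto itself with $\frac12\le\det D\Phi_t\le\frac32$; and $\Phi_1(D_0)=D_1$. Notation: functions are $\mathbb{R}^3$-valued, $(\nabla u)_{ij}=\partial u_i/\partial x_j$, $D\mathcal{U}$ is the Jacobian matrix, juxtaposition of matrices is the matrix product,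 $A\cdot B=\sum_{ij}A_{ij}B_{ij}$. *)

theory Defs
  imports "HOL-Analysis.Analysis" "HOL-Probability.Essential_Supremum"
begin

section \<open>Sobolev spaces\<close>

definition partial :: "3 \<Rightarrow> (real^3 \<Rightarrow> real) \<Rightarrow> real^3 \<Rightarrow> real" where
  "partial j \<phi> x = frechet_derivative \<phi> (at x) (axis j 1)"

definition support :: "(real^3 \<Rightarrow> 'b::zero) \<Rightarrow> (real^3) set" where
  "support \<phi> = closure {x. \<phi> x \<noteq> 0}"

definition smooth :: "(real^3 \<Rightarrow> real) \<Rightarrow> bool" where
  "smooth \<phi> \<longleftrightarrow> (\<forall>js. foldr partial js \<phi> differentiable_on UNIV)"

definition test_functions :: "(real^3) set \<Rightarrow> (real^3 \<Rightarrow> real) set" where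
  "test_functions \<Omega> = {\<phi>. smooth \<phi> \<and> compact (support \<phi>) \<and> support \<phi> \<subseteq> \<Omega>}"

definition vector_test_functions :: "(real^3) set \<Rightarrow> (real^3 \<Rightarrow> real^3) set" where
  "vector_test_functions \<Omega> = {\<phi>. \<forall>i. (\<lambda>x. \<phi> x $ i) \<in> test_functions \<Omega>}"

definition locally_integrable_on :: "(real^3 \<Rightarrow> 'b::euclidean_space) \<Rightarrow> (real^3) set \<Rightarrow> bool"
    (infix "locally'_integrable'_on" 50) where
  "u locally_integrable_on \<Omega> \<longleftrightarrow>
     (\<forall>K. compact K \<and> K \<subseteq> \<Omega> \<longrightarrow> set_integrable lebesgue K u)"

definition has_weak_jacobian ::
    "(real^3) set \<Rightarrow> (real^3 \<Rightarrow> real^3) \<Rightarrow> (real^3 \<Rightarrow> real^3^3) \<Rightarrow> bool" where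
  "has_weak_jacobian \<Omega> u G \<longleftrightarrow>
     u locally_integrable_on \<Omega> \<and> G locally_integrable_on \<Omega> \<and>
     (\<forall>\<phi>\<in>test_functions \<Omega>. \<forall>i j.
        (LINT x|lebesgue_on \<Omega>. u x $ i * partial j \<phi> x) =
        - (LINT x|lebesgue_on \<Omega>. G x $ i $ j * \<phi> x))"

text \<open>The entry \<open>$ i $ j\<close> is the weak derivative of the \<open>i\<close>-th component with respect to the
  \<open>j\<close>-th variable. Weak Jacobians are unique up to null sets, so the integrals and essential suprema
  below do not depend on the choice.\<close>

definition weak_jacobian :: "(real^3) set \<Rightarrow> (real^3 \<Rightarrow> real^3) \<Rightarrow> real^3 \<Rightarrow> real^3^3" where
  "weak_jacobian \<Omega> u = (SOME G. has_weak_jacobian \<Omega> u G)"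

definition L2 :: "(real^3) set \<Rightarrow> (real^3 \<Rightarrow> 'b::euclidean_space) set" where
  "L2 \<Omega> = {u. u \<in> borel_measurable (lebesgue_on \<Omega>) \<and>
               integrable (lebesgue_on \<Omega>) (\<lambda>x. (norm (u x))\<^sup>2)}"

text \<open>Elements of \<open>H1\<close> and \<open>H10\<close> are functions rather than classes modulo null sets, and
  their values outside \<open>\<Omega>\<close> are irrelevant.\<close>

definition H1 :: "(real^3) set \<Rightarrow> (real^3 \<Rightarrow> real^3) set" where
  "H1 \<Omega> = {u \<in> L2 \<Omega>. \<exists>G\<in>L2 \<Omega>. has_weak_jacobian \<Omega> u G}"

definition H1_norm :: "(real^3) set \<Rightarrow> (real^3 \<Rightarrow> real^3) \<Rightarrow> real" where
  "H1_norm \<Omega> u = sqrt ((LINT x|lebesgue_on \<Omega>. (norm (u x))\<^sup>2) +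
                       (LINT x|lebesgue_on \<Omega>. (norm (weak_jacobian \<Omega> u x))\<^sup>2))"

definition H10 :: "(real^3) set \<Rightarrow> (real^3 \<Rightarrow> real^3) set" where
  "H10 \<Omega> = {u \<in> H1 \<Omega>. \<exists>\<phi>::nat \<Rightarrow> real^3 \<Rightarrow> real^3.
     (\<forall>n. \<phi> n \<in> vector_test_functions \<Omega>) \<and> (\<lambda>n. H1_norm \<Omega> (\<lambda>x. \<phi> n x - u x)) \<longlonglongrightarrow> 0}"

definition tendsto_H1 ::
    "(real^3) set \<Rightarrow> ('t \<Rightarrow> real^3 \<Rightarrow> real^3) \<Rightarrow> (real^3 \<Rightarrow> real^3) \<Rightarrow> 't filter \<Rightarrow> bool" where
  "tendsto_H1 \<Omega> w l F \<longleftrightarrow> l \<in> H1 \<Omega> \<and> (\<forall>\<^sub>F t in F. w t \<in> H1 \<Omega>) \<and>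
     ((\<lambda>t. H1_norm \<Omega> (\<lambda>x. w t x - l x)) \<longlongrightarrow> 0) F"

text \<open>\<open>H\<^sup>1\<^sup>/\<^sup>2(\<partial>\<Omega>)\<close> is the trace space of \<open>H\<^sup>1(\<Omega>)\<close>, taken in its standard description as the
  quotient \<open>H\<^sup>1(\<Omega>) / H\<^sup>1\<^sub>0(\<Omega>)\<close>; the trace of \<open>u\<close> is its class.\<close>

definition boundary_trace :: "(real^3) set \<Rightarrow> (real^3 \<Rightarrow> real^3) \<Rightarrow> (real^3 \<Rightarrow> real^3) set" where
  "boundary_trace \<Omega> u = {v \<in> H1 \<Omega>. (\<lambda>x. v x - u x) \<in> H10 \<Omega>}"

definition H_half_boundary :: "(real^3) set \<Rightarrow> (real^3 \<Rightarrow> real^3) set set" where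
  "H_half_boundary \<Omega> = boundary_trace \<Omega> ` H1 \<Omega>"

text \<open>Members of \<open>W\<^sup>1\<^sup>,\<^sup>\<infinity>\<close> are identified with their continuous representatives,
  since they are evaluated pointwise.\<close>

definition W1_inf :: "(real^3 \<Rightarrow> real^3) set" where
  "W1_inf = {U. continuous_on UNIV U \<and> (\<exists>G. has_weak_jacobian UNIV U G) \<and>
     esssup lebesgue (\<lambda>x. ereal (norm (U x))) < \<infinity> \<and>
     esssup lebesgue (\<lambda>x. ereal (norm (weak_jacobian UNIV U x))) < \<infinity>}"


section \<open>Lipschitz boundaries\<close>

definition orthonormal_frame :: "('k::finite \<Rightarrow> real^3) \<Rightarrow> bool" where
  "orthonormal_frame e \<longleftrightarrow> (\<forall>i j. e i \<bullet> e j = (if i = j then 1 else 0))"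

definition lipschitz_graph ::
    "real \<Rightarrow> real \<Rightarrow> 'a::real_normed_vector set \<Rightarrow> ('a \<Rightarrow> real) \<Rightarrow> bool" where
  "lipschitz_graph r0 M0 Q g \<longleftrightarrow> g 0 = 0 \<and>
     (\<exists>K L. (\<forall>y\<in>Q. \<bar>g y\<bar> \<le> K) \<and> L-lipschitz_on Q g \<and> K + r0 * L \<le> M0 * r0)"

definition lipschitz_boundary_portion ::
    "real \<Rightarrow> real \<Rightarrow> (real^3) set \<Rightarrow> (real^3) set \<Rightarrow> bool" where
  "lipschitz_boundary_portion r0 M0 U S \<longleftrightarrow> (\<forall>P\<in>S. \<exists>e :: 3 \<Rightarrow> real^3. \<exists>g :: real \<times> real \<Rightarrow> real.
     orthonormal_frame e \<and> lipschitz_graph r0 M0 ({-r0..r0} \<times> {-r0..r0}) g \<and>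
     (\<forall>x1\<in>{-r0..r0}. \<forall>x2\<in>{-r0..r0}. \<forall>x3\<in>{-2*M0*r0..2*M0*r0}.
        P + x1 *\<^sub>R e 1 + x2 *\<^sub>R e 2 + x3 *\<^sub>R e 3 \<in> U \<longleftrightarrow> x3 > g (x1, x2)))"

text \<open>The planar analogue, for the relative interior of a plane region \<open>F\<close> inside its plane.\<close>

definition planar_lipschitz_boundary :: "real \<Rightarrow> real \<Rightarrow> (real^3) set \<Rightarrow> bool" where
  "planar_lipschitz_boundary r0 M0 F \<longleftrightarrow>
     (\<forall>P\<in>rel_frontier F. \<exists>e :: 2 \<Rightarrow> real^3. \<exists>g :: real \<Rightarrow> real.
     orthonormal_frame e \<and> range (\<lambda>(s, t). P + s *\<^sub>R e 1 + t *\<^sub>R e 2) = affine hull F \<and>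
     lipschitz_graph r0 M0 {-r0..r0} g \<and>
     (\<forall>x1\<in>{-r0..r0}. \<forall>x2\<in>{-2*M0*r0..2*M0*r0}.
        P + x1 *\<^sub>R e 1 + x2 *\<^sub>R e 2 \<in> rel_interior F \<longleftrightarrow> x2 > g x1))"


section \<open>Polyhedra\<close>

definition polygonal_region :: "(real^3) set \<Rightarrow> bool" where
  "polygonal_region F \<longleftrightarrow> compact F \<and> aff_dim F = 2 \<and> simply_connected F \<and>
     connected (rel_interior F) \<and> closure (rel_interior F) = F \<and>
     (\<exists>S. finite S \<and> rel_frontier F = (\<Union>(a, b)\<in>S. closed_segment a b))"

text \<open>The faces \<open>\<F>\<close> are explicit data. (The library's \<open>polyhedron\<close> is an intersection of
  half-spaces, hence convex; convexity is not required here.)\<close>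

definition polyhedron_with_faces :: "(real^3) set \<Rightarrow> (real^3) set set \<Rightarrow> bool" where
  "polyhedron_with_faces D \<F> \<longleftrightarrow> closed D \<and> D homeomorphic cball (0::real^3) 1 \<and>
     finite \<F> \<and> (\<forall>F\<in>\<F>. polygonal_region F) \<and> frontier D = \<Union>\<F> \<and>
     (\<forall>F\<in>\<F>. \<forall>G\<in>\<F>. F \<noteq> G \<longrightarrow> rel_interior F \<inter> rel_interior G = {})"

definition edges :: "(real^3) set set \<Rightarrow> (real^3) set set" where
  "edges \<F> = {E. (\<exists>F\<in>\<F>. \<exists>G\<in>\<F>. F \<noteq> G \<and> E = F \<inter> G) \<and> (\<exists>a b. a \<noteq> b \<and> E = closed_segment a b)}"

definition vertices :: "(real^3) set set \<Rightarrow> (real^3) set" where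
  "vertices \<F> = {v. \<exists>E\<in>edges \<F>. \<exists>E'\<in>edges \<F>. E \<noteq> E' \<and> E \<inter> E' = {v}}"

definition sector :: "real \<Rightarrow> real^3 \<Rightarrow> real^3 \<Rightarrow> (real^3) set" where
  "sector \<alpha> a b = {\<rho> *\<^sub>R (cos \<phi> *\<^sub>R a + sin \<phi> *\<^sub>R b) |\<rho> \<phi>. 0 \<le> \<rho> \<and> 0 \<le> \<phi> \<and> \<phi> \<le> \<alpha>}"

text \<open>The angle is the one measured inside \<open>D\<close>: near each relatively interior point of the edge,
  \<open>D\<close> is a wedge of opening \<open>\<alpha>\<close>.\<close>

definition dihedral_angle :: "(real^3) set \<Rightarrow> (real^3) set \<Rightarrow> real \<Rightarrow> bool" where
  "dihedral_angle D E \<alpha> \<longleftrightarrow> 0 < \<alpha> \<and> \<alpha> < 2 * pi \<and>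
     (\<forall>p\<in>rel_interior E. \<exists>e :: 3 \<Rightarrow> real^3. \<exists>\<epsilon>>0.
        orthonormal_frame e \<and> E \<subseteq> range (\<lambda>s. p + s *\<^sub>R e 3) \<and>
        D \<inter> ball p \<epsilon> = {p + s *\<^sub>R e 3 + y |s y. y \<in> sector \<alpha> (e 1) (e 2)} \<inter> ball p \<epsilon>)"

definition internal_angle :: "(real^3) set \<Rightarrow> real^3 \<Rightarrow> real \<Rightarrow> bool" where
  "internal_angle F v \<alpha> \<longleftrightarrow> 0 < \<alpha> \<and> \<alpha> < 2 * pi \<and>
     (\<exists>e :: 2 \<Rightarrow> real^3. \<exists>\<epsilon>>0. orthonormal_frame e \<and>
        F \<inter> ball v \<epsilon> = {v + y |y. y \<in> sector \<alpha> (e 1) (e 2)} \<inter> ball v \<epsilon>)"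

definition admissible_angles :: "real \<Rightarrow> real set" where
  "admissible_angles \<theta>0 = {\<theta>0<..<pi - \<theta>0} \<union> {pi + \<theta>0<..<2 * pi - \<theta>0}"

text \<open>\<open>D\<close> belongs to the class \<open>\<P>\<close>, with faces \<open>\<F>\<close>.\<close>

definition class_P ::
    "real \<Rightarrow> real \<Rightarrow> real \<Rightarrow> (real^3) set \<Rightarrow> (real^3) set \<Rightarrow> (real^3) set set \<Rightarrow> bool" where
  "class_P r0 M0 \<theta>0 \<Omega> D \<F> \<longleftrightarrow>
     polyhedron_with_faces D \<F> \<and> D \<subseteq> \<Omega> \<and> setdist D (frontier \<Omega>) \<ge> r0 \<and>
     (\<forall>E\<in>edges \<F>. \<exists>\<alpha>\<in>admissible_angles \<theta>0. dihedral_angle D E \<alpha>) \<and>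
     (\<forall>F\<in>\<F>. \<forall>v\<in>vertices \<F> \<inter> F. \<exists>\<alpha>\<in>admissible_angles \<theta>0. internal_angle F v \<alpha>) \<and>
     (\<forall>E\<in>edges \<F>. diameter E \<ge> r0) \<and>
     lipschitz_boundary_portion r0 M0 (\<Omega> - D) (frontier (\<Omega> - D)) \<and>
     (\<forall>F\<in>\<F>. planar_lipschitz_boundary r0 M0 F)"

definition hausdorff_dist :: "(real^3) set \<Rightarrow> (real^3) set \<Rightarrow> real" where
  "hausdorff_dist S T = max (SUP x\<in>S. infdist x T) (SUP y\<in>T. infdist y S)"


section \<open>The deformation field\<close>

definition flow :: "(real^3 \<Rightarrow> real^3) \<Rightarrow> real \<Rightarrow> real^3 \<Rightarrow> real^3" where
  "flow U t x = x + t *\<^sub>R U x"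

definition bilipschitz_self_map :: "(real^3) set \<Rightarrow> (real^3 \<Rightarrow> real^3) \<Rightarrow> bool" where
  "bilipschitz_self_map \<Omega> \<Phi> \<longleftrightarrow> bij_betw \<Phi> \<Omega> \<Omega> \<and>
     (\<exists>L. L-lipschitz_on \<Omega> \<Phi>) \<and> (\<exists>L. L-lipschitz_on \<Omega> (inv_into \<Omega> \<Phi>))"

text \<open>The enumerations \<open>V0\<close>, \<open>V1\<close> express that both polyhedra have \<open>N\<close> vertices and fix
  their order.\<close>

definition deformation_field :: "real \<Rightarrow> real \<Rightarrow> (real^3) set \<Rightarrow>
    (real^3) set \<Rightarrow> (real^3) set set \<Rightarrow> (real^3) set \<Rightarrow> (real^3) set set \<Rightarrow>
    (real^3 \<Rightarrow> real^3) \<Rightarrow> bool" where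
  "deformation_field r0 Ctil \<Omega> D0 \<F>0 D1 \<F>1 U \<longleftrightarrow>
     U \<in> W1_inf \<and>
     (\<exists>N :: nat. \<exists>V0 V1. bij_betw V0 {..<N} (vertices \<F>0) \<and> bij_betw V1 {..<N} (vertices \<F>1) \<and>
        (\<forall>i<N. U (V0 i) = V1 i - V0 i)) \<and>
     support U \<subseteq> {x. infdist x D0 \<le> r0 / 4} \<and>
     esssup lebesgue (\<lambda>x. ereal (norm (U x))) +
       ereal r0 * esssup lebesgue (\<lambda>x. ereal (norm (weak_jacobian UNIV U x)))
       \<le> ereal (Ctil * hausdorff_dist (frontier D0) (frontier D1)) \<and>
     hausdorff_dist (frontier D0) (frontier D1) \<le> r0 / (3 * Ctil) \<and>
     (\<forall>t\<in>{0..1}. bilipschitz_self_map \<Omega> (flow U t) \<and>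
        (AE x in lebesgue_on \<Omega>. 1/2 \<le> det (weak_jacobian UNIV (flow U t) x) \<and>
                               det (weak_jacobian UNIV (flow U t) x) \<le> 3/2)) \<and>
     flow U 1 ` D0 = D1"


section \<open>Elasticity\<close>

definition sym_part :: "real^3^3 \<Rightarrow> real^3^3" where
  "sym_part A = (1/2) *\<^sub>R (A + transpose A)"

definition elasticity :: "real \<Rightarrow> real \<Rightarrow> real^3^3 \<Rightarrow> real^3^3" where
  "elasticity \<mu> la A = (2 * \<mu>) *\<^sub>R sym_part A + (la * trace A) *\<^sub>R mat 1"

definition admissible_lame :: "real \<Rightarrow> real \<Rightarrow> real \<Rightarrow> real \<Rightarrow> bool" where
  "admissible_lame \<alpha>0 \<gamma>0 \<mu> la \<longleftrightarrow> \<mu> \<ge> \<alpha>0 \<and> 2 * \<mu> + 3 * la \<ge> \<gamma>0 \<and>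
     0 \<le> la / (2 * (la + \<mu>)) \<and> la / (2 * (la + \<mu>)) < 1/2"

definition elasticity_field :: "(real^3^3 \<Rightarrow> real^3^3) \<Rightarrow> (real^3^3 \<Rightarrow> real^3^3) \<Rightarrow>
    (real^3) set \<Rightarrow> (real^3) set \<Rightarrow> real^3 \<Rightarrow> real^3^3 \<Rightarrow> real^3^3" where
  "elasticity_field Ci Ce \<Omega> D x A =
     indicat_real D x *\<^sub>R Ci A + indicat_real (\<Omega> - D) x *\<^sub>R Ce A"

definition weak_solution :: "(real^3) set \<Rightarrow> (real^3 \<Rightarrow> real^3^3 \<Rightarrow> real^3^3) \<Rightarrow>
    (real^3 \<Rightarrow> real^3) set \<Rightarrow> (real^3 \<Rightarrow> real^3) \<Rightarrow> bool" where
  "weak_solution \<Omega> C f u \<longleftrightarrow> u \<in> H1 \<Omega> \<and> boundary_trace \<Omega> u = f \<and>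
     (\<forall>\<psi>\<in>H10 \<Omega>. (LINT x|lebesgue_on \<Omega>. C x (weak_jacobian \<Omega> u x) \<bullet> weak_jacobian \<Omega> \<psi> x) = 0)"

end

theory Submission
  imports Defs
begin

text \<open>Write \<open>B = D\<U>\<close>. Pulled back by \<open>\<Phi>\<^sub>t\<close>, the equation of \<open>u\<^sub>t\<close> becomes an equation for
  \<open>u\<^sub>t \<circ> \<Phi>\<^sub>t\<close> with the coefficient
  \<open>A \<mapsto> det (1 + tB) \<cdot> C\<^sup>0 (A (1 + tB)\<^sup>-\<^sup>1) (1 + tB)\<^sup>-\<^sup>T\<close>, in which the inclusion no longer moves; it is
  \<open>C\<^sup>0\<close> plus \<open>t\<close> times the tensor on the right of the claim, up to an error \<open>O(t\<^sup>2)\<close> that is uniform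
  in \<open>x\<close>. The difference quotients lie in \<open>H\<^sup>1\<^sub>0\<close> because \<open>\<U>\<close> vanishes near the boundary, and by
  coercivity and the Korn and Poincare inequalities they form a Cauchy family with rate \<open>O(t)\<close>;
  their limit solves the linearised equation.

  Since \<open>\<U>\<close> is only Lipschitz, the chain rule and the change of variables for \<open>\<Phi>\<^sub>t\<close> are obtained
  by mollifying \<open>\<U>\<close>. The limit passes through compositions because \<open>\<Phi>\<^sub>t\<close> and its mollifications do
  not contract distances by more than a fixed factor, so that composing with them is bounded on
  \<open>L\<^sup>2\<close>.\<close>

subsection \<open>Composition with expanding maps\<close>

text \<open>Low regularity shapes the argument: the coefficient jumps across the faces, and the
  Jacobian of \<open>\<Phi>\<close> is only bounded and measurable. The Jacobians of the smooth maps
  \<open>\<Phi>n\<close> therefore converge merely almost everywhere along a subsequence. This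
  suffices because in every limit the other factor, a square integrable function composed with
  \<open>\<Phi>n\<close>, converges strongly. No Hilbert space theorem solves the linearised
  problem: its solution is the limit of the difference quotients, and completeness of L2 is the only
  existence principle. Korn's inequality is needed only for zero boundary values, where it is a
  computation with the explicit constant 2. The smallness thresholds fit together as follows. The
  matrix t times the Jacobian of the field is kept below 1/100 in norm; mollifying it entry by entry
  costs a factor nine, and 9/100 is still below 1/10, under which inverse and determinant of a
  perturbed identity are controlled. This restricts only t, which is harmless for a limit at
  0.\<close>

definition expanding :: "real \<Rightarrow> ('a::euclidean_space \<Rightarrow> 'a) \<Rightarrow> bool" where
  "expanding c T \<longleftrightarrow> c > 0 \<and> continuous_on UNIV T \<and> (\<forall>x y. c * dist x y \<le> dist (T x) (T y))"

lemma expanding_inj: "expanding c T \<Longrightarrow> inj T"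
  unfolding expanding_def inj_def by (metis dist_eq_0_iff mult_pos_pos not_le zero_less_dist_iff)

lemma expanding_borel: "expanding c T \<Longrightarrow> T \<in> borel_measurable borel"
  unfolding expanding_def by (simp add: borel_measurable_continuous_onI)

text \<open>The preimage is the image of N under the inverse of T, which is Lipschitz with constant
  1/c on the range of T, and Lipschitz maps preserve null sets.\<close>

lemma expanding_vimage_null:
  fixes T :: "'a::euclidean_space \<Rightarrow> 'a"
  assumes T: "expanding c T" and N: "negligible N"
  shows "negligible (T -` N)"
proof -
  let ?N = "N \<inter> range T"
  have inv: "inv T (T x) = x" for x
    using expanding_inj[OF T] by simp
  have c: "c > 0" and le: "\<And>x y. c * dist x y \<le> dist (T x) (T y)"
    using T unfolding expanding_def by auto
  have "negligible (inv T ` ?N)"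
  proof (rule negligible_locally_Lipschitz_image)
    show "negligible ?N"
      using N negligible_subset by blast
    fix x assume x: "x \<in> ?N"
    show "\<exists>S B. open S \<and> x \<in> S \<and> (\<forall>y\<in>?N \<inter> S. norm (inv T y - inv T x) \<le> B * norm (y - x))"
    proof (intro exI conjI ballI)
      show "open UNIV" "x \<in> UNIV" by auto
      fix y assume "y \<in> ?N \<inter> UNIV"
      then obtain a b where "y = T a" "x = T b" using x by auto
      then show "norm (inv T y - inv T x) \<le> (1/c) * norm (y - x)"
        using le[of a b] c inv by (simp add: dist_norm field_simps)
    qed
  qed auto
  moreover have "T -` N \<subseteq> inv T ` ?N"
    using inv by (metis IntI imageI rangeI subsetI vimageE)
  ultimately show ?thesis using negligible_subset by blast
qed

text \<open>Continuity gives measurability only for Borel sets in the target. That null sets pull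
  back to null sets is what lets the target be completed.\<close>

lemma expanding_measurable:
  fixes T :: "'a::euclidean_space \<Rightarrow> 'a"
  assumes T: "expanding c T"
  shows "T \<in> lebesgue \<rightarrow>\<^sub>M lebesgue"
proof (rule completion.measurable_completion2)
  show *: "T \<in> lebesgue \<rightarrow>\<^sub>M lborel"
    using measurable_completion[of T lborel lborel] expanding_borel[OF T] by simp
  show "null_sets lborel \<subseteq> null_sets (distr lebesgue lborel T)"
  proof
    fix N :: "'a set" assume N: "N \<in> null_sets lborel"
    then have "negligible N"
      by (simp add: negligible_iff_null_sets null_sets_completionI)
    then have "T -` N \<in> null_sets lebesgue"
      using expanding_vimage_null[OF T] negligible_iff_null_sets by blast
    then show "N \<in> null_sets (distr lebesgue lborel T)"
      using N * by (auto simp: null_sets_def emeasure_distr)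
  qed
qed

text \<open>Two points in the preimage of a cube of side s are at distance at most DIM * s / c, the
  diameter of the cube being bounded through the 1-norm. The preimage thus fits into a cube of this
  half side centred at any of its points, which explains the factor 2 * DIM / c per
  dimension.\<close>

lemma expanding_emeasure_cube:
  fixes T :: "'a::euclidean_space \<Rightarrow> 'a"
  assumes T: "expanding c T" and s: "s \<ge> 0" and uv: "\<And>i. i \<in> Basis \<Longrightarrow> v \<bullet> i - u \<bullet> i = s"
  shows "emeasure lebesgue (T -` cbox u v)
     \<le> ennreal ((2 * DIM('a) / c) ^ DIM('a)) * emeasure lebesgue (cbox u v)"
proof (cases "T -` cbox u v = {}")
  case False
  then obtain x where x: "T x \<in> cbox u v" by auto
  have c: "c > 0" and le: "\<And>x y. c * dist x y \<le> dist (T x) (T y)"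
    using T unfolding expanding_def by auto
  define r where "r = DIM('a) * s / c"
  have r: "r \<ge> 0" unfolding r_def using c s by simp
  let ?w = "\<Sum>i\<in>Basis. r *\<^sub>R i :: 'a"
  have sub: "T -` cbox u v \<subseteq> cbox (x - ?w) (x + ?w)"
  proof
    fix y assume y: "y \<in> T -` cbox u v"
    have "norm (T y - T x) \<le> (\<Sum>i\<in>Basis. \<bar>(T y - T x) \<bullet> i\<bar>)"
      by (rule norm_le_l1)
    also have "\<dots> \<le> (\<Sum>i\<in>(Basis::'a set). s)"
    proof (rule sum_mono)
      fix i :: 'a assume i: "i \<in> Basis"
      have "T y \<bullet> i \<in> {u \<bullet> i..v \<bullet> i}" "T x \<bullet> i \<in> {u \<bullet> i..v \<bullet> i}"
        using x y i by (auto simp: mem_box)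
      then show "\<bar>(T y - T x) \<bullet> i\<bar> \<le> s"
        using uv[OF i] by (auto simp: inner_diff_left)
    qed
    finally have "c * dist y x \<le> DIM('a) * s"
      using le[of y x] by (simp add: dist_norm)
    then have d: "norm (y - x) \<le> r"
      using c by (simp add: r_def dist_norm field_simps)
    show "y \<in> cbox (x - ?w) (x + ?w)"
    proof (simp add: mem_box, intro ballI)
      fix i :: 'a assume i: "i \<in> Basis"
      have "?w \<bullet> i = r" using i by (simp add: inner_sum_left inner_Basis if_distrib cong: if_cong)
      moreover have "\<bar>(y - x) \<bullet> i\<bar> \<le> r"
        using Basis_le_norm[OF i, of "y - x"] d by linarith
      ultimately show "(x - ?w) \<bullet> i \<le> y \<bullet> i \<and> y \<bullet> i \<le> (x + ?w) \<bullet> i"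
        by (auto simp: inner_diff_left inner_add_left)
    qed
  qed
  have w: "?w \<bullet> i = r" if "i \<in> Basis" for i
    using that by (simp add: inner_sum_left inner_Basis if_distrib cong: if_cong)
  have "emeasure lebesgue (T -` cbox u v) \<le> emeasure lebesgue (cbox (x - ?w) (x + ?w))"
    by (rule emeasure_mono[OF sub]) simp
  also have "\<dots> = ennreal ((2 * r) ^ DIM('a))"
    using r w by (simp add: emeasure_lborel_cbox_eq inner_diff_left inner_add_left)
  also have "\<dots> = ennreal ((2 * DIM('a) / c) ^ DIM('a)) * ennreal (s ^ DIM('a))"
    using c s by (simp add: r_def ennreal_mult[symmetric] power_mult_distrib[symmetric] mult.assoc)
  also have "ennreal (s ^ DIM('a)) = emeasure lebesgue (cbox u v)"
  proof -
    have "\<forall>i\<in>Basis. u \<bullet> i \<le> v \<bullet> i" using uv s by force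
    then show ?thesis
      using s uv by (simp add: emeasure_lborel_cbox_eq inner_diff_left)
  qed
  finally show ?thesis .
qed simp

text \<open>The bound for cubes spreads to a measurable set by covering it, inside an open set of
  almost the same measure, with countably many cubes whose interiors are disjoint. Bounded sets come
  first; monotone exhaustion gives the rest.\<close>

lemma expanding_emeasure:
  fixes T :: "'a::euclidean_space \<Rightarrow> 'a"
  assumes T: "expanding c T" and E: "E \<in> sets lebesgue"
  shows "emeasure lebesgue (T -` E) \<le> ennreal ((2 * DIM('a) / c) ^ DIM('a)) * emeasure lebesgue E"
proof -
  let ?C = "(2 * DIM('a) / c) ^ DIM('a)"
  have c: "c > 0" using T unfolding expanding_def by auto
  have meas: "T -` A \<in> sets lebesgue" if "A \<in> sets lebesgue" for A
    using measurable_sets[OF expanding_measurable[OF T] that] by simp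
  have bdd: "emeasure lebesgue (T -` E) \<le> ennreal ?C * emeasure lebesgue E"
    if E: "E \<in> sets lebesgue" and sub: "E \<subseteq> cbox (\<Sum>i\<in>Basis. (- real (Suc n)) *\<^sub>R i) (\<Sum>i\<in>Basis. real (Suc n) *\<^sub>R i)" for E n
  proof (rule ennreal_le_epsilon)
    fix e :: real assume e: "e > 0"
    have C: "?C > 0" using c by simp
    obtain W where W: "open W" "E \<subseteq> W" "W - E \<in> lmeasurable" "emeasure lebesgue (W - E) < ennreal (e / ?C)"
      using sets_lebesgue_outer_open[OF E, of "e / ?C"] e C by auto
    have "\<forall>x. \<exists>r>0. x \<in> W \<longrightarrow> ball x r \<subseteq> W"
      using W(1) open_contains_ball zero_less_one by blast
    then obtain r where r: "\<And>x. r x > 0" "\<And>x. x \<in> W \<Longrightarrow> ball x (r x) \<subseteq> W" by metis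
    let ?a = "\<Sum>i\<in>Basis. (- real (Suc n)) *\<^sub>R i :: 'a" and ?b = "\<Sum>i\<in>Basis. real (Suc n) *\<^sub>R i :: 'a"
    have ab: "?a \<bullet> i = - real (Suc n)" "?b \<bullet> i = real (Suc n)" if "i \<in> Basis" for i
      using that by (simp_all add: inner_sum_left inner_Basis if_distrib cong: if_cong)
    have ne: "box ?a ?b \<noteq> {}"
      using ab by (simp add: box_ne_empty del: of_nat_Suc)
    \<comment> \<open>This gauge confines every covering cube to the open set W.\<close>
    have g: "gauge (\<lambda>x. ball x (r x))"
      using r by (simp add: gauge_def)
    obtain \<D> where D: "countable \<D>"
        "\<And>K. K \<in> \<D> \<Longrightarrow> interior K \<noteq> {} \<and> (\<exists>c d. K = cbox c d)"
        "pairwise (\<lambda>A B. interior A \<inter> interior B = {}) \<D>"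
        "\<And>K. K \<in> \<D> \<Longrightarrow> \<exists>x \<in> E \<inter> K. K \<subseteq> ball x (r x)"
        "\<And>u v. cbox u v \<in> \<D> \<Longrightarrow> \<exists>n. \<forall>i \<in> Basis. v \<bullet> i - u \<bullet> i = (?b \<bullet> i - ?a \<bullet> i) / 2^n"
        "E \<subseteq> \<Union>\<D>"
      using covering_lemma[OF sub ne g] by metis
    \<comment> \<open>Only the interiors of the cubes are disjoint. The frontiers form a null set
      whose preimage is null as well, so they can be discarded.\<close>
    let ?N = "\<Union>K\<in>\<D>. frontier K"
    have neg: "negligible ?N"
    proof -
      have "negligible (frontier K)" if "K \<in> \<D>" for K
        using D(2)[OF that] by (auto simp: negligible_convex_frontier)
      then show ?thesis
        using D(1) by (simp add: negligible_iff_null_sets null_sets_UN')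
    qed
    have disj: "disjoint_family_on (\<lambda>K. T -` interior K) \<D>" "disjoint_family_on interior \<D>"
      using D(3) by (auto simp: disjoint_family_on_def pairwise_def)
    have "E \<subseteq> (\<Union>K\<in>\<D>. interior K) \<union> ?N"
    proof
      fix x assume "x \<in> E"
      then obtain K where K: "K \<in> \<D>" "x \<in> K" using D(6) by blast
      then have "x \<in> interior K \<union> frontier K"
        using closure_subset[of K] by (auto simp: frontier_def)
      then show "x \<in> (\<Union>K\<in>\<D>. interior K) \<union> ?N" using K(1) by blast
    qed
    then have "T -` E \<subseteq> (\<Union>K\<in>\<D>. T -` interior K) \<union> T -` ?N"
      by (metis vimage_mono vimage_UN vimage_Un)
    moreover have m1: "(\<Union>K\<in>\<D>. T -` interior K) \<in> sets lebesgue"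
      using D(1) meas by (intro sets.countable_UN'') auto
    moreover have n1: "T -` ?N \<in> null_sets lebesgue"
      using expanding_vimage_null[OF T neg] negligible_iff_null_sets by blast
    ultimately have "emeasure lebesgue (T -` E) \<le> emeasure lebesgue ((\<Union>K\<in>\<D>. T -` interior K) \<union> T -` ?N)"
      by (intro emeasure_mono) auto
    also have "\<dots> = emeasure lebesgue (\<Union>K\<in>\<D>. T -` interior K)"
      by (rule emeasure_Un_null_set[OF m1 n1])
    also have "\<dots> = (\<integral>\<^sup>+K. emeasure lebesgue (T -` interior K) \<partial>count_space \<D>)"
      using D(1) disj meas by (intro emeasure_UN_countable) auto
    also have "\<dots> \<le> (\<integral>\<^sup>+K. ennreal ?C * emeasure lebesgue (interior K) \<partial>count_space \<D>)"
    proof (rule nn_integral_mono)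
      fix K assume "K \<in> space (count_space \<D>)"
      then have K: "K \<in> \<D>" by simp
      then obtain u v where uv: "K = cbox u v" using D(2) by blast
      \<comment> \<open>Dyadic subdivision of a cube gives cells of equal side in all directions, as
        the estimate for cubes requires.\<close>
      then obtain m where m: "\<And>i. i \<in> Basis \<Longrightarrow> v \<bullet> i - u \<bullet> i = 2 * real (Suc n) / 2 ^ m"
        using D(5)[of u v] K ab by auto
      have "emeasure lebesgue (T -` interior K) \<le> emeasure lebesgue (T -` K)"
        using uv by (intro emeasure_mono meas) (auto simp: mem_box less_imp_le)
      also have "\<dots> \<le> ennreal ?C * emeasure lebesgue K"
        unfolding uv by (rule expanding_emeasure_cube[OF T _ m]) auto
      also have "emeasure lebesgue K = emeasure lebesgue (interior K)"
        unfolding uv interior_cbox by (simp add: emeasure_lborel_cbox_eq emeasure_lborel_box_eq)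
      finally show "emeasure lebesgue (T -` interior K) \<le> ennreal ?C * emeasure lebesgue (interior K)" .
    qed
    also have "\<dots> = ennreal ?C * emeasure lebesgue (\<Union>K\<in>\<D>. interior K)"
      using D(1) disj by (subst emeasure_UN_countable) (auto simp: nn_integral_cmult)
    also have "\<dots> \<le> ennreal ?C * emeasure lebesgue W"
    proof (intro mult_left_mono emeasure_mono)
      show "(\<Union>K\<in>\<D>. interior K) \<subseteq> W"
        using D(4) W(2) r(2) interior_subset by fastforce
    qed (use W in auto)
    also have "\<dots> \<le> ennreal ?C * (emeasure lebesgue E + ennreal (e / ?C))"
    proof (rule mult_left_mono)
      have "emeasure lebesgue W \<le> emeasure lebesgue (E \<union> (W - E))"
        using E W by (intro emeasure_mono) auto
      also have "\<dots> \<le> emeasure lebesgue E + emeasure lebesgue (W - E)"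
        using E W by (intro emeasure_subadditive) auto
      finally show "emeasure lebesgue W \<le> emeasure lebesgue E + ennreal (e / ?C)"
        using W(4) by (meson add_left_mono dual_order.trans less_imp_le)
    qed simp
    also have "\<dots> = ennreal ?C * emeasure lebesgue E + ennreal e"
      using C e c by (simp add: distrib_left ennreal_mult[symmetric])
    finally show "emeasure lebesgue (T -` E) \<le> ennreal ?C * emeasure lebesgue E + ennreal e" .
  qed
  let ?B = "\<lambda>n. cbox (\<Sum>i\<in>Basis. (- real (Suc n)) *\<^sub>R i) (\<Sum>i\<in>Basis. real (Suc n) *\<^sub>R i) :: 'a set"
  have memB: "x \<in> ?B n \<longleftrightarrow> (\<forall>i\<in>Basis. \<bar>x \<bullet> i\<bar> \<le> real (Suc n))" for x n
  proof -
    have "(\<Sum>i\<in>Basis. c *\<^sub>R i) \<bullet> j = c" if "j \<in> Basis" for j :: 'a and c :: real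
      using that by (simp add: inner_sum_left inner_Basis if_distrib cong: if_cong)
    then show ?thesis
      unfolding mem_box by (intro ball_cong refl) (simp only: abs_le_iff, linarith)
  qed
  have un: "(\<Union>n. T -` (E \<inter> ?B n)) = T -` E"
  proof -
    have "\<exists>n. x \<in> ?B n" for x
    proof -
      obtain n where "norm x < real (Suc n)"
        using reals_Archimedean2[of "norm x"] by (metis less_Suc_eq of_nat_less_iff order_less_trans lessI)
      then show ?thesis
        unfolding memB using Basis_le_norm by (metis order.trans less_imp_le)
    qed
    then show ?thesis by blast
  qed
  have inc: "incseq (\<lambda>n. T -` (E \<inter> ?B n))"
  proof (rule incseq_SucI)
    have "?B n \<subseteq> ?B (Suc n)" for n unfolding subset_iff memB by force
    then show "T -` (E \<inter> ?B n) \<le> T -` (E \<inter> ?B (Suc n))" for n by blast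
  qed
  have "emeasure lebesgue (T -` E) = (SUP n. emeasure lebesgue (T -` (E \<inter> ?B n)))"
  proof -
    have "range (\<lambda>n. T -` (E \<inter> ?B n)) \<subseteq> sets lebesgue"
      by (intro image_subsetI meas sets.Int E) auto
    from SUP_emeasure_incseq[OF this inc] show ?thesis unfolding un by simp
  qed
  also have "\<dots> \<le> ennreal ?C * emeasure lebesgue E"
  proof (rule SUP_least)
    fix n
    have "emeasure lebesgue (T -` (E \<inter> ?B n)) \<le> ennreal ?C * emeasure lebesgue (E \<inter> ?B n)"
      by (rule bdd) (use E in auto)
    also have "\<dots> \<le> ennreal ?C * emeasure lebesgue E"
      using E by (intro mult_left_mono emeasure_mono) auto
    finally show "emeasure lebesgue (T -` (E \<inter> ?B n)) \<le> ennreal ?C * emeasure lebesgue E" .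
  qed
  finally show ?thesis .
qed

section \<open>Integrals of compositions with expanding maps\<close>

abbreviation expconst :: "'a::euclidean_space itself \<Rightarrow> real \<Rightarrow> real" where
  "expconst _ c \<equiv> (2 * DIM('a) / c) ^ DIM('a)"

text \<open>The push-forward of Lebesgue measure under T is dominated by a multiple of Lebesgue
  measure; the inequality is this domination tested on f.\<close>

lemma expanding_nn_integral:
  fixes T :: "'a::euclidean_space \<Rightarrow> 'a"
  assumes T: "expanding c T" and f: "f \<in> borel_measurable lebesgue"
  shows "(\<integral>\<^sup>+x. f (T x) \<partial>lebesgue) \<le> ennreal (expconst TYPE('a) c) * (\<integral>\<^sup>+x. f x \<partial>lebesgue)"
proof -
  let ?C = "ennreal (expconst TYPE('a) c)"
  note Tm = expanding_measurable[OF T]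
  have "(\<integral>\<^sup>+x. f (T x) \<partial>lebesgue) = (\<integral>\<^sup>+x. f x \<partial>distr lebesgue lebesgue T)"
    using Tm f by (intro nn_integral_distr[symmetric]) auto
  also have "\<dots> \<le> (\<integral>\<^sup>+x. f x \<partial>scale_measure ?C lebesgue)"
  proof (rule nn_integral_mono_measure)
    show "distr lebesgue lebesgue T \<le> scale_measure ?C lebesgue"
      using Tm expanding_emeasure[OF T]
      by (subst le_measure) (auto simp: le_fun_def emeasure_distr emeasure_notin_sets)
  qed auto
  also have "\<dots> = ?C * (\<integral>\<^sup>+x. f x \<partial>lebesgue)"
    using f by (rule nn_integral_scale_measure)
  finally show ?thesis .
qed

lemma expanding_integrable:
  fixes T :: "'a::euclidean_space \<Rightarrow> 'a" and f :: "'a \<Rightarrow> 'b::{banach, second_countable_topology}"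
  assumes T: "expanding c T" and f: "integrable lebesgue f"
  shows "integrable lebesgue (\<lambda>x. f (T x))"
    and "(LINT x|lebesgue. norm (f (T x))) \<le> expconst TYPE('a) c * (LINT x|lebesgue. norm (f x))"
proof -
  have c: "c > 0" using T unfolding expanding_def by auto
  have fm: "f \<in> borel_measurable lebesgue" using f by auto
  have fT: "(\<lambda>x. f (T x)) \<in> borel_measurable lebesgue"
    using measurable_compose[OF expanding_measurable[OF T] fm] .
  have n: "(\<integral>\<^sup>+x. ennreal (norm (f (T x))) \<partial>lebesgue) \<le> ennreal (expconst TYPE('a) c) * (\<integral>\<^sup>+x. ennreal (norm (f x)) \<partial>lebesgue)"
    by (rule expanding_nn_integral[OF T]) (use fm in measurable)
  also have "(\<integral>\<^sup>+x. ennreal (norm (f x)) \<partial>lebesgue) = ennreal (LINT x|lebesgue. norm (f x))"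
    using f by (intro nn_integral_eq_integral) auto
  finally have n2: "(\<integral>\<^sup>+x. ennreal (norm (f (T x))) \<partial>lebesgue) \<le> ennreal (expconst TYPE('a) c * (LINT x|lebesgue. norm (f x)))"
    using c by (simp add: ennreal_mult)
  show 1: "integrable lebesgue (\<lambda>x. f (T x))"
    using fT n2 by (auto simp: integrable_iff_bounded intro: le_less_trans)
  have "ennreal (LINT x|lebesgue. norm (f (T x))) \<le> ennreal (expconst TYPE('a) c * (LINT x|lebesgue. norm (f x)))"
    using n2 1 by (subst nn_integral_eq_integral[symmetric]) auto
  then show "(LINT x|lebesgue. norm (f (T x))) \<le> expconst TYPE('a) c * (LINT x|lebesgue. norm (f x))"
    using c by (subst (asm) ennreal_le_iff) (auto intro!: mult_nonneg_nonneg integral_nonneg)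
qed

text \<open>The integrand is nonzero only where exactly one of \<open>T i x\<close> and
  \<open>T' x\<close> lies in A. With W an open set slightly larger than A, the other point lies in
  \<open>W - A\<close>, or it lies outside W and the first one is close to the complement of W. Both
  exceptional sets are small, and so are their preimages.\<close>

lemma tendsto_L1_compose_indicator:
  fixes T :: "'i \<Rightarrow> 'a::euclidean_space \<Rightarrow> 'a"
  assumes T: "\<And>i. expanding c (T i)" and T': "expanding c T'"
    and lim: "\<And>e. e > 0 \<Longrightarrow> \<forall>\<^sub>F i in F. \<forall>x. dist (T i x) (T' x) < e"
    and A: "A \<in> sets lebesgue" "emeasure lebesgue A < \<infinity>"
  shows "((\<lambda>i. LINT x|lebesgue. \<bar>indicat_real A (T i x) - indicat_real A (T' x)\<bar>) \<longlongrightarrow> 0) F"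
proof (rule tendstoI)
  fix e :: real assume e: "e > 0"
  let ?C = "expconst TYPE('a) c"
  have c: "c > 0" using T' unfolding expanding_def by auto
  have C: "?C > 0" using c by simp
  \<comment> \<open>Four terms of size at most \<open>?C * d\<close> arise in the end, from two sets
    and two maps, so the 5 leaves a strict inequality.\<close>
  define d where "d = e / (5 * ?C)"
  have d: "d > 0" using e C by (simp add: d_def)
  obtain W where W: "open W" "A \<subseteq> W" "W - A \<in> lmeasurable" "emeasure lebesgue (W - A) < ennreal d"
    using sets_lebesgue_outer_open[OF A(1) d] by auto
  have A': "A \<in> lmeasurable" using A by (simp add: fmeasurable_def top.not_eq_extremum)
  have Wl: "W \<in> lmeasurable"
    using fmeasurable.Un[OF A' W(3)] W(2) by (simp add: Un_absorb1)
  \<comment> \<open>The distance to the empty set is 0 by convention, so the complement of W must be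
    nonempty for \<open>infdist\<close> to be meaningful below.\<close>
  have WU: "- W \<noteq> {}"
  proof
    assume "- W = {}"
    then have "W = UNIV" by blast
    then show False using Wl by simp
  qed
  \<comment> \<open>The strip of W next to its complement. As W is open, the strips shrink to the
    empty set, and their measures tend to 0.\<close>
  define V where "V k = {x \<in> W. infdist x (- W) < 1 / Suc k}" for k :: nat
  have Vm: "V k \<in> lmeasurable" for k
  proof (rule fmeasurableI2[OF Wl])
    have "V k = W \<inter> {x. infdist x (- W) < 1 / Suc k}" by (auto simp: V_def)
    moreover have "open {x. infdist x (- W) < 1 / Suc k}"
      by (intro open_Collect_less continuous_intros)
    ultimately show "V k \<in> sets lebesgue" using W(1) by auto
  qed (auto simp: V_def)
  have "(\<lambda>k. emeasure lebesgue (V k)) \<longlonglongrightarrow> emeasure lebesgue (\<Inter>k. V k)"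
  proof (rule Lim_emeasure_decseq)
    show "range V \<subseteq> sets lebesgue" using Vm by auto
    show "decseq V"
      unfolding decseq_Suc_iff V_def
    proof safe
      fix n x assume "infdist x (- W) < 1 / real (Suc (Suc n))"
      then show "infdist x (- W) < 1 / real (Suc n)"
        by (smt (verit) frac_le of_nat_0_less_iff of_nat_Suc zero_less_Suc)
    qed
    show "emeasure lebesgue (V i) \<noteq> \<infinity>" for i using fmeasurableD2[OF Vm[of i]] by simp
  qed
  moreover have "(\<Inter>k. V k) = {}"
  proof -
    { fix x assume x: "x \<in> (\<Inter>k. V k)"
      then have "infdist x (- W) > 0"
        using W(1) WU infdist_pos_not_in_closed[of "- W" x] by (auto simp: V_def closed_def)
      then obtain k where "1 / real (Suc k) < infdist x (- W)"
        using nat_approx_posE by blast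
      then have "x \<notin> V k" by (auto simp: V_def)
      then have False using x by blast }
    then show ?thesis by blast
  qed
  ultimately have "(\<lambda>k. emeasure lebesgue (V k)) \<longlonglongrightarrow> 0" by simp
  then have "\<forall>\<^sub>F k in sequentially. emeasure lebesgue (V k) < ennreal d"
    by (rule order_tendstoD) (use d in simp)
  then obtain k where k: "emeasure lebesgue (V k) < ennreal d"
    using eventually_happens'[OF sequentially_bot] by blast
  have mW: "measure lebesgue (W - A) \<le> d" "measure lebesgue (V k) \<le> d"
    using W(4) k d by (simp_all add: measure_def enn2real_leI less_imp_le)
  let ?g = "\<lambda>x. indicat_real (W - A) x + indicat_real (V k) x"
  have gi: "integrable lebesgue ?g"
    using W(3) Vm[of k] by (intro Bochner_Integration.integrable_add integrable_real_indicator) (auto simp: fmeasurable_def)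
  have gI: "(LINT x|lebesgue. norm (?g x)) \<le> 2 * d"
  proof -
    have "(LINT x|lebesgue. norm (?g x)) = (LINT x|lebesgue. ?g x)" by simp
    also have "\<dots> = measure lebesgue (W - A) + measure lebesgue (V k)"
      using W(3) Vm[of k] by (subst Bochner_Integration.integral_add) (auto simp: fmeasurable_def integrable_real_indicator)
    finally show ?thesis using mW by simp
  qed
  have gT: "integrable lebesgue (\<lambda>x. ?g (S x))" "(LINT x|lebesgue. ?g (S x)) \<le> ?C * (2 * d)"
    if "expanding c S" for S
  proof -
    show "integrable lebesgue (\<lambda>x. ?g (S x))" by (rule expanding_integrable(1)[OF that gi])
    have "(LINT x|lebesgue. ?g (S x)) = (LINT x|lebesgue. norm (?g (S x)))" by simp
    also have "\<dots> \<le> ?C * (LINT x|lebesgue. norm (?g x))"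
      by (rule expanding_integrable(2)[OF that gi])
    also have "\<dots> \<le> ?C * (2 * d)" using gI C by (intro mult_left_mono) auto
    finally show "(LINT x|lebesgue. ?g (S x)) \<le> ?C * (2 * d)" .
  qed
  have ev: "\<forall>\<^sub>F i in F. \<forall>x. dist (T i x) (T' x) < 1 / Suc k"
    by (rule lim) simp
  show "\<forall>\<^sub>F i in F. dist (LINT x|lebesgue. \<bar>indicat_real A (T i x) - indicat_real A (T' x)\<bar>) 0 < e"
    using ev
  proof eventually_elim
    case (elim i)
    have V: "x \<in> V k" if "x \<in> W" "y \<notin> W" "dist x y < 1 / Suc k" for x y
      using that infdist_le[of y "- W" x] by (auto simp: V_def)
    have pt: "\<bar>indicat_real A (T i x) - indicat_real A (T' x)\<bar> \<le> ?g (T i x) + ?g (T' x)" for x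
      using elim[rule_format, of x] W(2) V[of "T i x" "T' x"] V[of "T' x" "T i x"]
      by (auto simp: indicator_def dist_commute)
    have "(LINT x|lebesgue. \<bar>indicat_real A (T i x) - indicat_real A (T' x)\<bar>)
        \<le> (LINT x|lebesgue. ?g (T i x) + ?g (T' x))"
    proof (rule integral_mono_AE')
      show "integrable lebesgue (\<lambda>x. ?g (T i x) + ?g (T' x))"
        by (rule Bochner_Integration.integrable_add[OF gT(1)[OF T] gT(1)[OF T']])
    qed (use pt in auto)
    also have "\<dots> = (LINT x|lebesgue. ?g (T i x)) + (LINT x|lebesgue. ?g (T' x))"
      by (rule Bochner_Integration.integral_add[OF gT(1)[OF T] gT(1)[OF T']])
    also have "\<dots> \<le> ?C * (2 * d) + ?C * (2 * d)"
      by (rule add_mono[OF gT(2)[OF T] gT(2)[OF T']])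
    also have "\<dots> = 4 * (?C * d)" by simp
    also have "\<dots> < e" using C c e by (simp add: d_def)
    finally show ?case by simp
  qed
qed

text \<open>A density argument: indicators are the preceding lemma, sums are immediate, and a
  dominated limit passes because compositions with all \<open>T i\<close> and with \<open>T'\<close>
  are bounded on L1 by the same constant.\<close>

lemma tendsto_L1_compose:
  fixes T :: "'i \<Rightarrow> 'a::euclidean_space \<Rightarrow> 'a" and f :: "'a \<Rightarrow> 'b::{banach, second_countable_topology}"
  assumes T: "\<And>i. expanding c (T i)" and T': "expanding c T'"
    and lim: "\<And>e. e > 0 \<Longrightarrow> \<forall>\<^sub>F i in F. \<forall>x. dist (T i x) (T' x) < e"
    and f: "integrable lebesgue f"
  shows "((\<lambda>i. LINT x|lebesgue. norm (f (T i x) - f (T' x))) \<longlongrightarrow> 0) F"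
  using f
proof (induction rule: integrable_induct)
  case (base A y)
  have "((\<lambda>i. (LINT x|lebesgue. \<bar>indicat_real A (T i x) - indicat_real A (T' x)\<bar>) * norm y) \<longlongrightarrow> 0) F"
    using tendsto_mult_left_zero[OF tendsto_L1_compose_indicator[OF T T' lim base]] .
  moreover have "(LINT x|lebesgue. norm (indicat_real A (T i x) *\<^sub>R y - indicat_real A (T' x) *\<^sub>R y))
     = (LINT x|lebesgue. \<bar>indicat_real A (T i x) - indicat_real A (T' x)\<bar>) * norm y" for i
    by (simp flip: scaleR_diff_left)
  ultimately show ?case by simp
next
  case (add f g)
  have fi: "integrable lebesgue (\<lambda>x. norm (f (T i x) - f (T' x)))" for i
    by (intro integrable_norm Bochner_Integration.integrable_diff expanding_integrable(1)[OF T] expanding_integrable(1)[OF T'] add)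
  have gi: "integrable lebesgue (\<lambda>x. norm (g (T i x) - g (T' x)))" for i
    by (intro integrable_norm Bochner_Integration.integrable_diff expanding_integrable(1)[OF T] expanding_integrable(1)[OF T'] add)
  have *: "((\<lambda>i. (LINT x|lebesgue. norm (f (T i x) - f (T' x))) + (LINT x|lebesgue. norm (g (T i x) - g (T' x)))) \<longlongrightarrow> 0) F"
    using tendsto_add[OF add(3,4)] by simp
  show ?case
  proof (rule Lim_null_comparison[OF _ *], intro always_eventually allI)
    fix i
    have "norm (LINT x|lebesgue. norm (f (T i x) + g (T i x) - (f (T' x) + g (T' x))))
        = (LINT x|lebesgue. norm (f (T i x) + g (T i x) - (f (T' x) + g (T' x))))" by simp
    also have "\<dots> \<le> (LINT x|lebesgue. norm (f (T i x) - f (T' x)) + norm (g (T i x) - g (T' x)))"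
      by (rule integral_mono_AE'[OF Bochner_Integration.integrable_add[OF fi gi]])
        (auto intro!: norm_triangle_le norm_diff_triangle_ineq)
    also have "\<dots> = (LINT x|lebesgue. norm (f (T i x) - f (T' x))) + (LINT x|lebesgue. norm (g (T i x) - g (T' x)))"
      by (rule Bochner_Integration.integral_add[OF fi gi])
    finally show "norm (LINT x|lebesgue. norm (f (T i x) + g (T i x) - (f (T' x) + g (T' x)))) \<le> \<dots>" .
  qed
next
  case (lim f s)
  let ?C = "expconst TYPE('a) c"
  have c: "c > 0" using T' unfolding expanding_def by auto
  have C: "?C > 0" using c by simp
  have s0: "(\<lambda>i. LINT x|lebesgue. norm (f x - s i x)) \<longlonglongrightarrow> (LINT x|(lebesgue::'a measure). 0)"
  proof (rule integral_dominated_convergence)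
    show "integrable lebesgue (\<lambda>x. 3 * norm (f x))" using lim by auto
    show "AE x in lebesgue. (\<lambda>i. norm (f x - s i x)) \<longlonglongrightarrow> 0"
    proof (intro AE_I2)
      fix x
      have "(\<lambda>i. s i x) \<longlonglongrightarrow> f x" using lim(2)[of x] by simp
      then have "(\<lambda>i. norm (f x - s i x)) \<longlonglongrightarrow> norm (f x - f x)" by (intro tendsto_intros)
      then show "(\<lambda>i. norm (f x - s i x)) \<longlonglongrightarrow> 0" by simp
    qed
    show "AE x in lebesgue. norm (norm (f x - s i x)) \<le> 3 * norm (f x)" for i
    proof (intro AE_I2)
      fix x
      show "norm (norm (f x - s i x)) \<le> 3 * norm (f x)"
        using norm_triangle_ineq4[of "f x" "s i x"] lim(3)[of x i] by simp
    qed
  qed (use lim in auto)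
  show ?case
  proof (rule tendstoI)
    fix e :: real assume e: "e > 0"
    have "\<forall>\<^sub>F k in sequentially. (LINT x|lebesgue. norm (f x - s k x)) < e / (4 * ?C)"
      by (rule order_tendstoD(2)[OF s0]) (use e C in simp)
    then obtain k where k: "(LINT x|lebesgue. norm (f x - s k x)) < e / (4 * ?C)"
      using eventually_happens'[OF sequentially_bot] by blast
    have sk: "integrable lebesgue (\<lambda>x. f x - s k x)" using lim by auto
    have "\<forall>\<^sub>F i in F. (LINT x|lebesgue. norm (s k (T i x) - s k (T' x))) < e / 2"
      by (rule order_tendstoD(2)[OF lim(5)]) (use e in simp)
    then show "\<forall>\<^sub>F i in F. dist (LINT x|lebesgue. norm (f (T i x) - f (T' x))) 0 < e"
    proof eventually_elim
      case (elim i)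
      have b: "(LINT x|lebesgue. norm (f (S x) - s k (S x))) \<le> e / 4" if "expanding c S" for S
      proof -
        have "(LINT x|lebesgue. norm (f (S x) - s k (S x))) \<le> ?C * (LINT x|lebesgue. norm (f x - s k x))"
          by (rule expanding_integrable(2)[OF that sk])
        also have "\<dots> \<le> ?C * (e / (4 * ?C))" using k C by (intro mult_left_mono) auto
        also have "\<dots> = e / 4" using C c by simp
        finally show ?thesis .
      qed
      have bi: "integrable lebesgue (\<lambda>x. norm (f (S x) - s k (S x)))" if "expanding c S" for S
        by (rule integrable_norm[OF expanding_integrable(1)[OF that sk]])
      have si: "integrable lebesgue (\<lambda>x. norm (s k (T i x) - s k (T' x)))"
        by (intro integrable_norm Bochner_Integration.integrable_diff expanding_integrable(1)[OF T] expanding_integrable(1)[OF T'] lim(1))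
      have "(LINT x|lebesgue. norm (f (T i x) - f (T' x)))
        \<le> (LINT x|lebesgue. norm (f (T i x) - s k (T i x)) + (norm (f (T' x) - s k (T' x)) + norm (s k (T i x) - s k (T' x))))"
      proof (rule integral_mono_AE')
        show "integrable lebesgue (\<lambda>x. norm (f (T i x) - s k (T i x)) + (norm (f (T' x) - s k (T' x)) + norm (s k (T i x) - s k (T' x))))"
          by (intro Bochner_Integration.integrable_add bi T T' si)
        have "norm (a - b) \<le> norm (a - p) + (norm (b - q) + norm (p - q))" for a b p q :: 'b
        proof -
          have "a - b = (a - p) + ((p - q) - (b - q))" by simp
          also have "norm \<dots> \<le> norm (a - p) + norm ((p - q) - (b - q))" by (rule norm_triangle_ineq)
          also have "\<dots> \<le> norm (a - p) + (norm (b - q) + norm (p - q))"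
            using norm_triangle_ineq4[of "p - q" "b - q"] by simp
          finally show ?thesis .
        qed
        then show "AE x in lebesgue. norm (f (T i x) - f (T' x)) \<le> norm (f (T i x) - s k (T i x)) + (norm (f (T' x) - s k (T' x)) + norm (s k (T i x) - s k (T' x)))"
          by auto
      qed simp
      also have "\<dots> = (LINT x|lebesgue. norm (f (T i x) - s k (T i x))) + ((LINT x|lebesgue. norm (f (T' x) - s k (T' x))) + (LINT x|lebesgue. norm (s k (T i x) - s k (T' x))))"
        by (simp add: Bochner_Integration.integral_add Bochner_Integration.integrable_add bi T T' si)
      also have "\<dots> < e" using b[OF T[of i]] b[OF T'] elim by linarith
      finally show ?case by simp
    qed
  qed
qed

text \<open>Reduction to L1: for nonnegative numbers the square of the difference is at most the
  absolute difference of the squares. As f may change sign, this is applied to its positive and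
  negative parts.\<close>

lemma tendsto_L2_compose:
  fixes T :: "'i \<Rightarrow> 'a::euclidean_space \<Rightarrow> 'a" and f :: "'a \<Rightarrow> real"
  assumes T: "\<And>i. expanding c (T i)" and T': "expanding c T'"
    and lim: "\<And>e. e > 0 \<Longrightarrow> \<forall>\<^sub>F i in F. \<forall>x. dist (T i x) (T' x) < e"
    and f: "f \<in> borel_measurable lebesgue" "integrable lebesgue (\<lambda>x. (f x)\<^sup>2)"
  shows "((\<lambda>i. LINT x|lebesgue. (f (T i x) - f (T' x))\<^sup>2) \<longlongrightarrow> 0) F"
proof -
  let ?p = "\<lambda>x. (max 0 (f x))\<^sup>2" and ?n = "\<lambda>x. (max 0 (- f x))\<^sup>2"
  have p: "integrable lebesgue ?p"
    by (rule Bochner_Integration.integrable_bound[OF f(2)]) (use f(1) in \<open>auto simp: max_def\<close>)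
  have n: "integrable lebesgue ?n"
    by (rule Bochner_Integration.integrable_bound[OF f(2)]) (use f(1) in \<open>auto simp: max_def\<close>)
  have *: "((\<lambda>i. 2 * (LINT x|lebesgue. norm (?p (T i x) - ?p (T' x))) + 2 * (LINT x|lebesgue. norm (?n (T i x) - ?n (T' x)))) \<longlongrightarrow> 2 * 0 + 2 * 0) F"
    by (intro tendsto_add tendsto_mult tendsto_const tendsto_L1_compose[OF T T' lim p] tendsto_L1_compose[OF T T' lim n])
  have pt: "(a - b)\<^sup>2 \<le> 2 * norm ((max 0 a)\<^sup>2 - (max 0 b)\<^sup>2) + 2 * norm ((max 0 (- a))\<^sup>2 - (max 0 (- b))\<^sup>2)" for a b :: real
  proof -
    have sq: "(u - v)\<^sup>2 \<le> \<bar>u\<^sup>2 - v\<^sup>2\<bar>" if "u \<ge> 0" "v \<ge> 0" for u v :: real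
    proof -
      have "(u - v)\<^sup>2 = \<bar>u - v\<bar> * \<bar>u - v\<bar>" by (simp add: power2_eq_square)
      also have "\<dots> \<le> \<bar>u - v\<bar> * (u + v)" using that by (intro mult_left_mono) auto
      also have "\<dots> = \<bar>(u - v) * (u + v)\<bar>" using that by (simp add: abs_mult)
      also have "\<dots> = \<bar>u\<^sup>2 - v\<^sup>2\<bar>" by (simp add: power2_eq_square algebra_simps)
      finally show ?thesis .
    qed
    have "(a - b)\<^sup>2 = ((max 0 a - max 0 b) - (max 0 (- a) - max 0 (- b)))\<^sup>2"
      by (auto simp: max_def power2_eq_square algebra_simps)
    also have "\<dots> \<le> 2 * (max 0 a - max 0 b)\<^sup>2 + 2 * (max 0 (- a) - max 0 (- b))\<^sup>2"
    proof -
      have "(u - v)\<^sup>2 \<le> 2 * u\<^sup>2 + 2 * v\<^sup>2" for u v :: real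
        using zero_le_power2[of "u + v"] by (simp add: power2_eq_square algebra_simps)
      then show ?thesis .
    qed
    also have "\<dots> \<le> 2 * norm ((max 0 a)\<^sup>2 - (max 0 b)\<^sup>2) + 2 * norm ((max 0 (- a))\<^sup>2 - (max 0 (- b))\<^sup>2)"
      using sq[of "max 0 a" "max 0 b"] sq[of "max 0 (- a)" "max 0 (- b)"] by simp
    finally show ?thesis .
  qed
  show ?thesis
  proof (rule Lim_null_comparison)
    show "\<forall>\<^sub>F i in F. norm (LINT x|lebesgue. (f (T i x) - f (T' x))\<^sup>2)
      \<le> 2 * (LINT x|lebesgue. norm (?p (T i x) - ?p (T' x))) + 2 * (LINT x|lebesgue. norm (?n (T i x) - ?n (T' x)))"
    proof (intro always_eventually allI)
      fix i
      have pi: "integrable lebesgue (\<lambda>x. norm (?p (T i x) - ?p (T' x)))"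
        by (intro integrable_norm Bochner_Integration.integrable_diff expanding_integrable(1)[OF T p] expanding_integrable(1)[OF T' p])
      have ni: "integrable lebesgue (\<lambda>x. norm (?n (T i x) - ?n (T' x)))"
        by (intro integrable_norm Bochner_Integration.integrable_diff expanding_integrable(1)[OF T n] expanding_integrable(1)[OF T' n])
      have "norm (LINT x|lebesgue. (f (T i x) - f (T' x))\<^sup>2) = (LINT x|lebesgue. (f (T i x) - f (T' x))\<^sup>2)" by simp
      also have "\<dots> \<le> (LINT x|lebesgue. 2 * norm (?p (T i x) - ?p (T' x)) + 2 * norm (?n (T i x) - ?n (T' x)))"
        by (rule integral_mono_AE'[OF Bochner_Integration.integrable_add[OF integrable_mult_right[OF pi] integrable_mult_right[OF ni]]])
          (use pt in auto)
      also have "\<dots> = 2 * (LINT x|lebesgue. norm (?p (T i x) - ?p (T' x))) + 2 * (LINT x|lebesgue. norm (?n (T i x) - ?n (T' x)))"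
        using pi ni by (subst Bochner_Integration.integral_add) auto
      finally show "norm (LINT x|lebesgue. (f (T i x) - f (T' x))\<^sup>2) \<le> \<dots>" .
    qed
    show "((\<lambda>i. 2 * (LINT x|lebesgue. norm (?p (T i x) - ?p (T' x))) + 2 * (LINT x|lebesgue. norm (?n (T i x) - ?n (T' x)))) \<longlongrightarrow> 0) F"
      using * by simp
  qed
qed

subsection \<open>Square integrable functions\<close>

text \<open>The measure is a parameter so that the same facts serve for \<Omega> and for the whole
  space, between which functions are moved by zero extension.\<close>

definition sqint :: "'a measure \<Rightarrow> ('a \<Rightarrow> 'b::euclidean_space) \<Rightarrow> bool" where
  "sqint M u \<longleftrightarrow> u \<in> borel_measurable M \<and> integrable M (\<lambda>x. (norm (u x))\<^sup>2)"

definition n2 :: "'a measure \<Rightarrow> ('a \<Rightarrow> 'b::euclidean_space) \<Rightarrow> real" where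
  "n2 M u = sqrt (LINT x|M. (norm (u x))\<^sup>2)"

lemma L2_iff: "u \<in> L2 \<Omega> \<longleftrightarrow> sqint (lebesgue_on \<Omega>) u"
  by (simp add: L2_def sqint_def)

lemma n2_nonneg [simp]: "n2 M u \<ge> 0"
  by (simp add: n2_def)

lemma n2_sq: "(n2 M u)\<^sup>2 = (LINT x|M. (norm (u x))\<^sup>2)"
  by (simp add: n2_def)

lemma sqint_measurable: "sqint M u \<Longrightarrow> u \<in> borel_measurable M"
  and sqint_integrable: "sqint M u \<Longrightarrow> integrable M (\<lambda>x. (norm (u x))\<^sup>2)"
  by (simp_all add: sqint_def)

lemma sqint_bound:
  fixes u :: "'a \<Rightarrow> 'b::euclidean_space" and v :: "'a \<Rightarrow> 'c::euclidean_space"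
  assumes u: "sqint M u" and v: "v \<in> borel_measurable M"
    and le: "AE x in M. norm (v x) \<le> K * norm (u x)"
  shows "sqint M v" "K \<ge> 0 \<Longrightarrow> n2 M v \<le> K * n2 M u"
proof -
  have le2: "AE x in M. (norm (v x))\<^sup>2 \<le> K\<^sup>2 * (norm (u x))\<^sup>2"
    using le
  proof eventually_elim
    case (elim x)
    then have "(norm (v x))\<^sup>2 \<le> (K * norm (u x))\<^sup>2" by (intro power_mono) auto
    then show ?case by (simp add: power_mult_distrib)
  qed
  have ui: "integrable M (\<lambda>x. K\<^sup>2 * (norm (u x))\<^sup>2)" using u by (simp add: sqint_def)
  show sv: "sqint M v"
    unfolding sqint_def
    using v le2 by (auto intro!: Bochner_Integration.integrable_bound[OF ui])
  assume K: "K \<ge> 0"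
  have "(LINT x|M. (norm (v x))\<^sup>2) \<le> (LINT x|M. K\<^sup>2 * (norm (u x))\<^sup>2)"
    using le2 by (intro integral_mono_AE ui sqint_integrable[OF sv])
  also have "\<dots> = (K * n2 M u)\<^sup>2" by (simp add: power_mult_distrib n2_sq)
  finally show "n2 M v \<le> K * n2 M u"
    unfolding n2_def[of M v] using K by (intro real_le_lsqrt) auto
qed

lemma sqint_inner:
  assumes u: "sqint M u" and v: "sqint M v"
  shows "integrable M (\<lambda>x. u x \<bullet> v x)"
proof (rule Bochner_Integration.integrable_bound)
  show "integrable M (\<lambda>x. (norm (u x))\<^sup>2 + (norm (v x))\<^sup>2)"
    using u v by (auto simp: sqint_def)
  show "AE x in M. norm (u x \<bullet> v x) \<le> norm ((norm (u x))\<^sup>2 + (norm (v x))\<^sup>2)"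
  proof (intro AE_I2)
    fix x
    have "norm (u x \<bullet> v x) \<le> norm (u x) * norm (v x)" by (simp add: Cauchy_Schwarz_ineq2)
    also have "\<dots> \<le> (norm (u x))\<^sup>2 + (norm (v x))\<^sup>2"
    proof -
      have "0 \<le> norm (u x) * norm (v x)" by simp
      then show ?thesis using sum_squares_bound[of "norm (u x)" "norm (v x)"] by linarith
    qed
    finally show "norm (u x \<bullet> v x) \<le> norm ((norm (u x))\<^sup>2 + (norm (v x))\<^sup>2)" by simp
  qed
qed (use u v in \<open>auto simp: sqint_def\<close>)

lemma sqint_add:
  assumes u: "sqint M u" and v: "sqint M v"
  shows "sqint M (\<lambda>x. u x + v x)"
  unfolding sqint_def
proof
  have "(\<lambda>x. (norm (u x + v x))\<^sup>2) = (\<lambda>x. (norm (u x))\<^sup>2 + 2 * (u x \<bullet> v x) + (norm (v x))\<^sup>2)"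
    by (simp add: power2_norm_eq_inner inner_add_left inner_add_right inner_commute add_ac)
  then show "integrable M (\<lambda>x. (norm (u x + v x))\<^sup>2)"
    using u v sqint_inner[OF u v] by (auto simp: sqint_def)
qed (use u v in \<open>auto simp: sqint_def\<close>)

lemma sqint_scale: "sqint M u \<Longrightarrow> sqint M (\<lambda>x. c *\<^sub>R u x)"
  by (auto simp: sqint_def power_mult_distrib)

lemma sqint_minus: "sqint M u \<Longrightarrow> sqint M (\<lambda>x. - u x)"
  by (auto simp: sqint_def)

lemma sqint_diff: "sqint M u \<Longrightarrow> sqint M v \<Longrightarrow> sqint M (\<lambda>x. u x - v x)"
  using sqint_add[OF _ sqint_minus, of M u v] by simp

lemma sqint_zero [simp]: "sqint M (\<lambda>x. 0)"
  by (auto simp: sqint_def)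

lemma n2_scale: "n2 M (\<lambda>x. c *\<^sub>R u x) = \<bar>c\<bar> * n2 M u"
  by (simp add: n2_def power_mult_distrib real_sqrt_mult)

lemma n2_zero [simp]: "n2 M (\<lambda>x. 0) = 0"
  by (simp add: n2_def)

lemma n2_minus: "n2 M (\<lambda>x. - u x) = n2 M u"
  by (simp add: n2_def)

lemma n2_minus_commute: "n2 M (\<lambda>x. u x - v x) = n2 M (\<lambda>x. v x - u x)"
  by (simp add: n2_def norm_minus_commute)

text \<open>The squared norm of u - t v is a quadratic in t that is never negative, so its
  discriminant is not positive.\<close>

lemma n2_Cauchy_Schwarz:
  assumes u: "sqint M u" and v: "sqint M v"
  shows "\<bar>LINT x|M. u x \<bullet> v x\<bar> \<le> n2 M u * n2 M v"
proof -
  define I where "I = (LINT x|M. u x \<bullet> v x)"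
  have q: "0 \<le> (n2 M u)\<^sup>2 - 2 * t * I + t\<^sup>2 * (n2 M v)\<^sup>2" for t
  proof -
    have "0 \<le> (LINT x|M. (norm (u x - t *\<^sub>R v x))\<^sup>2)" by simp
    also have "(\<lambda>x. (norm (u x - t *\<^sub>R v x))\<^sup>2) = (\<lambda>x. (norm (u x))\<^sup>2 - 2 * t * (u x \<bullet> v x) + t\<^sup>2 * (norm (v x))\<^sup>2)"
      by (simp add: power2_norm_eq_inner inner_diff_left inner_diff_right inner_commute power2_eq_square[of t] algebra_simps)
    also have "(LINT x|M. \<dots> x) = (n2 M u)\<^sup>2 - 2 * t * I + t\<^sup>2 * (n2 M v)\<^sup>2"
      using u v sqint_inner[OF u v] by (simp add: sqint_def n2_sq I_def)
    finally show ?thesis .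
  qed
  have "I\<^sup>2 \<le> (n2 M u)\<^sup>2 * (n2 M v)\<^sup>2"
  proof (cases "n2 M v = 0")
    case True
    have "I = 0"
    proof (rule ccontr)
      assume "I \<noteq> 0"
      \<comment> \<open>With the leading coefficient zero, this t makes the remaining linear
        expression equal to -1.\<close>
      then show False using q[of "((n2 M u)\<^sup>2 + 1) / (2 * I)"] True by (simp add: field_simps)
    qed
    then show ?thesis by simp
  next
    case False
    then have p: "(n2 M v)\<^sup>2 > 0" by simp
    have "0 \<le> (n2 M u)\<^sup>2 - I\<^sup>2 / (n2 M v)\<^sup>2"
      using q[of "I / (n2 M v)\<^sup>2"] False by (simp add: power2_eq_square field_simps)
    then show ?thesis using p by (simp add: field_simps)
  qed
  then have "I\<^sup>2 \<le> (n2 M u * n2 M v)\<^sup>2" by (simp add: power_mult_distrib)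
  then have "\<bar>I\<bar> \<le> n2 M u * n2 M v" by (rule abs_le_square_iff[THEN iffD2, of I "n2 M u * n2 M v", simplified abs_of_nonneg[OF mult_nonneg_nonneg[OF n2_nonneg n2_nonneg]]])
  then show ?thesis by (simp add: I_def)
qed

lemma n2_triangle:
  assumes u: "sqint M u" and v: "sqint M v"
  shows "n2 M (\<lambda>x. u x + v x) \<le> n2 M u + n2 M v"
proof -
  have "(LINT x|M. (norm (u x + v x))\<^sup>2) = (LINT x|M. (norm (u x))\<^sup>2 + 2 * (u x \<bullet> v x) + (norm (v x))\<^sup>2)"
    by (simp add: power2_norm_eq_inner inner_add_left inner_add_right inner_commute add_ac)
  also have "\<dots> = (n2 M u)\<^sup>2 + 2 * (LINT x|M. u x \<bullet> v x) + (n2 M v)\<^sup>2"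
    using u v sqint_inner[OF u v] by (simp add: sqint_def n2_sq)
  also have "\<dots> \<le> (n2 M u)\<^sup>2 + 2 * (n2 M u * n2 M v) + (n2 M v)\<^sup>2"
    using n2_Cauchy_Schwarz[OF u v] by simp
  also have "\<dots> = (n2 M u + n2 M v)\<^sup>2" by (simp add: power2_sum)
  finally show ?thesis unfolding n2_def[of M "\<lambda>x. u x + v x"] by (intro real_le_lsqrt) auto
qed

lemma n2_triangle_diff:
  assumes "sqint M u" "sqint M v"
  shows "n2 M (\<lambda>x. u x - v x) \<le> n2 M u + n2 M v"
  using n2_triangle[OF assms(1) sqint_minus[OF assms(2)]] by (simp add: n2_minus)

lemma n2_triangle3:
  assumes "sqint M u" "sqint M v" "sqint M w"
  shows "n2 M (\<lambda>x. u x - w x) \<le> n2 M (\<lambda>x. u x - v x) + n2 M (\<lambda>x. v x - w x)"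
  using n2_triangle[OF sqint_diff[OF assms(1,2)] sqint_diff[OF assms(2,3)]] by simp

lemma n2_cong_AE:
  assumes "u \<in> borel_measurable M" "v \<in> borel_measurable M" "AE x in M. u x = v x"
  shows "n2 M u = n2 M v"
  unfolding n2_def using assms
  by (intro arg_cong[where f=sqrt] integral_cong_AE) auto

lemma sqint_cong_AE:
  assumes "sqint M u" "v \<in> borel_measurable M" "AE x in M. u x = v x"
  shows "sqint M v"
  by (rule sqint_bound(1)[OF assms(1,2), of 1]) (use assms(3) in auto)

lemma sqint_nth:
  fixes u :: "'a \<Rightarrow> 'b::euclidean_space ^ 'n::finite"
  assumes "sqint M u" shows "sqint M (\<lambda>x. u x $ i)" "n2 M (\<lambda>x. u x $ i) \<le> n2 M u"
proof -
  have m: "(\<lambda>x. u x $ i) \<in> borel_measurable M"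
    using measurable_compose[OF sqint_measurable[OF assms] borel_measurable_continuous_onI, of "\<lambda>v. v $ i"]
    by (simp add: continuous_on_component)
  show "sqint M (\<lambda>x. u x $ i)" "n2 M (\<lambda>x. u x $ i) \<le> n2 M u"
    using sqint_bound[OF assms m, of 1] Finite_Cartesian_Product.norm_nth_le[of "u _" i] by auto
qed

lemma borel_measurable_vecI:
  fixes u :: "'a \<Rightarrow> 'b::euclidean_space ^ 'n::finite"
  assumes "\<And>i. (\<lambda>x. u x $ i) \<in> borel_measurable M"
  shows "u \<in> borel_measurable M"
proof (subst borel_measurable_euclidean_space, intro ballI)
  fix b :: "'b ^ 'n" assume "b \<in> Basis"
  then obtain i a where b: "b = axis i a" "a \<in> Basis" by (auto simp: Basis_vec_def)
  have "(\<lambda>x. u x $ i \<bullet> a) \<in> borel_measurable M" using assms[of i] by measurable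
  then show "(\<lambda>x. u x \<bullet> b) \<in> borel_measurable M" by (simp add: b inner_axis)
qed

lemma norm_vec_square: "(norm (v::'b::real_inner ^ 'n::finite))\<^sup>2 = (\<Sum>i\<in>UNIV. (norm (v $ i))\<^sup>2)"
  by (simp add: norm_vec_def L2_set_def sum_nonneg)

lemma sqint_vecI:
  fixes u :: "'a \<Rightarrow> 'b::euclidean_space ^ 'n::finite"
  assumes "\<And>i. sqint M (\<lambda>x. u x $ i)"
  shows "sqint M u"
  unfolding sqint_def
proof
  show "u \<in> borel_measurable M" using assms by (intro borel_measurable_vecI) (simp add: sqint_def)
  show "integrable M (\<lambda>x. (norm (u x))\<^sup>2)"
    unfolding norm_vec_square using assms by (auto simp: sqint_def)
qed

lemma n2_vec:
  fixes u :: "'a \<Rightarrow> 'b::euclidean_space ^ 'n::finite"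
  assumes "\<And>i. sqint M (\<lambda>x. u x $ i)"
  shows "(n2 M u)\<^sup>2 = (\<Sum>i\<in>UNIV. (n2 M (\<lambda>x. u x $ i))\<^sup>2)"
  unfolding n2_sq norm_vec_square using assms by (simp add: sqint_def)

lemma n2_tendsto_0_iff: "((\<lambda>n. n2 M (f n)) \<longlongrightarrow> 0) F \<longleftrightarrow> ((\<lambda>n. LINT x|M. (norm (f n x))\<^sup>2) \<longlongrightarrow> 0) F"
proof
  assume "((\<lambda>n. n2 M (f n)) \<longlongrightarrow> 0) F"
  then have "((\<lambda>n. (n2 M (f n))\<^sup>2) \<longlongrightarrow> 0\<^sup>2) F" by (rule tendsto_power)
  then show "((\<lambda>n. LINT x|M. (norm (f n x))\<^sup>2) \<longlongrightarrow> 0) F" by (simp add: n2_sq)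
next
  assume "((\<lambda>n. LINT x|M. (norm (f n x))\<^sup>2) \<longlongrightarrow> 0) F"
  then show "((\<lambda>n. n2 M (f n)) \<longlongrightarrow> 0) F"
    unfolding n2_def using tendsto_real_sqrt by fastforce
qed

lemma n2_tendsto_vec:
  fixes f :: "'i \<Rightarrow> 'a \<Rightarrow> 'b::euclidean_space ^ 'n::finite"
  assumes "\<And>n i. sqint M (\<lambda>x. f n x $ i)"
    and "\<And>i. ((\<lambda>n. n2 M (\<lambda>x. f n x $ i)) \<longlongrightarrow> 0) F"
  shows "((\<lambda>n. n2 M (f n)) \<longlongrightarrow> 0) F"
proof -
  have "((\<lambda>n. sqrt (\<Sum>i\<in>UNIV. (n2 M (\<lambda>x. f n x $ i))\<^sup>2)) \<longlongrightarrow> sqrt (\<Sum>i\<in>(UNIV::'n set). 0\<^sup>2)) F"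
    using assms(2) by (intro tendsto_intros)
  moreover have "n2 M (f n) = sqrt (\<Sum>i\<in>UNIV. (n2 M (\<lambda>x. f n x $ i))\<^sup>2)" for n
    using n2_vec[of M "f n"] assms(1) by (metis n2_nonneg real_sqrt_unique)
  ultimately show ?thesis by simp
qed

lemma tendsto_inner_n2:
  assumes f: "\<And>n. sqint M (f n)" and g: "sqint M g" and h: "sqint M h"
    and lim: "((\<lambda>n. n2 M (\<lambda>x. f n x - g x)) \<longlongrightarrow> 0) F"
  shows "((\<lambda>n. LINT x|M. f n x \<bullet> h x) \<longlongrightarrow> (LINT x|M. g x \<bullet> h x)) F"
proof -
  have "((\<lambda>n. (LINT x|M. f n x \<bullet> h x) - (LINT x|M. g x \<bullet> h x)) \<longlongrightarrow> 0) F"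
  proof (rule Lim_null_comparison)
    show "((\<lambda>n. n2 M (\<lambda>x. f n x - g x) * n2 M h) \<longlongrightarrow> 0) F"
      using tendsto_mult_left_zero[OF lim] .
    show "\<forall>\<^sub>F n in F. norm ((LINT x|M. f n x \<bullet> h x) - (LINT x|M. g x \<bullet> h x)) \<le> n2 M (\<lambda>x. f n x - g x) * n2 M h"
    proof (intro always_eventually allI)
      fix n
      have "(LINT x|M. f n x \<bullet> h x) - (LINT x|M. g x \<bullet> h x) = (LINT x|M. (f n x - g x) \<bullet> h x)"
        using sqint_inner[OF f h] sqint_inner[OF g h] by (simp add: inner_diff_left)
      then show "norm ((LINT x|M. f n x \<bullet> h x) - (LINT x|M. g x \<bullet> h x)) \<le> n2 M (\<lambda>x. f n x - g x) * n2 M h"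
        using n2_Cauchy_Schwarz[OF sqint_diff[OF f g] h] by simp
    qed
  qed
  then show ?thesis by (simp add: LIM_zero_iff)
qed

text \<open>The Riesz-Fischer argument. The prescribed geometric rate makes the sequence itself
  converge almost everywhere, without passing to a subsequence, and Fatou's lemma hands the rate on
  to the limit.\<close>

lemma n2_complete:
  fixes u :: "nat \<Rightarrow> 'a \<Rightarrow> 'b::euclidean_space"
  assumes u: "\<And>k. sqint M (u k)" and K: "\<And>k m. k \<le> m \<Longrightarrow> n2 M (\<lambda>x. u m x - u k x) \<le> K / 4 ^ k"
  shows "\<exists>v. sqint M v \<and> (\<lambda>k. n2 M (\<lambda>x. u k x - v x)) \<longlonglongrightarrow> 0"
proof -
  have K0: "K \<ge> 0" using K[of 0 0] by simp
  have um[measurable]: "u k \<in> borel_measurable M" for k using u by (simp add: sqint_def)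
  have nn: "(\<integral>\<^sup>+x. ennreal ((norm (u m x - u k x))\<^sup>2) \<partial>M) \<le> ennreal ((K / 4 ^ k)\<^sup>2)" if "k \<le> m" for k m
  proof -
    have "(\<integral>\<^sup>+x. ennreal ((norm (u m x - u k x))\<^sup>2) \<partial>M) = ennreal ((n2 M (\<lambda>x. u m x - u k x))\<^sup>2)"
      unfolding n2_sq by (rule nn_integral_eq_integral) (use sqint_integrable[OF sqint_diff[OF u u]] in auto)
    also have "\<dots> \<le> ennreal ((K / 4 ^ k)\<^sup>2)"
      by (intro ennreal_leI power_mono K that) simp
    finally show ?thesis .
  qed
  \<comment> \<open>The squared increments have integrals of order 1/16^k, so the weight 4^k still
    gives a finite sum. Where that sum is finite, the increments are at most a multiple of 1/2^k and
    can be summed.\<close>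
  let ?d = "\<lambda>k x. (norm (u (Suc k) x - u k x))\<^sup>2"
  have "(\<integral>\<^sup>+x. (\<Sum>k. ennreal (4 ^ k * ?d k x)) \<partial>M) = (\<Sum>k. \<integral>\<^sup>+x. ennreal (4 ^ k * ?d k x) \<partial>M)"
    by (rule nn_integral_suminf) measurable
  also have "\<dots> \<le> (\<Sum>k. ennreal (K\<^sup>2 * (1 / 4) ^ k))"
  proof (intro suminf_le allI)
    fix k
    have "(\<integral>\<^sup>+x. ennreal (4 ^ k * ?d k x) \<partial>M) = ennreal (4 ^ k) * (\<integral>\<^sup>+x. ennreal (?d k x) \<partial>M)"
      by (simp add: ennreal_mult nn_integral_cmult)
    also have "\<dots> \<le> ennreal (4 ^ k) * ennreal ((K / 4 ^ k)\<^sup>2)"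
      by (intro mult_left_mono nn) auto
    also have "\<dots> = ennreal (K\<^sup>2 * (1 / 4) ^ k)"
      by (simp add: ennreal_mult[symmetric] power_divide power2_eq_square field_simps)
    finally show "(\<integral>\<^sup>+x. ennreal (4 ^ k * ?d k x) \<partial>M) \<le> ennreal (K\<^sup>2 * (1 / 4) ^ k)" .
  qed auto
  also have "\<dots> = ennreal (\<Sum>k. K\<^sup>2 * (1 / 4) ^ k)"
    by (intro suminf_ennreal2) (auto intro!: summable_mult summable_geometric)
  also have "\<dots> < \<infinity>" by simp
  finally have "(\<integral>\<^sup>+x. (\<Sum>k. ennreal (4 ^ k * ?d k x)) \<partial>M) \<noteq> \<infinity>" by simp
  note fin0 = this
  have gm: "(\<lambda>x. \<Sum>k. ennreal (4 ^ k * ?d k x)) \<in> borel_measurable M"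
    by (rule borel_measurable_suminf_order) measurable
  note fin = nn_integral_noteq_infinite[OF gm fin0]
  have conv: "AE x in M. convergent (\<lambda>k. u k x)"
  proof (rule AE_mp[OF fin AE_I2], rule impI)
    fix x assume elim: "(\<Sum>k. ennreal (4 ^ k * ?d k x)) \<noteq> \<infinity>"
    define S where "S = enn2real (\<Sum>k. ennreal (4 ^ k * ?d k x))"
    have le: "4 ^ k * ?d k x \<le> S" for k
    proof -
      have "ennreal (4 ^ k * ?d k x) \<le> (\<Sum>k. ennreal (4 ^ k * ?d k x))"
        by (rule sum_le_suminf[OF summableI, of "{k}", unfolded sum.insert_if sum.empty, simplified])
      also have "\<dots> = ennreal S" using elim by (simp add: S_def top.not_eq_extremum)
      finally show ?thesis by (subst (asm) ennreal_le_iff) (auto simp: S_def)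
    qed
    have S0: "S \<ge> 0" by (simp add: S_def)
    have "summable (\<lambda>k. u (Suc k) x - u k x)"
    proof (rule summable_comparison_test')
      show "summable (\<lambda>k. sqrt S * (1 / 2) ^ k)" by (intro summable_mult summable_geometric) auto
      show "norm (u (Suc k) x - u k x) \<le> sqrt S * (1 / 2) ^ k" for k
      proof -
        have "(2 ^ k * norm (u (Suc k) x - u k x))\<^sup>2 = 4 ^ k * ?d k x"
          by (simp add: power_mult_distrib power2_eq_square power_mult_distrib[symmetric])
        then have "(2 ^ k * norm (u (Suc k) x - u k x))\<^sup>2 \<le> S"
          using le[of k] by simp
        then have "2 ^ k * norm (u (Suc k) x - u k x) \<le> sqrt S" by (rule real_le_rsqrt)
        then show ?thesis by (simp add: field_simps power_divide)
      qed
    qed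
    then have "convergent (\<lambda>n. \<Sum>k<n. u (Suc k) x - u k x)"
      by (simp add: summable_iff_convergent)
    then obtain l where "(\<lambda>n. u n x - u 0 x) \<longlonglongrightarrow> l"
      unfolding sum_lessThan_telescope[of "\<lambda>k. u k x"] by (auto simp: convergent_def)
    then have "(\<lambda>n. (u n x - u 0 x) + u 0 x) \<longlonglongrightarrow> l + u 0 x" by (intro tendsto_intros)
    then show "convergent (\<lambda>k. u k x)" by (auto simp: convergent_def)
  qed
  define v where "v x = lim (\<lambda>k. u k x)" for x
  have vm[measurable]: "v \<in> borel_measurable M"
    unfolding v_def by (intro borel_measurable_lim_metric um)
  have vl: "AE x in M. (\<lambda>k. u k x) \<longlonglongrightarrow> v x"
    using conv unfolding v_def by (simp add: convergent_LIMSEQ_iff)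
  have fat: "(\<integral>\<^sup>+x. ennreal ((norm (v x - u k x))\<^sup>2) \<partial>M) \<le> ennreal ((K / 4 ^ k)\<^sup>2)" for k
  proof -
    have "(\<integral>\<^sup>+x. ennreal ((norm (v x - u k x))\<^sup>2) \<partial>M)
       = (\<integral>\<^sup>+x. liminf (\<lambda>m. ennreal ((norm (u m x - u k x))\<^sup>2)) \<partial>M)"
    proof (rule nn_integral_cong_AE)
      show "AE x in M. ennreal ((norm (v x - u k x))\<^sup>2) = liminf (\<lambda>m. ennreal ((norm (u m x - u k x))\<^sup>2))"
        using vl
      proof eventually_elim
        case (elim x)
        have "(\<lambda>m. ennreal ((norm (u m x - u k x))\<^sup>2)) \<longlonglongrightarrow> ennreal ((norm (v x - u k x))\<^sup>2)"
          by (intro tendsto_intros elim)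
        from lim_imp_Liminf[OF sequentially_bot this] show ?case by (rule sym)
      qed
    qed
    also have "\<dots> \<le> liminf (\<lambda>m. \<integral>\<^sup>+x. ennreal ((norm (u m x - u k x))\<^sup>2) \<partial>M)"
      by (rule nn_integral_liminf) measurable
    also have "\<dots> \<le> ennreal ((K / 4 ^ k)\<^sup>2)"
    proof (rule order_trans[OF Liminf_le_Limsup Limsup_bounded])
      show "\<forall>\<^sub>F m in sequentially. (\<integral>\<^sup>+x. ennreal ((norm (u m x - u k x))\<^sup>2) \<partial>M) \<le> ennreal ((K / 4 ^ k)\<^sup>2)"
        using eventually_ge_at_top[of k] by eventually_elim (rule nn)
    qed simp
    finally show ?thesis .
  qed
  have d: "sqint M (\<lambda>x. v x - u k x)" for k
  proof -
    have "(\<integral>\<^sup>+x. ennreal (norm ((norm (v x - u k x))\<^sup>2)) \<partial>M) < \<infinity>"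
      using fat[of k] by (auto intro: le_less_trans)
    then show ?thesis by (simp add: sqint_def integrable_iff_bounded)
  qed
  have dn: "n2 M (\<lambda>x. v x - u k x) \<le> K / 4 ^ k" for k
  proof -
    have "ennreal ((n2 M (\<lambda>x. v x - u k x))\<^sup>2) \<le> ennreal ((K / 4 ^ k)\<^sup>2)"
      unfolding n2_sq using fat[of k] sqint_integrable[OF d[of k]]
      by (subst nn_integral_eq_integral[symmetric]) auto
    then have "(n2 M (\<lambda>x. v x - u k x))\<^sup>2 \<le> (K / 4 ^ k)\<^sup>2" by (subst (asm) ennreal_le_iff) auto
    then show ?thesis by (rule power2_le_imp_le) (use K0 in simp)
  qed
  show ?thesis
  proof (intro exI conjI)
    show "sqint M v" using sqint_add[OF d[of 0] u[of 0]] by simp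
    show "(\<lambda>k. n2 M (\<lambda>x. u k x - v x)) \<longlonglongrightarrow> 0"
    proof (rule Lim_null_comparison)
      show "\<forall>\<^sub>F k in sequentially. norm (n2 M (\<lambda>x. u k x - v x)) \<le> K * (1 / 4) ^ k"
        using dn by (simp add: n2_minus_commute[of M "u _"] power_divide)
      show "(\<lambda>k. K * (1 / 4) ^ k) \<longlonglongrightarrow> 0"
        by (intro tendsto_mult_right_zero LIMSEQ_power_zero) auto
    qed
  qed
qed

subsection \<open>Smooth functions\<close>

lemma partial_eq:
  assumes "(\<phi> has_derivative D) (at x)"
  shows "partial j \<phi> x = D (axis j 1)"
  using frechet_derivative_at[OF assms] by (simp add: partial_def)

lemma smooth_differentiable: "smooth \<phi> \<Longrightarrow> \<phi> differentiable (at x)"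
  unfolding smooth_def by (drule spec[of _ "[]"]) (simp add: differentiable_on_def)

lemma smooth_partial: "smooth \<phi> \<Longrightarrow> smooth (partial j \<phi>)"
  unfolding smooth_def
proof (intro allI)
  fix js
  assume "\<forall>js. foldr partial js \<phi> differentiable_on UNIV"
  then have "foldr partial (js @ [j]) \<phi> differentiable_on UNIV" by blast
  then show "foldr partial js (partial j \<phi>) differentiable_on UNIV" by simp
qed

text \<open>Smoothness as a greatest fixed point: it suffices to name a class of differentiable
  functions closed under partial derivatives. Bumps, convolutions and reflections are all treated in
  this way.\<close>

lemma smooth_coinduct:
  assumes "\<phi> \<in> S" and "\<And>g x. g \<in> S \<Longrightarrow> g differentiable (at x)" and "\<And>g j. g \<in> S \<Longrightarrow> partial j g \<in> S"
  shows "smooth \<phi>"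
proof -
  have "foldr partial js \<phi> \<in> S" for js
    by (induction js) (use assms in auto)
  then show ?thesis unfolding smooth_def differentiable_on_def using assms(2) by blast
qed

lemma smooth_has_derivative:
  assumes "smooth \<phi>"
  shows "(\<phi> has_derivative (\<lambda>h. (\<chi> j. partial j \<phi> x) \<bullet> h)) (at x)"
proof -
  let ?D = "frechet_derivative \<phi> (at x)"
  have D: "(\<phi> has_derivative ?D) (at x)"
    using smooth_differentiable[OF assms] frechet_derivative_works by blast
  then have lin: "linear ?D" by (simp add: has_derivative_linear)
  have "?D h = (\<chi> j. partial j \<phi> x) \<bullet> h" for h
  proof -
    have "?D h = ?D (\<Sum>j\<in>UNIV. h $ j *\<^sub>R axis j 1)"
      by (simp add: basis_expansion scalar_mult_eq_scaleR[symmetric])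
    also have "\<dots> = (\<Sum>j\<in>UNIV. h $ j * ?D (axis j 1))"
      by (simp add: linear_sum[OF lin] linear_cmul[OF lin])
    finally show ?thesis by (simp add: inner_vec_def partial_def mult.commute)
  qed
  then have "?D = (\<lambda>h. (\<chi> j. partial j \<phi> x) \<bullet> h)" by (rule ext)
  then show ?thesis using D by (simp only:)
qed

lemma smooth_continuous: "smooth \<phi> \<Longrightarrow> continuous_on A \<phi>"
  by (meson continuous_at_imp_continuous_on differentiable_imp_continuous_within smooth_differentiable)

section \<open>Smooth bumps from the flat exponential\<close>

definition exp_flat :: "nat \<Rightarrow> real \<Rightarrow> real" where
  "exp_flat k s = (if s > 0 then exp (- inverse s) * inverse s ^ k else 0)"

lemma exp_flat_tendsto_0: "(exp_flat k \<longlongrightarrow> 0) (at 0)"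
proof -
  have "((\<lambda>s. inverse s ^ k / exp (inverse s)) \<longlongrightarrow> 0) (at_right (0::real))"
    by (rule filterlim_compose[OF tendsto_power_div_exp_0 filterlim_inverse_at_top_right])
  then have r: "(exp_flat k \<longlongrightarrow> 0) (at_right 0)"
    by (rule tendsto_cong[THEN iffD1, rotated])
      (auto simp: eventually_at_filter exp_flat_def exp_minus field_simps intro!: always_eventually)
  have "(exp_flat k \<longlongrightarrow> 0) (at_left 0)"
    by (rule tendsto_eventually) (auto simp: eventually_at_filter exp_flat_def)
  with r show ?thesis by (simp add: filterlim_at_split)
qed

text \<open>The powers of \<open>inverse s\<close> are built into the definition for the sake of
  this formula: the family indexed by k is closed under differentiation up to linear combinations.
  At the origin the difference quotient of index k is the function of index k + 1, which tends to
  0.\<close>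

lemma exp_flat_has_derivative:
  "(exp_flat k has_real_derivative (exp_flat (k + 2) s - real k * exp_flat (k + 1) s)) (at s)"
proof -
  consider "s > 0" | "s < 0" | "s = 0" by linarith
  then show ?thesis
  proof cases
    case 1
    have "((\<lambda>s. exp (- inverse s) * inverse s ^ k) has_real_derivative
        (exp_flat (k + 2) s - real k * exp_flat (k + 1) s)) (at s)"
    proof -
      have "((\<lambda>s. exp (- inverse s) * inverse s ^ k) has_real_derivative
          exp (- inverse s) * (inverse s * inverse s) * inverse s ^ k
          + exp (- inverse s) * (real k * inverse s ^ (k - 1) * (- (inverse s * inverse s)))) (at s)"
        using 1 by (auto intro!: derivative_eq_intros simp del: power_inverse simp: algebra_simps)
      moreover have "exp (- inverse s) * (inverse s * inverse s) * inverse s ^ k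
          + exp (- inverse s) * (real k * inverse s ^ (k - 1) * (- (inverse s * inverse s)))
          = exp_flat (k + 2) s - real k * exp_flat (k + 1) s"
        using 1 by (cases k) (simp_all add: exp_flat_def power2_eq_square algebra_simps del: power_inverse)
      ultimately show ?thesis by (rule DERIV_cong)
    qed
    moreover have "\<forall>\<^sub>F y in nhds s. exp_flat k y = exp (- inverse y) * inverse y ^ k"
      using eventually_nhds_in_open[of "{0<..}" s] 1 by (auto elim!: eventually_mono simp: exp_flat_def)
    ultimately show ?thesis
      by (subst DERIV_cong_ev[OF refl _ refl]) auto
  next
    case 2
    have "\<forall>\<^sub>F y in nhds s. exp_flat k y = 0"
      using eventually_nhds_in_open[of "{..<0}" s] 2 by (auto elim!: eventually_mono simp: exp_flat_def)
    then show ?thesis using 2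
      by (subst DERIV_cong_ev[OF refl _ refl]) (auto simp: exp_flat_def)
  next
    case 3
    have "exp_flat (k + 1) h = (exp_flat k (0 + h) - exp_flat k 0) / h" for h
      by (auto simp: exp_flat_def field_simps)
    then have "((\<lambda>h. (exp_flat k (0 + h) - exp_flat k 0) / h) \<longlongrightarrow> 0) (at 0)"
      using exp_flat_tendsto_0[of "k + 1"] by (metis (no_types, lifting) ext)
    then show ?thesis using 3 by (simp add: DERIV_def exp_flat_def)
  qed
qed

lemma exp_flat_nonneg [simp]: "exp_flat k s \<ge> 0"
  by (simp add: exp_flat_def)

text \<open>An algebra that contains the bumps and is closed under \<open>partial\<close>, to serve
  as the class in \<open>smooth_coinduct\<close>. Constants and coordinates enter because
  differentiating the squared distance to c produces them.\<close>

inductive_set bump_algebra :: "(real^3 \<Rightarrow> real) set" where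
  bump: "(\<lambda>y. exp_flat k (r - (norm (y - c))\<^sup>2)) \<in> bump_algebra"
| const: "(\<lambda>y. c) \<in> bump_algebra"
| coord: "(\<lambda>y. y $ i) \<in> bump_algebra"
| add: "f \<in> bump_algebra \<Longrightarrow> g \<in> bump_algebra \<Longrightarrow> (\<lambda>y. f y + g y) \<in> bump_algebra"
| mult: "f \<in> bump_algebra \<Longrightarrow> g \<in> bump_algebra \<Longrightarrow> (\<lambda>y. f y * g y) \<in> bump_algebra"

lemma bump_has_derivative:
  "((\<lambda>y::real^3. exp_flat k (r - (norm (y - c))\<^sup>2)) has_derivative
    (\<lambda>h. (exp_flat (k + 2) (r - (norm (y - c))\<^sup>2) - real k * exp_flat (k + 1) (r - (norm (y - c))\<^sup>2)) * (- 2 * ((y - c) \<bullet> h)))) (at y)"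
proof -
  have "((\<lambda>y::real^3. r - (y - c) \<bullet> (y - c)) has_derivative (\<lambda>h. - 2 * ((y - c) \<bullet> h))) (at y)"
    by (auto intro!: derivative_eq_intros simp: inner_commute)
  from has_derivative_compose[OF this exp_flat_has_derivative[unfolded has_field_derivative_def]]
  show ?thesis by (simp add: power2_norm_eq_inner)
qed

lemma bump_algebra_partial:
  assumes "g \<in> bump_algebra"
  shows "(\<forall>x. g differentiable (at x)) \<and> (\<forall>j. partial j g \<in> bump_algebra)"
  using assms
proof induction
  case (bump k r c)
  let ?g = "\<lambda>y::real^3. exp_flat k (r - (norm (y - c))\<^sup>2)"
  let ?e = "\<lambda>m y. exp_flat m (r - (norm (y - c))\<^sup>2)"
  have "partial j ?g = (\<lambda>y. (?e (k + 2) y + (- real k) * ?e (k + 1) y) * ((- 2) * (y $ j + (- c $ j))))" for j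
    by (rule ext) (simp add: partial_eq[OF bump_has_derivative] inner_axis)
  moreover have "(\<lambda>y. (?e (k + 2) y + (- real k) * ?e (k + 1) y) * ((- 2) * (y $ j + (- c $ j)))) \<in> bump_algebra" for j
    by (intro bump_algebra.intros)
  moreover have "?g differentiable (at x)" for x
    using bump_has_derivative unfolding differentiable_def by blast
  ultimately show ?case by auto
next
  case (const c)
  have "partial j (\<lambda>y. c) = (\<lambda>y. 0)" for j
    by (rule ext) (rule partial_eq[OF has_derivative_const, simplified])
  then show ?case by (auto intro: bump_algebra.const)
next
  case (coord i)
  have d: "((\<lambda>y::real^3. y $ i) has_derivative (\<lambda>h. h $ i)) (at x)" for x
    by (rule bounded_linear_imp_has_derivative) (rule bounded_linear_vec_nth)
  have "partial j (\<lambda>y. y $ i) = (\<lambda>y. axis j 1 $ i)" for j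
    by (rule ext) (rule partial_eq[OF d])
  then show ?case using d by (auto intro: bump_algebra.const simp: differentiable_def)
next
  case (add f g)
  have fd: "(f has_derivative frechet_derivative f (at x)) (at x)" "(g has_derivative frechet_derivative g (at x)) (at x)" for x
    using add frechet_derivative_works by blast+
  have "partial j (\<lambda>y. f y + g y) = (\<lambda>y. partial j f y + partial j g y)" for j
    by (rule ext) (simp add: partial_eq[OF has_derivative_add[OF fd]] partial_def)
  then show ?case using add by (auto intro: bump_algebra.intros)
next
  case (mult f g)
  have fd: "(f has_derivative frechet_derivative f (at x)) (at x)" "(g has_derivative frechet_derivative g (at x)) (at x)" for x
    using mult frechet_derivative_works by blast+
  have "partial j (\<lambda>y. f y * g y) = (\<lambda>y. f y * partial j g y + partial j f y * g y)" for j
    by (rule ext) (simp add: partial_eq[OF has_derivative_mult[OF fd]] partial_def)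
  then show ?case using mult by (auto intro!: bump_algebra.intros)
qed

lemma smooth_bump: "smooth (\<lambda>y. a * exp_flat k (r - (norm (y - c))\<^sup>2))"
  by (rule smooth_coinduct[of _ bump_algebra])
    (use bump_algebra_partial in \<open>auto intro: bump_algebra.intros\<close>)

lemma smooth_lincomb:
  assumes "smooth f" "smooth g"
  shows "smooth (\<lambda>x. a * f x + b * g x)"
    and "partial j (\<lambda>x. a * f x + b * g x) = (\<lambda>x. a * partial j f x + b * partial j g x)"
proof -
  have D: "((\<lambda>x. a * f x + b * g x) has_derivative (\<lambda>h. a * ((\<chi> j. partial j f x) \<bullet> h) + b * ((\<chi> j. partial j g x) \<bullet> h))) (at x)"
    if "smooth f" "smooth g" for f g x
    by (intro derivative_intros smooth_has_derivative that)
  have p: "partial j (\<lambda>x. a * f x + b * g x) = (\<lambda>x. a * partial j f x + b * partial j g x)"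
    if "smooth f" "smooth g" for f g j
    by (rule ext) (simp add: partial_eq[OF D[OF that]] inner_axis)
  show "partial j (\<lambda>x. a * f x + b * g x) = (\<lambda>x. a * partial j f x + b * partial j g x)"
    using p assms by blast
  let ?S = "{\<lambda>x. a * f x + b * g x | f g. smooth f \<and> smooth g}"
  show "smooth (\<lambda>x. a * f x + b * g x)"
  proof (rule smooth_coinduct[of _ ?S])
    fix h x j assume "h \<in> ?S"
    then obtain f g where h: "h = (\<lambda>x. a * f x + b * g x)" "smooth f" "smooth g" by blast
    show "h differentiable (at x)"
      unfolding h(1) differentiable_def using D[OF h(2,3)] by blast
    show "partial j h \<in> ?S"
      unfolding h(1) p[OF h(2,3)] using smooth_partial[OF h(2)] smooth_partial[OF h(3)] by blast
  qed (use assms in blast)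
qed

section \<open>Supports and test functions\<close>

lemma partial_outside_support: "x \<notin> support \<phi> \<Longrightarrow> partial j \<phi> x = 0"
proof -
  assume x: "x \<notin> support \<phi>"
  have "(\<phi> has_derivative (\<lambda>h. 0)) (at x)"
  proof (rule has_derivative_transform_within_open[OF has_derivative_const])
    show "open (- support \<phi>)" "x \<in> - support \<phi>" using x by (auto simp: support_def)
    show "0 = \<phi> y" if "y \<in> - support \<phi>" for y
      using that closure_subset[of "{x. \<phi> x \<noteq> 0}"] by (auto simp: support_def)
  qed
  from partial_eq[OF this] show ?thesis by simp
qed

lemma support_outside: "x \<notin> support \<phi> \<Longrightarrow> \<phi> x = 0"
  using closure_subset[of "{x. \<phi> x \<noteq> 0}"] by (auto simp: support_def)

lemma support_subsetI: "closed S \<Longrightarrow> (\<And>x. x \<notin> S \<Longrightarrow> \<phi> x = 0) \<Longrightarrow> support \<phi> \<subseteq> S"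
  unfolding support_def by (rule closure_minimal) auto

lemma closed_support [simp]: "closed (support \<phi>)"
  by (simp add: support_def)

lemma test_functionsI:
  assumes "smooth \<phi>" "compact K" "K \<subseteq> \<Omega>" "\<And>x. x \<notin> K \<Longrightarrow> \<phi> x = 0"
  shows "\<phi> \<in> test_functions \<Omega>"
proof -
  have "support \<phi> \<subseteq> K" using assms by (intro support_subsetI) (auto simp: compact_imp_closed)
  moreover from this have "compact (support \<phi>)"
    using assms(2) closed_Int_compact[of "support \<phi>" K] by (simp add: Int_absorb2)
  ultimately show ?thesis using assms by (auto simp: test_functions_def)
qed

lemma test_functions_mono: "A \<subseteq> B \<Longrightarrow> test_functions A \<subseteq> test_functions B"
  by (auto simp: test_functions_def)

lemma test_partial: "\<phi> \<in> test_functions \<Omega> \<Longrightarrow> partial j \<phi> \<in> test_functions \<Omega>"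
  by (rule test_functionsI[of _ "support \<phi>"])
    (auto simp: test_functions_def smooth_partial partial_outside_support)

lemma test_bounded:
  assumes "\<phi> \<in> test_functions \<Omega>"
  obtains B where "B > 0" "\<And>x. \<bar>\<phi> x\<bar> \<le> B"
proof -
  have "compact (\<phi> ` support \<phi>)"
    using assms smooth_continuous by (intro compact_continuous_image) (auto simp: test_functions_def)
  then obtain B where B: "\<And>y. y \<in> \<phi> ` support \<phi> \<Longrightarrow> \<bar>y\<bar> \<le> B"
    by (metis compact_imp_bounded bounded_iff real_norm_def)
  have "\<bar>\<phi> x\<bar> \<le> max B 1" for x
    using B[of "\<phi> x"] support_outside[of x \<phi>] by (cases "x \<in> support \<phi>") auto
  then show ?thesis by (intro that[of "max B 1"]) auto
qed

lemma lipschitz_from_gradient: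
  fixes k :: "real^3 \<Rightarrow> real"
  assumes "\<And>x. (k has_derivative (\<lambda>h. g x \<bullet> h)) (at x)" "\<And>x. norm (g x) \<le> L"
  shows "\<bar>k x - k y\<bar> \<le> L * norm (x - y)"
proof -
  have "norm (k x - k y) \<le> L * norm (x - y)"
  proof (rule differentiable_bound[where S=UNIV and f'="\<lambda>x h. g x \<bullet> h"])
    show "onorm (\<lambda>h. g x \<bullet> h) \<le> L" for x
    proof (rule onorm_le)
      fix h
      show "norm (g x \<bullet> h) \<le> L * norm h"
        using Cauchy_Schwarz_ineq2[of "g x" h] mult_right_mono[OF assms(2)[of x] norm_ge_zero[of h]]
        unfolding real_norm_def by linarith
    qed
  qed (use assms in auto)
  then show ?thesis by simp
qed

subsection \<open>Convolution\<close>

definition grad :: "(real^3 \<Rightarrow> real) \<Rightarrow> real^3 \<Rightarrow> real^3" where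
  "grad \<phi> x = (\<chi> j. partial j \<phi> x)"

lemma grad_nth [simp]: "grad \<phi> x $ j = partial j \<phi> x"
  by (simp add: grad_def)

text \<open>The gradient is only bounded and Borel. This is enough for differentiating under the
  convolution integral, and it admits products of a test function with a merely differentiable
  function, on which integration by parts rests.\<close>

definition kernel :: "(real^3 \<Rightarrow> real) \<Rightarrow> (real^3 \<Rightarrow> real^3) \<Rightarrow> real \<Rightarrow> real \<Rightarrow> bool" where
  "kernel k g L R \<longleftrightarrow> (\<forall>x. (k has_derivative (\<lambda>h. g x \<bullet> h)) (at x)) \<and> (\<forall>x. norm (g x) \<le> L) \<and>
     g \<in> borel_measurable borel \<and> (\<forall>x. norm x > R \<longrightarrow> k x = 0)"

lemma test_kernel:
  assumes "\<phi> \<in> test_functions \<Omega>"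
  obtains L R where "kernel \<phi> (grad \<phi>) L R"
proof -
  have sm: "smooth \<phi>" and cs: "compact (support \<phi>)" using assms by (auto simp: test_functions_def)
  have "\<forall>j. \<exists>B>0. \<forall>x. \<bar>partial j \<phi> x\<bar> \<le> B"
    using test_bounded[OF test_partial[OF assms]] by metis
  then obtain B where B: "\<And>j x. \<bar>partial j \<phi> x\<bar> \<le> B j" by metis
  have L: "norm (grad \<phi> x) \<le> (\<Sum>j\<in>UNIV. B j)" for x
    by (rule order_trans[OF norm_le_l1_cart]) (use B in \<open>auto intro: sum_mono\<close>)
  obtain R where R: "\<And>x. x \<in> support \<phi> \<Longrightarrow> norm x \<le> R"
    using compact_imp_bounded[OF cs] by (auto simp: bounded_iff)
  have "grad \<phi> \<in> borel_measurable borel"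
    by (rule borel_measurable_vecI)
      (simp add: borel_measurable_continuous_onI smooth_continuous smooth_partial sm)
  moreover have "\<phi> x = 0" if "norm x > R" for x
    using R[of x] that support_outside[of x \<phi>] by force
  ultimately have "kernel \<phi> (grad \<phi>) (\<Sum>j\<in>UNIV. B j) R"
    using smooth_has_derivative[OF sm] L by (simp add: kernel_def grad_def[abs_def])
  then show ?thesis by (rule that)
qed

definition conv :: "(real^3 \<Rightarrow> real) \<Rightarrow> (real^3 \<Rightarrow> 'b::euclidean_space) \<Rightarrow> real^3 \<Rightarrow> 'b" where
  "conv f k x = (LINT y|lebesgue. f y *\<^sub>R k (x - y))"

lemma borel_measurable_lebesgueI: "h \<in> borel_measurable borel \<Longrightarrow> h \<in> borel_measurable lebesgue"
  by (rule measurable_completion) simp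

lemma locally_integrable_cball:
  "f locally_integrable_on UNIV \<Longrightarrow> integrable lebesgue (\<lambda>y. indicat_real (cball c r) y *\<^sub>R f y)"
  by (simp add: locally_integrable_on_def set_integrable_def)

lemma integrable_mult_bounded:
  fixes h :: "real^3 \<Rightarrow> 'b::euclidean_space" and f :: "real^3 \<Rightarrow> real"
  assumes f: "integrable lebesgue (\<lambda>y. indicat_real S y *\<^sub>R f y)"
    and h: "h \<in> borel_measurable lebesgue" "\<And>y. norm (h y) \<le> B" "\<And>y. y \<notin> S \<Longrightarrow> h y = 0"
  shows "integrable lebesgue (\<lambda>y. f y *\<^sub>R h y)"
proof -
  have eq: "(\<lambda>y. f y *\<^sub>R h y) = (\<lambda>y. (indicat_real S y *\<^sub>R f y) *\<^sub>R h y)"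
  proof
    fix y show "f y *\<^sub>R h y = (indicat_real S y *\<^sub>R f y) *\<^sub>R h y"
      using h(3)[of y] by (cases "y \<in> S") auto
  qed
  show ?thesis
  proof (rule Bochner_Integration.integrable_bound)
    show "integrable lebesgue (\<lambda>y. B * norm (indicat_real S y *\<^sub>R f y))" using f by auto
    show "(\<lambda>y. f y *\<^sub>R h y) \<in> borel_measurable lebesgue"
      unfolding eq using f h(1) by measurable
    show "AE y in lebesgue. norm (f y *\<^sub>R h y) \<le> norm (B * norm (indicat_real S y *\<^sub>R f y))"
    proof (rule AE_I2)
      fix y
      have B: "B \<ge> 0" using h(2)[of y] norm_ge_zero order_trans by blast
      have "norm (f y *\<^sub>R h y) = norm (h y) * norm (indicat_real S y *\<^sub>R f y)"
        using h(3)[of y] by (auto simp: indicator_def)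
      also have "\<dots> \<le> B * norm (indicat_real S y *\<^sub>R f y)"
        by (intro mult_right_mono h) auto
      finally show "norm (f y *\<^sub>R h y) \<le> norm (B * norm (indicat_real S y *\<^sub>R f y))"
        using B by simp
    qed
  qed
qed

lemma kernelD:
  assumes "kernel k g L R"
  shows "(k has_derivative (\<lambda>h. g x \<bullet> h)) (at x)" "norm (g x) \<le> L" "g \<in> borel_measurable borel"
    "norm x > R \<Longrightarrow> k x = 0" "L \<ge> 0"
proof -
  show *: "(k has_derivative (\<lambda>h. g x \<bullet> h)) (at x)" "norm (g x) \<le> L" "g \<in> borel_measurable borel"
    "norm x > R \<Longrightarrow> k x = 0" for x
    using assms by (auto simp: kernel_def)
  show "L \<ge> 0" using *(2)[of 0] norm_ge_zero order_trans by blast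
qed

lemma kernel_continuous: "kernel k g L R \<Longrightarrow> continuous_on A k"
  by (meson continuous_at_imp_continuous_on has_derivative_continuous kernelD(1))

lemma kernel_lipschitz: "kernel k g L R \<Longrightarrow> \<bar>k x - k y\<bar> \<le> L * norm (x - y)"
  by (rule lipschitz_from_gradient[OF kernelD(1) kernelD(2)])

lemma kernel_gradient_outside:
  assumes "kernel k g L R" "norm x > R"
  shows "g x = 0"
proof -
  have "(k has_derivative (\<lambda>h. 0)) (at x)"
  proof (rule has_derivative_transform_within_open[OF has_derivative_const])
    show "open {x::real^3. norm x > R}" by (intro open_Collect_less continuous_intros)
    show "x \<in> {x. norm x > R}" using assms by simp
    show "0 = k y" if "y \<in> {x. norm x > R}" for y using that kernelD(4)[OF assms(1), of y] by simp
  qed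
  from has_derivative_unique[OF this kernelD(1)[OF assms(1), of x]]
  have "g x \<bullet> g x = 0" by metis
  then show ?thesis by simp
qed

text \<open>Every point of the ball is at distance 2 |R| + 1 from a point outside it, where the
  kernel vanishes; the Lipschitz bound does the rest.\<close>

lemma kernel_bounded:
  assumes "kernel k g L R"
  shows "\<bar>k x\<bar> \<le> L * (2 * \<bar>R\<bar> + 1)"
proof (cases "norm x > R")
  case True
  then show ?thesis using kernelD(4)[OF assms, of x] kernelD(5)[OF assms] by simp
next
  case False
  define y where "y = x + (2 * \<bar>R\<bar> + 1) *\<^sub>R axis 1 1"
  have xy: "norm (x - y) = 2 * \<bar>R\<bar> + 1" by (simp add: y_def norm_axis_1)
  have "norm y > R"
    using norm_triangle_ineq4[of x y] xy False by linarith
  then show ?thesis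
    using kernel_lipschitz[OF assms, of x y] kernelD(4)[OF assms, of y] xy by simp
qed

lemma kernel_conv_integrable:
  assumes f: "f locally_integrable_on UNIV" and k: "kernel k g L R"
  shows "integrable lebesgue (\<lambda>y. f y *\<^sub>R k (x - y))" "integrable lebesgue (\<lambda>y. f y *\<^sub>R g (x - y))"
proof -
  note fi = locally_integrable_cball[OF f, of x R]
  have out: "norm (x - y) > R" if "y \<notin> cball x R" for y using that by (simp add: dist_norm)
  have "(\<lambda>y. k (x - y)) \<in> borel_measurable borel"
    by (intro borel_measurable_continuous_onI continuous_on_compose2[OF kernel_continuous[OF k, of UNIV]] continuous_intros) auto
  then show "integrable lebesgue (\<lambda>y. f y *\<^sub>R k (x - y))"
    by (intro integrable_mult_bounded[OF fi, of _ "L * (2 * \<bar>R\<bar> + 1)"])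
      (use kernel_bounded[OF k] kernelD(4)[OF k] out in \<open>simp_all add: borel_measurable_lebesgueI\<close>)
  have "(\<lambda>y. g (x - y)) \<in> borel_measurable borel"
    using kernelD(3)[OF k] by measurable
  then show "integrable lebesgue (\<lambda>y. f y *\<^sub>R g (x - y))"
    by (intro integrable_mult_bounded[OF fi, of _ L])
      (use kernelD(2)[OF k] kernel_gradient_outside[OF k] out in \<open>simp_all add: borel_measurable_lebesgueI\<close>)
qed

text \<open>Dominated convergence for the difference quotient, which falls on the kernel alone: the
  quotients converge pointwise because the kernel is differentiable, and they are at most 2 L in
  absolute value. Hence f may be merely locally integrable.\<close>

lemma conv_has_derivative:
  assumes f: "f locally_integrable_on UNIV" and k: "kernel k g L R"
  shows "(conv f k has_derivative (\<lambda>h. conv f g x \<bullet> h)) (at x)"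
  unfolding has_derivative_at
proof (intro conjI)
  show "bounded_linear (\<lambda>h. conv f g x \<bullet> h)" by (rule bounded_linear_inner_right)
  let ?q = "\<lambda>h. norm (conv f k (x + h) - conv f k x - conv f g x \<bullet> h) / norm h"
  show "?q \<midarrow>0\<rightarrow> 0"
  proof (subst tendsto_at_iff_sequentially, intro allI impI)
    fix X :: "nat \<Rightarrow> real^3"
    assume X: "\<forall>i. X i \<in> UNIV - {0}" "X \<longlonglongrightarrow> 0"
    have "\<forall>\<^sub>F i in sequentially. norm (X i) < 1"
      using tendstoD[OF X(2), of 1] by simp
    then obtain N where N: "\<And>i. i \<ge> N \<Longrightarrow> norm (X i) < 1"
      by (auto simp: eventually_sequentially)
    \<comment> \<open>With increments of norm at most 1, all quotients vanish outside one ball of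
      radius R + 1, so a single dominating function serves for all of them.\<close>
    define H where "H i = X (i + N)" for i
    have H: "norm (H i) \<le> 1" "H i \<noteq> 0" for i using N[of "i + N"] X(1) by (auto simp: H_def less_imp_le)
    have H0: "H \<longlonglongrightarrow> 0" unfolding H_def by (rule LIMSEQ_ignore_initial_segment[OF X(2)])
    define r where "r i y = f y *\<^sub>R ((k (x + H i - y) - k (x - y) - g (x - y) \<bullet> H i) / norm (H i))" for i y
    have int: "(conv f k (x + H i) - conv f k x - conv f g x \<bullet> H i) / norm (H i) = (LINT y|lebesgue. r i y)"
      and meas: "integrable lebesgue (r i)" for i
    proof -
      note i1 = kernel_conv_integrable(1)[OF f k, of "x + H i"] and i2 = kernel_conv_integrable(1)[OF f k, of x]
        and i3 = kernel_conv_integrable(2)[OF f k, of x]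
      have r: "r i = (\<lambda>y. (f y *\<^sub>R k (x + H i - y) - f y *\<^sub>R k (x - y) - (f y *\<^sub>R g (x - y)) \<bullet> H i) / norm (H i))"
        by (rule ext) (simp add: r_def algebra_simps)
      have i4: "integrable lebesgue (\<lambda>y. (f y *\<^sub>R g (x - y)) \<bullet> H i)"
        using i3 by (intro integrable_inner_left)
      show "integrable lebesgue (r i)" unfolding r
        by (intro integrable_divide Bochner_Integration.integrable_diff i1 i2 i4)
      show "(conv f k (x + H i) - conv f k x - conv f g x \<bullet> H i) / norm (H i) = (LINT y|lebesgue. r i y)"
        unfolding r conv_def using i1 i2 i4 integral_inner_left[OF i3, of "H i"]
        by (simp add: Bochner_Integration.integral_diff Bochner_Integration.integrable_diff)
    qed
    have "(\<lambda>i. LINT y|lebesgue. r i y) \<longlonglongrightarrow> (LINT y|(lebesgue :: (real^3) measure). (0::real))"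
    proof (rule integral_dominated_convergence)
      let ?w = "\<lambda>y. 2 * L * norm (indicat_real (cball x (R + 1)) y *\<^sub>R f y)"
      show "integrable lebesgue ?w"
        using locally_integrable_cball[OF f, of x "R + 1"] by auto
      show "r i \<in> borel_measurable lebesgue" for i using meas by auto
      show "AE y in lebesgue. norm (r i y) \<le> ?w y" for i
      proof (rule AE_I2)
        fix y
        show "norm (r i y) \<le> ?w y"
        proof (cases "y \<in> cball x (R + 1)")
          case True
          have "\<bar>k (x + H i - y) - k (x - y) - g (x - y) \<bullet> H i\<bar> \<le> 2 * L * norm (H i)"
          proof -
            have "\<bar>g (x - y) \<bullet> H i\<bar> \<le> L * norm (H i)"
              using Cauchy_Schwarz_ineq2[of "g (x - y)" "H i"] mult_right_mono[OF kernelD(2)[OF k, of "x - y"] norm_ge_zero[of "H i"]]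
              by linarith
            then show ?thesis using kernel_lipschitz[OF k, of "x + H i - y" "x - y"] by simp
          qed
          then have "\<bar>(k (x + H i - y) - k (x - y) - g (x - y) \<bullet> H i) / norm (H i)\<bar> \<le> 2 * L"
            using H(2)[of i] by (simp add: abs_divide divide_le_eq)
          note q = this
          have "norm (r i y) = \<bar>(k (x + H i - y) - k (x - y) - g (x - y) \<bullet> H i) / norm (H i)\<bar> * \<bar>f y\<bar>"
            by (simp add: r_def abs_mult)
          also have "\<dots> \<le> 2 * L * \<bar>f y\<bar>" by (rule mult_right_mono[OF q]) simp
          finally show ?thesis using True by simp
        next
          case False
          then have d: "norm (x - y) > R + 1" by (simp add: dist_norm)
          have "norm (x + H i - y) > R"
            using norm_triangle_ineq2[of "x - y" "- H i"] H(1)[of i] d by (simp add: algebra_simps)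
          then have "r i y = 0"
            using d kernelD(4)[OF k] kernel_gradient_outside[OF k, of "x - y"] by (simp add: r_def)
          then show ?thesis using False by simp
        qed
      qed
      show "AE y in lebesgue. (\<lambda>i. r i y) \<longlonglongrightarrow> 0"
      proof (rule AE_I2)
        fix y
        have "(\<lambda>h. norm (k (x - y + h) - k (x - y) - g (x - y) \<bullet> h) / norm h) \<midarrow>0\<rightarrow> 0"
          using kernelD(1)[OF k, of "x - y"] unfolding has_derivative_at by blast
        then have "((\<lambda>h. norm (k (x - y + h) - k (x - y) - g (x - y) \<bullet> h) / norm h) \<circ> H) \<longlonglongrightarrow> 0"
          unfolding tendsto_at_iff_sequentially using H(2) H0 by blast
        then have "(\<lambda>i. (k (x - y + H i) - k (x - y) - g (x - y) \<bullet> H i) / norm (H i)) \<longlonglongrightarrow> 0"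
          by (intro tendsto_norm_zero_cancel[of "\<lambda>i. (k (x - y + H i) - k (x - y) - g (x - y) \<bullet> H i) / norm (H i)"])
            (simp add: o_def)
        from tendsto_scaleR[OF tendsto_const[of "f y"] this] show "(\<lambda>i. r i y) \<longlonglongrightarrow> 0"
          by (simp add: r_def algebra_simps)
      qed
    qed auto
    then have "(\<lambda>i. norm ((conv f k (x + H i) - conv f k x - conv f g x \<bullet> H i) / norm (H i))) \<longlonglongrightarrow> 0"
      unfolding int by (intro tendsto_norm_zero) simp
    then have "(\<lambda>i. ?q (X (i + N))) \<longlonglongrightarrow> 0"
      by (simp add: H_def)
    then show "(?q \<circ> X) \<longlonglongrightarrow> 0"
      unfolding o_def by (rule LIMSEQ_offset)
  qed
qed

lemma conv_nth:
  fixes k :: "real^3 \<Rightarrow> real^'n::finite"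
  assumes "integrable lebesgue (\<lambda>y. f y *\<^sub>R k (x - y))"
  shows "conv f k x $ j = conv f (\<lambda>z. k z $ j) x"
  using integral_bounded_linear[OF bounded_linear_vec_nth[of j] assms] by (simp add: conv_def)

text \<open>Convolutions of f with test functions form a class closed under \<open>partial\<close>,
  since every derivative falls on the kernel.\<close>

lemma conv_smooth:
  assumes f: "f locally_integrable_on UNIV" and k: "k \<in> test_functions UNIV"
  shows "smooth (conv f k)" "partial j (conv f k) x = conv f (partial j k) x"
proof -
  have D: "(conv f k has_derivative (\<lambda>h. conv f (grad k) x \<bullet> h)) (at x)"
      and P: "conv f (grad k) x $ j = conv f (partial j k) x"
    if "k \<in> test_functions UNIV" for k x j
  proof -
    obtain L R where kk: "kernel k (grad k) L R" using test_kernel[OF \<open>k \<in> _\<close>] by blast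
    show "(conv f k has_derivative (\<lambda>h. conv f (grad k) x \<bullet> h)) (at x)" by (rule conv_has_derivative[OF f kk])
    show "conv f (grad k) x $ j = conv f (partial j k) x"
      using conv_nth[OF kernel_conv_integrable(2)[OF f kk]] by simp
  qed
  have p: "partial j (conv f k) = conv f (partial j k)" if "k \<in> test_functions UNIV" for k j
    by (rule ext) (simp add: partial_eq[OF D[OF that]] inner_axis P[OF that])
  show "partial j (conv f k) x = conv f (partial j k) x" using p[OF k] by simp
  show "smooth (conv f k)"
  proof (rule smooth_coinduct[of _ "conv f ` test_functions UNIV"])
    show "conv f k \<in> conv f ` test_functions UNIV" using k by blast
    fix h x j assume "h \<in> conv f ` test_functions UNIV"
    then obtain l where l: "h = conv f l" "l \<in> test_functions UNIV" by blast
    show "h differentiable (at x)" unfolding l(1) differentiable_def using D[OF l(2)] by blast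
    show "partial j h \<in> conv f ` test_functions UNIV" unfolding l(1) p[OF l(2)] using test_partial[OF l(2)] by blast
  qed
qed

lemma locally_integrable_const: "(\<lambda>x::real^3. c::'b::euclidean_space) locally_integrable_on \<Omega>"
  unfolding locally_integrable_on_def set_integrable_def
proof (intro allI impI)
  fix K :: "(real^3) set" assume "compact K \<and> K \<subseteq> \<Omega>"
  then have "K \<in> lmeasurable" by (simp add: lmeasurable_compact)
  then show "integrable lebesgue (\<lambda>x. indicat_real K x *\<^sub>R c)"
    by (intro integrable_scaleR_left integrable_real_indicator) (auto simp: fmeasurable_def)
qed

text \<open>On a set of finite measure the norm of f is dominated by 1 plus its square.\<close>

lemma sqint_integrable_on:
  fixes f :: "'a::euclidean_space \<Rightarrow> 'b::euclidean_space"
  assumes f: "sqint lebesgue f" and K: "K \<in> lmeasurable"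
  shows "integrable lebesgue (\<lambda>x. indicat_real K x *\<^sub>R f x)"
proof (rule Bochner_Integration.integrable_bound)
  show "integrable lebesgue (\<lambda>x. indicat_real K x + (norm (f x))\<^sup>2)"
    using f K by (intro Bochner_Integration.integrable_add integrable_real_indicator) (auto simp: fmeasurable_def sqint_def)
  show "(\<lambda>x. indicat_real K x *\<^sub>R f x) \<in> borel_measurable lebesgue"
    using f K by (intro borel_measurable_scaleR borel_measurable_indicator) (auto simp: fmeasurable_def sqint_def)
  show "AE x in lebesgue. norm (indicat_real K x *\<^sub>R f x) \<le> norm (indicat_real K x + (norm (f x))\<^sup>2)"
  proof (rule AE_I2)
    fix x
    have "norm (f x) \<le> 1 + (norm (f x))\<^sup>2"
      using zero_le_power2[of "norm (f x) - 1 / 2"] by (simp add: power2_eq_square algebra_simps)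
    then show "norm (indicat_real K x *\<^sub>R f x) \<le> norm (indicat_real K x + (norm (f x))\<^sup>2)"
      by (auto simp: indicator_def)
  qed
qed

lemma sqint_locally_integrable:
  fixes f :: "real^3 \<Rightarrow> 'b::euclidean_space"
  assumes f: "sqint lebesgue f"
  shows "f locally_integrable_on \<Omega>"
  unfolding locally_integrable_on_def set_integrable_def
  using sqint_integrable_on[OF f lmeasurable_compact] by blast

lemma test_integrable:
  assumes "\<phi> \<in> test_functions \<Omega>"
  shows "integrable lebesgue \<phi>"
proof -
  obtain L R where k: "kernel \<phi> (grad \<phi>) L R" using test_kernel[OF assms] .
  have "integrable lebesgue (\<lambda>y. 1 *\<^sub>R \<phi> y)"
  proof (rule integrable_mult_bounded)
    show "integrable lebesgue (\<lambda>y::real^3. indicat_real (cball 0 R) y *\<^sub>R (1::real))"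
      using locally_integrable_cball[OF locally_integrable_const[of "1::real"], of 0 R] by simp
    show "\<phi> \<in> borel_measurable lebesgue"
      by (intro borel_measurable_lebesgueI borel_measurable_continuous_onI kernel_continuous[OF k])
    show "norm (\<phi> y) \<le> L * (2 * \<bar>R\<bar> + 1)" for y using kernel_bounded[OF k] by simp
    show "\<phi> y = 0" if "y \<notin> cball 0 R" for y using that kernelD(4)[OF k, of y] by simp
  qed
  then show ?thesis by simp
qed

subsection \<open>Mollification\<close>

definition bump_mass :: "real \<Rightarrow> real" where
  "bump_mass e = (LINT z|lebesgue. exp_flat 0 (e\<^sup>2 - (norm (z :: real^3))\<^sup>2))"

definition moll :: "real \<Rightarrow> real^3 \<Rightarrow> real" where
  "moll e z = exp_flat 0 (e\<^sup>2 - (norm z)\<^sup>2) / bump_mass e"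

lemma bump_test:
  assumes e: "e > 0" and sub: "cball x e \<subseteq> \<Omega>"
  shows "(\<lambda>y. a * exp_flat 0 (e\<^sup>2 - (norm (y - x))\<^sup>2)) \<in> test_functions \<Omega>"
proof (rule test_functionsI[OF smooth_bump compact_cball sub])
  fix y assume "y \<notin> cball x e"
  then have "e\<^sup>2 \<le> (norm (y - x))\<^sup>2"
    using e by (intro power_mono) (auto simp: dist_norm norm_minus_commute)
  then show "a * exp_flat 0 (e\<^sup>2 - (norm (y - x))\<^sup>2) = 0" by (simp add: exp_flat_def)
qed

lemma bump_mass_pos:
  assumes e: "e > 0" shows "bump_mass e > 0"
proof -
  let ?b = "\<lambda>z::real^3. exp_flat 0 (e\<^sup>2 - (norm z)\<^sup>2)"
  \<comment> \<open>On the ball of radius e / 2 the argument of the flat exponential is at least 3/4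
    of the square of e, so c bounds the bump from below there.\<close>
  define c where "c = exp (- inverse (3 / 4 * e\<^sup>2))"
  have int: "integrable lebesgue ?b"
    using test_integrable[OF bump_test[OF e, of 0 UNIV 1]] by simp
  have le: "indicat_real (ball 0 (e / 2)) z * c \<le> ?b z" for z :: "real^3"
  proof (cases "z \<in> ball 0 (e / 2)")
    case True
    then have "(norm z)\<^sup>2 \<le> (e / 2)\<^sup>2" by (intro power_mono) auto
    then have d: "3 / 4 * e\<^sup>2 \<le> e\<^sup>2 - (norm z)\<^sup>2" by (simp add: power_divide)
    have p: "0 < 3 / 4 * e\<^sup>2" using e by simp
    then have "inverse (e\<^sup>2 - (norm z)\<^sup>2) \<le> inverse (3 / 4 * e\<^sup>2)"
      by (rule le_imp_inverse_le[OF d])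
    moreover have "0 < e\<^sup>2 - (norm z)\<^sup>2" using p d by linarith
    ultimately show ?thesis using True by (simp add: exp_flat_def c_def del: diff_gt_0_iff_gt)
  qed simp
  have "0 < measure lebesgue (ball (0::real^3) (e / 2)) * c"
    using e content_ball_pos[of "e / 2" "0::real^3"] by (simp add: c_def)
  also have "\<dots> = (LINT z|lebesgue. indicat_real (ball (0::real^3) (e / 2)) z * c)" by simp
  also have "(LINT z|lebesgue. indicat_real (ball (0::real^3) (e / 2)) z * c) \<le> (LINT z|lebesgue. ?b z)"
    by (intro integral_mono integrable_mult_left integrable_real_indicator int le)
      (use emeasure_lborel_ball_finite[of "0::real^3" "e / 2"] in \<open>auto simp: infinity_ennreal_def\<close>)
  finally show ?thesis by (simp add: bump_mass_def)
qed

lemma moll_test: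
  assumes "e > 0" "cball x e \<subseteq> \<Omega>"
  shows "(\<lambda>y. moll e (x - y)) \<in> test_functions \<Omega>"
  using bump_test[OF assms, of "1 / bump_mass e"] by (simp add: moll_def norm_minus_commute)

lemma moll_test_UNIV: "e > 0 \<Longrightarrow> moll e \<in> test_functions UNIV"
  using moll_test[of e 0 UNIV] by (simp add: moll_def[abs_def])

lemma moll_nonneg: "e > 0 \<Longrightarrow> moll e z \<ge> 0"
  using bump_mass_pos[of e] by (simp add: moll_def)

lemma moll_outside: "e > 0 \<Longrightarrow> norm z \<ge> e \<Longrightarrow> moll e z = 0"
proof -
  assume "e > 0" "norm z \<ge> e"
  then have "e\<^sup>2 \<le> (norm z)\<^sup>2" by (intro power_mono) auto
  then show ?thesis by (simp add: moll_def exp_flat_def)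
qed

lemma moll_integral: "e > 0 \<Longrightarrow> (LINT z|lebesgue. moll e z) = 1"
  using bump_mass_pos[of e] by (simp add: moll_def bump_mass_def)

lemma moll_borel [measurable]: "e > 0 \<Longrightarrow> moll e \<in> borel_measurable borel"
  using moll_test_UNIV[of e] smooth_continuous by (auto simp: test_functions_def intro!: borel_measurable_continuous_onI)

lemma lborel_reflect: "distr lborel borel (\<lambda>z. x - z) = (lborel :: 'a::euclidean_space measure)"
  using lborel_affine[of "-1" x] by (simp add: density_1)

lemma lborel_integral_reflect:
  fixes f :: "'a::euclidean_space \<Rightarrow> 'b::euclidean_space"
  assumes [measurable]: "f \<in> borel_measurable borel"
  shows "(LINT z|lborel. f (x - z)) = (LINT z|lborel. f z)"
    and "integrable lborel f \<Longrightarrow> integrable lborel (\<lambda>z. f (x - z))"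
proof -
  have "(LINT z|lborel. f z) = (LINT z|distr lborel borel (\<lambda>z. x - z). f z)"
    by (simp add: lborel_reflect)
  also have "\<dots> = (LINT z|lborel. f (x - z))" by (rule integral_distr) auto
  finally show "(LINT z|lborel. f (x - z)) = (LINT z|lborel. f z)" by simp
  assume "integrable lborel f"
  then have "integrable (distr lborel borel (\<lambda>z. x - z)) f" by (simp add: lborel_reflect)
  then show "integrable lborel (\<lambda>z. f (x - z))" by (subst (asm) integrable_distr_eq) auto
qed

lemma conv_reflect:
  assumes [measurable]: "f \<in> borel_measurable borel" "k \<in> borel_measurable borel"
  shows "conv f k x = (LINT z|lborel. f (x - z) *\<^sub>R k z)"
  unfolding conv_def
  using lborel_integral_reflect(1)[of "\<lambda>z. f (x - z) *\<^sub>R k z" x]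
  by (subst integral_completion) auto

lemma conv_cong_AE:
  assumes ae: "AE y in lebesgue. f y = f' y" and m: "f \<in> borel_measurable lebesgue" "f' \<in> borel_measurable lebesgue"
    and k: "k \<in> borel_measurable borel"
  shows "conv f k x = conv f' k x"
  unfolding conv_def
proof (rule integral_cong_AE)
  have "(\<lambda>y. k (x - y)) \<in> borel_measurable lebesgue"
    by (rule borel_measurable_lebesgueI) (use k in measurable)
  with m show "(\<lambda>y. f y *\<^sub>R k (x - y)) \<in> borel_measurable lebesgue" "(\<lambda>y. f' y *\<^sub>R k (x - y)) \<in> borel_measurable lebesgue"
    by measurable
  show "AE y in lebesgue. f y *\<^sub>R k (x - y) = f' y *\<^sub>R k (x - y)" using ae by eventually_elim simp
qed

lemma conv_moll_continuous:
  "f locally_integrable_on UNIV \<Longrightarrow> e > 0 \<Longrightarrow> continuous_on A (conv f (moll e))"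
  by (intro smooth_continuous conv_smooth moll_test_UNIV)

text \<open>Jensen's inequality for the probability density \<open>moll e\<close>, obtained from the
  Cauchy-Schwarz inequality by splitting the density into two square roots, one of which has L2 norm
  1.\<close>

lemma moll_jensen:
  assumes e: "e > 0" and fm[measurable]: "f \<in> borel_measurable borel" and f2: "integrable lborel (\<lambda>x. (f x)\<^sup>2)"
  shows "ennreal ((conv f (moll e) x - f x)\<^sup>2) \<le> (\<integral>\<^sup>+z. ennreal ((f (x - z) - f x)\<^sup>2 * moll e z) \<partial>lborel)"
proof -
  note [measurable] = moll_borel[OF e]
  obtain L R where kk: "kernel (moll e) (grad (moll e)) L R" using test_kernel[OF moll_test_UNIV[OF e]] .
  define B where "B = L * (2 * \<bar>R\<bar> + 1)"
  have B: "moll e z \<le> B" for z using kernel_bounded[OF kk, of z] by (auto simp: B_def)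
  have mi: "integrable lborel (moll e)"
    using test_integrable[OF moll_test_UNIV[OF e]] by (subst (asm) integrable_completion) auto
  have m1: "(LINT z|lborel. moll e z) = 1"
    using moll_integral[OF e] by (subst (asm) integral_completion) auto
  define u where "u z = (f (x - z) - f x) * sqrt (moll e z)" for z
  define v where "v z = sqrt (moll e z)" for z
  have u2: "(norm (u z))\<^sup>2 = (f (x - z) - f x)\<^sup>2 * moll e z" and v2: "(norm (v z))\<^sup>2 = moll e z" for z
    using moll_nonneg[OF e, of z] by (simp_all add: u_def v_def power_mult_distrib)
  have fr: "integrable lborel (\<lambda>z. (f (x - z))\<^sup>2)"
    using lborel_integral_reflect(2)[OF _ f2, of x] by simp
  have su: "sqint lborel u"
    unfolding sqint_def
  proof
    show "u \<in> borel_measurable lborel" unfolding u_def by measurable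
    show "integrable lborel (\<lambda>z. (norm (u z))\<^sup>2)"
      unfolding u2
    proof (rule Bochner_Integration.integrable_bound)
      show "integrable lborel (\<lambda>z. 2 * B * (f (x - z))\<^sup>2 + 2 * (f x)\<^sup>2 * moll e z)"
        using fr mi by auto
      show "AE z in lborel. norm ((f (x - z) - f x)\<^sup>2 * moll e z) \<le> norm (2 * B * (f (x - z))\<^sup>2 + 2 * (f x)\<^sup>2 * moll e z)"
      proof (rule AE_I2)
        fix z
        have "(f (x - z) - f x)\<^sup>2 \<le> 2 * (f (x - z))\<^sup>2 + 2 * (f x)\<^sup>2"
          using zero_le_power2[of "f (x - z) + f x"] by (simp add: power2_eq_square algebra_simps)
        from mult_right_mono[OF this moll_nonneg[OF e, of z]]
        have "(f (x - z) - f x)\<^sup>2 * moll e z \<le> 2 * (f (x - z))\<^sup>2 * moll e z + 2 * (f x)\<^sup>2 * moll e z"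
          by (simp add: algebra_simps)
        also have "\<dots> \<le> 2 * (f (x - z))\<^sup>2 * B + 2 * (f x)\<^sup>2 * moll e z"
          by (intro add_right_mono mult_left_mono B) auto
        finally have "(f (x - z) - f x)\<^sup>2 * moll e z \<le> 2 * B * (f (x - z))\<^sup>2 + 2 * (f x)\<^sup>2 * moll e z"
          by (simp add: mult_ac)
        moreover have "0 \<le> (f (x - z) - f x)\<^sup>2 * moll e z" using moll_nonneg[OF e, of z] by simp
        ultimately show "norm ((f (x - z) - f x)\<^sup>2 * moll e z) \<le> norm (2 * B * (f (x - z))\<^sup>2 + 2 * (f x)\<^sup>2 * moll e z)"
          by simp
      qed
    qed measurable
  qed
  have sv: "sqint lborel v"
    unfolding sqint_def v2 using mi by (simp add: v_def[abs_def])
  have uv: "u z \<bullet> v z = f (x - z) * moll e z - f x * moll e z" for z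
    using moll_nonneg[OF e, of z] by (simp add: u_def v_def algebra_simps real_sqrt_mult_self flip: mult.assoc)
  have fmi: "integrable lborel (\<lambda>z. f (x - z) * moll e z)"
  proof -
    have "integrable lborel (\<lambda>z. u z \<bullet> v z + f x * moll e z)"
      using sqint_inner[OF su sv] mi by auto
    then show ?thesis unfolding uv by simp
  qed
  have "conv f (moll e) x - f x = (LINT z|lborel. u z \<bullet> v z)"
    unfolding uv using fmi mi m1 by (simp add: conv_reflect)
  then have "\<bar>conv f (moll e) x - f x\<bar> \<le> n2 lborel u * n2 lborel v"
    using n2_Cauchy_Schwarz[OF su sv] by simp
  also have "n2 lborel v = 1" unfolding n2_def v2 m1 by simp
  finally have "(conv f (moll e) x - f x)\<^sup>2 \<le> (n2 lborel u)\<^sup>2"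
    using power_mono[of "\<bar>conv f (moll e) x - f x\<bar>" "n2 lborel u" 2] by simp
  then have "ennreal ((conv f (moll e) x - f x)\<^sup>2) \<le> ennreal (LINT z|lborel. (norm (u z))\<^sup>2)"
    by (simp add: n2_sq ennreal_leI)
  also have "\<dots> = (\<integral>\<^sup>+z. ennreal ((norm (u z))\<^sup>2) \<partial>lborel)"
    by (rule nn_integral_eq_integral[symmetric]) (use sqint_integrable[OF su] in auto)
  finally show ?thesis unfolding u2 .
qed

lemma expanding_translation: "expanding 1 (\<lambda>x. x - z)"
  by (auto simp: expanding_def dist_norm intro!: continuous_intros)

text \<open>Integrated over x, Jensen's inequality and Tonelli's theorem turn the error into an
  average, with weight \<open>moll e\<close>, of the L2 errors of translations by vectors shorter
  than e.\<close>

lemma moll_L2_borel: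
  assumes fm[measurable]: "f \<in> borel_measurable borel" and f2: "integrable lborel (\<lambda>x. (f x)\<^sup>2)"
    and \<eta>: "\<eta> \<ge> 0" and e: "e > 0"
    and om: "\<And>z. norm z < e \<Longrightarrow> (\<integral>\<^sup>+x. ennreal ((f (x - z) - f x)\<^sup>2) \<partial>lborel) \<le> ennreal \<eta>"
  shows "(\<integral>\<^sup>+x. ennreal ((conv f (moll e) x - f x)\<^sup>2) \<partial>lborel) \<le> ennreal \<eta>"
proof -
  note [measurable] = moll_borel[OF e]
  have "(\<integral>\<^sup>+x. ennreal ((conv f (moll e) x - f x)\<^sup>2) \<partial>lborel)
     \<le> (\<integral>\<^sup>+x. \<integral>\<^sup>+z. ennreal ((f (x - z) - f x)\<^sup>2 * moll e z) \<partial>lborel \<partial>lborel)"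
    by (intro nn_integral_mono moll_jensen[OF e fm f2])
  also have "\<dots> = (\<integral>\<^sup>+z. \<integral>\<^sup>+x. ennreal ((f (x - z) - f x)\<^sup>2 * moll e z) \<partial>lborel \<partial>lborel)"
    by (rule lborel_pair.Fubini'[symmetric]) measurable
  also have "\<dots> \<le> (\<integral>\<^sup>+z. ennreal (\<eta> * moll e z) \<partial>lborel)"
  proof (rule nn_integral_mono)
    fix z :: "real^3"
    show "(\<integral>\<^sup>+x. ennreal ((f (x - z) - f x)\<^sup>2 * moll e z) \<partial>lborel) \<le> ennreal (\<eta> * moll e z)"
    proof (cases "norm z < e")
      case True
      have "(\<integral>\<^sup>+x. ennreal ((f (x - z) - f x)\<^sup>2 * moll e z) \<partial>lborel)
         = (\<integral>\<^sup>+x. ennreal ((f (x - z) - f x)\<^sup>2) \<partial>lborel) * ennreal (moll e z)"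
        by (subst nn_integral_multc[symmetric]) (auto simp: ennreal_mult' moll_nonneg e)
      also have "\<dots> \<le> ennreal \<eta> * ennreal (moll e z)"
        using True by (intro mult_right_mono om) auto
      finally show ?thesis using \<eta> by (simp add: ennreal_mult')
    next
      case False
      then show ?thesis using moll_outside[OF e, of z] by simp
    qed
  qed
  also have "\<dots> = ennreal (LINT z|lborel. \<eta> * moll e z)"
    using \<eta> test_integrable[OF moll_test_UNIV[OF e]] moll_nonneg[OF e]
    by (intro nn_integral_eq_integral) (auto simp: integrable_completion)
  also have "(LINT z|lborel. \<eta> * moll e z) = \<eta>"
    using moll_integral[OF e] by (subst (asm) integral_completion) auto
  finally show ?thesis .
qed

text \<open>A translation is the composition of two reflections, so the reflection invariance of the
  integral suffices. The factor 4 is 2 + 2 from splitting the square of a difference.\<close>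

lemma translation_diff_bound:
  fixes f :: "real^3 \<Rightarrow> real"
  assumes fm[measurable]: "f \<in> borel_measurable borel" and f2: "integrable lborel (\<lambda>x. (f x)\<^sup>2)"
  shows "integrable lborel (\<lambda>x. (f (x - z) - f x)\<^sup>2)"
    and "(LINT x|lborel. (f (x - z) - f x)\<^sup>2) \<le> 4 * (LINT x|lborel. (f x)\<^sup>2)"
proof -
  have g: "integrable lborel (\<lambda>x. (f (- x))\<^sup>2)" "(LINT x|lborel. (f (- x))\<^sup>2) = (LINT x|lborel. (f x)\<^sup>2)"
    using lborel_integral_reflect(2)[OF _ f2, of 0] lborel_integral_reflect(1)[of "\<lambda>x. (f x)\<^sup>2" 0] by simp_all
  have tr: "integrable lborel (\<lambda>x. (f (x - z))\<^sup>2)" "(LINT x|lborel. (f (x - z))\<^sup>2) = (LINT x|lborel. (f x)\<^sup>2)"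
    using lborel_integral_reflect(2)[OF _ g(1), of z] lborel_integral_reflect(1)[of "\<lambda>x. (f (- x))\<^sup>2" z] g(2) by simp_all
  have b: "integrable lborel (\<lambda>x. 2 * (f (x - z))\<^sup>2 + 2 * (f x)\<^sup>2)" using tr f2 by auto
  have le: "(f (x - z) - f x)\<^sup>2 \<le> 2 * (f (x - z))\<^sup>2 + 2 * (f x)\<^sup>2" for x
    using zero_le_power2[of "f (x - z) + f x"] by (simp add: power2_eq_square algebra_simps)
  show i: "integrable lborel (\<lambda>x. (f (x - z) - f x)\<^sup>2)"
    by (rule Bochner_Integration.integrable_bound[OF b]) (use le in auto)
  have "(LINT x|lborel. (f (x - z) - f x)\<^sup>2) \<le> (LINT x|lborel. 2 * (f (x - z))\<^sup>2 + 2 * (f x)\<^sup>2)"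
    by (rule integral_mono[OF i b le])
  also have "\<dots> = 4 * (LINT x|lborel. (f x)\<^sup>2)" using tr f2 by simp
  finally show "(LINT x|lborel. (f (x - z) - f x)\<^sup>2) \<le> 4 * (LINT x|lborel. (f x)\<^sup>2)" .
qed

lemma translation_nn_integral:
  fixes f :: "real^3 \<Rightarrow> real"
  assumes "f \<in> borel_measurable borel" "integrable lborel (\<lambda>x. (f x)\<^sup>2)"
    and "(LINT x|lborel. (f (x - z) - f x)\<^sup>2) \<le> \<eta>"
  shows "(\<integral>\<^sup>+x. ennreal ((f (x - z) - f x)\<^sup>2) \<partial>lborel) \<le> ennreal \<eta>"
  using nn_integral_eq_integral[OF translation_diff_bound(1)[OF assms(1,2), of z]] assms(3)
  by (simp add: ennreal_leI)

text \<open>The alternative in \<open>om\<close> serves two purposes: small translation errors give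
  convergence, while twice the norm of f as \<eta> meets the second option at once and shows that
  the convolution stays in L2. The proof passes to a Borel representative so that Tonelli's theorem
  applies.\<close>

lemma moll_L2_step:
  assumes f: "sqint lebesgue f" and e: "e > 0" and \<eta>: "\<eta> \<ge> 0"
    and om: "\<And>z. norm z < e \<Longrightarrow> (LINT x|lebesgue. (f (x - z) - f x)\<^sup>2) \<le> \<eta>\<^sup>2 \<or> 4 * (n2 lebesgue f)\<^sup>2 \<le> \<eta>\<^sup>2"
  shows "sqint lebesgue (conv f (moll e))" "n2 lebesgue (\<lambda>x. conv f (moll e) x - f x) \<le> \<eta>"
proof -
  have fm: "f \<in> borel_measurable lebesgue" using f by (simp add: sqint_def)
  obtain f' where f'm[measurable]: "f' \<in> borel_measurable borel" and ae: "AE x in lborel. f x = f' x"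
    using completion_ex_borel_measurable_real[OF fm] by auto
  have ae': "AE x in lebesgue. f x = f' x" using ae by (rule AE_completion)
  have f'l: "f' \<in> borel_measurable lebesgue" by (rule borel_measurable_lebesgueI) measurable
  have sf': "sqint lebesgue f'" by (rule sqint_cong_AE[OF f f'l ae'])
  have f2: "integrable lborel (\<lambda>x. (f' x)\<^sup>2)"
    using sqint_integrable[OF sf'] by (subst (asm) integrable_completion) auto
  have nf: "(n2 lebesgue f)\<^sup>2 = (LINT x|lborel. (f' x)\<^sup>2)"
    unfolding n2_cong_AE[OF fm f'l ae'] n2_sq by (subst integral_completion) auto
  have tr: "(LINT x|lebesgue. (f (x - z) - f x)\<^sup>2) = (LINT x|lborel. (f' (x - z) - f' x)\<^sup>2)" for z
  proof -
    have T: "(\<lambda>x. x - z) \<in> lebesgue \<rightarrow>\<^sub>M lebesgue" by (rule expanding_measurable[OF expanding_translation])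
    have N: "{x. f x \<noteq> f' x} \<in> null_sets lebesgue"
      using ae' completion.AE_iff_null_sets[of "\<lambda>x. f x = f' x" lborel] by simp
    have "(\<lambda>x. x - z) -` {x. f x \<noteq> f' x} \<in> null_sets lebesgue"
      using expanding_vimage_null[OF expanding_translation, of "{x. f x \<noteq> f' x}" z] N by (simp add: negligible_iff_null_sets)
    then have aez: "AE x in lebesgue. f (x - z) = f' (x - z)"
      using completion.AE_iff_null_sets[of "\<lambda>x. f (x - z) = f' (x - z)" lborel] by (simp add: vimage_def)
    have "(LINT x|lebesgue. (f (x - z) - f x)\<^sup>2) = (LINT x|lebesgue. (f' (x - z) - f' x)\<^sup>2)"
    proof (rule integral_cong_AE)
      show "(\<lambda>x. (f (x - z) - f x)\<^sup>2) \<in> borel_measurable lebesgue"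
        using measurable_compose[OF T fm] fm by measurable
      show "(\<lambda>x. (f' (x - z) - f' x)\<^sup>2) \<in> borel_measurable lebesgue"
        using measurable_compose[OF T f'l] f'l by measurable
      show "AE x in lebesgue. (f (x - z) - f x)\<^sup>2 = (f' (x - z) - f' x)\<^sup>2"
        using ae' aez by eventually_elim simp
    qed
    also have "\<dots> = (LINT x|lborel. (f' (x - z) - f' x)\<^sup>2)"
      by (rule integral_completion) measurable
    finally show ?thesis .
  qed
  have d: "(\<integral>\<^sup>+x. ennreal ((conv f' (moll e) x - f' x)\<^sup>2) \<partial>lborel) \<le> ennreal (\<eta>\<^sup>2)"
  proof (rule moll_L2_borel[OF f'm f2 _ e])
    fix z :: "real^3" assume "norm z < e"
    then show "(\<integral>\<^sup>+x. ennreal ((f' (x - z) - f' x)\<^sup>2) \<partial>lborel) \<le> ennreal (\<eta>\<^sup>2)"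
      using om[of z] translation_diff_bound(2)[OF f'm f2, of z] unfolding tr nf
      by (intro translation_nn_integral[OF f'm f2]) linarith
  qed simp
  have c: "conv f (moll e) = conv f' (moll e)"
    by (rule ext) (rule conv_cong_AE[OF ae' fm f'l moll_borel[OF e]])
  have cm: "conv f' (moll e) \<in> borel_measurable borel"
    by (intro borel_measurable_continuous_onI conv_moll_continuous sqint_locally_integrable sf' e)
  have b: "(\<integral>\<^sup>+x. ennreal (norm ((norm (conv f' (moll e) x - f' x))\<^sup>2)) \<partial>lebesgue) \<le> ennreal (\<eta>\<^sup>2)"
    using d cm by (subst nn_integral_completion) auto
  have dm: "(\<lambda>x. conv f' (moll e) x - f' x) \<in> borel_measurable lebesgue"
    by (rule borel_measurable_lebesgueI) (use cm in measurable)
  have sd: "sqint lebesgue (\<lambda>x. conv f' (moll e) x - f' x)"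
    unfolding sqint_def using dm b by (auto simp: integrable_iff_bounded intro: le_less_trans)
  have "sqint lebesgue (\<lambda>x. (conv f' (moll e) x - f' x) + f' x)" by (rule sqint_add[OF sd sf'])
  then show "sqint lebesgue (conv f (moll e))" by (simp add: c)
  have "ennreal ((n2 lebesgue (\<lambda>x. conv f' (moll e) x - f' x))\<^sup>2) \<le> ennreal (\<eta>\<^sup>2)"
    unfolding n2_sq using b sqint_integrable[OF sd] by (subst nn_integral_eq_integral[symmetric]) auto
  then have "n2 lebesgue (\<lambda>x. conv f' (moll e) x - f' x) \<le> \<eta>"
    using \<eta> by (subst (asm) ennreal_le_iff) (auto intro: power2_le_imp_le)
  moreover have "n2 lebesgue (\<lambda>x. conv f (moll e) x - f x) = n2 lebesgue (\<lambda>x. conv f' (moll e) x - f' x)"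
  proof (rule n2_cong_AE)
    show "(\<lambda>x. conv f (moll e) x - f x) \<in> borel_measurable lebesgue"
      unfolding c using borel_measurable_lebesgueI[OF cm] fm by simp
    show "AE x in lebesgue. conv f (moll e) x - f x = conv f' (moll e) x - f' x"
      using ae' by eventually_elim (simp add: c)
  qed (rule dm)
  ultimately show "n2 lebesgue (\<lambda>x. conv f (moll e) x - f x) \<le> \<eta>" by simp
qed

lemma conv_moll_sqint:
  assumes "sqint lebesgue f" "e > 0"
  shows "sqint lebesgue (conv f (moll e))"
  by (rule moll_L2_step(1)[OF assms, of "2 * n2 lebesgue f"]) (auto simp: power_mult_distrib)

text \<open>Translations are expanding with constant 1, so their continuity in L2 at 0 is an
  instance of \<open>tendsto_L2_compose\<close>.\<close>

lemma moll_tendsto_L2: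
  assumes f: "sqint lebesgue f"
  shows "((\<lambda>e. n2 lebesgue (\<lambda>x. conv f (moll e) x - f x)) \<longlongrightarrow> 0) (at_right 0)"
proof (rule tendstoI)
  fix \<eta> :: real assume \<eta>: "\<eta> > 0"
  have fl: "f \<in> borel_measurable lebesgue" and f2l: "integrable lebesgue (\<lambda>x. (f x)\<^sup>2)"
    using f by (auto simp: sqint_def)
  have "((\<lambda>z. LINT x|lebesgue. (f (x - z) - f (x - 0))\<^sup>2) \<longlongrightarrow> 0) (nhds 0)"
  proof (rule tendsto_L2_compose[OF expanding_translation expanding_translation _ fl f2l])
    fix r :: real assume "r > 0"
    then have "\<forall>\<^sub>F z in nhds 0. z \<in> ball (0::real^3) r" by (intro eventually_nhds_in_open) auto
    then show "\<forall>\<^sub>F z in nhds 0. \<forall>x::real^3. dist (x - z) (x - 0) < r"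
      by eventually_elim (auto simp: dist_norm)
  qed
  then have "\<forall>\<^sub>F z in nhds 0. (LINT x|lebesgue. (f (x - z) - f (x - 0))\<^sup>2) < (\<eta> / 2)\<^sup>2"
    by (rule order_tendstoD(2)) (use \<eta> in simp)
  then obtain \<delta> where d: "\<delta> > 0" "\<And>z. norm z < \<delta> \<Longrightarrow> (LINT x|lebesgue. (f (x - z) - f x)\<^sup>2) < (\<eta> / 2)\<^sup>2"
    unfolding eventually_nhds_metric by (auto simp: dist_norm)
  have "\<forall>\<^sub>F e in at_right 0. 0 < e \<and> e < \<delta>"
    using d(1) eventually_at_right_field[of "\<lambda>e. 0 < e \<and> e < \<delta>" 0] by blast
  then show "\<forall>\<^sub>F e in at_right 0. dist (n2 lebesgue (\<lambda>x. conv f (moll e) x - f x)) 0 < \<eta>"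
  proof eventually_elim
    case (elim e)
    have "n2 lebesgue (\<lambda>x. conv f (moll e) x - f x) \<le> \<eta> / 2"
    proof (rule moll_L2_step(2)[OF f])
      fix z :: "real^3" assume "norm z < e"
      then have "norm z < \<delta>" using elim by simp
      from d(2)[OF this]
      show "(LINT x|lebesgue. (f (x - z) - f x)\<^sup>2) \<le> (\<eta> / 2)\<^sup>2 \<or> 4 * (n2 lebesgue f)\<^sup>2 \<le> (\<eta> / 2)\<^sup>2" by simp
    qed (use elim \<eta> in auto)
    then show ?case using \<eta> by simp
  qed
qed

definition mollseq :: "nat \<Rightarrow> real^3 \<Rightarrow> real" where
  "mollseq n = moll (1 / Suc n)"

lemma mollseq_tendsto_L2:
  assumes f: "sqint lebesgue f"
  shows "(\<lambda>n. n2 lebesgue (\<lambda>x. conv f (mollseq n) x - f x)) \<longlonglongrightarrow> 0"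
proof -
  have "(\<lambda>n. 1 / real (Suc n)) \<longlonglongrightarrow> 0"
    using LIMSEQ_inverse_real_of_nat by (simp add: inverse_eq_divide)
  then have "filterlim (\<lambda>n. 1 / real (Suc n)) (at_right 0) sequentially"
    by (auto simp: filterlim_at)
  from filterlim_compose[OF moll_tendsto_L2[OF f] this] show ?thesis by (simp add: mollseq_def)
qed

lemma n2_AE_subseq:
  fixes f :: "nat \<Rightarrow> 'a \<Rightarrow> 'b::euclidean_space"
  assumes f: "\<And>n. sqint M (f n)" and lim: "(\<lambda>n. n2 M (f n)) \<longlonglongrightarrow> 0"
  shows "\<exists>r::nat\<Rightarrow>nat. strict_mono r \<and> (AE x in M. (\<lambda>n. f (r n) x) \<longlonglongrightarrow> 0)"
proof -
  have "\<exists>r::nat\<Rightarrow>nat. strict_mono r \<and> (AE x in M. (\<lambda>n. (norm (f (r n) x))\<^sup>2) \<longlonglongrightarrow> 0)"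
    using lim unfolding n2_tendsto_0_iff
    by (intro tendsto_L1_AE_subseq) (use f in \<open>auto simp: sqint_def\<close>)
  then obtain r :: "nat \<Rightarrow> nat" where r: "strict_mono r" "AE x in M. (\<lambda>n. (norm (f (r n) x))\<^sup>2) \<longlonglongrightarrow> 0" by blast
  have "AE x in M. (\<lambda>n. f (r n) x) \<longlonglongrightarrow> 0"
    using r(2)
  proof eventually_elim
    case (elim x)
    have "(\<lambda>n. sqrt ((norm (f (r n) x))\<^sup>2)) \<longlonglongrightarrow> sqrt 0" by (intro tendsto_real_sqrt elim)
    then show ?case by (simp add: tendsto_norm_zero_iff)
  qed
  with r(1) show ?thesis by blast
qed

subsection \<open>Weak derivatives\<close>

abbreviation ext0 :: "'a set \<Rightarrow> ('a \<Rightarrow> 'b::real_vector) \<Rightarrow> 'a \<Rightarrow> 'b" where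
  "ext0 \<Omega> f \<equiv> (\<lambda>x. indicat_real \<Omega> x *\<^sub>R f x)"

lemma integral_lebesgue_on:
  "\<Omega> \<in> sets lebesgue \<Longrightarrow> (LINT x|lebesgue_on \<Omega>. h x) = (LINT x|lebesgue. ext0 \<Omega> h x)"
  for h :: "_ \<Rightarrow> 'b::{banach, second_countable_topology}"
  by (rule integral_restrict_space) auto

lemma integral_lebesgue_on_zero:
  fixes h :: "_ \<Rightarrow> 'b::{banach, second_countable_topology}"
  assumes "\<Omega> \<in> sets lebesgue" "\<And>x. x \<notin> \<Omega> \<Longrightarrow> h x = 0"
  shows "(LINT x|lebesgue_on \<Omega>. h x) = (LINT x|lebesgue. h x)"
proof -
  have "ext0 \<Omega> h = h" using assms(2) by (auto simp: indicator_def)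
  then show ?thesis using integral_lebesgue_on[OF assms(1), of h] by simp
qed

lemma integrable_lebesgue_on:
  "\<Omega> \<in> sets lebesgue \<Longrightarrow> integrable (lebesgue_on \<Omega>) h \<longleftrightarrow> integrable lebesgue (ext0 \<Omega> h)"
  for h :: "_ \<Rightarrow> 'b::{banach, second_countable_topology}"
  by (rule integrable_restrict_space) auto

lemma measurable_lebesgue_on:
  "\<Omega> \<in> sets lebesgue \<Longrightarrow> h \<in> borel_measurable (lebesgue_on \<Omega>) \<longleftrightarrow> ext0 \<Omega> h \<in> borel_measurable lebesgue"
  for h :: "_ \<Rightarrow> 'b::real_normed_vector"
  by (rule borel_measurable_restrict_space_iff) auto

lemma sqint_lebesgue_on:
  assumes "\<Omega> \<in> sets lebesgue"
  shows "sqint (lebesgue_on \<Omega>) u \<longleftrightarrow> sqint lebesgue (ext0 \<Omega> u)"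
    and "n2 (lebesgue_on \<Omega>) u = n2 lebesgue (ext0 \<Omega> u)"
proof -
  have eq: "(\<lambda>x. (norm (ext0 \<Omega> u x))\<^sup>2) = ext0 \<Omega> (\<lambda>x. (norm (u x))\<^sup>2)"
    by (auto simp: indicator_def)
  show "sqint (lebesgue_on \<Omega>) u \<longleftrightarrow> sqint lebesgue (ext0 \<Omega> u)"
    unfolding sqint_def eq integrable_lebesgue_on[OF assms] measurable_lebesgue_on[OF assms] ..
  show "n2 (lebesgue_on \<Omega>) u = n2 lebesgue (ext0 \<Omega> u)"
    unfolding n2_def eq integral_lebesgue_on[OF assms] ..
qed

lemma sqint_on_restrict:
  assumes "\<Omega> \<in> sets lebesgue" "sqint lebesgue u"
  shows "sqint (lebesgue_on \<Omega>) u" "n2 (lebesgue_on \<Omega>) u \<le> n2 lebesgue u"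
proof -
  have "ext0 \<Omega> u \<in> borel_measurable lebesgue"
    using assms by (intro borel_measurable_scaleR borel_measurable_indicator) (auto simp: sqint_def)
  from sqint_bound[OF assms(2) this, of 1]
  show "sqint (lebesgue_on \<Omega>) u" "n2 (lebesgue_on \<Omega>) u \<le> n2 lebesgue u"
    unfolding sqint_lebesgue_on[OF assms(1)] by (auto simp: indicator_def)
qed

lemma AE_lebesgue_on:
  "\<Omega> \<in> sets lebesgue \<Longrightarrow> (AE x in lebesgue_on \<Omega>. P x) \<longleftrightarrow> (AE x in lebesgue. x \<in> \<Omega> \<longrightarrow> P x)"
  by (rule AE_restrict_space_iff) auto

lemma measurable_lebesgue_AE:
  fixes f g :: "'a::euclidean_space \<Rightarrow> 'b::topological_space"
  assumes f: "f \<in> borel_measurable lebesgue" and ae: "AE x in lebesgue. f x = g x"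
  shows "g \<in> borel_measurable lebesgue"
proof (rule measurableI)
  fix A :: "'b set" assume "A \<in> sets borel"
  then have "f -` A \<inter> space lebesgue \<in> sets lebesgue" using f by (rule measurable_sets[rotated])
  then show "g -` A \<inter> space lebesgue \<in> sets lebesgue"
    by (rule completion.in_sets_AE[rotated]) (use ae in \<open>auto elim!: eventually_mono\<close>)
qed auto

lemma measurable_lebesgue_on_AE:
  fixes f g :: "'a::euclidean_space \<Rightarrow> 'b::real_normed_vector"
  assumes \<Omega>: "\<Omega> \<in> sets lebesgue" and f: "f \<in> borel_measurable (lebesgue_on \<Omega>)"
    and ae: "AE x in lebesgue_on \<Omega>. f x = g x"
  shows "g \<in> borel_measurable (lebesgue_on \<Omega>)"
  unfolding measurable_lebesgue_on[OF \<Omega>]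
  by (rule measurable_lebesgue_AE[of "ext0 \<Omega> f"])
    (use f ae in \<open>auto simp: measurable_lebesgue_on[OF \<Omega>] AE_lebesgue_on[OF \<Omega>] indicator_def elim!: eventually_mono\<close>)

lemma integrable_vecI:
  fixes f :: "'a \<Rightarrow> 'b::euclidean_space ^ 'n::finite"
  assumes "\<And>i. integrable M (\<lambda>x. f x $ i)"
  shows "integrable M f"
proof (rule Bochner_Integration.integrable_bound)
  show "integrable M (\<lambda>x. \<Sum>i\<in>UNIV. norm (f x $ i))" using assms by auto
  show "f \<in> borel_measurable M" using assms by (intro borel_measurable_vecI) auto
  show "AE x in M. norm (f x) \<le> norm (\<Sum>i\<in>UNIV. norm (f x $ i))"
    using L2_set_le_sum[of UNIV "\<lambda>i. norm (f _ $ i)"] by (intro AE_I2) (auto simp: norm_vec_def sum_nonneg)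
qed

lemma locally_integrable_vec_iff:
  fixes u :: "real^3 \<Rightarrow> 'b::euclidean_space ^ 'n::finite"
  shows "u locally_integrable_on \<Omega> \<longleftrightarrow> (\<forall>i. (\<lambda>x. u x $ i) locally_integrable_on \<Omega>)"
proof -
  have "integrable lebesgue (ext0 K u) \<longleftrightarrow> (\<forall>i. integrable lebesgue (ext0 K (\<lambda>x. u x $ i)))" for K
  proof
    assume "integrable lebesgue (ext0 K u)"
    from integrable_bounded_linear[OF bounded_linear_vec_nth this]
    show "\<forall>i. integrable lebesgue (ext0 K (\<lambda>x. u x $ i))" by simp
  qed (auto intro: integrable_vecI)
  then show ?thesis unfolding locally_integrable_on_def set_integrable_def by blast
qed

text \<open>The scalar form of \<open>has_weak_jacobian\<close>: a weak Jacobian consists of one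
  weak gradient per row, and the analytic work is done row by row.\<close>

definition has_weak_gradient :: "(real^3) set \<Rightarrow> (real^3 \<Rightarrow> real) \<Rightarrow> (real^3 \<Rightarrow> real^3) \<Rightarrow> bool" where
  "has_weak_gradient \<Omega> f g \<longleftrightarrow> f locally_integrable_on \<Omega> \<and> g locally_integrable_on \<Omega> \<and>
     (\<forall>\<phi>\<in>test_functions \<Omega>. \<forall>j. (LINT x|lebesgue_on \<Omega>. f x * partial j \<phi> x) = - (LINT x|lebesgue_on \<Omega>. g x $ j * \<phi> x))"

lemma weak_jacobian_iff_gradient:
  "has_weak_jacobian \<Omega> u G \<longleftrightarrow> (\<forall>i. has_weak_gradient \<Omega> (\<lambda>x. u x $ i) (\<lambda>x. G x $ i))"
  unfolding has_weak_jacobian_def has_weak_gradient_def locally_integrable_vec_iff[of u] locally_integrable_vec_iff[of G]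
  by blast

lemma test_outside: "\<phi> \<in> test_functions \<Omega> \<Longrightarrow> x \<notin> \<Omega> \<Longrightarrow> \<phi> x = 0"
  using support_outside[of x \<phi>] by (auto simp: test_functions_def)

lemma open_lebesgue: "open \<Omega> \<Longrightarrow> \<Omega> \<in> sets lebesgue"
  by auto

lemma has_weak_gradient_mono:
  assumes "has_weak_gradient \<Omega> f g" "open \<Omega>" "open \<Omega>'" "\<Omega>' \<subseteq> \<Omega>"
  shows "has_weak_gradient \<Omega>' f g"
  unfolding has_weak_gradient_def
proof (intro conjI ballI allI)
  show "f locally_integrable_on \<Omega>'" "g locally_integrable_on \<Omega>'"
    using assms(1,4) unfolding has_weak_gradient_def locally_integrable_on_def by blast+
  fix \<phi> j assume p: "\<phi> \<in> test_functions \<Omega>'"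
  then have p': "\<phi> \<in> test_functions \<Omega>" using test_functions_mono[OF assms(4)] by blast
  have "(LINT x|lebesgue_on \<Omega>'. h x * \<psi> x) = (LINT x|lebesgue_on \<Omega>. h x * \<psi> x)" if "\<psi> \<in> test_functions \<Omega>'" for h \<psi>
  proof -
    have "h x * \<psi> x = 0" if "x \<notin> \<Omega>'" for x using test_outside[OF \<open>\<psi> \<in> _\<close> that] by simp
    moreover from this have "h x * \<psi> x = 0" if "x \<notin> \<Omega>" for x using that assms(4) by blast
    ultimately show ?thesis
      using integral_lebesgue_on_zero[OF open_lebesgue[OF assms(3)], of "\<lambda>x. h x * \<psi> x"]
        integral_lebesgue_on_zero[OF open_lebesgue[OF assms(2)], of "\<lambda>x. h x * \<psi> x"] by simp
  qed
  with p test_partial[OF p] show "(LINT x|lebesgue_on \<Omega>'. f x * partial j \<phi> x) = - (LINT x|lebesgue_on \<Omega>'. g x $ j * \<phi> x)"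
    using assms(1) p' unfolding has_weak_gradient_def by simp
qed

lemma has_weak_gradient_lincomb:
  assumes \<Omega>: "open \<Omega>" and 1: "has_weak_gradient \<Omega> f g" "has_weak_gradient \<Omega> f' g'"
  shows "has_weak_gradient \<Omega> (\<lambda>x. a * f x + b * f' x) (\<lambda>x. a *\<^sub>R g x + b *\<^sub>R g' x)"
proof -
  note \<Omega>s = open_lebesgue[OF \<Omega>]
  have loc: "(\<lambda>x. a *\<^sub>R h x + b *\<^sub>R h' x) locally_integrable_on \<Omega>"
    if "h locally_integrable_on \<Omega>" "h' locally_integrable_on \<Omega>" for h h' :: "real^3 \<Rightarrow> 'b::euclidean_space"
    unfolding locally_integrable_on_def set_integrable_def
  proof (intro allI impI)
    fix K assume "compact K \<and> K \<subseteq> \<Omega>"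
    then have "integrable lebesgue (ext0 K h)" "integrable lebesgue (ext0 K h')"
      using that unfolding locally_integrable_on_def set_integrable_def by blast+
    then have "integrable lebesgue (\<lambda>x. a *\<^sub>R ext0 K h x + b *\<^sub>R ext0 K h' x)"
      by (intro Bochner_Integration.integrable_add integrable_scaleR_right)
    moreover have "(\<lambda>x. a *\<^sub>R ext0 K h x + b *\<^sub>R ext0 K h' x) = ext0 K (\<lambda>x. a *\<^sub>R h x + b *\<^sub>R h' x)"
      by (auto simp: indicator_def)
    ultimately show "integrable lebesgue (ext0 K (\<lambda>x. a *\<^sub>R h x + b *\<^sub>R h' x))" by (simp only:)
  qed
  have int: "integrable (lebesgue_on \<Omega>) (\<lambda>x. h x * \<phi> x)"
    if h: "h locally_integrable_on \<Omega>" and p: "\<phi> \<in> test_functions \<Omega>" for h \<phi>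
  proof -
    have sup: "compact (support \<phi>)" "support \<phi> \<subseteq> \<Omega>" "smooth \<phi>" using p by (auto simp: test_functions_def)
    obtain B where B: "\<And>x. \<bar>\<phi> x\<bar> \<le> B" using test_bounded[OF p] by metis
    have "integrable lebesgue (\<lambda>x. h x *\<^sub>R \<phi> x)"
    proof (rule integrable_mult_bounded)
      show "integrable lebesgue (\<lambda>y. indicat_real (support \<phi>) y *\<^sub>R h y)"
        using h sup unfolding locally_integrable_on_def set_integrable_def by blast
      show "\<phi> \<in> borel_measurable lebesgue"
        by (intro borel_measurable_lebesgueI borel_measurable_continuous_onI smooth_continuous sup)
      show "norm (\<phi> y) \<le> B" for y using B by simp
    qed (rule support_outside)
    moreover have "ext0 \<Omega> (\<lambda>x. h x * \<phi> x) = (\<lambda>x. h x *\<^sub>R \<phi> x)"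
    proof
      fix x show "ext0 \<Omega> (\<lambda>x. h x * \<phi> x) x = h x *\<^sub>R \<phi> x"
        using test_outside[OF p, of x] by (cases "x \<in> \<Omega>") auto
    qed
    ultimately show ?thesis unfolding integrable_lebesgue_on[OF \<Omega>s] by simp
  qed
  note l = 1[unfolded has_weak_gradient_def locally_integrable_vec_iff[of g] locally_integrable_vec_iff[of g']]
  show ?thesis unfolding has_weak_gradient_def
  proof (intro conjI ballI allI)
    show "(\<lambda>x. a * f x + b * f' x) locally_integrable_on \<Omega>" using loc[of f f'] l by simp
    show "(\<lambda>x. a *\<^sub>R g x + b *\<^sub>R g' x) locally_integrable_on \<Omega>"
      using loc[of g g'] 1 by (simp add: has_weak_gradient_def)
    fix \<phi> j assume p: "\<phi> \<in> test_functions \<Omega>"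
    note p' = test_partial[OF p, of j]
    have i: "integrable (lebesgue_on \<Omega>) (\<lambda>x. f x * partial j \<phi> x)" "integrable (lebesgue_on \<Omega>) (\<lambda>x. f' x * partial j \<phi> x)"
      "integrable (lebesgue_on \<Omega>) (\<lambda>x. g x $ j * \<phi> x)" "integrable (lebesgue_on \<Omega>) (\<lambda>x. g' x $ j * \<phi> x)"
      using l by (intro int p p'; blast)+
    have "(LINT x|lebesgue_on \<Omega>. (a * f x + b * f' x) * partial j \<phi> x)
      = a * (LINT x|lebesgue_on \<Omega>. f x * partial j \<phi> x) + b * (LINT x|lebesgue_on \<Omega>. f' x * partial j \<phi> x)"
      using i by (simp add: distrib_right mult.assoc)
    also have "\<dots> = - (a * (LINT x|lebesgue_on \<Omega>. g x $ j * \<phi> x) + b * (LINT x|lebesgue_on \<Omega>. g' x $ j * \<phi> x))"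
      using l p by simp
    also have "\<dots> = - (LINT x|lebesgue_on \<Omega>. (a *\<^sub>R g x + b *\<^sub>R g' x) $ j * \<phi> x)"
      using i by (simp add: distrib_right mult.assoc)
    finally show "(LINT x|lebesgue_on \<Omega>. (a * f x + b * f' x) * partial j \<phi> x)
      = - (LINT x|lebesgue_on \<Omega>. (a *\<^sub>R g x + b *\<^sub>R g' x) $ j * \<phi> x)" .
  qed
qed

text \<open>The test functions are mollifications of the sign of \<open>h\<close> on a compact box.\<close>

lemma fundamental_lemma:
  assumes \<Omega>: "open \<Omega>" and h: "h locally_integrable_on \<Omega>"
    and zero: "\<And>\<phi>. \<phi> \<in> test_functions \<Omega> \<Longrightarrow> (LINT x|lebesgue_on \<Omega>. h x * \<phi> x) = 0"
  shows "AE x in lebesgue_on \<Omega>. h x = 0"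
proof -
  have K: "AE x in lebesgue. x \<in> K \<longrightarrow> h x = 0" if K: "compact K" "K \<subseteq> \<Omega>" "K \<noteq> {}" for K
  proof -
    obtain d where d: "d > 0" "(\<Union>x\<in>K. cball x d) \<subseteq> \<Omega>"
      using compact_subset_open_imp_cball_epsilon_subset[OF K(1) \<Omega> K(2)] by auto
    \<comment> \<open>A compact neighbourhood of K inside \<Omega> that contains the supports of all
      the mollified signs, so that h is integrable wherever these test functions live.\<close>
    define K' where "K' = {x. infdist x K \<le> d}"
    have K'c: "compact K'" unfolding K'_def by (intro compact_infdist_le K d)
    have K'\<Omega>: "K' \<subseteq> \<Omega>"
    proof
      fix x assume "x \<in> K'"
      then have "infdist x K \<le> d" by (simp add: K'_def)
      moreover obtain y where "y \<in> K" "infdist x K = dist x y"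
        using infdist_attains_inf[of K x] K compact_imp_closed by blast
      ultimately have "x \<in> cball y d" by (simp add: dist_commute)
      then show "x \<in> \<Omega>" using d(2) \<open>y \<in> K\<close> by blast
    qed
    have hK: "integrable lebesgue (ext0 K h)" and hK': "integrable lebesgue (ext0 K' h)"
      using h K K'c K'\<Omega> unfolding locally_integrable_on_def set_integrable_def by blast+
    define s where "s x = sgn (ext0 K h x)" for x
    have sm: "s \<in> borel_measurable lebesgue" unfolding s_def using hK by measurable
    have Km: "K \<in> lmeasurable" by (rule lmeasurable_compact[OF K(1)])
    have ss: "sqint lebesgue s"
      unfolding sqint_def
    proof (intro conjI)
      show "integrable lebesgue (\<lambda>x. (norm (s x))\<^sup>2)"
      proof (rule Bochner_Integration.integrable_bound)
        show "integrable lebesgue (indicat_real K)"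
          using Km by (intro integrable_real_indicator) (auto simp: fmeasurable_def)
        show "AE x in lebesgue. norm ((norm (s x))\<^sup>2) \<le> norm (indicat_real K x)"
        proof (rule AE_I2)
          fix x show "norm ((norm (s x))\<^sup>2) \<le> norm (indicat_real K x)"
            by (cases "x \<in> K") (auto simp: s_def sgn_if)
        qed
      qed (use sm in measurable)
    qed (rule sm)
    have sl: "s locally_integrable_on UNIV" by (rule sqint_locally_integrable[OF ss])
    obtain N where N: "1 / real (Suc N) < d" using nat_approx_posE[OF d(1)] by blast
    define \<phi> where "\<phi> n = conv s (mollseq (n + N))" for n
    have e: "0 < 1 / real (Suc (n + N))" "1 / real (Suc (n + N)) \<le> d" for n
    proof -
      have "1 / real (Suc (n + N)) \<le> 1 / real (Suc N)" by (intro divide_left_mono) auto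
      then show "1 / real (Suc (n + N)) \<le> d" using N by simp
    qed simp
    have out: "\<phi> n x = 0" if "x \<notin> K'" for n x
    proof -
      have "s y * moll (1 / Suc (n + N)) (x - y) = 0" for y
      proof (cases "y \<in> K")
        case True
        then have "infdist x K \<le> dist x y" by (rule infdist_le)
        then have "norm (x - y) \<ge> 1 / real (Suc (n + N))" using that e(2)[of n] by (simp add: K'_def dist_norm)
        then show ?thesis using moll_outside[OF e(1)[of n]] by simp
      qed (simp add: s_def)
      then have "(\<lambda>y. s y *\<^sub>R moll (1 / Suc (n + N)) (x - y)) = (\<lambda>y. 0)" by (intro ext) simp
      then show ?thesis unfolding \<phi>_def conv_def mollseq_def by (simp only: Bochner_Integration.integral_zero)
    qed
    have test: "\<phi> n \<in> test_functions \<Omega>" for n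
      unfolding \<phi>_def mollseq_def
      by (rule test_functionsI[OF conv_smooth(1)[OF sl moll_test_UNIV[OF e(1)]] K'c K'\<Omega>])
        (rule out[unfolded \<phi>_def mollseq_def])
    have b: "\<bar>\<phi> n x\<bar> \<le> 1" for n x
    proof -
      note mt = moll_test[OF e(1)[of n], of x UNIV, simplified]
      have "norm (\<phi> n x) \<le> (LINT y|lebesgue. moll (1 / real (Suc (n + N))) (x - y))"
        unfolding \<phi>_def conv_def mollseq_def
      proof (rule Bochner_Integration.integral_norm_bound_integral)
        obtain L R where kk: "kernel (moll (1 / real (Suc (n + N)))) (grad (moll (1 / real (Suc (n + N))))) L R"
          using test_kernel[OF moll_test_UNIV[OF e(1)]] .
        show "integrable lebesgue (\<lambda>y. s y *\<^sub>R moll (1 / real (Suc (n + N))) (x - y))"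
          by (rule kernel_conv_integrable(1)[OF sl kk])
        show "integrable lebesgue (\<lambda>y. moll (1 / real (Suc (n + N))) (x - y))"
          using test_integrable[OF mt] by simp
        show "norm (s y *\<^sub>R moll (1 / real (Suc (n + N))) (x - y)) \<le> moll (1 / real (Suc (n + N))) (x - y)" for y
        proof -
          have "\<bar>s y\<bar> \<le> 1" by (simp add: s_def sgn_if)
          then show ?thesis using moll_nonneg[OF e(1)[of n], of "x - y"]
            by (simp add: abs_mult mult_left_le_one_le)
        qed
      qed
      also have "\<dots> = (LINT y|lborel. moll (1 / real (Suc (n + N))) (x - y))"
        using moll_borel[OF e(1)[of n]] by (intro integral_completion) measurable
      also have "\<dots> = (LINT y|lborel. moll (1 / real (Suc (n + N))) y)"
        by (rule lborel_integral_reflect(1)[OF moll_borel[OF e(1)]])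
      also have "\<dots> = (LINT y|lebesgue. moll (1 / real (Suc (n + N))) y)"
        using moll_borel[OF e(1)[of n]] by (intro integral_completion[symmetric]) measurable
      also have "\<dots> = 1" by (rule moll_integral[OF e(1)])
      finally show ?thesis by simp
    qed
    have p2: "sqint lebesgue (\<phi> n)" for n unfolding \<phi>_def mollseq_def by (rule conv_moll_sqint[OF ss e(1)])
    have "(\<lambda>n. n2 lebesgue (\<lambda>x. \<phi> n x - s x)) \<longlonglongrightarrow> 0"
      unfolding \<phi>_def by (rule LIMSEQ_ignore_initial_segment[OF mollseq_tendsto_L2[OF ss]])
    from n2_AE_subseq[OF sqint_diff[OF p2 ss] this]
    obtain r :: "nat \<Rightarrow> nat" where r: "AE x in lebesgue. (\<lambda>n. \<phi> (r n) x - s x) \<longlonglongrightarrow> 0" by blast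
    \<comment> \<open>The mollified signs are bounded by 1 and converge almost everywhere along r.
      The integrals, all of them zero, therefore converge to the integral of the absolute value of h
      over K.\<close>
    have "(\<lambda>n. LINT x|lebesgue. ext0 K' h x * \<phi> (r n) x) \<longlonglongrightarrow> (LINT x|lebesgue. ext0 K' h x * s x)"
    proof (rule integral_dominated_convergence)
      show "integrable lebesgue (\<lambda>x. norm (ext0 K' h x))" using hK' by auto
      show "(\<lambda>x. ext0 K' h x * s x) \<in> borel_measurable lebesgue" using hK' sm by measurable
      show "(\<lambda>x. ext0 K' h x * \<phi> (r n) x) \<in> borel_measurable lebesgue" for n
        using hK' sqint_measurable[OF p2[of "r n"]] by measurable
      show "AE x in lebesgue. norm (ext0 K' h x * \<phi> (r n) x) \<le> norm (ext0 K' h x)" for n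
        using b by (intro AE_I2) (simp add: abs_mult mult_left_le)
      show "AE x in lebesgue. (\<lambda>n. ext0 K' h x * \<phi> (r n) x) \<longlonglongrightarrow> ext0 K' h x * s x"
        using r
      proof eventually_elim
        case (elim x)
        then have "(\<lambda>n. \<phi> (r n) x) \<longlonglongrightarrow> s x" by (simp add: LIM_zero_iff)
        then show ?case by (intro tendsto_mult tendsto_const)
      qed
    qed
    moreover have "(LINT x|lebesgue. ext0 K' h x * \<phi> (r n) x) = 0" for n
    proof -
      have e: "(\<lambda>x. ext0 K' h x * \<phi> (r n) x) = (\<lambda>x. h x * \<phi> (r n) x)"
      proof
        fix x show "ext0 K' h x * \<phi> (r n) x = h x * \<phi> (r n) x"
          using out[of x "r n"] by (cases "x \<in> K'") auto
      qed
      have "(LINT x|lebesgue. h x * \<phi> (r n) x) = 0"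
        using zero[OF test[of "r n"]] test_outside[OF test[of "r n"]]
        by (subst (asm) integral_lebesgue_on_zero) (auto simp: open_lebesgue[OF \<Omega>])
      then show ?thesis by (simp only: e)
    qed
    ultimately have "(LINT x|lebesgue. ext0 K' h x * s x) = 0"
      using LIMSEQ_unique by (simp add: LIMSEQ_const_iff)
    moreover have "K \<subseteq> K'" using d(1) by (auto simp: K'_def)
    then have "ext0 K' h x * s x = \<bar>ext0 K h x\<bar>" for x
      by (cases "x \<in> K") (auto simp: s_def sgn_if)
    ultimately have "(LINT x|lebesgue. \<bar>ext0 K h x\<bar>) = 0" by simp
    then have "AE x in lebesgue. \<bar>ext0 K h x\<bar> = 0"
      by (subst (asm) integral_nonneg_eq_0_iff_AE) (use hK in auto)
    then show ?thesis by eventually_elim (auto simp: indicator_def)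
  qed
  \<comment> \<open>Countably many compact boxes exhaust \<Omega>, so the statement for compact sets
    gives the one for \<Omega>.\<close>
  obtain \<D> where D: "countable \<D>" "\<D> \<subseteq> Pow \<Omega>" "\<And>X. X \<in> \<D> \<Longrightarrow> \<exists>a b. X = cbox a b" "\<Union>\<D> = \<Omega>"
  proof (rule open_countable_Union_open_cbox[OF \<Omega>])
    fix \<D> assume "countable \<D>" "\<D> \<subseteq> Pow \<Omega>" "\<And>X. X \<in> \<D> \<Longrightarrow> \<exists>a b. X = cbox a b" "\<Union>\<D> = \<Omega>"
    then show thesis by (rule that)
  qed
  have "\<forall>X\<in>\<D>. AE x in lebesgue. x \<in> X \<longrightarrow> h x = 0"
  proof
    fix X assume X: "X \<in> \<D>"
    show "AE x in lebesgue. x \<in> X \<longrightarrow> h x = 0"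
    proof (cases "X = {}")
      case False
      obtain a b where "X = cbox a b" using D(3)[OF X] by blast
      then show ?thesis using False K[of X] D(2) X by auto
    qed simp
  qed
  then have "AE x in lebesgue. \<forall>X\<in>\<D>. x \<in> X \<longrightarrow> h x = 0"
    by (simp only: AE_ball_countable[OF D(1)])
  then have "AE x in lebesgue. x \<in> \<Omega> \<longrightarrow> h x = 0"
    by eventually_elim (use D(4) in blast)
  then show ?thesis by (simp add: AE_lebesgue_on open_lebesgue[OF \<Omega>])
qed

lemma weak_jacobian_unique:
  assumes \<Omega>: "open \<Omega>" and G: "has_weak_jacobian \<Omega> u G" and G': "has_weak_jacobian \<Omega> u G'"
  shows "AE x in lebesgue_on \<Omega>. G x = G' x"
proof -
  have "AE x in lebesgue_on \<Omega>. G x $ i $ j = G' x $ i $ j" for i j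
  proof -
    let ?h = "\<lambda>x. 1 *\<^sub>R G x $ i + (-1) *\<^sub>R G' x $ i"
    have "has_weak_gradient \<Omega> (\<lambda>x. 1 * u x $ i + (-1) * u x $ i) ?h"
      using G G' unfolding weak_jacobian_iff_gradient by (intro has_weak_gradient_lincomb[OF \<Omega>]) auto
    then have h: "?h locally_integrable_on \<Omega>"
      and z: "\<And>\<phi>. \<phi> \<in> test_functions \<Omega> \<Longrightarrow> (LINT x|lebesgue_on \<Omega>. ?h x $ j * \<phi> x) = 0"
      unfolding has_weak_gradient_def by auto
    have "(\<lambda>x. ?h x $ j) locally_integrable_on \<Omega>"
      using h locally_integrable_vec_iff[of ?h \<Omega>] by blast
    then have "AE x in lebesgue_on \<Omega>. ?h x $ j = 0" by (rule fundamental_lemma[OF \<Omega>]) (rule z)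
    then show ?thesis by eventually_elim simp
  qed
  then have "AE x in lebesgue_on \<Omega>. \<forall>i j. G x $ i $ j = G' x $ i $ j"
    by (simp add: AE_all_countable)
  then show ?thesis by eventually_elim (simp add: vec_eq_iff)
qed

section \<open>The chosen weak Jacobian and the norm of \<open>H1\<close>\<close>

lemma weak_jacobian_has: "has_weak_jacobian \<Omega> u G \<Longrightarrow> has_weak_jacobian \<Omega> u (weak_jacobian \<Omega> u)"
  unfolding weak_jacobian_def by (rule someI[where P="has_weak_jacobian \<Omega> u"])

lemma weak_jacobian_AE:
  "open \<Omega> \<Longrightarrow> has_weak_jacobian \<Omega> u G \<Longrightarrow> AE x in lebesgue_on \<Omega>. weak_jacobian \<Omega> u x = G x"
  by (rule weak_jacobian_unique[OF _ weak_jacobian_has])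

lemma sqint_on_locally_integrable:
  fixes u :: "real^3 \<Rightarrow> 'b::euclidean_space"
  assumes \<Omega>: "\<Omega> \<in> sets lebesgue" and u: "sqint (lebesgue_on \<Omega>) u"
  shows "u locally_integrable_on \<Omega>"
  unfolding locally_integrable_on_def set_integrable_def
proof (intro allI impI)
  fix K assume K: "compact K \<and> K \<subseteq> \<Omega>"
  have "integrable lebesgue (ext0 K (ext0 \<Omega> u))"
    using u K unfolding sqint_lebesgue_on[OF \<Omega>] by (intro sqint_integrable_on lmeasurable_compact) auto
  moreover have "ext0 K (ext0 \<Omega> u) = ext0 K u"
  proof
    fix x show "ext0 K (ext0 \<Omega> u) x = ext0 K u x" using K by (cases "x \<in> K") auto
  qed
  ultimately show "integrable lebesgue (ext0 K u)" by simp
qed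

abbreviation on_L2 :: "(real^3) set \<Rightarrow> (real^3 \<Rightarrow> 'b::euclidean_space) \<Rightarrow> bool" where
  "on_L2 \<Omega> u \<equiv> sqint (lebesgue_on \<Omega>) u"

abbreviation norm_L2 :: "(real^3) set \<Rightarrow> (real^3 \<Rightarrow> 'b::euclidean_space) \<Rightarrow> real" where
  "norm_L2 \<Omega> u \<equiv> n2 (lebesgue_on \<Omega>) u"

lemma H1I:
  assumes "on_L2 \<Omega> u" "on_L2 \<Omega> G" "has_weak_jacobian \<Omega> u G"
  shows "u \<in> H1 \<Omega>"
  using assms unfolding H1_def L2_iff by (auto simp: L2_iff)

text \<open>The chosen weak Jacobian need not be the square integrable one that witnesses
  membership, but by uniqueness the two agree almost everywhere.\<close>

lemma H1D:
  assumes \<Omega>: "open \<Omega>" and u: "u \<in> H1 \<Omega>"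
  shows "on_L2 \<Omega> u" "on_L2 \<Omega> (weak_jacobian \<Omega> u)" "has_weak_jacobian \<Omega> u (weak_jacobian \<Omega> u)"
proof -
  obtain G where G: "on_L2 \<Omega> u" "on_L2 \<Omega> G" "has_weak_jacobian \<Omega> u G"
    using u by (auto simp: H1_def L2_iff)
  show "on_L2 \<Omega> u" by (rule G)
  show "has_weak_jacobian \<Omega> u (weak_jacobian \<Omega> u)" by (rule weak_jacobian_has[OF G(3)])
  have ae: "AE x in lebesgue_on \<Omega>. G x = weak_jacobian \<Omega> u x"
    using weak_jacobian_AE[OF \<Omega> G(3)] by eventually_elim simp
  show "on_L2 \<Omega> (weak_jacobian \<Omega> u)"
    by (rule sqint_cong_AE[OF G(2) measurable_lebesgue_on_AE[OF open_lebesgue[OF \<Omega>] sqint_measurable[OF G(2)] ae] ae])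
qed

lemma H1_lincomb:
  assumes \<Omega>: "open \<Omega>" and u: "u \<in> H1 \<Omega>" and v: "v \<in> H1 \<Omega>"
  shows "(\<lambda>x. a *\<^sub>R u x + b *\<^sub>R v x) \<in> H1 \<Omega>"
    and "AE x in lebesgue_on \<Omega>. weak_jacobian \<Omega> (\<lambda>x. a *\<^sub>R u x + b *\<^sub>R v x) x = a *\<^sub>R weak_jacobian \<Omega> u x + b *\<^sub>R weak_jacobian \<Omega> v x"
proof -
  have j: "has_weak_jacobian \<Omega> (\<lambda>x. a *\<^sub>R u x + b *\<^sub>R v x) (\<lambda>x. a *\<^sub>R weak_jacobian \<Omega> u x + b *\<^sub>R weak_jacobian \<Omega> v x)"
    using has_weak_gradient_lincomb[OF \<Omega>] H1D(3)[OF \<Omega> u] H1D(3)[OF \<Omega> v]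
    unfolding weak_jacobian_iff_gradient by simp
  show "(\<lambda>x. a *\<^sub>R u x + b *\<^sub>R v x) \<in> H1 \<Omega>"
    by (rule H1I[OF _ _ j]) (intro sqint_add sqint_scale H1D[OF \<Omega>] u v)+
  show "AE x in lebesgue_on \<Omega>. weak_jacobian \<Omega> (\<lambda>x. a *\<^sub>R u x + b *\<^sub>R v x) x = a *\<^sub>R weak_jacobian \<Omega> u x + b *\<^sub>R weak_jacobian \<Omega> v x"
    by (rule weak_jacobian_AE[OF \<Omega> j])
qed

lemma H1_diff:
  assumes \<Omega>: "open \<Omega>" and u: "u \<in> H1 \<Omega>" and v: "v \<in> H1 \<Omega>"
  shows "(\<lambda>x. u x - v x) \<in> H1 \<Omega>"
    and "AE x in lebesgue_on \<Omega>. weak_jacobian \<Omega> (\<lambda>x. u x - v x) x = weak_jacobian \<Omega> u x - weak_jacobian \<Omega> v x"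
  using H1_lincomb[OF assms, of 1 "-1"] by simp_all

lemma H1_norm_le: "H1_norm \<Omega> u \<le> norm_L2 \<Omega> u + norm_L2 \<Omega> (weak_jacobian \<Omega> u)"
  unfolding H1_norm_def n2_sq[symmetric]
  by (rule sqrt_sum_squares_le_sum) auto

lemma H1_norm_ge: "norm_L2 \<Omega> u \<le> H1_norm \<Omega> u" "norm_L2 \<Omega> (weak_jacobian \<Omega> u) \<le> H1_norm \<Omega> u"
  unfolding H1_norm_def n2_sq[symmetric] by (auto intro: real_le_rsqrt)

lemma H1_norm_nonneg: "0 \<le> H1_norm \<Omega> u"
  unfolding H1_norm_def by simp

lemma norm_L2_jacobian_diff:
  assumes \<Omega>: "open \<Omega>" and u: "u \<in> H1 \<Omega>" and v: "v \<in> H1 \<Omega>"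
  shows "norm_L2 \<Omega> (weak_jacobian \<Omega> (\<lambda>x. u x - v x)) = norm_L2 \<Omega> (\<lambda>x. weak_jacobian \<Omega> u x - weak_jacobian \<Omega> v x)"
  by (rule n2_cong_AE[OF _ _ H1_diff(2)[OF assms]])
    (intro sqint_measurable sqint_diff H1D[OF \<Omega>] H1_diff[OF \<Omega>] u v)+

lemma H1_norm_tendsto_iff:
  assumes \<Omega>: "open \<Omega>" and u: "\<And>n. u n \<in> H1 \<Omega>" and v: "v \<in> H1 \<Omega>"
  shows "((\<lambda>n. H1_norm \<Omega> (\<lambda>x. u n x - v x)) \<longlongrightarrow> 0) F \<longleftrightarrow>
     ((\<lambda>n. norm_L2 \<Omega> (\<lambda>x. u n x - v x)) \<longlongrightarrow> 0) F \<and>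
     ((\<lambda>n. norm_L2 \<Omega> (\<lambda>x. weak_jacobian \<Omega> (u n) x - weak_jacobian \<Omega> v x)) \<longlongrightarrow> 0) F"
  unfolding norm_L2_jacobian_diff[OF \<Omega> u v, symmetric]
proof (intro iffI conjI)
  assume *: "((\<lambda>n. H1_norm \<Omega> (\<lambda>x. u n x - v x)) \<longlongrightarrow> 0) F"
  show "((\<lambda>n. norm_L2 \<Omega> (\<lambda>x. u n x - v x)) \<longlongrightarrow> 0) F"
    by (rule Lim_null_comparison[OF _ *]) (use H1_norm_ge(1) in auto)
  show "((\<lambda>n. norm_L2 \<Omega> (weak_jacobian \<Omega> (\<lambda>x. u n x - v x))) \<longlongrightarrow> 0) F"
    by (rule Lim_null_comparison[OF _ *]) (use H1_norm_ge(2) in auto)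
next
  assume *: "((\<lambda>n. norm_L2 \<Omega> (\<lambda>x. u n x - v x)) \<longlongrightarrow> 0) F \<and>
     ((\<lambda>n. norm_L2 \<Omega> (weak_jacobian \<Omega> (\<lambda>x. u n x - v x))) \<longlongrightarrow> 0) F"
  have "((\<lambda>n. norm_L2 \<Omega> (\<lambda>x. u n x - v x) + norm_L2 \<Omega> (weak_jacobian \<Omega> (\<lambda>x. u n x - v x))) \<longlongrightarrow> 0 + 0) F"
    using * by (intro tendsto_add) auto
  then have *: "((\<lambda>n. norm_L2 \<Omega> (\<lambda>x. u n x - v x) + norm_L2 \<Omega> (weak_jacobian \<Omega> (\<lambda>x. u n x - v x))) \<longlongrightarrow> 0) F"
    by simp
  show "((\<lambda>n. H1_norm \<Omega> (\<lambda>x. u n x - v x)) \<longlongrightarrow> 0) F"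
    by (rule Lim_null_comparison[OF _ *]) (use H1_norm_le H1_norm_nonneg in auto)
qed

subsection \<open>Integration by parts\<close>

text \<open>Convolving the constant 1 with k gives a constant function; its derivative, which is 0,
  is the integral of g.\<close>

lemma kernel_integral_gradient:
  assumes k: "kernel k g L R"
  shows "(LINT y|lebesgue. g y) = 0"
proof -
  note loc = locally_integrable_const[of "1::real" UNIV]
  have kb: "k \<in> borel_measurable borel"
    by (intro borel_measurable_continuous_onI kernel_continuous[OF k])
  have gb: "g \<in> borel_measurable borel" by (rule kernelD(3)[OF k])
  have const: "conv (\<lambda>x. 1) k = (\<lambda>x. LINT z|lborel. k z)"
    by (rule ext, subst conv_reflect) (use kb in auto)
  have "(conv (\<lambda>x. 1) k has_derivative (\<lambda>h. conv (\<lambda>x. 1) g 0 \<bullet> h)) (at 0)"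
    by (rule conv_has_derivative[OF loc k])
  then have "((\<lambda>x::real^3. LINT z|lborel. k z) has_derivative (\<lambda>h. conv (\<lambda>x. 1) g 0 \<bullet> h)) (at 0)"
    unfolding const .
  from has_derivative_unique[OF this has_derivative_const]
  have "conv (\<lambda>x. 1) g 0 \<bullet> conv (\<lambda>x. 1) g 0 = 0" by metis
  then have "conv (\<lambda>x. 1) g 0 = 0" by simp
  then have "(LINT z|lborel. g z) = 0" using gb by (subst (asm) conv_reflect) auto
  then show ?thesis using gb by (subst integral_completion) auto
qed

text \<open>The product of k and \<phi> is again a kernel, so its gradient integrates to 0.\<close>

lemma integration_by_parts:
  fixes k :: "real^3 \<Rightarrow> real"
  assumes k: "\<And>x. (k has_derivative (\<lambda>h. g x \<bullet> h)) (at x)" and g: "g \<in> borel_measurable borel"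
    and b: "\<And>R. \<exists>B. \<forall>x. norm x \<le> R \<longrightarrow> norm (g x) \<le> B"
    and p: "\<phi> \<in> test_functions \<Omega>"
  shows "(LINT x|lebesgue. k x * partial j \<phi> x) = - (LINT x|lebesgue. g x $ j * \<phi> x)"
proof -
  have sm: "smooth \<phi>" using p by (simp add: test_functions_def)
  have kc: "continuous_on A k" for A
    by (meson continuous_at_imp_continuous_on has_derivative_continuous k)
  obtain L R where kk: "kernel \<phi> (grad \<phi>) L R" using test_kernel[OF p] .
  obtain B where B: "\<And>x. norm x \<le> R \<Longrightarrow> norm (g x) \<le> B" using b[of R] by blast
  have "bounded (k ` cball 0 R)" by (intro compact_imp_bounded compact_continuous_image kc compact_cball)
  then obtain B' where "\<forall>y\<in>k ` cball 0 R. norm y \<le> B'" unfolding bounded_iff by blast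
  then have B': "\<And>x. norm x \<le> R \<Longrightarrow> \<bar>k x\<bar> \<le> B'" by simp
  define C where "C = L * (2 * \<bar>R\<bar> + 1)"
  have C: "\<bar>\<phi> x\<bar> \<le> C" for x unfolding C_def by (rule kernel_bounded[OF kk])
  let ?g = "\<lambda>x. k x *\<^sub>R grad \<phi> x + \<phi> x *\<^sub>R g x"
  have kb: "k \<in> borel_measurable borel" and pb: "\<phi> \<in> borel_measurable borel"
    by (intro borel_measurable_continuous_onI kc kernel_continuous[OF kk])+
  have ker: "kernel (\<lambda>x. k x * \<phi> x) ?g (\<bar>B'\<bar> * L + C * \<bar>B\<bar>) R"
    unfolding kernel_def
  proof (intro conjI allI impI)
    fix x
    have "((\<lambda>x. k x * \<phi> x) has_derivative (\<lambda>h. k x * (grad \<phi> x \<bullet> h) + (g x \<bullet> h) * \<phi> x)) (at x)"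
      by (rule has_derivative_mult[OF k kernelD(1)[OF kk]])
    then show "((\<lambda>x. k x * \<phi> x) has_derivative (\<lambda>h. ?g x \<bullet> h)) (at x)"
      by (simp add: inner_add_left mult.commute)
    show "norm (?g x) \<le> \<bar>B'\<bar> * L + C * \<bar>B\<bar>"
    proof (cases "norm x \<le> R")
      case True
      have "norm (?g x) \<le> \<bar>k x\<bar> * norm (grad \<phi> x) + \<bar>\<phi> x\<bar> * norm (g x)"
        using norm_triangle_ineq[of "k x *\<^sub>R grad \<phi> x" "\<phi> x *\<^sub>R g x"] by simp
      also have "\<dots> \<le> \<bar>B'\<bar> * L + C * \<bar>B\<bar>"
        using B[OF True] B'[OF True] kernelD(2)[OF kk, of x] C[of x] kernelD(5)[OF kk]
        by (intro add_mono mult_mono) auto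
      finally show ?thesis .
    next
      case False
      then have "?g x = 0" using kernelD(4)[OF kk, of x] kernel_gradient_outside[OF kk, of x] by simp
      then show ?thesis using kernelD(5)[OF kk] C[of x] by simp
    qed
    show "k x * \<phi> x = 0" if "norm x > R" using kernelD(4)[OF kk that] by simp
  qed (use kb pb g kernelD(3)[OF kk] in measurable)
  have i1: "integrable lebesgue (\<lambda>x. k x * partial j \<phi> x)"
  proof -
    have "integrable lebesgue (\<lambda>x. (1::real) *\<^sub>R (k x * partial j \<phi> x))"
    proof (rule integrable_mult_bounded[where S="cball 0 R" and B="\<bar>B'\<bar> * L"])
      show "(\<lambda>x. k x * partial j \<phi> x) \<in> borel_measurable lebesgue"
        by (intro borel_measurable_lebesgueI borel_measurable_times kb borel_measurable_continuous_onI smooth_continuous smooth_partial sm)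
      show "k x * partial j \<phi> x = 0" if "x \<notin> cball 0 R" for x
        using kernel_gradient_outside[OF kk, of x] that by (simp add: vec_eq_iff)
      show "norm (k x * partial j \<phi> x) \<le> \<bar>B'\<bar> * L" for x
      proof (cases "norm x \<le> R")
        case True
        have "\<bar>partial j \<phi> x\<bar> \<le> L"
          using Finite_Cartesian_Product.norm_nth_le[of "grad \<phi> x" j] kernelD(2)[OF kk, of x] by simp
        then show ?thesis unfolding real_norm_def abs_mult
          using B'[OF True] by (intro mult_mono) auto
      next
        case False
        then show ?thesis using kernel_gradient_outside[OF kk, of x] kernelD(5)[OF kk] by (simp add: vec_eq_iff)
      qed
    qed (rule locally_integrable_cball[OF locally_integrable_const])
    then show ?thesis by simp
  qed
  have i0: "integrable lebesgue (\<lambda>x. (1::real) *\<^sub>R ?g x)"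
  proof (rule integrable_mult_bounded[where S="cball 0 R" and B="\<bar>B'\<bar> * L + C * \<bar>B\<bar>"])
    show "?g \<in> borel_measurable lebesgue" by (rule borel_measurable_lebesgueI[OF kernelD(3)[OF ker]])
    show "norm (?g x) \<le> \<bar>B'\<bar> * L + C * \<bar>B\<bar>" for x by (rule kernelD(2)[OF ker])
    show "?g x = 0" if "x \<notin> cball 0 R" for x using that by (intro kernel_gradient_outside[OF ker]) simp
  qed (rule locally_integrable_cball[OF locally_integrable_const])
  then have i0': "integrable lebesgue (\<lambda>x. ?g x $ j)"
    using integrable_bounded_linear[OF bounded_linear_vec_nth, of lebesgue ?g j] by simp
  have "0 = (LINT x|lebesgue. ?g x) $ j" using kernel_integral_gradient[OF ker] by simp
  also have "\<dots> = (LINT x|lebesgue. ?g x $ j)"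
    using integral_bounded_linear[OF bounded_linear_vec_nth[of j], of lebesgue ?g] i0 by simp
  finally have z: "(LINT x|lebesgue. ?g x $ j) = 0" by simp
  have "(\<lambda>x. g x $ j * \<phi> x) = (\<lambda>x. ?g x $ j - k x * partial j \<phi> x)" by (rule ext) simp
  then have "(LINT x|lebesgue. g x $ j * \<phi> x) = (LINT x|lebesgue. ?g x $ j) - (LINT x|lebesgue. k x * partial j \<phi> x)"
    using Bochner_Integration.integral_diff[OF i0' i1] by simp
  then show ?thesis using z by simp
qed

text \<open>The bridge from classical to weak derivatives. Besides test functions it covers
  compositions with \<open>\<Psi>n\<close>, which are only known to be differentiable with a
  continuous gradient.\<close>

lemma classical_weak_gradient:
  fixes k :: "real^3 \<Rightarrow> real"
  assumes k: "\<And>x. (k has_derivative (\<lambda>h. g x \<bullet> h)) (at x)" and g: "g \<in> borel_measurable borel"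
    and b: "\<And>R. \<exists>B. \<forall>x. norm x \<le> R \<longrightarrow> norm (g x) \<le> B" and \<Omega>: "open \<Omega>"
  shows "has_weak_gradient \<Omega> k g"
  unfolding has_weak_gradient_def
proof (intro conjI ballI allI)
  have loc: "h locally_integrable_on \<Omega>" if h: "h \<in> borel_measurable borel" and b: "\<And>R. \<exists>B. \<forall>x. norm x \<le> R \<longrightarrow> norm (h x) \<le> B"
    for h :: "real^3 \<Rightarrow> 'b::euclidean_space"
    unfolding locally_integrable_on_def set_integrable_def
  proof (intro allI impI)
    fix K assume K: "compact K \<and> K \<subseteq> \<Omega>"
    then obtain R where R: "\<And>x. x \<in> K \<Longrightarrow> norm x \<le> R" using compact_imp_bounded[of K] by (auto simp: bounded_iff)
    obtain B where B: "\<And>x. norm x \<le> R \<Longrightarrow> norm (h x) \<le> B" using b[of R] by blast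
    show "integrable lebesgue (ext0 K h)"
    proof (rule Bochner_Integration.integrable_bound)
      show "integrable lebesgue (ext0 K (\<lambda>x. B))"
        using locally_integrable_const[of B \<Omega>] K unfolding locally_integrable_on_def set_integrable_def by blast
      show "ext0 K h \<in> borel_measurable lebesgue"
        using K lmeasurable_compact[of K] borel_measurable_lebesgueI[OF h]
        by (intro borel_measurable_scaleR borel_measurable_indicator) auto
      show "AE x in lebesgue. norm (ext0 K h x) \<le> norm (ext0 K (\<lambda>x. B) x)"
        using B R by (intro AE_I2) (force simp: indicator_def)
    qed
  qed
  have kc: "continuous_on A k" for A
    by (meson continuous_at_imp_continuous_on has_derivative_continuous k)
  show "k locally_integrable_on \<Omega>"
  proof (rule loc)
    show "\<exists>B. \<forall>x. norm x \<le> R \<longrightarrow> norm (k x) \<le> B" for R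
    proof -
      have "bounded (k ` cball 0 R)" by (intro compact_imp_bounded compact_continuous_image kc compact_cball)
      then obtain B where "\<forall>y\<in>k ` cball 0 R. norm y \<le> B" unfolding bounded_iff by blast
      then have "\<forall>x. norm x \<le> R \<longrightarrow> norm (k x) \<le> B" by simp
      then show ?thesis ..
    qed
  qed (intro borel_measurable_continuous_onI kc)
  show "g locally_integrable_on \<Omega>" by (rule loc[OF g b])
  fix \<phi> j assume p: "\<phi> \<in> test_functions \<Omega>"
  show "(LINT x|lebesgue_on \<Omega>. k x * partial j \<phi> x) = - (LINT x|lebesgue_on \<Omega>. g x $ j * \<phi> x)"
    using integration_by_parts[OF k g b p, of j] test_outside[OF p] test_outside[OF test_partial[OF p]]
    by (subst (1 2) integral_lebesgue_on_zero[OF open_lebesgue[OF \<Omega>]]) auto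
qed

subsection \<open>The spaces \<open>H1\<close> and \<open>H10\<close>\<close>

definition cjac :: "(real^3 \<Rightarrow> real^3) \<Rightarrow> real^3 \<Rightarrow> real^3^3" where
  "cjac \<phi> x = (\<chi> i. grad (\<lambda>y. \<phi> y $ i) x)"

lemma cjac_nth [simp]: "cjac \<phi> x $ i = grad (\<lambda>y. \<phi> y $ i) x"
  by (simp add: cjac_def)

lemma test_sqint:
  assumes p: "\<phi> \<in> test_functions \<Omega>" shows "sqint lebesgue \<phi>"
  unfolding sqint_def
proof
  obtain B where B: "\<And>x. \<bar>\<phi> x\<bar> \<le> B" using test_bounded[OF p] by metis
  show m: "\<phi> \<in> borel_measurable lebesgue" using test_integrable[OF p] by auto
  show "integrable lebesgue (\<lambda>x. (norm (\<phi> x))\<^sup>2)"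
  proof (rule Bochner_Integration.integrable_bound)
    show "integrable lebesgue (\<lambda>x. B * \<bar>\<phi> x\<bar>)" using test_integrable[OF p] by auto
    show "AE x in lebesgue. norm ((norm (\<phi> x))\<^sup>2) \<le> norm (B * \<bar>\<phi> x\<bar>)"
    proof (rule AE_I2)
      fix x
      have "\<bar>\<phi> x\<bar> * \<bar>\<phi> x\<bar> \<le> B * \<bar>\<phi> x\<bar>" by (intro mult_right_mono B) auto
      then show "norm ((norm (\<phi> x))\<^sup>2) \<le> norm (B * \<bar>\<phi> x\<bar>)" by (simp add: power2_eq_square)
    qed
  qed (use m in measurable)
qed

lemma vtestD: "\<phi> \<in> vector_test_functions \<Omega> \<Longrightarrow> (\<lambda>x. \<phi> x $ i) \<in> test_functions \<Omega>"
  by (auto simp: vector_test_functions_def)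

lemma vtest_sqint:
  assumes p: "\<phi> \<in> vector_test_functions \<Omega>"
  shows "sqint lebesgue \<phi>" "sqint lebesgue (cjac \<phi>)"
  by (rule sqint_vecI, rule test_sqint[OF vtestD[OF p]])
    (rule sqint_vecI, rule sqint_vecI, simp add: test_sqint[OF test_partial[OF vtestD[OF p]]])

lemma vtest_weak_jacobian:
  assumes \<Omega>: "open \<Omega>" and p: "\<phi> \<in> vector_test_functions \<Omega>"
  shows "has_weak_jacobian \<Omega> \<phi> (cjac \<phi>)"
  unfolding weak_jacobian_iff_gradient
proof
  fix i
  obtain L R where k: "kernel (\<lambda>x. \<phi> x $ i) (grad (\<lambda>x. \<phi> x $ i)) L R" using test_kernel[OF vtestD[OF p]] .
  show "has_weak_gradient \<Omega> (\<lambda>x. \<phi> x $ i) (\<lambda>x. cjac \<phi> x $ i)"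
    using classical_weak_gradient[OF kernelD(1)[OF k] kernelD(3)[OF k] _ \<Omega>] kernelD(2)[OF k] by auto
qed

lemma vtest_H1:
  assumes \<Omega>: "open \<Omega>" and p: "\<phi> \<in> vector_test_functions \<Omega>"
  shows "on_L2 \<Omega> \<phi>" "on_L2 \<Omega> (cjac \<phi>)" "\<phi> \<in> H1 \<Omega>" "AE x in lebesgue_on \<Omega>. weak_jacobian \<Omega> \<phi> x = cjac \<phi> x"
proof -
  show 1: "on_L2 \<Omega> \<phi>" "on_L2 \<Omega> (cjac \<phi>)"
    by (intro sqint_on_restrict open_lebesgue[OF \<Omega>] vtest_sqint[OF p])+
  show "\<phi> \<in> H1 \<Omega>" by (rule H1I[OF 1 vtest_weak_jacobian[OF \<Omega> p]])
  show "AE x in lebesgue_on \<Omega>. weak_jacobian \<Omega> \<phi> x = cjac \<phi> x"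
    by (rule weak_jacobian_AE[OF \<Omega> vtest_weak_jacobian[OF \<Omega> p]])
qed

lemma vtest_lincomb:
  assumes "\<phi> \<in> vector_test_functions \<Omega>" "\<psi> \<in> vector_test_functions \<Omega>"
  shows "(\<lambda>x. a *\<^sub>R \<phi> x + b *\<^sub>R \<psi> x) \<in> vector_test_functions \<Omega>"
  unfolding vector_test_functions_def
proof (intro CollectI allI)
  fix i :: 3
  let ?S = "\<lambda>\<phi>. support (\<lambda>x. \<phi> x $ i)"
  have *: "smooth (\<lambda>x. \<phi> x $ i)" "smooth (\<lambda>x. \<psi> x $ i)" "compact (?S \<phi> \<union> ?S \<psi>)" "?S \<phi> \<union> ?S \<psi> \<subseteq> \<Omega>"
    using vtestD[OF assms(1), of i] vtestD[OF assms(2), of i] by (auto simp: test_functions_def)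
  show "(\<lambda>x. (a *\<^sub>R \<phi> x + b *\<^sub>R \<psi> x) $ i) \<in> test_functions \<Omega>"
  proof (rule test_functionsI[OF _ *(3,4)])
    show "smooth (\<lambda>x. (a *\<^sub>R \<phi> x + b *\<^sub>R \<psi> x) $ i)" using smooth_lincomb(1)[OF *(1,2), of a b] by simp
    show "(a *\<^sub>R \<phi> x + b *\<^sub>R \<psi> x) $ i = 0" if "x \<notin> ?S \<phi> \<union> ?S \<psi>" for x
      using that support_outside[of x "\<lambda>x. \<phi> x $ i"] support_outside[of x "\<lambda>x. \<psi> x $ i"] by simp
  qed
qed

lemma H10_H1: "u \<in> H10 \<Omega> \<Longrightarrow> u \<in> H1 \<Omega>"
  by (simp add: H10_def)

lemma H10_iff:
  assumes \<Omega>: "open \<Omega>" and u: "u \<in> H1 \<Omega>"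
  shows "u \<in> H10 \<Omega> \<longleftrightarrow> (\<exists>\<phi>::nat \<Rightarrow> real^3 \<Rightarrow> real^3. (\<forall>n. \<phi> n \<in> vector_test_functions \<Omega>) \<and>
     (\<lambda>n. norm_L2 \<Omega> (\<lambda>x. \<phi> n x - u x)) \<longlonglongrightarrow> 0 \<and>
     (\<lambda>n. norm_L2 \<Omega> (\<lambda>x. cjac (\<phi> n) x - weak_jacobian \<Omega> u x)) \<longlonglongrightarrow> 0)"
proof -
  have "((\<lambda>n. H1_norm \<Omega> (\<lambda>x. \<phi> n x - u x)) \<longlonglongrightarrow> 0) \<longleftrightarrow>
     (\<lambda>n. norm_L2 \<Omega> (\<lambda>x. \<phi> n x - u x)) \<longlonglongrightarrow> 0 \<and>
     (\<lambda>n. norm_L2 \<Omega> (\<lambda>x. cjac (\<phi> n) x - weak_jacobian \<Omega> u x)) \<longlonglongrightarrow> 0"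
    if p: "\<forall>n. \<phi> n \<in> vector_test_functions \<Omega>" for \<phi> :: "nat \<Rightarrow> real^3 \<Rightarrow> real^3"
  proof -
    have "norm_L2 \<Omega> (\<lambda>x. weak_jacobian \<Omega> (\<phi> n) x - weak_jacobian \<Omega> u x) = norm_L2 \<Omega> (\<lambda>x. cjac (\<phi> n) x - weak_jacobian \<Omega> u x)" for n
    proof (rule n2_cong_AE)
      note pn = vtest_H1[OF \<Omega> p[rule_format, of n]]
      show "AE x in lebesgue_on \<Omega>. weak_jacobian \<Omega> (\<phi> n) x - weak_jacobian \<Omega> u x = cjac (\<phi> n) x - weak_jacobian \<Omega> u x"
        using pn(4) by eventually_elim simp
    qed (intro sqint_measurable sqint_diff H1D[OF \<Omega>] u vtest_H1[OF \<Omega> p[rule_format, of n]])+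
    then show ?thesis using H1_norm_tendsto_iff[OF \<Omega> vtest_H1(3)[OF \<Omega> p[rule_format]] u] by simp
  qed
  then show ?thesis unfolding H10_def using u by blast
qed

lemma norm_L2_lincomb_tendsto:
  assumes "\<And>n. sqint M (f n)" "sqint M f'" "\<And>n. sqint M (g n)" "sqint M g'"
    and "((\<lambda>n. n2 M (\<lambda>x. f n x - f' x)) \<longlongrightarrow> 0) F" "((\<lambda>n. n2 M (\<lambda>x. g n x - g' x)) \<longlongrightarrow> 0) F"
  shows "((\<lambda>n. n2 M (\<lambda>x. (a *\<^sub>R f n x + b *\<^sub>R g n x) - (a *\<^sub>R f' x + b *\<^sub>R g' x))) \<longlongrightarrow> 0) F"
proof (rule Lim_null_comparison)
  have "((\<lambda>n. \<bar>a\<bar> * n2 M (\<lambda>x. f n x - f' x) + \<bar>b\<bar> * n2 M (\<lambda>x. g n x - g' x)) \<longlongrightarrow> \<bar>a\<bar> * 0 + \<bar>b\<bar> * 0) F"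
    by (intro tendsto_add tendsto_mult tendsto_const assms)
  then show "((\<lambda>n. \<bar>a\<bar> * n2 M (\<lambda>x. f n x - f' x) + \<bar>b\<bar> * n2 M (\<lambda>x. g n x - g' x)) \<longlongrightarrow> 0) F" by simp
  show "\<forall>\<^sub>F n in F. norm (n2 M (\<lambda>x. (a *\<^sub>R f n x + b *\<^sub>R g n x) - (a *\<^sub>R f' x + b *\<^sub>R g' x)))
     \<le> \<bar>a\<bar> * n2 M (\<lambda>x. f n x - f' x) + \<bar>b\<bar> * n2 M (\<lambda>x. g n x - g' x)"
  proof (intro always_eventually allI)
    fix n
    have "(\<lambda>x. (a *\<^sub>R f n x + b *\<^sub>R g n x) - (a *\<^sub>R f' x + b *\<^sub>R g' x)) = (\<lambda>x. a *\<^sub>R (f n x - f' x) + b *\<^sub>R (g n x - g' x))"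
      by (simp add: algebra_simps)
    then show "norm (n2 M (\<lambda>x. (a *\<^sub>R f n x + b *\<^sub>R g n x) - (a *\<^sub>R f' x + b *\<^sub>R g' x)))
     \<le> \<bar>a\<bar> * n2 M (\<lambda>x. f n x - f' x) + \<bar>b\<bar> * n2 M (\<lambda>x. g n x - g' x)"
      using n2_triangle[OF sqint_scale[OF sqint_diff[OF assms(1,2)], of a n] sqint_scale[OF sqint_diff[OF assms(3,4)], of b n]]
      by (simp add: n2_scale)
  qed
qed

lemma cjac_lincomb:
  assumes "\<phi> \<in> vector_test_functions \<Omega>" "\<psi> \<in> vector_test_functions \<Omega>"
  shows "cjac (\<lambda>x. a *\<^sub>R \<phi> x + b *\<^sub>R \<psi> x) x = a *\<^sub>R cjac \<phi> x + b *\<^sub>R cjac \<psi> x"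
proof -
  have "smooth (\<lambda>x. \<phi> x $ i)" "smooth (\<lambda>x. \<psi> x $ i)" for i
    using vtestD[OF assms(1)] vtestD[OF assms(2)] by (auto simp: test_functions_def)
  from smooth_lincomb(2)[OF this] show ?thesis by (simp add: vec_eq_iff)
qed

lemma H10_lincomb:
  assumes \<Omega>: "open \<Omega>" and u: "u \<in> H10 \<Omega>" and v: "v \<in> H10 \<Omega>"
  shows "(\<lambda>x. a *\<^sub>R u x + b *\<^sub>R v x) \<in> H10 \<Omega>"
proof -
  note u1 = H10_H1[OF u] and v1 = H10_H1[OF v]
  obtain \<phi> :: "nat \<Rightarrow> real^3 \<Rightarrow> real^3" where p: "\<And>n. \<phi> n \<in> vector_test_functions \<Omega>"
     "(\<lambda>n. norm_L2 \<Omega> (\<lambda>x. \<phi> n x - u x)) \<longlonglongrightarrow> 0"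
     "(\<lambda>n. norm_L2 \<Omega> (\<lambda>x. cjac (\<phi> n) x - weak_jacobian \<Omega> u x)) \<longlonglongrightarrow> 0"
    using u unfolding H10_iff[OF \<Omega> u1] by blast
  obtain \<psi> :: "nat \<Rightarrow> real^3 \<Rightarrow> real^3" where q: "\<And>n. \<psi> n \<in> vector_test_functions \<Omega>"
     "(\<lambda>n. norm_L2 \<Omega> (\<lambda>x. \<psi> n x - v x)) \<longlonglongrightarrow> 0"
     "(\<lambda>n. norm_L2 \<Omega> (\<lambda>x. cjac (\<psi> n) x - weak_jacobian \<Omega> v x)) \<longlonglongrightarrow> 0"
    using v unfolding H10_iff[OF \<Omega> v1] by blast
  note w = H1_lincomb[OF \<Omega> u1 v1, of a b]
  show ?thesis unfolding H10_iff[OF \<Omega> w(1)]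
  proof (intro exI[of _ "\<lambda>n x. a *\<^sub>R \<phi> n x + b *\<^sub>R \<psi> n x"] conjI allI)
    show "(\<lambda>x. a *\<^sub>R \<phi> n x + b *\<^sub>R \<psi> n x) \<in> vector_test_functions \<Omega>" for n
      by (rule vtest_lincomb[OF p(1) q(1)])
    show "(\<lambda>n. norm_L2 \<Omega> (\<lambda>x. (a *\<^sub>R \<phi> n x + b *\<^sub>R \<psi> n x) - (a *\<^sub>R u x + b *\<^sub>R v x))) \<longlonglongrightarrow> 0"
      by (rule norm_L2_lincomb_tendsto) (intro p q vtest_H1[OF \<Omega>] H1D[OF \<Omega>] u1 v1)+
    have "(\<lambda>n. norm_L2 \<Omega> (\<lambda>x. (a *\<^sub>R cjac (\<phi> n) x + b *\<^sub>R cjac (\<psi> n) x) - (a *\<^sub>R weak_jacobian \<Omega> u x + b *\<^sub>R weak_jacobian \<Omega> v x))) \<longlonglongrightarrow> 0"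
      by (rule norm_L2_lincomb_tendsto) (intro p q vtest_H1[OF \<Omega>] H1D[OF \<Omega>] u1 v1)+
    moreover have "norm_L2 \<Omega> (\<lambda>x. (a *\<^sub>R cjac (\<phi> n) x + b *\<^sub>R cjac (\<psi> n) x) - (a *\<^sub>R weak_jacobian \<Omega> u x + b *\<^sub>R weak_jacobian \<Omega> v x))
       = norm_L2 \<Omega> (\<lambda>x. cjac (\<lambda>x. a *\<^sub>R \<phi> n x + b *\<^sub>R \<psi> n x) x - weak_jacobian \<Omega> (\<lambda>x. a *\<^sub>R u x + b *\<^sub>R v x) x)" for n
    proof (rule n2_cong_AE)
      show "AE x in lebesgue_on \<Omega>. (a *\<^sub>R cjac (\<phi> n) x + b *\<^sub>R cjac (\<psi> n) x) - (a *\<^sub>R weak_jacobian \<Omega> u x + b *\<^sub>R weak_jacobian \<Omega> v x)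
        = cjac (\<lambda>x. a *\<^sub>R \<phi> n x + b *\<^sub>R \<psi> n x) x - weak_jacobian \<Omega> (\<lambda>x. a *\<^sub>R u x + b *\<^sub>R v x) x"
        using w(2) by eventually_elim (simp add: cjac_lincomb[OF p(1) q(1)])
    qed (intro sqint_measurable sqint_diff sqint_add sqint_scale H1D[OF \<Omega>] u1 v1 w(1) vtest_H1[OF \<Omega>] vtest_lincomb p(1) q(1))+
    ultimately show "(\<lambda>n. norm_L2 \<Omega> (\<lambda>x. cjac (\<lambda>x. a *\<^sub>R \<phi> n x + b *\<^sub>R \<psi> n x) x - weak_jacobian \<Omega> (\<lambda>x. a *\<^sub>R u x + b *\<^sub>R v x) x)) \<longlonglongrightarrow> 0"
      by simp
  qed
qed

text \<open>A diagonal choice: test functions within 1 / (n + 1) of \<open>u n\<close> converge to v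
  as well.\<close>

lemma H10_closed:
  assumes \<Omega>: "open \<Omega>" and u: "\<And>n. u n \<in> H10 \<Omega>" and v: "v \<in> H1 \<Omega>"
    and lim: "(\<lambda>n. H1_norm \<Omega> (\<lambda>x. u n x - v x)) \<longlonglongrightarrow> 0"
  shows "v \<in> H10 \<Omega>"
proof -
  note u1 = H10_H1[OF u]
  have "\<exists>\<phi>\<in>vector_test_functions \<Omega>. H1_norm \<Omega> (\<lambda>x. \<phi> x - u n x) < 1 / real (Suc n)" for n
  proof -
    obtain \<phi> :: "nat \<Rightarrow> real^3 \<Rightarrow> real^3" where p: "\<And>n. \<phi> n \<in> vector_test_functions \<Omega>"
       "(\<lambda>m. H1_norm \<Omega> (\<lambda>x. \<phi> m x - u n x)) \<longlonglongrightarrow> 0"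
      using u[of n] by (auto simp: H10_def)
    have "\<forall>\<^sub>F m in sequentially. H1_norm \<Omega> (\<lambda>x. \<phi> m x - u n x) < 1 / real (Suc n)"
      by (rule order_tendstoD(2)[OF p(2)]) simp
    then obtain m where "H1_norm \<Omega> (\<lambda>x. \<phi> m x - u n x) < 1 / real (Suc n)"
      using eventually_happens'[OF sequentially_bot] by blast
    then show ?thesis using p(1) by blast
  qed
  then obtain \<phi> where p: "\<And>n. \<phi> n \<in> vector_test_functions \<Omega>" "\<And>n. H1_norm \<Omega> (\<lambda>x. \<phi> n x - u n x) < 1 / real (Suc n)"
    by metis
  note p1 = vtest_H1(3)[OF \<Omega> p(1)]
  have small: "H1_norm \<Omega> (\<lambda>x. \<phi> n x - u n x) \<le> inverse (real (Suc n))" for n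
    using p(2)[of n] by (simp add: inverse_eq_divide)
  note l = lim[unfolded H1_norm_tendsto_iff[OF \<Omega> u1 v]]
  have inv: "(\<lambda>n. inverse (real (Suc n))) \<longlonglongrightarrow> 0" by (rule LIMSEQ_inverse_real_of_nat)
  have "(\<lambda>n. H1_norm \<Omega> (\<lambda>x. \<phi> n x - v x)) \<longlonglongrightarrow> 0"
    unfolding H1_norm_tendsto_iff[OF \<Omega> p1 v]
  proof
    show "(\<lambda>n. norm_L2 \<Omega> (\<lambda>x. \<phi> n x - v x)) \<longlonglongrightarrow> 0"
    proof (rule Lim_null_comparison)
      show "(\<lambda>n. inverse (real (Suc n)) + norm_L2 \<Omega> (\<lambda>x. u n x - v x)) \<longlonglongrightarrow> 0"
        using tendsto_add[OF inv l[THEN conjunct1]] by simp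
      show "\<forall>\<^sub>F n in sequentially. norm (norm_L2 \<Omega> (\<lambda>x. \<phi> n x - v x)) \<le> inverse (real (Suc n)) + norm_L2 \<Omega> (\<lambda>x. u n x - v x)"
      proof (intro always_eventually allI)
        fix n
        show "norm (norm_L2 \<Omega> (\<lambda>x. \<phi> n x - v x)) \<le> inverse (real (Suc n)) + norm_L2 \<Omega> (\<lambda>x. u n x - v x)"
          using n2_triangle3[OF H1D(1)[OF \<Omega> p1] H1D(1)[OF \<Omega> u1] H1D(1)[OF \<Omega> v], of n n]
            H1_norm_ge(1)[of \<Omega> "\<lambda>x. \<phi> n x - u n x"] small[of n] n2_nonneg[of _ "\<lambda>x. \<phi> n x - v x"]
          unfolding real_norm_def by (smt (verit))
      qed
    qed
    show "(\<lambda>n. norm_L2 \<Omega> (\<lambda>x. weak_jacobian \<Omega> (\<phi> n) x - weak_jacobian \<Omega> v x)) \<longlonglongrightarrow> 0"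
    proof (rule Lim_null_comparison)
      show "(\<lambda>n. inverse (real (Suc n)) + norm_L2 \<Omega> (\<lambda>x. weak_jacobian \<Omega> (u n) x - weak_jacobian \<Omega> v x)) \<longlonglongrightarrow> 0"
        using tendsto_add[OF inv l[THEN conjunct2]] by simp
      show "\<forall>\<^sub>F n in sequentially. norm (norm_L2 \<Omega> (\<lambda>x. weak_jacobian \<Omega> (\<phi> n) x - weak_jacobian \<Omega> v x)) \<le> inverse (real (Suc n)) + norm_L2 \<Omega> (\<lambda>x. weak_jacobian \<Omega> (u n) x - weak_jacobian \<Omega> v x)"
      proof (intro always_eventually allI)
        fix n
        show "norm (norm_L2 \<Omega> (\<lambda>x. weak_jacobian \<Omega> (\<phi> n) x - weak_jacobian \<Omega> v x)) \<le> inverse (real (Suc n)) + norm_L2 \<Omega> (\<lambda>x. weak_jacobian \<Omega> (u n) x - weak_jacobian \<Omega> v x)"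
          using n2_triangle3[OF H1D(2)[OF \<Omega> p1] H1D(2)[OF \<Omega> u1] H1D(2)[OF \<Omega> v], of n n]
            H1_norm_ge(2)[of \<Omega> "\<lambda>x. \<phi> n x - u n x"] small[of n] norm_L2_jacobian_diff[OF \<Omega> p1 u1, of n n]
            n2_nonneg[of _ "\<lambda>x. weak_jacobian \<Omega> (\<phi> n) x - weak_jacobian \<Omega> v x"]
          unfolding real_norm_def by (smt (verit))
      qed
    qed
  qed
  then show ?thesis unfolding H10_def using v p(1) by blast
qed

text \<open>Near a point at distance more than \<open>e\<close> from the boundary, mollification commutes with weak
  differentiation, because the kernel centred at that point is a test function.\<close>

lemma partial_conv_moll:
  assumes \<Omega>: "open \<Omega>" and fg: "has_weak_gradient \<Omega> f g" and f: "sqint lebesgue (ext0 \<Omega> f)"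
    and e: "e > 0" and x: "cball x e \<subseteq> \<Omega>"
  shows "partial j (conv (ext0 \<Omega> f) (moll e)) x = conv (ext0 \<Omega> (\<lambda>y. g y $ j)) (moll e) x"
proof -
  let ?\<phi> = "\<lambda>y. moll e (x - y)"
  have \<phi>: "?\<phi> \<in> test_functions \<Omega>" by (rule moll_test[OF e x])
  have sm: "smooth (moll e)" using moll_test_UNIV[OF e] by (simp add: test_functions_def)
  have p: "partial j ?\<phi> y = - partial j (moll e) (x - y)" for y
  proof -
    have "((\<lambda>y. x - y) has_derivative (\<lambda>h. - h)) (at y)" by (auto intro!: derivative_eq_intros)
    from has_derivative_compose[OF this smooth_has_derivative[OF sm]]
    show ?thesis by (simp add: partial_eq[where D="\<lambda>h. (\<chi> j. partial j (moll e) (x - y)) \<bullet> - h"] inner_axis)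
  qed
  have ext: "(\<lambda>y. ext0 \<Omega> h y *\<^sub>R k y) = ext0 \<Omega> (\<lambda>y. h y * k y)" for h k :: "real^3 \<Rightarrow> real"
    by (auto simp: indicator_def)
  have "partial j (conv (ext0 \<Omega> f) (moll e)) x = (LINT y|lebesgue. ext0 \<Omega> f y *\<^sub>R (- partial j ?\<phi> y))"
    unfolding conv_smooth(2)[OF sqint_locally_integrable[OF f] moll_test_UNIV[OF e]] conv_def by (simp add: p)
  also have "\<dots> = - (LINT y|lebesgue_on \<Omega>. f y * partial j ?\<phi> y)"
    unfolding ext integral_lebesgue_on[OF open_lebesgue[OF \<Omega>]] by simp
  also have "\<dots> = (LINT y|lebesgue_on \<Omega>. g y $ j * ?\<phi> y)"
    using fg \<phi> unfolding has_weak_gradient_def by simp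
  also have "\<dots> = conv (ext0 \<Omega> (\<lambda>y. g y $ j)) (moll e) x"
    unfolding conv_def ext integral_lebesgue_on[OF open_lebesgue[OF \<Omega>]] ..
  finally show ?thesis .
qed

section \<open>Zero boundary values from compact support\<close>

lemma compact_neighbourhood:
  fixes K :: "(real^3) set"
  assumes "open \<Omega>" "compact K" "K \<subseteq> \<Omega>"
  obtains d K' where "d > 0" "compact K'" "K' \<subseteq> \<Omega>" "\<And>x y. x \<in> K \<Longrightarrow> dist x y \<le> d \<Longrightarrow> y \<in> K'"
proof -
  obtain d where d: "d > 0" "(\<Union>x\<in>K. cball x d) \<subseteq> \<Omega>"
    using compact_subset_open_imp_cball_epsilon_subset[OF assms(2,1,3)] by auto
  have "compact (\<Union>x\<in>K. \<Union>y\<in>cball 0 d. {x + y})" using assms(2) by (intro compact_sums') auto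
  moreover have "(\<Union>x\<in>K. \<Union>y\<in>cball 0 d. {x + y}) = (\<Union>x\<in>K. cball x d)"
  proof (intro set_eqI iffI)
    fix z assume "z \<in> (\<Union>x\<in>K. cball x d)"
    then obtain x where x: "x \<in> K" "dist x z \<le> d" by auto
    then have "z - x \<in> cball 0 d" "x + (z - x) = z" by (auto simp: dist_norm norm_minus_commute)
    with x show "z \<in> (\<Union>x\<in>K. \<Union>y\<in>cball 0 d. {x + y})" by force
  next
    fix z assume "z \<in> (\<Union>x\<in>K. \<Union>y\<in>cball 0 d. {x + y})"
    then obtain x y where "x \<in> K" "norm y \<le> d" "z = x + y" by auto
    then show "z \<in> (\<Union>x\<in>K. cball x d)" by (intro UN_I[of x]) (auto simp: dist_norm)
  qed
  ultimately show ?thesis using d by (intro that[of d "\<Union>x\<in>K. cball x d"]) auto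
qed

lemma n2_cong: "(\<And>x. x \<in> space M \<Longrightarrow> u x = v x) \<Longrightarrow> n2 M u = n2 M v"
  unfolding n2_def by (intro arg_cong[where f=sqrt] Bochner_Integration.integral_cong) auto

lemma conv_eq_0: "(\<And>y. f y *\<^sub>R k (x - y) = 0) \<Longrightarrow> conv f k x = 0"
  unfolding conv_def by (simp only: Bochner_Integration.integral_zero)

lemma conv_ext0_tendsto:
  assumes \<Omega>: "open \<Omega>" and f: "on_L2 \<Omega> f"
  shows "(\<lambda>n. norm_L2 \<Omega> (\<lambda>x. conv (ext0 \<Omega> f) (mollseq n) x - f x)) \<longlonglongrightarrow> 0"
proof -
  have f': "sqint lebesgue (ext0 \<Omega> f)"
    using f unfolding sqint_lebesgue_on[OF open_lebesgue[OF \<Omega>]] .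
  show ?thesis
  proof (rule Lim_null_comparison[OF _ mollseq_tendsto_L2[OF f']], intro always_eventually allI)
    fix n
    have "norm_L2 \<Omega> (\<lambda>x. conv (ext0 \<Omega> f) (mollseq n) x - f x) = norm_L2 \<Omega> (\<lambda>x. conv (ext0 \<Omega> f) (mollseq n) x - ext0 \<Omega> f x)"
      by (rule n2_cong) simp
    also have "\<dots> \<le> n2 lebesgue (\<lambda>x. conv (ext0 \<Omega> f) (mollseq n) x - ext0 \<Omega> f x)"
    proof (rule sqint_on_restrict(2)[OF open_lebesgue[OF \<Omega>] sqint_diff[OF _ f']])
      show "sqint lebesgue (conv (ext0 \<Omega> f) (mollseq n))"
        unfolding mollseq_def by (rule conv_moll_sqint[OF f']) simp
    qed
    finally show "norm (norm_L2 \<Omega> (\<lambda>x. conv (ext0 \<Omega> f) (mollseq n) x - f x)) \<le> n2 lebesgue (\<lambda>x. conv (ext0 \<Omega> f) (mollseq n) x - ext0 \<Omega> f x)"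
      by simp
  qed
qed

text \<open>On the open set \<Omega> - K both G and 0 are weak Jacobians of w, so uniqueness applies
  there.\<close>

lemma weak_jacobian_zero_outside:
  assumes \<Omega>: "open \<Omega>" and w: "has_weak_jacobian \<Omega> w G" and K: "closed K" and zero: "\<And>x. x \<in> \<Omega> - K \<Longrightarrow> w x = 0"
  shows "AE x in lebesgue_on (\<Omega> - K). G x = 0"
proof -
  have o: "open (\<Omega> - K)" using \<Omega> K by (rule open_Diff)
  have G: "has_weak_jacobian (\<Omega> - K) w G"
    using w has_weak_gradient_mono[OF _ \<Omega> o] unfolding weak_jacobian_iff_gradient by auto
  have "has_weak_jacobian (\<Omega> - K) w (\<lambda>x. 0)"
    unfolding has_weak_jacobian_def
  proof (intro conjI ballI allI)
    show "w locally_integrable_on (\<Omega> - K)" using G by (simp add: has_weak_jacobian_def)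
    show "(\<lambda>x. 0::real^3^3) locally_integrable_on (\<Omega> - K)" by (rule locally_integrable_const)
    fix \<phi> i j
    have "(LINT x|lebesgue_on (\<Omega> - K). w x $ i * partial j \<phi> x) = (LINT x|lebesgue_on (\<Omega> - K). 0)"
      by (rule Bochner_Integration.integral_cong) (use zero in auto)
    then show "(LINT x|lebesgue_on (\<Omega> - K). w x $ i * partial j \<phi> x) = - (LINT x|lebesgue_on (\<Omega> - K). (0::real^3^3) $ i $ j * \<phi> x)"
      by simp
  qed
  from weak_jacobian_unique[OF o G this] show ?thesis .
qed

text \<open>Mollifications of the zero extension are test functions once the radius is small
  compared with the distance to the boundary. Their derivatives are the mollified weak Jacobian:
  close to K the mollifying ball stays inside \<Omega>, and away from K both sides vanish.\<close>

lemma compact_support_H10: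
  assumes \<Omega>: "open \<Omega>" and w: "w \<in> H1 \<Omega>" and K: "compact K" "K \<subseteq> \<Omega>" and zero: "\<And>x. x \<in> \<Omega> - K \<Longrightarrow> w x = 0"
  shows "w \<in> H10 \<Omega>"
proof -
  define W where "W = weak_jacobian \<Omega> w"
  note wD = H1D[OF \<Omega> w, folded W_def]
  note \<Omega>s = open_lebesgue[OF \<Omega>]
  obtain d K' where d: "d > 0" "compact K'" "K' \<subseteq> \<Omega>" "\<And>x y. x \<in> K \<Longrightarrow> dist x y \<le> d \<Longrightarrow> y \<in> K'"
    using compact_neighbourhood[OF \<Omega> K] by metis
  have W0: "AE x in lebesgue. x \<in> \<Omega> - K \<longrightarrow> W x = 0"
  proof -
    have "AE x in lebesgue_on (\<Omega> - K). W x = 0"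
      by (rule weak_jacobian_zero_outside[OF \<Omega> wD(3) compact_imp_closed[OF K(1)]]) (rule zero)
    then show ?thesis
      by (simp only: AE_lebesgue_on[OF open_lebesgue[OF open_Diff[OF \<Omega> compact_imp_closed[OF K(1)]]]])
  qed
  \<comment> \<open>Twice the radius stays below d, since a ball of radius \<open>e n\<close> around
    a point within \<open>e n\<close> of K has to remain in the d-neighbourhood of K.\<close>
  obtain N where N: "1 / real (Suc N) < d / 2" using nat_approx_posE[of "d / 2"] d(1) by auto
  define e where "e n = 1 / real (Suc (n + N))" for n
  have e: "0 < e n" "2 * e n \<le> d" for n
  proof -
    have "1 / real (Suc (n + N)) \<le> 1 / real (Suc N)" by (intro divide_left_mono) auto
    then show "2 * e n \<le> d" using N by (simp add: e_def)
  qed (simp add: e_def)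
  define \<phi> where "\<phi> n x = (\<chi> i. conv (ext0 \<Omega> (\<lambda>y. w y $ i)) (moll (e n)) x)" for n x
  have fi: "on_L2 \<Omega> (\<lambda>x. w x $ i)" "on_L2 \<Omega> (\<lambda>x. W x $ i $ j)" for i j
    using sqint_nth(1)[OF wD(1)] sqint_nth(1)[OF sqint_nth(1)[OF wD(2)]] by auto
  have fe: "sqint lebesgue (ext0 \<Omega> (\<lambda>x. w x $ i))" "sqint lebesgue (ext0 \<Omega> (\<lambda>x. W x $ i $ j))" for i j
    using fi unfolding sqint_lebesgue_on[OF \<Omega>s] by auto
  have test: "\<phi> n \<in> vector_test_functions \<Omega>" for n
    unfolding vector_test_functions_def
  proof (intro CollectI allI test_functionsI)
    fix i
    show "smooth (\<lambda>x. \<phi> n x $ i)"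
      using conv_smooth(1)[OF sqint_locally_integrable[OF fe(1)] moll_test_UNIV[OF e(1)]] by (simp add: \<phi>_def)
    show "\<phi> n x $ i = 0" if x: "x \<notin> K'" for x
    proof -
      have "ext0 \<Omega> (\<lambda>y. w y $ i) y *\<^sub>R moll (e n) (x - y) = 0" for y
      proof (cases "y \<in> K")
        case True
        then have "\<not> dist y x \<le> d" using d(4) x by blast
        then have "norm (x - y) \<ge> e n" using e[of n] by (simp add: dist_norm norm_minus_commute)
        then show ?thesis using moll_outside[OF e(1)] by simp
      qed (use zero[of y] in \<open>auto simp: indicator_def\<close>)
      then show ?thesis unfolding \<phi>_def vec_lambda_beta by (rule conv_eq_0)
    qed
  qed (rule d)+
  have D: "cjac (\<phi> n) x $ i $ j = conv (ext0 \<Omega> (\<lambda>y. W y $ i $ j)) (moll (e n)) x" for n x i j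
  proof -
    have *: "cjac (\<phi> n) x $ i $ j = partial j (conv (ext0 \<Omega> (\<lambda>y. w y $ i)) (moll (e n))) x"
      by (simp add: \<phi>_def)
    have hg: "has_weak_gradient \<Omega> (\<lambda>y. w y $ i) (\<lambda>y. W y $ i)"
      using wD(3) unfolding weak_jacobian_iff_gradient by blast
    show ?thesis
    proof (cases "\<exists>y\<in>K. dist y x \<le> e n")
      case True
      then obtain y where y: "y \<in> K" "dist y x \<le> e n" by blast
      have "cball x (e n) \<subseteq> \<Omega>"
      proof
        fix z assume "z \<in> cball x (e n)"
        then have "dist y z \<le> d" using y(2) e(2)[of n] dist_triangle[of y z x] by simp
        then show "z \<in> \<Omega>" using d(3,4) y(1) by blast
      qed
      from partial_conv_moll[OF \<Omega> hg fe(1) e(1) this] show ?thesis unfolding * .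
    next
      case False
      then have far: "e n < norm (x - y)" if "y \<in> K" for y
        using that by (force simp: dist_norm norm_minus_commute)
      have mk: "moll (e n) y = 0" if "norm y > e n" for y using moll_outside[OF e(1), of n y] that by simp
      have "partial j (moll (e n)) y = 0" if "norm y > e n" for y
      proof -
        have "support (moll (e n)) \<subseteq> cball 0 (e n)" by (rule support_subsetI) (use mk in auto)
        then show ?thesis using that by (intro partial_outside_support) auto
      qed
      then have "ext0 \<Omega> (\<lambda>y. w y $ i) y *\<^sub>R partial j (moll (e n)) (x - y) = 0" for y
        using far[of y] zero[of y] by (cases "y \<in> K") (auto simp: indicator_def)
      then have l: "partial j (conv (ext0 \<Omega> (\<lambda>y. w y $ i)) (moll (e n))) x = 0"
        unfolding conv_smooth(2)[OF sqint_locally_integrable[OF fe(1)] moll_test_UNIV[OF e(1)]] by (rule conv_eq_0)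
      have "conv (ext0 \<Omega> (\<lambda>y. W y $ i $ j)) (moll (e n)) x = (LINT y|(lebesgue :: (real^3) measure). 0)"
        unfolding conv_def
      proof (rule integral_cong_AE)
        have "(\<lambda>y. moll (e n) (x - y)) \<in> borel_measurable lebesgue"
          by (rule borel_measurable_lebesgueI) (use moll_borel[OF e(1)] in measurable)
        with sqint_measurable[OF fe(2)[of i j]]
        show "(\<lambda>y. ext0 \<Omega> (\<lambda>y. W y $ i $ j) y *\<^sub>R moll (e n) (x - y)) \<in> borel_measurable lebesgue" by measurable
        show "AE y in lebesgue. ext0 \<Omega> (\<lambda>y. W y $ i $ j) y *\<^sub>R moll (e n) (x - y) = 0"
          using W0
        proof eventually_elim
          case (elim y)
          show ?case using far[of y] mk[of "x - y"] elim by (cases "y \<in> K") (auto simp: indicator_def)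
        qed
      qed simp
      then show ?thesis unfolding * l by simp
    qed
  qed
  have shift: "moll (e n) = mollseq (n + N)" for n by (simp add: e_def mollseq_def)
  note p1 = vtest_H1(1,2)[OF \<Omega> test]
  show ?thesis unfolding H10_iff[OF \<Omega> w] W_def[symmetric]
  proof (intro exI[of _ \<phi>] conjI allI test)
    show "(\<lambda>n. norm_L2 \<Omega> (\<lambda>x. \<phi> n x - w x)) \<longlonglongrightarrow> 0"
    proof (rule n2_tendsto_vec)
      show "on_L2 \<Omega> (\<lambda>x. (\<phi> n x - w x) $ i)" for n i by (intro sqint_nth sqint_diff p1 wD)
      show "(\<lambda>n. norm_L2 \<Omega> (\<lambda>x. (\<phi> n x - w x) $ i)) \<longlonglongrightarrow> 0" for i
        using LIMSEQ_ignore_initial_segment[OF conv_ext0_tendsto[OF \<Omega> fi(1)[of i]], of N] by (simp add: \<phi>_def shift)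
    qed
    show "(\<lambda>n. norm_L2 \<Omega> (\<lambda>x. cjac (\<phi> n) x - W x)) \<longlonglongrightarrow> 0"
    proof (intro n2_tendsto_vec)
      show "on_L2 \<Omega> (\<lambda>x. (cjac (\<phi> n) x - W x) $ i)" "on_L2 \<Omega> (\<lambda>x. (cjac (\<phi> n) x - W x) $ i $ j)" for n i j
        by (intro sqint_nth sqint_diff p1 wD)+
      show "(\<lambda>n. norm_L2 \<Omega> (\<lambda>x. (cjac (\<phi> n) x - W x) $ i $ j)) \<longlonglongrightarrow> 0" for i j
        using LIMSEQ_ignore_initial_segment[OF conv_ext0_tendsto[OF \<Omega> fi(2)[of i j]], of N]
        by (simp add: D shift del: cjac_nth)
    qed
  qed
qed

subsection \<open>Poincare and Korn inequalities\<close>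

text \<open>The first coordinate has derivative 1. Inserting this into the integral of the square of
  \<phi> and integrating by parts brings in the coordinate itself, which is at most R on
  \<Omega>.\<close>

lemma poincare_test:
  assumes p: "\<phi> \<in> test_functions \<Omega>" and R: "\<And>x. x \<in> \<Omega> \<Longrightarrow> \<bar>x $ 1\<bar> \<le> R" "R \<ge> 0"
  shows "n2 lebesgue \<phi> \<le> 2 * R * n2 lebesgue (partial 1 \<phi>)"
proof -
  obtain L S where k: "kernel \<phi> (grad \<phi>) L S" using test_kernel[OF p] .
  have sm: "smooth \<phi>" using p by (simp add: test_functions_def)
  have pb: "\<phi> \<in> borel_measurable borel" by (intro borel_measurable_continuous_onI kernel_continuous[OF k])
  let ?g = "\<lambda>x. \<phi> x *\<^sub>R axis 1 1 + x $ 1 *\<^sub>R grad \<phi> x"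
  \<comment> \<open>One copy of \<phi> carries the coordinate and the other is the test function.
    The derivative of the coordinate reproduces the square of \<phi>; the remaining term equals the
    left-hand side, which produces the factor 2.\<close>
  have ibp: "(LINT x|lebesgue. (\<phi> x * x $ 1) * partial 1 \<phi> x) = - (LINT x|lebesgue. ?g x $ 1 * \<phi> x)"
  proof (rule integration_by_parts[OF _ _ _ p])
    fix x :: "real^3"
    have "((\<lambda>y::real^3. y $ 1) has_derivative (\<lambda>h. h $ 1)) (at x)"
      by (rule bounded_linear_imp_has_derivative) (rule bounded_linear_vec_nth)
    from has_derivative_mult[OF kernelD(1)[OF k] this]
    show "((\<lambda>x. \<phi> x * x $ 1) has_derivative (\<lambda>h. ?g x \<bullet> h)) (at x)"
      by (simp add: inner_add_left inner_axis' mult.commute)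
  next
    show "?g \<in> borel_measurable borel"
    proof -
      have "(\<lambda>x::real^3. x $ 1) \<in> borel_measurable borel"
        by (intro borel_measurable_continuous_onI continuous_intros)
      then show ?thesis using pb kernelD(3)[OF k] by measurable
    qed
    fix r :: real
    show "\<exists>B. \<forall>x. norm x \<le> r \<longrightarrow> norm (?g x) \<le> B"
    proof (intro exI allI impI)
      fix x :: "real^3" assume x: "norm x \<le> r"
      have "norm (?g x) \<le> \<bar>\<phi> x\<bar> + \<bar>x $ 1\<bar> * norm (grad \<phi> x)"
        using norm_triangle_ineq[of "\<phi> x *\<^sub>R axis 1 (1::real)" "x $ 1 *\<^sub>R grad \<phi> x"] by (simp add: norm_axis_1)
      also have "\<dots> \<le> L * (2 * \<bar>S\<bar> + 1) + r * L"
        using kernel_bounded[OF k, of x] kernelD(2)[OF k, of x] x component_le_norm_cart[of x 1] kernelD(5)[OF k]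
        by (intro add_mono mult_mono) (auto intro: order_trans[OF norm_ge_zero])
      finally show "norm (?g x) \<le> L * (2 * \<bar>S\<bar> + 1) + r * L" .
    qed
  qed
  define v where "v x = x $ 1 * partial 1 \<phi> x" for x
  note s1 = test_sqint[OF p] and s2 = test_sqint[OF test_partial[OF p, of 1]]
  have vm: "v \<in> borel_measurable lebesgue"
    unfolding v_def by (intro borel_measurable_lebesgueI borel_measurable_continuous_onI continuous_intros smooth_continuous smooth_partial sm)
  have vle: "AE x in lebesgue. norm (v x) \<le> R * norm (partial 1 \<phi> x)"
  proof (rule AE_I2)
    fix x
    show "norm (v x) \<le> R * norm (partial 1 \<phi> x)"
      using R(1)[of x] test_outside[OF test_partial[OF p], of x 1]
      by (cases "x \<in> \<Omega>") (auto simp: v_def abs_mult intro: mult_right_mono)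
  qed
  note s3 = sqint_bound[OF s2 vm vle]
  have i: "integrable lebesgue (\<lambda>x. \<phi> x \<bullet> v x)" "integrable lebesgue (\<lambda>x. \<phi> x \<bullet> \<phi> x)"
    by (intro sqint_inner s1 s3(1))+
  have "(LINT x|lebesgue. \<phi> x \<bullet> v x) = - ((LINT x|lebesgue. \<phi> x \<bullet> \<phi> x) + (LINT x|lebesgue. \<phi> x \<bullet> v x))"
  proof -
    have "(LINT x|lebesgue. \<phi> x \<bullet> v x) = - (LINT x|lebesgue. \<phi> x \<bullet> \<phi> x + \<phi> x \<bullet> v x)"
      using ibp by (simp add: v_def algebra_simps)
    also have "(LINT x|lebesgue. \<phi> x \<bullet> \<phi> x + \<phi> x \<bullet> v x) = (LINT x|lebesgue. \<phi> x \<bullet> \<phi> x) + (LINT x|lebesgue. \<phi> x \<bullet> v x)"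
      by (rule Bochner_Integration.integral_add[OF i(2,1)])
    finally show ?thesis .
  qed
  then have "(LINT x|lebesgue. \<phi> x \<bullet> \<phi> x) = - 2 * (LINT x|lebesgue. \<phi> x \<bullet> v x)" by linarith
  then have "(n2 lebesgue \<phi>)\<^sup>2 = - 2 * (LINT x|lebesgue. \<phi> x \<bullet> v x)"
    unfolding n2_sq power2_norm_eq_inner .
  also have "\<dots> \<le> 2 * (n2 lebesgue \<phi> * n2 lebesgue v)"
    using n2_Cauchy_Schwarz[OF s1 s3(1)] by linarith
  also have "\<dots> \<le> 2 * (n2 lebesgue \<phi> * (R * n2 lebesgue (partial 1 \<phi>)))"
    using s3(2)[OF R(2)] by (intro mult_left_mono) auto
  finally have *: "n2 lebesgue \<phi> * n2 lebesgue \<phi> \<le> n2 lebesgue \<phi> * (2 * R * n2 lebesgue (partial 1 \<phi>))"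
    by (simp add: power2_eq_square mult_ac)
  show ?thesis
  proof (cases "n2 lebesgue \<phi> = 0")
    case False
    then show ?thesis using * n2_nonneg[of lebesgue \<phi>] by (simp add: mult_le_cancel_left)
  qed (use R(2) in simp)
qed

lemma norm_L2_test:
  assumes \<Omega>: "open \<Omega>" and zero: "\<And>x. x \<notin> \<Omega> \<Longrightarrow> f x = 0"
  shows "norm_L2 \<Omega> f = n2 lebesgue f"
  unfolding sqint_lebesgue_on(2)[OF open_lebesgue[OF \<Omega>]]
  by (rule n2_cong) (use zero in \<open>auto simp: indicator_def\<close>)

lemma vtest_outside:
  assumes p: "\<phi> \<in> vector_test_functions \<Omega>" and x: "x \<notin> \<Omega>"
  shows "\<phi> x = 0" "cjac \<phi> x = 0"
  using test_outside[OF vtestD[OF p] x] test_outside[OF test_partial[OF vtestD[OF p]] x] by (auto simp: vec_eq_iff)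

lemma poincare_vtest:
  assumes \<Omega>: "open \<Omega>" and p: "\<phi> \<in> vector_test_functions \<Omega>" and R: "\<And>x. x \<in> \<Omega> \<Longrightarrow> \<bar>x $ 1\<bar> \<le> R" "R \<ge> 0"
  shows "norm_L2 \<Omega> \<phi> \<le> 2 * R * norm_L2 \<Omega> (cjac \<phi>)"
proof -
  have "(n2 lebesgue \<phi>)\<^sup>2 = (\<Sum>i\<in>UNIV. (n2 lebesgue (\<lambda>x. \<phi> x $ i))\<^sup>2)"
    by (rule n2_vec) (rule test_sqint[OF vtestD[OF p]])
  also have "\<dots> \<le> (\<Sum>i\<in>UNIV. (2 * R * n2 lebesgue (\<lambda>x. cjac \<phi> x $ i))\<^sup>2)"
  proof (intro sum_mono power_mono)
    fix i
    have "n2 lebesgue (\<lambda>x. \<phi> x $ i) \<le> 2 * R * n2 lebesgue (partial 1 (\<lambda>x. \<phi> x $ i))"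
      by (rule poincare_test[OF vtestD[OF p] R])
    also have "\<dots> \<le> 2 * R * n2 lebesgue (\<lambda>x. cjac \<phi> x $ i)"
      using sqint_nth(2)[OF sqint_nth(1)[OF vtest_sqint(2)[OF p], of i], of 1] R(2) by (intro mult_left_mono) auto
    finally show "n2 lebesgue (\<lambda>x. \<phi> x $ i) \<le> 2 * R * n2 lebesgue (\<lambda>x. cjac \<phi> x $ i)" .
  qed simp
  also have "\<dots> = (2 * R * n2 lebesgue (cjac \<phi>))\<^sup>2"
    unfolding power_mult_distrib[of "2 * R"] n2_vec[OF sqint_nth(1)[OF vtest_sqint(2)[OF p]]] by (simp add: sum_distrib_left)
  finally have "n2 lebesgue \<phi> \<le> 2 * R * n2 lebesgue (cjac \<phi>)"
    by (rule power2_le_imp_le) (use R(2) in simp)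
  then show ?thesis
    using norm_L2_test[OF \<Omega>, of \<phi>] norm_L2_test[OF \<Omega>, of "cjac \<phi>"] vtest_outside[OF p] by simp
qed

lemma test_reflect:
  assumes "\<phi> \<in> test_functions UNIV"
  shows "(\<lambda>x. \<phi> (- x)) \<in> test_functions UNIV" "partial j (\<lambda>x. \<phi> (- x)) x = - partial j \<phi> (- x)"
proof -
  have D: "((\<lambda>x. c * f (- x)) has_derivative (\<lambda>h. c * ((\<chi> j. partial j f (- x)) \<bullet> - h))) (at x)" if "smooth f" for f c x
  proof -
    have "((\<lambda>y. - y) has_derivative (\<lambda>h. - h)) (at x)" by (auto intro!: derivative_eq_intros)
    from has_derivative_compose[OF this smooth_has_derivative[OF that]]
    show ?thesis by (intro has_derivative_mult_right)
  qed
  have p: "partial j (\<lambda>x. c * f (- x)) = (\<lambda>x. (- c) * partial j f (- x))" if "smooth f" for f c j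
    by (rule ext) (simp add: partial_eq[OF D[OF that]] inner_axis)
  have s: "smooth \<phi>" using assms by (simp add: test_functions_def)
  show "partial j (\<lambda>x. \<phi> (- x)) x = - partial j \<phi> (- x)" using fun_cong[OF p[OF s, where c=1 and j=j], of x] by simp
  let ?S = "{\<lambda>x. c * f (- x) |f c. smooth f}"
  have "smooth (\<lambda>x. 1 * \<phi> (- x))"
  proof (rule smooth_coinduct[of _ ?S])
    show "(\<lambda>x. 1 * \<phi> (- x)) \<in> ?S" using s by blast
    fix h x j assume "h \<in> ?S"
    then obtain f c where h: "h = (\<lambda>x. c * f (- x))" "smooth f" by blast
    show "h differentiable (at x)" unfolding h(1) differentiable_def using D[OF h(2)] by blast
    show "partial j h \<in> ?S" unfolding h(1) p[OF h(2)] using smooth_partial[OF h(2)] by blast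
  qed
  moreover have "compact (uminus ` support \<phi>)"
    using assms by (intro compact_continuous_image continuous_intros) (simp add: test_functions_def)
  ultimately show "(\<lambda>x. \<phi> (- x)) \<in> test_functions UNIV"
  proof (intro test_functionsI[where K="uminus ` support \<phi>"])
    fix x assume x: "x \<notin> uminus ` support \<phi>"
    have "- x \<notin> support \<phi>" using x imageI[of "- x" "support \<phi>" uminus] by auto
    then show "\<phi> (- x) = 0" by (rule support_outside)
  qed auto
qed

text \<open>Both sides are the mixed second derivative at 0 of the convolution of \<open>b\<close> with the
  reflection of \<open>a\<close>, so no commutation of second derivatives is needed.\<close>

lemma swap_partials:
  assumes a: "a \<in> test_functions UNIV" and b: "b \<in> test_functions UNIV"
  shows "(LINT x|lebesgue. partial i a x * partial j b x) = (LINT x|lebesgue. partial j a x * partial i b x)"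
proof -
  define k where "k = (\<lambda>x. a (- x))"
  have k: "k \<in> test_functions UNIV" unfolding k_def by (rule test_reflect[OF a])
  have kp: "partial i k (- y) = - partial i a y" for i y using test_reflect(2)[OF a, of i "- y"] by (simp add: k_def)
  note loc = sqint_locally_integrable[OF test_sqint]
  \<comment> \<open>Reflection in the argument of the kernel and integration by parts each change
    the sign, and the two changes cancel.\<close>
  have by_parts: "conv (partial j b) k x = conv b (partial j k) x" if k: "k \<in> test_functions UNIV" for k x j
  proof -
    obtain L R where kb: "kernel b (grad b) L R" using test_kernel[OF b] .
    have p: "(\<lambda>y. k (x - y)) \<in> test_functions UNIV" "partial j (\<lambda>y. k (x - y)) y = - partial j k (x - y)" for y
    proof -
      have sm: "smooth k" using k by (simp add: test_functions_def)
      have D: "((\<lambda>y. c * f (x - y)) has_derivative (\<lambda>h. c * ((\<chi> j. partial j f (x - y)) \<bullet> - h))) (at y)" if "smooth f" for f c y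
      proof -
        have "((\<lambda>y. x - y) has_derivative (\<lambda>h. - h)) (at y)" by (auto intro!: derivative_eq_intros)
        from has_derivative_compose[OF this smooth_has_derivative[OF that]]
        show ?thesis by (intro has_derivative_mult_right)
      qed
      have p: "partial j (\<lambda>y. c * f (x - y)) = (\<lambda>y. (- c) * partial j f (x - y))" if "smooth f" for f c j
        by (rule ext) (simp add: partial_eq[OF D[OF that]] inner_axis)
      show "partial j (\<lambda>y. k (x - y)) y = - partial j k (x - y)" using fun_cong[OF p[OF sm, where c=1 and j=j], of y] by simp
      let ?S = "{\<lambda>y. c * f (x - y) |f c. smooth f}"
      have "smooth (\<lambda>y. 1 * k (x - y))"
      proof (rule smooth_coinduct[of _ ?S])
        show "(\<lambda>y. 1 * k (x - y)) \<in> ?S" using sm by blast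
        fix h z j assume "h \<in> ?S"
        then obtain f c where h: "h = (\<lambda>y. c * f (x - y))" "smooth f" by blast
        show "h differentiable (at z)" unfolding h(1) differentiable_def using D[OF h(2)] by blast
        show "partial j h \<in> ?S" unfolding h(1) p[OF h(2)] using smooth_partial[OF h(2)] by blast
      qed
      moreover have "compact ((\<lambda>z. x - z) ` support k)"
        using k by (intro compact_continuous_image continuous_intros) (simp add: test_functions_def)
      ultimately show "(\<lambda>y. k (x - y)) \<in> test_functions UNIV"
      proof (intro test_functionsI[where K="(\<lambda>z. x - z) ` support k"])
        fix y assume y: "y \<notin> (\<lambda>z. x - z) ` support k"
        have "x - y \<notin> support k" using y imageI[of "x - y" "support k" "\<lambda>z. x - z"] by auto
        then show "k (x - y) = 0" by (rule support_outside)
      qed auto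
    qed
    have "(LINT y|lebesgue. b y * partial j (\<lambda>y. k (x - y)) y) = - (LINT y|lebesgue. grad b y $ j * k (x - y))"
      using kernelD(2)[OF kb] by (intro integration_by_parts[OF kernelD(1)[OF kb] kernelD(3)[OF kb] _ p(1)]) auto
    then show ?thesis by (simp add: p(2) conv_def)
  qed
  have "conv (partial j b) (partial i k) 0 = partial i (conv (partial j b) k) 0"
    by (rule conv_smooth(2)[OF loc[OF test_partial[OF b]] k, symmetric])
  also have "conv (partial j b) k = conv b (partial j k)" by (rule ext) (rule by_parts[OF k])
  also have "partial i (conv b (partial j k)) 0 = conv b (partial i (partial j k)) 0"
    by (rule conv_smooth(2)[OF loc[OF b] test_partial[OF k]])
  also have "\<dots> = conv (partial i b) (partial j k) 0" by (rule by_parts[OF test_partial[OF k], symmetric])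
  finally show ?thesis by (simp add: conv_def kp mult.commute)
qed

section \<open>Korn's inequality for zero boundary values\<close>

lemma norm_sym_part: "2 * (norm (sym_part A))\<^sup>2 = (norm A)\<^sup>2 + (\<Sum>i\<in>UNIV. \<Sum>j\<in>UNIV. A $ i $ j * A $ j $ i)"
  by (simp add: power2_norm_eq_inner inner_vec_def sum_3 sym_part_def transpose_def algebra_simps)

lemma norm_sym_part_le: "norm (sym_part A) \<le> norm A"
proof -
  have "norm (transpose A) = norm A"
  proof -
    have "(norm (transpose A))\<^sup>2 = (norm A)\<^sup>2"
      by (simp add: power2_norm_eq_inner inner_vec_def sum_3 transpose_def)
    then show ?thesis by (simp add: power2_eq_iff_nonneg)
  qed
  then show ?thesis using norm_triangle_ineq[of A "transpose A"] by (simp add: sym_part_def)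
qed

lemma sym_part_linear: "sym_part (A + B) = sym_part A + sym_part B" "sym_part (A - B) = sym_part A - sym_part B"
  "sym_part (c *\<^sub>R A) = c *\<^sub>R sym_part A"
  by (simp_all add: sym_part_def transpose_def vec_eq_iff algebra_simps)

lemma sym_part_sqint:
  assumes "sqint M u" shows "sqint M (\<lambda>x. sym_part (u x))" "n2 M (\<lambda>x. sym_part (u x)) \<le> n2 M u"
proof -
  have "bounded_linear sym_part"
    by (rule bounded_linear_intro[where K=1]) (auto simp: sym_part_linear norm_sym_part_le)
  then have "(\<lambda>x. sym_part (u x)) \<in> borel_measurable M"
    by (intro measurable_compose[OF sqint_measurable[OF assms]] borel_measurable_continuous_onI linear_continuous_on)
  from sqint_bound[OF assms this, of 1] norm_sym_part_le
  show "sqint M (\<lambda>x. sym_part (u x))" "n2 M (\<lambda>x. sym_part (u x)) \<le> n2 M u" by auto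
qed

text \<open>The integral of the squared divergence is nonnegative. After interchanging the two
  derivatives in every product it becomes the cross term of \<open>norm_sym_part\<close>, which
  yields the constant 2.\<close>

lemma korn_vtest:
  assumes \<Omega>: "open \<Omega>" and p: "\<phi> \<in> vector_test_functions \<Omega>"
  shows "(norm_L2 \<Omega> (cjac \<phi>))\<^sup>2 \<le> 2 * (norm_L2 \<Omega> (\<lambda>x. sym_part (cjac \<phi> x)))\<^sup>2"
proof -
  let ?d = "\<lambda>i j x. partial j (\<lambda>y. \<phi> y $ i) x"
  have t: "(\<lambda>y. \<phi> y $ i) \<in> test_functions UNIV" for i
    using vtestD[OF p] test_functions_mono[of \<Omega> UNIV] by blast
  have int: "integrable lebesgue (\<lambda>x. ?d i j x * ?d k l x)" for i j k l
    using sqint_inner[OF test_sqint[OF test_partial[OF t[of i], of j]] test_sqint[OF test_partial[OF t[of k], of l]]] by simp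
  have "0 \<le> (LINT x|lebesgue. (\<Sum>i\<in>UNIV. ?d i i x)\<^sup>2)" by simp
  also have "\<dots> = (LINT x|lebesgue. (\<Sum>i\<in>UNIV. \<Sum>j\<in>UNIV. ?d i i x * ?d j j x))"
    by (simp add: power2_eq_square sum_product)
  also have "\<dots> = (\<Sum>i\<in>UNIV. \<Sum>j\<in>UNIV. (LINT x|lebesgue. ?d i i x * ?d j j x))"
    using int by (simp add: Bochner_Integration.integral_sum)
  also have "\<dots> = (\<Sum>i\<in>UNIV. \<Sum>j\<in>UNIV. (LINT x|lebesgue. ?d i j x * ?d j i x))"
    using swap_partials[OF t t] by simp
  also have "\<dots> = (LINT x|lebesgue. (\<Sum>i\<in>UNIV. \<Sum>j\<in>UNIV. cjac \<phi> x $ i $ j * cjac \<phi> x $ j $ i))"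
    using int by (simp add: Bochner_Integration.integral_sum)
  also have "\<dots> = (LINT x|lebesgue. 2 * (norm (sym_part (cjac \<phi> x)))\<^sup>2 - (norm (cjac \<phi> x))\<^sup>2)"
    by (intro Bochner_Integration.integral_cong) (auto simp only: norm_sym_part)
  also have "\<dots> = 2 * (n2 lebesgue (\<lambda>x. sym_part (cjac \<phi> x)))\<^sup>2 - (n2 lebesgue (cjac \<phi>))\<^sup>2"
    using sqint_integrable[OF vtest_sqint(2)[OF p]] sqint_integrable[OF sym_part_sqint(1)[OF vtest_sqint(2)[OF p]]]
    by (simp add: n2_sq)
  finally show ?thesis
    using norm_L2_test[OF \<Omega>, of "cjac \<phi>"] norm_L2_test[OF \<Omega>, of "\<lambda>x. sym_part (cjac \<phi> x)"] vtest_outside[OF p]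
    by (simp add: sym_part_def transpose_def vec_eq_iff)
qed

lemma n2_tendsto:
  assumes "\<And>n. sqint M (f n)" "sqint M g" "((\<lambda>n. n2 M (\<lambda>x. f n x - g x)) \<longlongrightarrow> 0) F"
  shows "((\<lambda>n. n2 M (f n)) \<longlongrightarrow> n2 M g) F"
proof -
  have "((\<lambda>n. n2 M (f n) - n2 M g) \<longlongrightarrow> 0) F"
  proof (rule Lim_null_comparison[OF _ assms(3)], intro always_eventually allI)
    fix n
    have "n2 M (f n) \<le> n2 M (\<lambda>x. f n x - g x) + n2 M g"
      using n2_triangle[OF sqint_diff[OF assms(1)[of n] assms(2)] assms(2)] by simp
    moreover have "n2 M g \<le> n2 M (\<lambda>x. f n x - g x) + n2 M (f n)"
      using n2_triangle[OF sqint_diff[OF assms(2) assms(1)[of n]] assms(1)[of n]] n2_minus_commute[of M g "f n"] by simp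
    ultimately show "norm (n2 M (f n) - n2 M g) \<le> n2 M (\<lambda>x. f n x - g x)" by simp
  qed
  then show ?thesis by (simp add: LIM_zero_iff)
qed

text \<open>Both sides of each inequality are continuous in L2 with respect to the function and its
  Jacobian, so the bounds for test functions pass to the limit.\<close>

lemma poincare_korn_H10:
  assumes \<Omega>: "open \<Omega>" and R: "\<And>x. x \<in> \<Omega> \<Longrightarrow> \<bar>x $ 1\<bar> \<le> R" "R \<ge> 0" and w: "w \<in> H10 \<Omega>"
  shows "norm_L2 \<Omega> w \<le> 2 * R * norm_L2 \<Omega> (weak_jacobian \<Omega> w)"
    and "(norm_L2 \<Omega> (weak_jacobian \<Omega> w))\<^sup>2 \<le> 2 * (norm_L2 \<Omega> (\<lambda>x. sym_part (weak_jacobian \<Omega> w x)))\<^sup>2"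
proof -
  note w1 = H10_H1[OF w]
  note wD = H1D[OF \<Omega> w1]
  obtain \<phi> :: "nat \<Rightarrow> real^3 \<Rightarrow> real^3" where p: "\<And>n. \<phi> n \<in> vector_test_functions \<Omega>"
     "(\<lambda>n. norm_L2 \<Omega> (\<lambda>x. \<phi> n x - w x)) \<longlonglongrightarrow> 0"
     "(\<lambda>n. norm_L2 \<Omega> (\<lambda>x. cjac (\<phi> n) x - weak_jacobian \<Omega> w x)) \<longlonglongrightarrow> 0"
    using w unfolding H10_iff[OF \<Omega> w1] by blast
  note p1 = vtest_H1(1,2)[OF \<Omega> p(1)]
  have l1: "(\<lambda>n. norm_L2 \<Omega> (\<phi> n)) \<longlonglongrightarrow> norm_L2 \<Omega> w" by (rule n2_tendsto[OF p1(1) wD(1) p(2)])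
  have l2: "(\<lambda>n. norm_L2 \<Omega> (cjac (\<phi> n))) \<longlonglongrightarrow> norm_L2 \<Omega> (weak_jacobian \<Omega> w)" by (rule n2_tendsto[OF p1(2) wD(2) p(3)])
  have l3: "(\<lambda>n. norm_L2 \<Omega> (\<lambda>x. sym_part (cjac (\<phi> n) x))) \<longlonglongrightarrow> norm_L2 \<Omega> (\<lambda>x. sym_part (weak_jacobian \<Omega> w x))"
  proof (rule n2_tendsto[OF sym_part_sqint(1)[OF p1(2)] sym_part_sqint(1)[OF wD(2)]])
    show "(\<lambda>n. norm_L2 \<Omega> (\<lambda>x. sym_part (cjac (\<phi> n) x) - sym_part (weak_jacobian \<Omega> w x))) \<longlonglongrightarrow> 0"
      by (rule Lim_null_comparison[OF _ p(3)])
        (use sym_part_sqint(2)[OF sqint_diff[OF p1(2) wD(2)]] in \<open>auto simp: sym_part_linear\<close>)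
  qed
  show "norm_L2 \<Omega> w \<le> 2 * R * norm_L2 \<Omega> (weak_jacobian \<Omega> w)"
    by (rule LIMSEQ_le[OF l1 tendsto_mult[OF tendsto_const l2]]) (use poincare_vtest[OF \<Omega> p(1) R] in blast)
  show "(norm_L2 \<Omega> (weak_jacobian \<Omega> w))\<^sup>2 \<le> 2 * (norm_L2 \<Omega> (\<lambda>x. sym_part (weak_jacobian \<Omega> w x)))\<^sup>2"
    by (rule LIMSEQ_le[OF tendsto_power[OF l2] tendsto_mult[OF tendsto_const tendsto_power[OF l3]]]) (use korn_vtest[OF \<Omega> p(1)] in blast)
qed

subsection \<open>Matrices close to the identity\<close>

type_synonym mat3 = "real^3^3"

lemma norm_matrix_vector_le: "norm (A *v h) \<le> norm A * norm (h :: real^'n)" for A :: "real^'n^'m"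
proof -
  have "(norm (A *v h))\<^sup>2 = (\<Sum>i\<in>UNIV. (A $ i \<bullet> h)\<^sup>2)"
    by (simp add: norm_vec_square matrix_vector_mul_component)
  also have "\<dots> \<le> (\<Sum>i\<in>UNIV. (norm (A $ i))\<^sup>2 * (norm h)\<^sup>2)"
  proof (rule sum_mono)
    fix i
    show "(A $ i \<bullet> h)\<^sup>2 \<le> (norm (A $ i))\<^sup>2 * (norm h)\<^sup>2"
      using power_mono[OF Cauchy_Schwarz_ineq2[of "A $ i" h], of 2] by (simp add: power_mult_distrib)
  qed
  also have "\<dots> = (norm A * norm h)\<^sup>2"
    by (simp add: power_mult_distrib norm_vec_square[of A] sum_distrib_right)
  finally show ?thesis by (rule power2_le_imp_le) simp
qed

lemma norm_transpose_eq: "norm (transpose A) = norm (A::mat3)"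
proof -
  have "(norm (transpose A))\<^sup>2 = (norm A)\<^sup>2"
    by (simp add: power2_norm_eq_inner inner_vec_def sum_3 transpose_def)
  then show ?thesis by (simp add: power2_eq_iff_nonneg)
qed

lemma norm_matrix_mult_le: "norm (A ** B) \<le> norm A * norm (B :: mat3)" for A :: mat3
proof -
  have row: "(A ** B) $ i = transpose B *v (A $ i)" for i
    by (simp add: vec_eq_iff matrix_matrix_mult_def matrix_vector_mult_def transpose_def mult.commute)
  have "(norm (A ** B))\<^sup>2 = (\<Sum>i\<in>UNIV. (norm (transpose B *v (A $ i)))\<^sup>2)"
    unfolding norm_vec_square row ..
  also have "\<dots> \<le> (\<Sum>i\<in>UNIV. (norm B * norm (A $ i))\<^sup>2)"
    using norm_matrix_vector_le[of "transpose B"] by (intro sum_mono power_mono) (auto simp: norm_transpose_eq)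
  also have "\<dots> = (norm A * norm B)\<^sup>2"
    by (simp add: power_mult_distrib norm_vec_square[of A] sum_distrib_left mult.commute)
  finally show ?thesis by (rule power2_le_imp_le) simp
qed

interpretation mm: bounded_bilinear "(**) :: mat3 \<Rightarrow> mat3 \<Rightarrow> mat3"
proof
  fix A A' B B' :: mat3 and r :: real
  show "(A + A') ** B = A ** B + A' ** B" "A ** (B + B') = A ** B + A ** B'"
    by (simp_all add: matrix_matrix_mult_def vec_eq_iff sum.distrib algebra_simps)
  show "r *\<^sub>R A ** B = r *\<^sub>R (A ** B)" "A ** r *\<^sub>R B = r *\<^sub>R (A ** B)"
    by (simp_all add: matrix_matrix_mult_def vec_eq_iff sum_distrib_left mult_ac)
  show "\<exists>K. \<forall>(A::mat3) (B::mat3). norm (A ** B) \<le> norm A * norm B * K"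
    using norm_matrix_mult_le by (intro exI[of _ 1]) auto
qed

lemma inner_matrix_mult_right: "X \<bullet> (Z ** B) = (X ** transpose B) \<bullet> Z" for X Z B :: mat3
  by (simp add: inner_vec_def matrix_matrix_mult_def transpose_def sum_3 algebra_simps)

text \<open>The norm is the Frobenius norm, here the square root of 3. The bound 9/5 is the one for
  which x \<le> 9/5 + x/10 gives x \<le> 2 in \<open>finv_bounds\<close>.\<close>

lemma norm_mat_1: "norm (mat 1 :: mat3) \<le> 9 / 5"
proof -
  have "(norm (mat 1 :: mat3))\<^sup>2 = 3" by (simp add: norm_vec_square sum_3 mat_def)
  also have "\<dots> \<le> (9 / 5)\<^sup>2" by (simp add: power2_eq_square)
  finally show ?thesis by (rule power2_le_imp_le) simp
qed

definition finv :: "mat3 \<Rightarrow> mat3" where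
  "finv A = matrix_inv (mat 1 + A)"

text \<open>A vector in the kernel satisfies h = - A h, impossible for nonzero h when A shrinks
  lengths; a square matrix with trivial kernel is invertible.\<close>

lemma finv:
  assumes A: "norm A \<le> 1 / 10"
  shows "(mat 1 + A) ** finv A = mat 1" "finv A ** (mat 1 + A) = mat 1"
proof -
  have "h = 0" if "(mat 1 + A) *v h = 0" for h
  proof -
    have "h + A *v h = 0" using that by (simp add: matrix_vector_mult_add_rdistrib)
    then have "norm h = norm (A *v h)" by (metis add_eq_0_iff norm_minus_cancel)
    also have "\<dots> \<le> norm A * norm h" by (rule norm_matrix_vector_le)
    also have "\<dots> \<le> 1 / 10 * norm h" using A by (intro mult_right_mono) auto
    finally show ?thesis by simp
  qed
  then have "\<exists>B. B ** (mat 1 + A) = mat 1" using matrix_left_invertible_ker[of "mat 1 + A"] by blast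
  then have "invertible (mat 1 + A)" by (simp add: invertible_left_inverse)
  then have "(mat 1 + A) ** finv A = mat 1 \<and> finv A ** (mat 1 + A) = mat 1"
    unfolding finv_def matrix_inv_def invertible_def by (rule someI_ex)
  then show "(mat 1 + A) ** finv A = mat 1" "finv A ** (mat 1 + A) = mat 1" by auto
qed

text \<open>Every bound comes from X = 1 - X A for the inverse X of 1 + A, each later one by
  inserting the one before. These are truncations of the Neumann series with their
  remainders.\<close>

lemma finv_bounds:
  assumes A: "norm A \<le> 1 / 10"
  shows "norm (finv A) \<le> 2" "norm (finv A - mat 1) \<le> 2 * norm A" "norm (finv A - mat 1 + A) \<le> 2 * (norm A)\<^sup>2"
proof -
  have eq: "finv A = mat 1 - finv A ** A"
    using finv(2)[OF A] by (simp add: mm.add_right eq_diff_eq)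
  have "norm (finv A ** A) \<le> norm (finv A) * (1 / 10)"
    using norm_matrix_mult_le[of "finv A" A] mult_left_mono[OF A norm_ge_zero[of "finv A"]] by linarith
  moreover have "norm (finv A) \<le> norm (mat 1 :: mat3) + norm (finv A ** A)"
    by (subst eq) (rule norm_triangle_ineq4)
  ultimately show b: "norm (finv A) \<le> 2" using norm_mat_1 by linarith
  have "finv A - mat 1 = - (finv A ** A)" using eq by (simp add: algebra_simps)
  then have "norm (finv A - mat 1) \<le> norm (finv A) * norm A" using norm_matrix_mult_le[of "finv A" A] by simp
  also have "\<dots> \<le> 2 * norm A" using b by (intro mult_right_mono) auto
  finally show c: "norm (finv A - mat 1) \<le> 2 * norm A" .
  have "finv A - mat 1 + A = - ((finv A - mat 1) ** A)" using eq by (simp add: mm.diff_left algebra_simps)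
  then have "norm (finv A - mat 1 + A) \<le> norm (finv A - mat 1) * norm A"
    using norm_matrix_mult_le[of "finv A - mat 1" A] by simp
  also have "\<dots> \<le> 2 * norm A * norm A" using c by (intro mult_right_mono) auto
  finally show "norm (finv A - mat 1 + A) \<le> 2 * (norm A)\<^sup>2" by (simp add: power2_eq_square)
qed

text \<open>The resolvent identity, in which each of the two inverses contributes a factor 2. Its
  purpose is the continuity of \<open>finv\<close>, on which measurability and limits rely.\<close>

lemma finv_lipschitz:
  assumes A: "norm A \<le> 1 / 10" and A': "norm A' \<le> 1 / 10"
  shows "norm (finv A - finv A') \<le> 4 * norm (A - A')"
proof -
  have "finv A ** ((mat 1 + A') - (mat 1 + A)) ** finv A' = finv A - finv A'"
    using finv[OF A] finv[OF A'] by (simp only: mm.diff_right mm.diff_left matrix_mul_assoc[symmetric]) (simp add: matrix_mul_assoc)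
  then have "finv A - finv A' = finv A ** (A' - A) ** finv A'" by simp
  also have "norm \<dots> \<le> norm (finv A ** (A' - A)) * norm (finv A')" by (rule norm_matrix_mult_le)
  also have "\<dots> \<le> (norm (finv A) * norm (A' - A)) * norm (finv A')"
    by (intro mult_right_mono norm_matrix_mult_le) auto
  also have "\<dots> \<le> (2 * norm (A' - A)) * 2"
    using finv_bounds(1)[OF A] finv_bounds(1)[OF A'] by (intro mult_mono) auto
  finally show ?thesis by (simp add: norm_minus_commute)
qed

lemma finv_continuous: "continuous_on (cball 0 (1 / 10)) finv"
proof -
  have "4-lipschitz_on (cball 0 (1 / 10)) finv"
    using finv_lipschitz by (intro lipschitz_onI) (auto simp: dist_norm)
  then show ?thesis by (rule lipschitz_on_continuous_on)
qed

lemma finv_measurable: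
  assumes H: "H \<in> borel_measurable M" "\<And>x. norm (H x) \<le> 1 / 10"
  shows "(\<lambda>x. finv (H x)) \<in> borel_measurable M"
proof -
  have "(\<lambda>A. indicat_real (cball 0 (1 / 10)) A *\<^sub>R finv A) \<in> borel_measurable borel"
    by (rule borel_measurable_continuous_on_indicator[OF _ finv_continuous]) simp
  from measurable_compose[OF H(1) this] H(2) show ?thesis by (simp add: indicator_def)
qed

text \<open>Beyond the constant and the linear part there are six quadratic and six cubic monomials
  in the entries, each at most the square of the norm of A.\<close>

lemma det_expansion: "\<bar>det (mat 1 + A) - 1 - trace A\<bar> \<le> 12 * (norm A)\<^sup>2" if a: "norm A \<le> 1" for A :: mat3
proof -
  have e: "\<bar>A $ i $ j\<bar> \<le> norm A" for i j
    using Finite_Cartesian_Product.norm_nth_le[of A i] component_le_norm_cart[of "A $ i" j] by linarith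
  have p2: "\<bar>A $ i $ j * A $ k $ l\<bar> \<le> (norm A)\<^sup>2" for i j k l
    unfolding abs_mult power2_eq_square by (intro mult_mono e) auto
  have p3: "\<bar>A $ i $ j * A $ k $ l * A $ m $ n\<bar> \<le> (norm A)\<^sup>2" for i j k l m n
  proof -
    have "\<bar>A $ i $ j * A $ k $ l * A $ m $ n\<bar> \<le> (norm A)\<^sup>2 * 1"
      unfolding abs_mult[of "A $ i $ j * A $ k $ l"] by (intro mult_mono p2 order_trans[OF e a]) auto
    then show ?thesis by simp
  qed
  have id: "det (mat 1 + A) - 1 - trace A =
     A$1$1 * A$2$2 + A$1$1 * A$3$3 + A$2$2 * A$3$3 - A$1$2 * A$2$1 - A$1$3 * A$3$1 - A$2$3 * A$3$2
     + A$1$1 * A$2$2 * A$3$3 + A$1$2 * A$2$3 * A$3$1 + A$1$3 * A$2$1 * A$3$2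
     - A$1$1 * A$2$3 * A$3$2 - A$1$2 * A$2$1 * A$3$3 - A$1$3 * A$2$2 * A$3$1"
    by (simp add: det_3 mat_def trace_def sum_3 algebra_simps)
  show ?thesis unfolding id abs_le_iff
    using p2[of 1 1 2 2] p2[of 1 1 3 3] p2[of 2 2 3 3] p2[of 1 2 2 1] p2[of 1 3 3 1] p2[of 2 3 3 2]
      p3[of 1 1 2 2 3 3] p3[of 1 2 2 3 3 1] p3[of 1 3 2 1 3 2] p3[of 1 1 2 3 3 2] p3[of 1 2 2 1 3 3] p3[of 1 3 2 2 3 1]
    unfolding abs_le_iff by linarith
qed

lemma trace_bound: "\<bar>trace A\<bar> \<le> 3 * norm (A :: mat3)"
proof -
  have "\<bar>A $ i $ j\<bar> \<le> norm A" for i j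
    using Finite_Cartesian_Product.norm_nth_le[of A i] component_le_norm_cart[of "A $ i" j] by linarith
  from this[of 1 1] this[of 2 2] this[of 3 3] show ?thesis by (simp add: trace_def sum_3)
qed

lemma det_bounds:
  fixes A :: mat3
  assumes A: "norm A \<le> 1 / 10"
  shows "1 / 2 \<le> det (mat 1 + A)" "det (mat 1 + A) \<le> 2"
proof -
  have "(norm A)\<^sup>2 \<le> (1 / 10)\<^sup>2" using A by (intro power_mono) auto
  then have "12 * (norm A)\<^sup>2 \<le> 12 / 100" by (simp add: power2_eq_square)
  then show "1 / 2 \<le> det (mat 1 + A)" "det (mat 1 + A) \<le> 2"
    using det_expansion[of A] trace_bound[of A] A by linarith+
qed

lemma det_continuous: "continuous_on S (\<lambda>A::mat3. det A)"
  unfolding det_3 by (intro continuous_intros)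

lemma finv_tendsto:
  assumes "\<And>n. norm (A n) \<le> 1 / 10" "norm B \<le> 1 / 10" "(A \<longlongrightarrow> B) F"
  shows "((\<lambda>n. finv (A n)) \<longlongrightarrow> finv B) F" "((\<lambda>n. det (mat 1 + A n)) \<longlongrightarrow> det (mat 1 + B)) F"
proof -
  show "((\<lambda>n. finv (A n)) \<longlongrightarrow> finv B) F"
    by (rule continuous_on_tendsto_compose[OF finv_continuous assms(3)]) (use assms in auto)
  have "((\<lambda>n. mat 1 + A n) \<longlongrightarrow> mat 1 + B) F" by (intro tendsto_intros assms)
  then show "((\<lambda>n. det (mat 1 + A n)) \<longlongrightarrow> det (mat 1 + B)) F"
    by (rule continuous_on_tendsto_compose[OF det_continuous[of UNIV]]) auto
qed

subsection \<open>Mollified deformation fields\<close>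

text \<open>Mollification is an average, so a bound on the distance from f to c near x survives. It
  is used with c = 0 to bound mollified Jacobians, and with c the value at x to compare a field with
  its mollification.\<close>

lemma conv_moll_near:
  assumes f: "f locally_integrable_on UNIV" and e: "e > 0"
    and fm: "f \<in> borel_measurable lebesgue" and near: "AE y in lebesgue. dist x y \<le> e \<longrightarrow> \<bar>f y - c\<bar> \<le> B"
  shows "\<bar>conv f (moll e) x - c\<bar> \<le> B"
proof -
  obtain L R where kk: "kernel (moll e) (grad (moll e)) L R" using test_kernel[OF moll_test_UNIV[OF e]] .
  note mi = test_integrable[OF moll_test[OF e, of x UNIV, simplified]]
  have mb: "(\<lambda>y. moll e (x - y)) \<in> borel_measurable lborel" "moll e \<in> borel_measurable lborel"
    using measurable_compose[OF _ moll_borel[OF e], of "\<lambda>y. x - y" borel] moll_borel[OF e] by simp_all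
  have m1: "(LINT y|lebesgue. moll e (x - y)) = 1"
    unfolding integral_completion[OF mb(1)] lborel_integral_reflect(1)[OF moll_borel[OF e]]
    using moll_integral[OF e] integral_completion[OF mb(2)] by simp
  have fi: "integrable lebesgue (\<lambda>y. f y *\<^sub>R moll e (x - y))" by (rule kernel_conv_integrable(1)[OF f kk])
  have "conv f (moll e) x - c = (LINT y|lebesgue. f y *\<^sub>R moll e (x - y)) - (LINT y|lebesgue. c * moll e (x - y))"
    using m1 by (simp add: conv_def)
  also have "\<dots> = (LINT y|lebesgue. f y *\<^sub>R moll e (x - y) - c * moll e (x - y))"
    using fi mi by (intro Bochner_Integration.integral_diff[symmetric]) auto
  also have "\<bar>\<dots>\<bar> \<le> (LINT y|lebesgue. B * moll e (x - y))"
  proof (rule order_trans[OF integral_abs_bound integral_mono_AE])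
    show "integrable lebesgue (\<lambda>y. \<bar>f y *\<^sub>R moll e (x - y) - c * moll e (x - y)\<bar>)"
      using fi mi by (intro integrable_abs Bochner_Integration.integrable_diff) auto
    show "integrable lebesgue (\<lambda>y. B * moll e (x - y))" using mi by auto
    show "AE y in lebesgue. \<bar>f y *\<^sub>R moll e (x - y) - c * moll e (x - y)\<bar> \<le> B * moll e (x - y)"
      using near
    proof eventually_elim
      case (elim y)
      show ?case
      proof (cases "dist x y \<le> e")
        case True
        have "\<bar>f y *\<^sub>R moll e (x - y) - c * moll e (x - y)\<bar> = \<bar>f y - c\<bar> * moll e (x - y)"
          using moll_nonneg[OF e, of "x - y"] by (simp add: left_diff_distrib[symmetric] abs_mult)
        also have "\<dots> \<le> B * moll e (x - y)" using elim True moll_nonneg[OF e] by (intro mult_right_mono) auto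
        finally show ?thesis .
      next
        case False
        then show ?thesis using moll_outside[OF e, of "x - y"] by (simp add: dist_norm)
      qed
    qed
  qed
  also have "\<dots> = B" using m1 by simp
  finally show ?thesis .
qed

lemma norm_le_of_entries:
  assumes "\<And>i j. \<bar>A $ i $ j\<bar> \<le> B" shows "norm (A::mat3) \<le> 9 * B"
proof -
  have "norm A \<le> (\<Sum>i\<in>UNIV. norm (A $ i))" unfolding norm_vec_def by (rule L2_set_le_sum) simp
  also have "\<dots> \<le> (\<Sum>i\<in>(UNIV::3 set). 3 * B)"
  proof (rule sum_mono)
    fix i
    have "norm (A $ i) \<le> (\<Sum>j\<in>UNIV. \<bar>A $ i $ j\<bar>)" by (rule norm_le_l1_cart)
    also have "\<dots> \<le> (\<Sum>j\<in>(UNIV::3 set). B)" by (intro sum_mono assms)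
    finally show "norm (A $ i) \<le> 3 * B" by simp
  qed
  finally show ?thesis by simp
qed

lemma has_derivative_vecI:
  fixes f :: "real^3 \<Rightarrow> real^3"
  assumes "\<And>i. ((\<lambda>x. f x $ i) has_derivative (\<lambda>h. A $ i \<bullet> h)) (at x)"
  shows "(f has_derivative (\<lambda>h. A *v h)) (at x)"
proof -
  show ?thesis
    unfolding has_derivative_componentwise_within[of f _ x UNIV]
    using assms by (auto simp: Basis_vec_def inner_axis matrix_vector_mul_component)
qed

lemma id_plus_expanding:
  assumes "\<And>x y. norm (W x - W y) \<le> 1 / 2 * norm (x - y)" "continuous_on UNIV (W :: real^3 \<Rightarrow> real^3)"
  shows "expanding (1 / 2) (\<lambda>x. x + W x)"
  unfolding expanding_def
proof (intro conjI allI)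
  show "continuous_on UNIV (\<lambda>x. x + W x)" by (intro continuous_intros assms)
  fix x y
  have "x - y = (x + W x - (y + W y)) - (W x - W y)" by simp
  then have "norm (x - y) \<le> norm (x + W x - (y + W y)) + norm (W x - W y)" by (metis norm_triangle_ineq4)
  then show "1 / 2 * dist x y \<le> dist (x + W x) (y + W y)"
    using assms(1)[of x y] by (simp add: dist_norm)
qed simp

text \<open>\<open>H\<close> is a representative of the weak Jacobian that is small everywhere, not only almost
  everywhere.\<close>

locale small_field =
  fixes V :: "real^3 \<Rightarrow> real^3" and H :: "real^3 \<Rightarrow> mat3"
  assumes V_cont: "continuous_on UNIV V" and V_L2: "sqint lebesgue V"
    and V_jac: "has_weak_jacobian UNIV V H" and H_small: "\<And>x. norm (H x) \<le> 1 / 100" and H_L2: "sqint lebesgue H"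
begin

definition Vn :: "nat \<Rightarrow> real^3 \<Rightarrow> real^3" where
  "Vn n x = (\<chi> i. conv (\<lambda>y. V y $ i) (mollseq n) x)"

definition Jn :: "nat \<Rightarrow> real^3 \<Rightarrow> mat3" where
  "Jn n x = (\<chi> i j. conv (\<lambda>y. H y $ i $ j) (mollseq n) x)"

lemma V_loc: "(\<lambda>y. V y $ i) locally_integrable_on UNIV"
  by (rule sqint_locally_integrable[OF sqint_nth(1)[OF V_L2]])

lemma H_ij: "sqint lebesgue (\<lambda>y. H y $ i $ j)"
  by (intro sqint_nth H_L2)

lemma mollseq_pos: "0 < 1 / real (Suc n)"
  by simp

lemma Vn_smooth: "smooth (\<lambda>x. Vn n x $ i)"
  unfolding Vn_def mollseq_def using conv_smooth(1)[OF V_loc moll_test_UNIV[OF mollseq_pos]] by simp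

lemma Vn_partial: "partial j (\<lambda>x. Vn n x $ i) x = Jn n x $ i $ j"
proof -
  have "has_weak_gradient UNIV (\<lambda>y. V y $ i) (\<lambda>y. H y $ i)"
    using V_jac unfolding weak_jacobian_iff_gradient by blast
  from partial_conv_moll[OF open_UNIV this _ mollseq_pos, of x n j] sqint_nth(1)[OF V_L2, of i]
  show ?thesis by (simp add: Vn_def Jn_def mollseq_def)
qed

lemma Vn_has_derivative: "(Vn n has_derivative (\<lambda>h. Jn n x *v h)) (at x)"
proof (rule has_derivative_vecI)
  fix i
  have "(\<chi> j. partial j (\<lambda>x. Vn n x $ i) x) = Jn n x $ i"
    by (simp add: vec_eq_iff Vn_partial)
  then show "((\<lambda>x. Vn n x $ i) has_derivative (\<lambda>h. Jn n x $ i \<bullet> h)) (at x)"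
    using smooth_has_derivative[OF Vn_smooth[of n i], of x] by simp
qed

text \<open>Mollification preserves the bound 1/100 for each entry, and the norm of the matrix is at
  most the sum of the absolute values of its nine entries.\<close>

lemma Jn_small: "norm (Jn n x) \<le> 9 / 100"
proof -
  have "\<bar>Jn n x $ i $ j - 0\<bar> \<le> 1 / 100" for i j
    unfolding Jn_def mollseq_def vec_lambda_beta
  proof (rule conv_moll_near[OF sqint_locally_integrable[OF H_ij] mollseq_pos sqint_measurable[OF H_ij]])
    show "AE y in lebesgue. dist x y \<le> 1 / real (Suc n) \<longrightarrow> \<bar>H y $ i $ j - 0\<bar> \<le> 1 / 100"
    proof (intro AE_I2 impI)
      fix y
      show "\<bar>H y $ i $ j - 0\<bar> \<le> 1 / 100"
        using Finite_Cartesian_Product.norm_nth_le[of "H y" i] component_le_norm_cart[of "H y $ i" j] H_small[of y] by linarith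
    qed
  qed
  then show ?thesis using norm_le_of_entries[of "Jn n x" "1 / 100"] by simp
qed

lemma Jn_continuous: "continuous_on A (Jn n)"
proof -
  have "continuous_on A (\<lambda>x. \<chi> i j. conv (\<lambda>y. H y $ i $ j) (mollseq n) x)"
    unfolding mollseq_def
    by (intro continuous_intros conv_moll_continuous sqint_locally_integrable[OF H_ij] mollseq_pos)
  then show ?thesis by (simp add: Jn_def[abs_def])
qed

lemma Vn_lipschitz: "norm (Vn n x - Vn n y) \<le> 9 / 100 * norm (x - y)"
proof (rule differentiable_bound[where S=UNIV and f'="\<lambda>x h. Jn n x *v h"])
  show "onorm (\<lambda>h. Jn n x *v h) \<le> 9 / 100" for x
  proof (rule onorm_le)
    fix h
    show "norm (Jn n x *v h) \<le> 9 / 100 * norm h"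
      using norm_matrix_vector_le[of "Jn n x" h] mult_right_mono[OF Jn_small[of n x] norm_ge_zero[of h]] by linarith
  qed
qed (use Vn_has_derivative in auto)

lemma Vn_cont: "continuous_on A (Vn n)"
  by (meson Vn_has_derivative continuous_at_imp_continuous_on has_derivative_continuous)

lemma Vn_close:
  assumes "\<And>y i. dist x y \<le> 1 / real (Suc n) \<Longrightarrow> \<bar>V y $ i - V x $ i\<bar> \<le> B"
  shows "norm (Vn n x - V x) \<le> 3 * B"
proof -
  have "\<bar>(Vn n x - V x) $ i\<bar> \<le> B" for i
    unfolding Vn_def mollseq_def vec_lambda_beta vector_minus_component
    by (rule conv_moll_near[OF V_loc mollseq_pos sqint_measurable[OF sqint_nth(1)[OF V_L2]]]) (use assms in auto)
  then have "(\<Sum>i\<in>UNIV. \<bar>(Vn n x - V x) $ i\<bar>) \<le> (\<Sum>i\<in>(UNIV::3 set). B)" by (intro sum_mono)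
  then show ?thesis using norm_le_l1_cart[of "Vn n x - V x"] by simp
qed

lemma inv_Suc_small: "e > 0 \<Longrightarrow> \<forall>\<^sub>F n in sequentially. 1 / real (Suc n) < e"
  using order_tendstoD(2)[OF LIMSEQ_inverse_real_of_nat, of e] by (simp add: inverse_eq_divide)

lemma Vn_pointwise: "(\<lambda>n. Vn n x) \<longlonglongrightarrow> V x"
proof (rule tendstoI)
  fix e :: real assume e: "e > 0"
  have "\<forall>d>0. \<exists>r>0. \<forall>y. dist y x < r \<longrightarrow> dist (V y) (V x) < d"
    using V_cont by (simp add: continuous_on_iff)
  then obtain r where r: "r > 0" "\<And>y. dist y x < r \<Longrightarrow> dist (V y) (V x) < e / 4"
    using e by (metis divide_pos_pos zero_less_numeral)
  show "\<forall>\<^sub>F n in sequentially. dist (Vn n x) (V x) < e"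
    using inv_Suc_small[OF r(1)]
  proof eventually_elim
    case (elim n)
    have "norm (Vn n x - V x) \<le> 3 * (e / 4)"
    proof (rule Vn_close)
      fix y i assume "dist x y \<le> 1 / real (Suc n)"
      then have "dist (V y) (V x) < e / 4" using r(2)[of y] elim by (simp add: dist_commute)
      then show "\<bar>V y $ i - V x $ i\<bar> \<le> e / 4"
        using component_le_norm_cart[of "V y - V x" i] unfolding dist_norm by simp
    qed
    then show ?case using e by (simp add: dist_norm)
  qed
qed

text \<open>The constant is read off from the mollifications, which have classical derivatives,
  because V is known only through its weak Jacobian.\<close>

lemma V_lipschitz: "norm (V x - V y) \<le> 9 / 100 * norm (x - y)"
proof (rule LIMSEQ_le_const2)
  show "(\<lambda>n. norm (Vn n x - Vn n y)) \<longlonglongrightarrow> norm (V x - V y)" by (intro tendsto_intros Vn_pointwise)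
qed (use Vn_lipschitz in blast)

text \<open>Within the mollification radius V varies by at most 9/100 of that radius; summed over
  three coordinates this is still less than the radius, uniformly in x.\<close>

lemma Vn_uniform:
  assumes e: "e > 0"
  shows "\<forall>\<^sub>F n in sequentially. \<forall>x. dist (x + Vn n x) (x + V x) < e"
  using inv_Suc_small[OF e]
proof eventually_elim
  case (elim n)
  show ?case
  proof
    fix x
    have "norm (Vn n x - V x) \<le> 3 * (9 / 100 * (1 / real (Suc n)))"
    proof (rule Vn_close)
      fix y i assume "dist x y \<le> 1 / real (Suc n)"
      then have "norm (y - x) \<le> 1 / real (Suc n)" by (simp add: dist_norm norm_minus_commute)
      then have "9 / 100 * norm (y - x) \<le> 9 / 100 * (1 / real (Suc n))" by (rule mult_left_mono) simp
      then show "\<bar>V y $ i - V x $ i\<bar> \<le> 9 / 100 * (1 / real (Suc n))"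
        using component_le_norm_cart[of "V y - V x" i] V_lipschitz[of y x] unfolding vector_minus_component by linarith
    qed
    also have "\<dots> \<le> 1 / real (Suc n)" by (simp add: field_simps)
    finally show "dist (x + Vn n x) (x + V x) < e" using elim by (simp add: dist_norm)
  qed
qed

lemma Vn_expanding: "expanding (1 / 2) (\<lambda>x. x + Vn n x)"
  by (rule id_plus_expanding[OF _ Vn_cont]) (rule order_trans[OF Vn_lipschitz mult_right_mono], auto)

lemma V_expanding: "expanding (1 / 2) (\<lambda>x. x + V x)"
  by (rule id_plus_expanding[OF _ V_cont]) (rule order_trans[OF V_lipschitz mult_right_mono], auto)

text \<open>The Jacobian is merely bounded and square integrable, so its mollifications converge in
  L2 and, along a subsequence, almost everywhere. Such a subsequence is fixed in every limit
  below.\<close>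

lemma Jn_AE: "\<exists>r. strict_mono r \<and> (AE x in lebesgue. (\<lambda>n. Jn (r n) x) \<longlonglongrightarrow> H x)"
proof -
  have s: "sqint lebesgue (\<lambda>x. (Jn n x - H x) $ i $ j)" for n i j
    using sqint_diff[OF conv_moll_sqint[OF H_ij mollseq_pos] H_ij] by (simp add: Jn_def mollseq_def)
  then have s': "sqint lebesgue (\<lambda>x. (Jn n x - H x) $ i)" for n i by (rule sqint_vecI)
  have "(\<lambda>n. n2 lebesgue (\<lambda>x. Jn n x - H x)) \<longlonglongrightarrow> 0"
  proof (intro n2_tendsto_vec s s')
    show "(\<lambda>n. n2 lebesgue (\<lambda>x. (Jn n x - H x) $ i $ j)) \<longlonglongrightarrow> 0" for i j
      using mollseq_tendsto_L2[OF H_ij] by (simp add: Jn_def)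
  qed
  from n2_AE_subseq[OF sqint_vecI[OF s'] this] show ?thesis by (simp add: LIM_zero_iff)
qed

end

subsection \<open>The chain rule and the transformed equation\<close>

lemma compose_sqint:
  fixes T :: "'a::euclidean_space \<Rightarrow> 'a" and f :: "'a \<Rightarrow> 'b::euclidean_space"
  assumes T: "expanding c T" and f: "sqint lebesgue f"
  shows "sqint lebesgue (\<lambda>x. f (T x))" "n2 lebesgue (\<lambda>x. f (T x)) \<le> sqrt (expconst TYPE('a) c) * n2 lebesgue f"
proof -
  note i = expanding_integrable[OF T sqint_integrable[OF f]]
  show "sqint lebesgue (\<lambda>x. f (T x))"
    unfolding sqint_def using measurable_compose[OF expanding_measurable[OF T] sqint_measurable[OF f]] i(1) by simp
  have "sqrt (LINT x|lebesgue. (norm (f (T x)))\<^sup>2) \<le> sqrt (expconst TYPE('a) c * (LINT x|lebesgue. (norm (f x))\<^sup>2))"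
    using i(2) by (intro real_sqrt_le_mono) simp
  then show "n2 lebesgue (\<lambda>x. f (T x)) \<le> sqrt (expconst TYPE('a) c) * n2 lebesgue f"
    by (simp add: n2_def real_sqrt_mult)
qed

lemma tendsto_inner_n2_both:
  assumes f: "\<And>n. sqint M (f n)" "sqint M f'" and g: "\<And>n. sqint M (g n)" "sqint M g'"
    and lf: "((\<lambda>n. n2 M (\<lambda>x. f n x - f' x)) \<longlongrightarrow> 0) F" and lg: "((\<lambda>n. n2 M (\<lambda>x. g n x - g' x)) \<longlongrightarrow> 0) F"
  shows "((\<lambda>n. LINT x|M. f n x \<bullet> g n x) \<longlongrightarrow> (LINT x|M. f' x \<bullet> g' x)) F"
proof -
  have "((\<lambda>n. (LINT x|M. f n x \<bullet> g n x) - (LINT x|M. f' x \<bullet> g' x)) \<longlongrightarrow> 0) F"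
  proof (rule Lim_null_comparison)
    have "((\<lambda>n. n2 M (\<lambda>x. f n x - f' x) * n2 M (g n) + n2 M f' * n2 M (\<lambda>x. g n x - g' x)) \<longlongrightarrow> 0 * n2 M g' + n2 M f' * 0) F"
      by (intro tendsto_add tendsto_mult tendsto_const lf lg n2_tendsto[OF g lg])
    then show "((\<lambda>n. n2 M (\<lambda>x. f n x - f' x) * n2 M (g n) + n2 M f' * n2 M (\<lambda>x. g n x - g' x)) \<longlongrightarrow> 0) F" by simp
    show "\<forall>\<^sub>F n in F. norm ((LINT x|M. f n x \<bullet> g n x) - (LINT x|M. f' x \<bullet> g' x))
      \<le> n2 M (\<lambda>x. f n x - f' x) * n2 M (g n) + n2 M f' * n2 M (\<lambda>x. g n x - g' x)"
    proof (intro always_eventually allI)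
      fix n
      note d1 = sqint_diff[OF f(1)[of n] f(2)] and d2 = sqint_diff[OF g(1)[of n] g(2)]
      have "(LINT x|M. f n x \<bullet> g n x) - (LINT x|M. f' x \<bullet> g' x) = (LINT x|M. (f n x - f' x) \<bullet> g n x) + (LINT x|M. f' x \<bullet> (g n x - g' x))"
        using sqint_inner[OF f(1)[of n] g(1)[of n]] sqint_inner[OF f(2) g(1)[of n]] sqint_inner[OF f(2) g(2)]
        by (simp add: inner_diff_left inner_diff_right)
      then show "norm ((LINT x|M. f n x \<bullet> g n x) - (LINT x|M. f' x \<bullet> g' x))
        \<le> n2 M (\<lambda>x. f n x - f' x) * n2 M (g n) + n2 M f' * n2 M (\<lambda>x. g n x - g' x)"
        using n2_Cauchy_Schwarz[OF d1 g(1)[of n]] n2_Cauchy_Schwarz[OF f(2) d2] by simp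
    qed
  qed
  then show ?thesis by (simp add: LIM_zero_iff)
qed

lemma n2_dominated_convergence:
  fixes f :: "nat \<Rightarrow> 'a \<Rightarrow> 'b::euclidean_space" and w :: "'a \<Rightarrow> 'c::euclidean_space"
  assumes w: "sqint M w" and f: "\<And>n. f n \<in> borel_measurable M" "f' \<in> borel_measurable M"
    and le: "\<And>n x. norm (f n x) \<le> B * norm (w x)" "\<And>x. norm (f' x) \<le> B * norm (w x)"
    and lim: "AE x in M. (\<lambda>n. f n x) \<longlonglongrightarrow> f' x"
  shows "(\<lambda>n. n2 M (\<lambda>x. f n x - f' x)) \<longlonglongrightarrow> 0"
  unfolding n2_tendsto_0_iff
proof -
  have "(\<lambda>n. LINT x|M. (norm (f n x - f' x))\<^sup>2) \<longlonglongrightarrow> (LINT x|M. 0)"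
  proof (rule integral_dominated_convergence)
    show "integrable M (\<lambda>x. (2 * B)\<^sup>2 * (norm (w x))\<^sup>2)" using w by (auto simp: sqint_def)
    show "AE x in M. norm ((norm (f n x - f' x))\<^sup>2) \<le> (2 * B)\<^sup>2 * (norm (w x))\<^sup>2" for n
    proof (rule AE_I2)
      fix x
      have "norm (f n x - f' x) \<le> 2 * B * norm (w x)"
        using norm_triangle_ineq4[of "f n x" "f' x"] le(1)[of n x] le(2)[of x] by linarith
      then have "(norm (f n x - f' x))\<^sup>2 \<le> (2 * B * norm (w x))\<^sup>2" by (intro power_mono) auto
      then show "norm ((norm (f n x - f' x))\<^sup>2) \<le> (2 * B)\<^sup>2 * (norm (w x))\<^sup>2" by (simp add: power_mult_distrib)
    qed
    show "AE x in M. (\<lambda>n. (norm (f n x - f' x))\<^sup>2) \<longlonglongrightarrow> 0"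
      using lim
    proof eventually_elim
      case (elim x)
      have "(\<lambda>n. (norm (f n x - f' x))\<^sup>2) \<longlonglongrightarrow> (norm (f' x - f' x))\<^sup>2" by (intro tendsto_intros elim)
      then show ?case by simp
    qed
  qed (use f in auto)
  then show "(\<lambda>n. LINT x|M. (norm (f n x - f' x))\<^sup>2) \<longlonglongrightarrow> 0" by simp
qed

lemma borel_measurable_nth:
  "u \<in> borel_measurable M \<Longrightarrow> (\<lambda>x. u x $ i) \<in> borel_measurable M" for u :: "'a \<Rightarrow> 'b::euclidean_space ^ 'n::finite"
  by (rule measurable_compose[OF _ borel_measurable_continuous_onI]) (auto intro: continuous_intros)

lemma borel_measurable_matrix_vector:
  fixes A :: "'a \<Rightarrow> mat3" and v :: "'a \<Rightarrow> real^3"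
  assumes "A \<in> borel_measurable M" "v \<in> borel_measurable M"
  shows "(\<lambda>x. A x *v v x) \<in> borel_measurable M"
  by (intro borel_measurable_vecI) (simp add: matrix_vector_mult_def borel_measurable_sum borel_measurable_times borel_measurable_nth assms)

lemma borel_measurable_matrix_mult:
  fixes A B :: "'a \<Rightarrow> mat3"
  assumes "A \<in> borel_measurable M" "B \<in> borel_measurable M"
  shows "(\<lambda>x. A x ** B x) \<in> borel_measurable M"
  by (intro borel_measurable_vecI) (simp add: matrix_matrix_mult_def borel_measurable_sum borel_measurable_times borel_measurable_nth assms)

lemma borel_measurable_transpose:
  fixes A :: "'a \<Rightarrow> mat3"
  assumes "A \<in> borel_measurable M"
  shows "(\<lambda>x. transpose (A x)) \<in> borel_measurable M"
  by (intro borel_measurable_vecI) (simp add: transpose_def borel_measurable_nth assms)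

lemma borel_measurable_det:
  fixes A :: "'a \<Rightarrow> mat3"
  assumes "A \<in> borel_measurable M"
  shows "(\<lambda>x. det (A x)) \<in> borel_measurable M"
  by (rule measurable_compose[OF assms borel_measurable_continuous_onI[OF det_continuous]])

lemma inner_matrix_vector: "x \<bullet> (A *v y) = (transpose A *v x) \<bullet> (y :: real^3)" for A :: mat3
  by (simp add: inner_vec_def matrix_vector_mult_def transpose_def sum_3 algebra_simps)

lemma matrix_mult_row: "(A ** B) $ i = transpose B *v (A $ i)" for A B :: mat3
  by (simp add: vec_eq_iff matrix_matrix_mult_def matrix_vector_mult_def transpose_def mult.commute)

lemma norm_id_plus: "norm (A :: mat3) \<le> 1 / 10 \<Longrightarrow> norm (mat 1 + A) \<le> 2"
  using norm_triangle_ineq[of "mat 1" A] norm_mat_1 by linarith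

context small_field
begin

section \<open>The deformation, its smooth approximations and the chain rule\<close>

definition \<Phi> :: "real^3 \<Rightarrow> real^3" where "\<Phi> x = x + V x"

definition \<Phi>n :: "nat \<Rightarrow> real^3 \<Rightarrow> real^3" where "\<Phi>n n x = x + Vn n x"

lemma \<Phi>_expanding: "expanding (1 / 2) \<Phi>"
  using V_expanding by (simp add: \<Phi>_def[abs_def])

lemma \<Phi>n_expanding: "expanding (1 / 2) (\<Phi>n n)"
  using Vn_expanding by (simp add: \<Phi>n_def[abs_def])

lemma \<Phi>n_uniform: "e > 0 \<Longrightarrow> \<forall>\<^sub>F n in sequentially. \<forall>x. dist (\<Phi>n n x) (\<Phi> x) < e"
  using Vn_uniform by (simp add: \<Phi>_def \<Phi>n_def)

lemma \<Phi>n_uniform_subseq: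
  "strict_mono r \<Longrightarrow> e > 0 \<Longrightarrow> \<forall>\<^sub>F n in sequentially. \<forall>x. dist (\<Phi>n (r n) x) (\<Phi> x) < e"
  using eventually_subseq[OF _ \<Phi>n_uniform] .

lemma \<Phi>n_has_derivative: "(\<Phi>n n has_derivative (\<lambda>h. (mat 1 + Jn n x) *v h)) (at x)"
  unfolding \<Phi>n_def[abs_def] matrix_vector_mult_add_rdistrib matrix_vector_mul_lid
  by (intro has_derivative_add has_derivative_ident Vn_has_derivative)

lemma Jn_10: "norm (Jn n x) \<le> 1 / 10" and H_10: "norm (H x) \<le> 1 / 10"
  using Jn_small[of n x] H_small[of x] by linarith+

lemma \<Phi>_continuous: "continuous_on A \<Phi>" and \<Phi>n_continuous: "continuous_on A (\<Phi>n n)"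
  using \<Phi>_expanding \<Phi>n_expanding[of n] continuous_on_subset[of UNIV] unfolding expanding_def by blast+

lemma compose_tendsto:
  fixes f :: "real^3 \<Rightarrow> real"
  assumes r: "strict_mono r" and f: "sqint lebesgue f"
  shows "(\<lambda>n. n2 lebesgue (\<lambda>x. f (\<Phi>n (r n) x) - f (\<Phi> x))) \<longlonglongrightarrow> 0"
  unfolding n2_tendsto_0_iff real_norm_def power2_abs
  by (rule tendsto_L2_compose[OF \<Phi>n_expanding \<Phi>_expanding \<Phi>n_uniform_subseq[OF r]])
    (use f in \<open>auto simp: sqint_def\<close>)

text \<open>Function and map are regularised at the same time. The error splits into the
  mollification error composed with the approximate map, which is bounded uniformly in n, and the
  effect of replacing the map with f kept fixed.\<close>

lemma compose_moll_tendsto: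
  fixes f :: "real^3 \<Rightarrow> real"
  assumes r: "strict_mono r" and f: "sqint lebesgue f"
  shows "(\<lambda>n. n2 lebesgue (\<lambda>x. conv f (mollseq n) (\<Phi>n (r n) x) - f (\<Phi> x))) \<longlonglongrightarrow> 0"
proof -
  let ?C = "sqrt (expconst TYPE(real^3) (1 / 2))"
  have m: "sqint lebesgue (conv f (mollseq n))" for n unfolding mollseq_def by (rule conv_moll_sqint[OF f]) simp
  have *: "(\<lambda>n. ?C * n2 lebesgue (\<lambda>x. conv f (mollseq n) x - f x) + n2 lebesgue (\<lambda>x. f (\<Phi>n (r n) x) - f (\<Phi> x))) \<longlonglongrightarrow> 0"
    using tendsto_add[OF tendsto_mult[OF tendsto_const mollseq_tendsto_L2[OF f]] compose_tendsto[OF r f], of ?C] by simp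
  show ?thesis
  proof (rule Lim_null_comparison[OF _ *], intro always_eventually allI)
    fix n
    have "n2 lebesgue (\<lambda>x. conv f (mollseq n) (\<Phi>n (r n) x) - f (\<Phi> x))
      \<le> n2 lebesgue (\<lambda>x. conv f (mollseq n) (\<Phi>n (r n) x) - f (\<Phi>n (r n) x)) + n2 lebesgue (\<lambda>x. f (\<Phi>n (r n) x) - f (\<Phi> x))"
      by (rule n2_triangle3) (intro compose_sqint(1)[OF \<Phi>n_expanding] compose_sqint(1)[OF \<Phi>_expanding] m f)+
    also have "n2 lebesgue (\<lambda>x. conv f (mollseq n) (\<Phi>n (r n) x) - f (\<Phi>n (r n) x)) \<le> ?C * n2 lebesgue (\<lambda>x. conv f (mollseq n) x - f x)"
      by (rule compose_sqint(2)[OF \<Phi>n_expanding sqint_diff[OF m f]])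
    finally show "norm (n2 lebesgue (\<lambda>x. conv f (mollseq n) (\<Phi>n (r n) x) - f (\<Phi> x)))
      \<le> ?C * n2 lebesgue (\<lambda>x. conv f (mollseq n) x - f x) + n2 lebesgue (\<lambda>x. f (\<Phi>n (r n) x) - f (\<Phi> x))" by simp
  qed
qed

text \<open>The image of K has a compact neighbourhood in \<Omega>; half of its width absorbs the
  distance between the maps and the other half the mollification radius. This places the image
  points where mollification commutes with weak differentiation.\<close>

lemma uniform_neighbourhood:
  assumes \<Omega>: "open \<Omega>" and map: "\<Phi> ` \<Omega> \<subseteq> \<Omega>" and K: "compact K" "K \<subseteq> \<Omega>" and r: "strict_mono r"
  shows "\<forall>\<^sub>F n in sequentially. \<forall>x\<in>K. cball (\<Phi>n (r n) x) (1 / real (Suc n)) \<subseteq> \<Omega>"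
proof -
  have "compact (\<Phi> ` K)" "\<Phi> ` K \<subseteq> \<Omega>" using K map by (auto intro: compact_continuous_image \<Phi>_continuous)
  then obtain d K' where d: "d > 0" "K' \<subseteq> \<Omega>" "\<And>x y. x \<in> \<Phi> ` K \<Longrightarrow> dist x y \<le> d \<Longrightarrow> y \<in> K'"
    using compact_neighbourhood[OF \<Omega>] by metis
  have d2: "d / 2 > 0" using d by simp
  show ?thesis
    using \<Phi>n_uniform_subseq[OF r d2] inv_Suc_small[OF d2]
  proof eventually_elim
    case (elim n)
    show ?case
    proof (intro ballI subsetI)
      fix x y assume x: "x \<in> K" and y: "y \<in> cball (\<Phi>n (r n) x) (1 / real (Suc n))"
      have "dist (\<Phi> x) y \<le> dist (\<Phi> x) (\<Phi>n (r n) x) + dist (\<Phi>n (r n) x) y" by (rule dist_triangle)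
      also have "\<dots> \<le> d / 2 + d / 2"
      proof (rule add_mono)
        show "dist (\<Phi> x) (\<Phi>n (r n) x) \<le> d / 2" using elim(1) by (metis dist_commute less_imp_le)
        show "dist (\<Phi>n (r n) x) y \<le> d / 2" using y elim(2) unfolding mem_cball by linarith
      qed
      also have "\<dots> = d" by simp
      finally show "y \<in> \<Omega>" using d(2,3) x by blast
    qed
  qed
qed

lemma compose_on_L2:
  assumes \<Omega>: "open \<Omega>" and map: "\<Phi> ` \<Omega> \<subseteq> \<Omega>" and f: "on_L2 \<Omega> f"
  shows "on_L2 \<Omega> (\<lambda>x. f (\<Phi> x))"
proof -
  have "sqint lebesgue (ext0 \<Omega> f)" using f unfolding sqint_lebesgue_on[OF open_lebesgue[OF \<Omega>]] .
  from sqint_on_restrict(1)[OF open_lebesgue[OF \<Omega>] compose_sqint(1)[OF \<Phi>_expanding this]]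
  have 1: "on_L2 \<Omega> (\<lambda>x. ext0 \<Omega> f (\<Phi> x))" .
  show ?thesis
  proof (rule sqint_cong_AE[OF 1])
    show "AE x in lebesgue_on \<Omega>. ext0 \<Omega> f (\<Phi> x) = f (\<Phi> x)" using map by (intro AE_I2) auto
    then show "(\<lambda>x. f (\<Phi> x)) \<in> borel_measurable (lebesgue_on \<Omega>)"
      by (rule measurable_lebesgue_on_AE[OF open_lebesgue[OF \<Omega>] sqint_measurable[OF 1]])
  qed
qed

text \<open>For a smooth function and a smooth map the classical chain rule and integration by parts
  apply, and the weak identity is their limit. The mollified gradient of f composed with the map
  converges in L2. The mollified Jacobian of the field converges only almost everywhere; it is
  grouped with the test function, where dominated convergence makes the product converge in L2 as
  well.\<close>

lemma chain_rule_gradient: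
  assumes \<Omega>: "open \<Omega>" and map: "\<Phi> ` \<Omega> \<subseteq> \<Omega>"
    and f: "on_L2 \<Omega> f" and g: "on_L2 \<Omega> g" and fg: "has_weak_gradient \<Omega> f g"
  shows "has_weak_gradient \<Omega> (\<lambda>x. f (\<Phi> x)) (\<lambda>x. transpose (mat 1 + H x) *v g (\<Phi> x))"
    and "on_L2 \<Omega> (\<lambda>x. transpose (mat 1 + H x) *v g (\<Phi> x))"
proof -
  note \<Omega>s = open_lebesgue[OF \<Omega>]
  have f': "sqint lebesgue (ext0 \<Omega> f)" and g': "sqint lebesgue (ext0 \<Omega> g)"
    using f g unfolding sqint_lebesgue_on[OF \<Omega>s] .
  have g'k: "sqint lebesgue (ext0 \<Omega> (\<lambda>x. g x $ k))" for k using sqint_nth(1)[OF g', of k] by simp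
  note gc = compose_on_L2[OF \<Omega> map g]
  have Hm: "(\<lambda>x. mat 1 + H x) \<in> borel_measurable lebesgue" using sqint_measurable[OF H_L2] by measurable
  have Hm': "(\<lambda>x. mat 1 + H x) \<in> borel_measurable (lebesgue_on \<Omega>)" by (rule measurable_restrict_space1[OF Hm])
  show L: "on_L2 \<Omega> (\<lambda>x. transpose (mat 1 + H x) *v g (\<Phi> x))"
  proof (rule sqint_bound(1)[OF gc, of _ 2])
    show "(\<lambda>x. transpose (mat 1 + H x) *v g (\<Phi> x)) \<in> borel_measurable (lebesgue_on \<Omega>)"
      by (intro borel_measurable_matrix_vector borel_measurable_transpose Hm' sqint_measurable gc)
    show "AE x in lebesgue_on \<Omega>. norm (transpose (mat 1 + H x) *v g (\<Phi> x)) \<le> 2 * norm (g (\<Phi> x))"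
    proof (rule AE_I2)
      fix x
      show "norm (transpose (mat 1 + H x) *v g (\<Phi> x)) \<le> 2 * norm (g (\<Phi> x))"
        using norm_matrix_vector_le[of "transpose (mat 1 + H x)" "g (\<Phi> x)"] mult_right_mono[OF norm_id_plus[OF H_10[of x]] norm_ge_zero[of "g (\<Phi> x)"]]
        by (simp add: norm_transpose_eq)
    qed
  qed
  obtain r where r: "strict_mono r" "AE x in lebesgue. (\<lambda>n. Jn (r n) x) \<longlonglongrightarrow> H x" using Jn_AE by blast
  show "has_weak_gradient \<Omega> (\<lambda>x. f (\<Phi> x)) (\<lambda>x. transpose (mat 1 + H x) *v g (\<Phi> x))"
    unfolding has_weak_gradient_def
  proof (intro conjI ballI allI)
    show "(\<lambda>x. f (\<Phi> x)) locally_integrable_on \<Omega>"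
      by (rule sqint_on_locally_integrable[OF \<Omega>s compose_on_L2[OF \<Omega> map f]])
    show "(\<lambda>x. transpose (mat 1 + H x) *v g (\<Phi> x)) locally_integrable_on \<Omega>"
      by (rule sqint_on_locally_integrable[OF \<Omega>s L])
    fix \<phi> j assume p: "\<phi> \<in> test_functions \<Omega>"
    define F where "F n = conv (ext0 \<Omega> f) (mollseq n)" for n
    define G where "G n y = (\<chi> k. conv (ext0 \<Omega> (\<lambda>x. g x $ k)) (mollseq n) y)" for n y
    have Fs: "smooth (F n)" for n
      unfolding F_def mollseq_def by (rule conv_smooth(1)[OF sqint_locally_integrable[OF f'] moll_test_UNIV[OF mollseq_pos]])
    define gr where "gr n x = transpose (mat 1 + Jn (r n) x) *v grad (F n) (\<Phi>n (r n) x)" for n x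
    have gradc: "continuous_on UNIV (grad (F n))" for n
      unfolding grad_def[abs_def] by (intro continuous_intros smooth_continuous smooth_partial Fs)
    have grc: "continuous_on UNIV (gr n)" for n
    proof -
      have "continuous_on UNIV (\<lambda>x. \<chi> i. \<Sum>k\<in>UNIV. (mat 1 + Jn (r n) x) $ k $ i * grad (F n) (\<Phi>n (r n) x) $ k)"
        by (intro continuous_intros Jn_continuous continuous_on_compose2[OF gradc \<Phi>n_continuous]) auto
      then show ?thesis by (simp add: gr_def[abs_def] matrix_vector_mult_def transpose_def)
    qed
    have ibp: "(LINT x|lebesgue. F n (\<Phi>n (r n) x) * partial j \<phi> x) = - (LINT x|lebesgue. gr n x $ j * \<phi> x)" for n
    proof (rule integration_by_parts[OF _ _ _ p])
      fix x
      show "((\<lambda>x. F n (\<Phi>n (r n) x)) has_derivative (\<lambda>h. gr n x \<bullet> h)) (at x)"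
        using has_derivative_compose[OF \<Phi>n_has_derivative smooth_has_derivative[OF Fs, of n "\<Phi>n (r n) x"]]
        by (simp add: gr_def inner_matrix_vector grad_def del: transpose_matrix_vector)
    next
      show "gr n \<in> borel_measurable borel" by (rule borel_measurable_continuous_onI[OF grc])
      fix R :: real
      have "bounded (gr n ` cball 0 R)"
        by (intro compact_imp_bounded compact_continuous_image compact_cball continuous_on_subset[OF grc]) auto
      then obtain B where "\<forall>y\<in>gr n ` cball 0 R. norm y \<le> B" unfolding bounded_iff by blast
      then show "\<exists>B. \<forall>x. norm x \<le> R \<longrightarrow> norm (gr n x) \<le> B" by (intro exI[of _ B]) simp
    qed
    note ps = test_sqint[OF p] and pps = test_sqint[OF test_partial[OF p, of j]]
    have Fsq: "sqint lebesgue (F n)" for n unfolding F_def mollseq_def by (rule conv_moll_sqint[OF f' mollseq_pos])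
    have l1: "(\<lambda>n. LINT x|lebesgue. F n (\<Phi>n (r n) x) \<bullet> partial j \<phi> x) \<longlonglongrightarrow> (LINT x|lebesgue. ext0 \<Omega> f (\<Phi> x) \<bullet> partial j \<phi> x)"
      by (rule tendsto_inner_n2[OF compose_sqint(1)[OF \<Phi>n_expanding Fsq] compose_sqint(1)[OF \<Phi>_expanding f'] pps])
        (use compose_moll_tendsto[OF r(1) f'] in \<open>simp add: F_def\<close>)
    have Gsq: "sqint lebesgue (\<lambda>x. G n (\<Phi>n (r n) x))" for n
      unfolding G_def mollseq_def
      by (rule sqint_vecI) (simp add: compose_sqint(1)[OF \<Phi>n_expanding] conv_moll_sqint g'k[simplified])
    define h where "h n x = \<phi> x *\<^sub>R transpose (mat 1 + Jn (r n) x) $ j" for n x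
    define h' where "h' x = \<phi> x *\<^sub>R transpose (mat 1 + H x) $ j" for x
    have hb: "norm (\<phi> x *\<^sub>R transpose (mat 1 + A) $ j) \<le> 2 * norm (\<phi> x)" if "norm A \<le> 1 / 10" for x and A :: mat3
    proof -
      have "norm (transpose (mat 1 + A) $ j) \<le> 2"
        using Finite_Cartesian_Product.norm_nth_le[of "transpose (mat 1 + A)" j] norm_id_plus[OF that] by (simp add: norm_transpose_eq)
      from mult_left_mono[OF this, of "\<bar>\<phi> x\<bar>"] show ?thesis by (simp add: mult.commute)
    qed
    have phm: "\<phi> \<in> borel_measurable lebesgue" by (rule sqint_measurable[OF ps])
    have hm: "h n \<in> borel_measurable lebesgue" "h' \<in> borel_measurable lebesgue" for n
      unfolding h_def h'_def
      by (intro borel_measurable_scaleR phm borel_measurable_nth borel_measurable_transpose Hm borel_measurable_add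
          borel_measurable_const borel_measurable_lebesgueI[OF borel_measurable_continuous_onI[OF Jn_continuous]])+
    have hs: "sqint lebesgue (h n)" "sqint lebesgue h'" for n
      by (rule sqint_bound(1)[OF ps hm(1), of _ 2], use hb[OF Jn_10] in \<open>simp add: h_def\<close>)
        (rule sqint_bound(1)[OF ps hm(2), of 2], use hb[OF H_10] in \<open>simp add: h'_def\<close>)
    have l2: "(\<lambda>n. LINT x|lebesgue. G n (\<Phi>n (r n) x) \<bullet> h n x) \<longlonglongrightarrow> (LINT x|lebesgue. ext0 \<Omega> g (\<Phi> x) \<bullet> h' x)"
    proof (rule tendsto_inner_n2_both[OF Gsq compose_sqint(1)[OF \<Phi>_expanding g'] hs])
      show "(\<lambda>n. n2 lebesgue (\<lambda>x. G n (\<Phi>n (r n) x) - ext0 \<Omega> g (\<Phi> x))) \<longlonglongrightarrow> 0"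
      proof (rule n2_tendsto_vec)
        show "sqint lebesgue (\<lambda>x. (G n (\<Phi>n (r n) x) - ext0 \<Omega> g (\<Phi> x)) $ k)" for n k
          by (intro sqint_nth sqint_diff Gsq compose_sqint(1)[OF \<Phi>_expanding g'])
        show "(\<lambda>n. n2 lebesgue (\<lambda>x. (G n (\<Phi>n (r n) x) - ext0 \<Omega> g (\<Phi> x)) $ k)) \<longlonglongrightarrow> 0" for k
          using compose_moll_tendsto[OF r(1) g'k[of k]] by (simp add: G_def)
      qed
      show "(\<lambda>n. n2 lebesgue (\<lambda>x. h n x - h' x)) \<longlonglongrightarrow> 0"
      proof (rule n2_dominated_convergence[OF ps hm, where B=2])
        show "norm (h n x) \<le> 2 * norm (\<phi> x)" "norm (h' x) \<le> 2 * norm (\<phi> x)" for n x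
          unfolding h_def h'_def by (rule hb[OF Jn_10], rule hb[OF H_10])
        show "AE x in lebesgue. (\<lambda>n. h n x) \<longlonglongrightarrow> h' x"
          using r(2)
        proof eventually_elim
          case (elim x)
          have "(\<lambda>n. transpose (mat 1 + Jn (r n) x) $ j) \<longlonglongrightarrow> transpose (mat 1 + H x) $ j"
            unfolding transpose_def vec_lambda_beta by (intro tendsto_intros elim)
          then show ?case unfolding h_def h'_def by (rule tendsto_scaleR[OF tendsto_const])
        qed
      qed
    qed
    \<comment> \<open>The gradient of the mollification is the mollified gradient only for large n
      and at image points of the support of \<phi>; off the support both integrands vanish.\<close>
    have ev: "\<forall>\<^sub>F n in sequentially. (LINT x|lebesgue. F n (\<Phi>n (r n) x) \<bullet> partial j \<phi> x) = - (LINT x|lebesgue. G n (\<Phi>n (r n) x) \<bullet> h n x)"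
    proof -
      have "compact (support \<phi>)" "support \<phi> \<subseteq> \<Omega>" using p by (auto simp: test_functions_def)
      from uniform_neighbourhood[OF \<Omega> map this r(1)]
      show ?thesis
      proof eventually_elim
        case (elim n)
        have "gr n x $ j * \<phi> x = G n (\<Phi>n (r n) x) \<bullet> h n x" for x
        proof (cases "x \<in> support \<phi>")
          case True
          have "grad (F n) (\<Phi>n (r n) x) = G n (\<Phi>n (r n) x)"
            unfolding vec_eq_iff F_def G_def mollseq_def grad_nth vec_lambda_beta
            using partial_conv_moll[OF \<Omega> fg f' mollseq_pos] elim True by blast
          then show ?thesis
            by (simp add: gr_def h_def matrix_vector_mul_component inner_commute del: transpose_matrix_vector)
        qed (simp add: support_outside h_def)
        then show ?case using ibp[of n] by simp
      qed
    qed
    have "(\<lambda>n. LINT x|lebesgue. F n (\<Phi>n (r n) x) \<bullet> partial j \<phi> x) \<longlonglongrightarrow> - (LINT x|lebesgue. ext0 \<Omega> g (\<Phi> x) \<bullet> h' x)"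
      by (rule Lim_transform_eventually[OF tendsto_minus[OF l2]]) (use ev in \<open>auto elim: eventually_mono\<close>)
    from LIMSEQ_unique[OF l1 this]
    have e: "(LINT x|lebesgue. ext0 \<Omega> f (\<Phi> x) \<bullet> partial j \<phi> x) = - (LINT x|lebesgue. ext0 \<Omega> g (\<Phi> x) \<bullet> h' x)" .
    have e1: "ext0 \<Omega> f (\<Phi> x) \<bullet> partial j \<phi> x = ext0 \<Omega> (\<lambda>x. f (\<Phi> x) * partial j \<phi> x) x" for x
      using map test_outside[OF test_partial[OF p], of x j] by (cases "x \<in> \<Omega>") (auto simp: image_subset_iff)
    have e2: "ext0 \<Omega> g (\<Phi> x) \<bullet> h' x = ext0 \<Omega> (\<lambda>x. (transpose (mat 1 + H x) *v g (\<Phi> x)) $ j * \<phi> x) x" for x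
      using map test_outside[OF p, of x]
      by (cases "x \<in> \<Omega>") (auto simp: image_subset_iff h'_def matrix_vector_mul_component inner_commute simp del: transpose_matrix_vector)
    show "(LINT x|lebesgue_on \<Omega>. f (\<Phi> x) * partial j \<phi> x) = - (LINT x|lebesgue_on \<Omega>. (transpose (mat 1 + H x) *v g (\<Phi> x)) $ j * \<phi> x)"
      unfolding integral_lebesgue_on[OF \<Omega>s] using e unfolding e1 e2 .
  qed
qed

lemma chain_rule:
  assumes \<Omega>: "open \<Omega>" and map: "\<Phi> ` \<Omega> \<subseteq> \<Omega>" and u: "u \<in> H1 \<Omega>"
  shows "(\<lambda>x. u (\<Phi> x)) \<in> H1 \<Omega>"
    and "AE x in lebesgue_on \<Omega>. weak_jacobian \<Omega> (\<lambda>x. u (\<Phi> x)) x = weak_jacobian \<Omega> u (\<Phi> x) ** (mat 1 + H x)"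
proof -
  note uD = H1D[OF \<Omega> u]
  let ?G = "\<lambda>x. weak_jacobian \<Omega> u (\<Phi> x) ** (mat 1 + H x)"
  have hg: "has_weak_gradient \<Omega> (\<lambda>x. u x $ i) (\<lambda>x. weak_jacobian \<Omega> u x $ i)" for i
    using uD(3) unfolding weak_jacobian_iff_gradient by blast
  note c = chain_rule_gradient[OF \<Omega> map sqint_nth(1)[OF uD(1)] sqint_nth(1)[OF uD(2)] hg]
  have j: "has_weak_jacobian \<Omega> (\<lambda>x. u (\<Phi> x)) ?G"
    unfolding weak_jacobian_iff_gradient matrix_mult_row using c(1) by blast
  have "on_L2 \<Omega> ?G" by (rule sqint_vecI) (unfold matrix_mult_row, rule c(2))
  then show "(\<lambda>x. u (\<Phi> x)) \<in> H1 \<Omega>" by (rule H1I[OF compose_on_L2[OF \<Omega> map uD(1)] _ j])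
  show "AE x in lebesgue_on \<Omega>. weak_jacobian \<Omega> (\<lambda>x. u (\<Phi> x)) x = ?G x" by (rule weak_jacobian_AE[OF \<Omega> j])
qed

section \<open>Inverse maps and the equation on the reference configuration\<close>

lemma \<Phi>n_surj: "surj (\<Phi>n n)"
proof -
  have "\<exists>x. \<Phi>n n x = y" for y
  proof -
    \<comment> \<open>The preimages of y are the fixed points of this contraction.\<close>
    have "\<exists>!x. y - Vn n x = x"
    proof (rule banach_fix_type[of "9 / 100"])
      show "\<forall>x z. dist (y - Vn n x) (y - Vn n z) \<le> 9 / 100 * dist x z"
        using Vn_lipschitz[of n] by (simp add: dist_norm norm_minus_commute)
    qed auto
    then obtain x where "y - Vn n x = x" by blast
    then have "\<Phi>n n x = y" by (simp add: \<Phi>n_def algebra_simps)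
    then show ?thesis ..
  qed
  then show ?thesis by (metis surjI)
qed

definition \<Psi>n :: "nat \<Rightarrow> real^3 \<Rightarrow> real^3" where "\<Psi>n n = inv (\<Phi>n n)"

lemma \<Psi>n_inv [simp]: "\<Psi>n n (\<Phi>n n x) = x" "\<Phi>n n (\<Psi>n n y) = y"
  using expanding_inj[OF \<Phi>n_expanding] \<Phi>n_surj by (simp_all add: \<Psi>n_def surj_f_inv_f)

lemma \<Psi>n_continuous: "continuous_on A (\<Psi>n n)"
proof -
  have "2-lipschitz_on A (\<Psi>n n)"
  proof (rule lipschitz_onI)
    fix x y
    have "1 / 2 * dist (\<Psi>n n x) (\<Psi>n n y) \<le> dist (\<Phi>n n (\<Psi>n n x)) (\<Phi>n n (\<Psi>n n y))"
      using \<Phi>n_expanding unfolding expanding_def by blast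
    then show "dist (\<Psi>n n x) (\<Psi>n n y) \<le> 2 * dist x y" by simp
  qed simp
  then show ?thesis by (rule lipschitz_on_continuous_on)
qed

lemma \<Psi>n_has_derivative: "(\<Psi>n n has_derivative (\<lambda>h. finv (Jn n (\<Psi>n n y)) *v h)) (at y)"
proof (rule has_derivative_inverse_basic[OF \<Phi>n_has_derivative, where T=UNIV])
  show "bounded_linear (\<lambda>h. finv (Jn n (\<Psi>n n y)) *v h)"
    by (rule matrix_vector_mul_bounded_linear)
  show "(\<lambda>h. finv (Jn n (\<Psi>n n y)) *v h) \<circ> (\<lambda>h. (mat 1 + Jn n (\<Psi>n n y)) *v h) = id"
    using finv(2)[OF Jn_10] by (simp add: fun_eq_iff matrix_vector_mul_assoc)
  show "continuous (at y) (\<Psi>n n)"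
    using \<Psi>n_continuous[of UNIV n] by (simp add: continuous_on_eq_continuous_at)
qed auto

text \<open>The approximate maps are differentiable bijections of the whole space, and
  \<open>det_bounds\<close> makes their determinants positive, so no absolute value remains.\<close>

lemma change_of_variables:
  fixes k :: "real^3 \<Rightarrow> real"
  assumes k: "integrable lebesgue k"
  shows "(LINT x|lebesgue. det (mat 1 + Jn n x) * k (\<Phi>n n x)) = (LINT y|lebesgue. k y)"
proof -
  \<comment> \<open>The scalar integrand is placed in the first coordinate of a vector field, the
    shape in which the change of variables theorem is stated.\<close>
  let ?a = "axis 1 1 :: real^3"
  let ?g' = "\<lambda>x h. (mat 1 + Jn n x) *v h"
  let ?f = "\<lambda>y. k y *\<^sub>R ?a"
  have abs: "h absolutely_integrable_on UNIV \<longleftrightarrow> integrable lebesgue h" for h :: "real^3 \<Rightarrow> real^3"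
    by (simp add: set_integrable_def)
  have hk: "integral UNIV h = (LINT x|lebesgue. h x)" if "integrable lebesgue h" for h :: "real^3 \<Rightarrow> real^3"
    using set_lebesgue_integral_eq_integral(2)[of UNIV h] that by (simp add: set_integrable_def set_lebesgue_integral_def)
  have fi: "integrable lebesgue ?f" using k by auto
  have im: "\<Phi>n n ` UNIV = UNIV" using \<Phi>n_surj .
  have d: "det (mat 1 + Jn n x) > 0" for x using det_bounds(1)[OF Jn_10[of n x]] by simp
  have "(\<lambda>x. \<bar>det (matrix (?g' x))\<bar> *\<^sub>R ?f (\<Phi>n n x)) absolutely_integrable_on UNIV \<and>
        integral UNIV (\<lambda>x. \<bar>det (matrix (?g' x))\<bar> *\<^sub>R ?f (\<Phi>n n x)) = integral UNIV ?f
     \<longleftrightarrow> ?f absolutely_integrable_on (\<Phi>n n ` UNIV) \<and> integral (\<Phi>n n ` UNIV) ?f = integral UNIV ?f"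
    by (rule has_absolute_integral_change_of_variables) (use \<Phi>n_has_derivative expanding_inj[OF \<Phi>n_expanding] in auto)
  then have *: "integrable lebesgue (\<lambda>x. \<bar>det (mat 1 + Jn n x)\<bar> *\<^sub>R ?f (\<Phi>n n x))"
    "integral UNIV (\<lambda>x. \<bar>det (mat 1 + Jn n x)\<bar> *\<^sub>R ?f (\<Phi>n n x)) = integral UNIV ?f"
    using fi unfolding im abs by (simp_all only: matrix_of_matrix_vector_mul simp_thms)
  have "(LINT x|lebesgue. \<bar>det (mat 1 + Jn n x)\<bar> *\<^sub>R ?f (\<Phi>n n x)) = (LINT y|lebesgue. ?f y)"
    using *(2) unfolding hk[OF *(1)] hk[OF fi] .
  then have "(LINT x|lebesgue. (\<bar>det (mat 1 + Jn n x)\<bar> *\<^sub>R ?f (\<Phi>n n x)) $ 1) = (LINT y|lebesgue. ?f y $ 1)"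
    using integral_bounded_linear[OF bounded_linear_vec_nth[of 1] *(1)] integral_bounded_linear[OF bounded_linear_vec_nth[of 1] fi] by metis
  then show ?thesis using d by (simp add: abs_of_pos)
qed

text \<open>Testing with \<open>\<psi> \<circ> \<Psi>n\<close>, which is Lipschitz with compact support, transports the weak equation
  to the reference configuration.\<close>

lemma pull_back_H10:
  assumes \<Omega>: "open \<Omega>" and p: "\<psi> \<in> vector_test_functions \<Omega>"
    and K: "compact K" "\<forall>x. x \<notin> K \<longrightarrow> \<psi> x = 0" and map: "\<Phi>n n ` K \<subseteq> \<Omega>"
  defines "D \<equiv> (\<lambda>y. cjac \<psi> (\<Psi>n n y) ** finv (Jn n (\<Psi>n n y)))"
  shows "(\<lambda>y. \<psi> (\<Psi>n n y)) \<in> H10 \<Omega>" "has_weak_jacobian \<Omega> (\<lambda>y. \<psi> (\<Psi>n n y)) D" "sqint lebesgue D"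
proof -
  have sm: "smooth (\<lambda>y. \<psi> y $ i)" for i using vtestD[OF p] by (simp add: test_functions_def)
  have out: "cjac \<psi> x = 0" if "x \<notin> K" for x
  proof -
    have "support (\<lambda>y. \<psi> y $ i) \<subseteq> K" for i using K by (intro support_subsetI compact_imp_closed) auto
    then have "partial j (\<lambda>y. \<psi> y $ i) x = 0" for i j using that by (intro partial_outside_support) auto
    then show ?thesis by (simp add: vec_eq_iff)
  qed
  have cj: "continuous_on UNIV (cjac \<psi>)"
    unfolding cjac_def[abs_def] grad_def[abs_def] by (intro continuous_intros smooth_continuous smooth_partial sm)
  have fc: "continuous_on UNIV (\<lambda>x. finv (Jn n x))"
    by (rule continuous_on_compose2[OF finv_continuous Jn_continuous]) (use Jn_10 in auto)
  have Dc: "continuous_on UNIV D"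
    unfolding D_def
    by (intro mm.continuous_on continuous_on_compose2[OF cj \<Psi>n_continuous] continuous_on_compose2[OF fc \<Psi>n_continuous]) auto
  have row: "D y $ i = transpose (finv (Jn n (\<Psi>n n y))) *v grad (\<lambda>y. \<psi> y $ i) (\<Psi>n n y)" for i y
    by (simp add: D_def matrix_mult_row)
  have bdd: "\<exists>B. \<forall>x. norm x \<le> R \<longrightarrow> norm (D x) \<le> B" for R
  proof -
    have "bounded (D ` cball 0 R)"
      by (intro compact_imp_bounded compact_continuous_image compact_cball continuous_on_subset[OF Dc]) auto
    then obtain B where "\<forall>y\<in>D ` cball 0 R. norm y \<le> B" unfolding bounded_iff by blast
    then show ?thesis by (intro exI[of _ B]) simp
  qed
  show jac: "has_weak_jacobian \<Omega> (\<lambda>y. \<psi> (\<Psi>n n y)) D"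
    unfolding weak_jacobian_iff_gradient
  proof (intro allI classical_weak_gradient[OF _ _ _ \<Omega>])
    fix i y
    show "((\<lambda>y. \<psi> (\<Psi>n n y) $ i) has_derivative (\<lambda>h. D y $ i \<bullet> h)) (at y)"
      using has_derivative_compose[OF \<Psi>n_has_derivative smooth_has_derivative[OF sm[of i], of "\<Psi>n n y"]]
      unfolding row by (simp add: inner_matrix_vector grad_def del: transpose_matrix_vector)
  next
    fix i
    show "(\<lambda>x. D x $ i) \<in> borel_measurable borel" by (intro borel_measurable_nth borel_measurable_continuous_onI Dc)
    fix R
    show "\<exists>B. \<forall>x. norm x \<le> R \<longrightarrow> norm (D x $ i) \<le> B"
      using bdd[of R] Finite_Cartesian_Product.norm_nth_le order_trans by meson
  qed
  define K' where "K' = \<Phi>n n ` K"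
  have K': "compact K'" "K' \<subseteq> \<Omega>" using K(1) map by (auto simp: K'_def intro: compact_continuous_image \<Phi>n_continuous)
  have mem: "\<Psi>n n y \<notin> K" if "y \<notin> K'" for y
  proof
    assume "\<Psi>n n y \<in> K"
    then have "\<Phi>n n (\<Psi>n n y) \<in> K'" unfolding K'_def by (rule imageI)
    then show False using that by simp
  qed
  \<comment> \<open>The transported function and its Jacobian are both continuous and vanish off the
    compact image of K, hence they are bounded with support of finite measure.\<close>
  have sq: "sqint lebesgue h" if hc: "continuous_on UNIV h" and h0: "\<forall>y. y \<notin> K' \<longrightarrow> h y = 0" for h :: "real^3 \<Rightarrow> 'b::euclidean_space"
  proof -
    have "bounded (h ` K')" by (intro compact_imp_bounded compact_continuous_image continuous_on_subset[OF hc] K') auto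
    then obtain B where B: "\<And>y. y \<in> K' \<Longrightarrow> norm (h y) \<le> B" by (auto simp: bounded_iff)
    have "sqint lebesgue (\<lambda>x. indicat_real K' x)"
      using lmeasurable_compact[OF K'(1)] unfolding sqint_def
      by (auto simp: fmeasurable_def power2_eq_square indicator_inter_arith[symmetric] intro!: integrable_real_indicator)
    then show ?thesis
      by (rule sqint_bound(1)[of _ _ _ B]) (use B h0 in \<open>auto simp: indicator_def intro!: borel_measurable_lebesgueI borel_measurable_continuous_onI hc\<close>)
  qed
  have D0: "\<forall>y. y \<notin> K' \<longrightarrow> D y = 0" using out[OF mem] by (simp add: D_def mm.zero_left)
  show Ds: "sqint lebesgue D" by (rule sq[OF Dc D0])
  have pc: "continuous_on UNIV (\<lambda>y. \<psi> (\<Psi>n n y))"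
  proof -
    have "continuous_on UNIV \<psi>" using smooth_continuous[OF sm] by (subst continuous_on_componentwise) (auto simp: Basis_vec_def inner_axis)
    then show ?thesis by (rule continuous_on_compose2[OF _ \<Psi>n_continuous]) auto
  qed
  have p0: "\<forall>y. y \<notin> K' \<longrightarrow> \<psi> (\<Psi>n n y) = 0" using K(2) mem by blast
  have "(\<lambda>y. \<psi> (\<Psi>n n y)) \<in> H1 \<Omega>"
    by (rule H1I[OF sqint_on_restrict(1)[OF open_lebesgue[OF \<Omega>] sq[OF pc p0]] sqint_on_restrict(1)[OF open_lebesgue[OF \<Omega>] Ds] jac])
  then show "(\<lambda>y. \<psi> (\<Psi>n n y)) \<in> H10 \<Omega>"
    by (rule compact_support_H10[OF \<Omega> _ K']) (use p0 in blast)
qed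

text \<open>The field h plays the role of the stress of the deformed problem. Only its square
  integrability and its weak equation are used, so the jumps of the coefficient cause no difficulty.
  After a change of variables by \<open>\<Phi>n\<close> the composition of h with the map converges
  strongly in L2, while the matrix factors stay bounded and converge almost everywhere.\<close>

lemma transformed_equation:
  assumes \<Omega>: "open \<Omega>" and map: "\<Phi> ` \<Omega> \<subseteq> \<Omega>" and h: "on_L2 \<Omega> h"
    and eq: "\<And>\<psi>. \<psi> \<in> H10 \<Omega> \<Longrightarrow> (LINT x|lebesgue_on \<Omega>. h x \<bullet> weak_jacobian \<Omega> \<psi> x) = 0"
    and p: "\<psi> \<in> vector_test_functions \<Omega>"
  shows "(LINT x|lebesgue_on \<Omega>. (det (mat 1 + H x) *\<^sub>R (h (\<Phi> x) ** transpose (finv (H x)))) \<bullet> cjac \<psi> x) = 0"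
proof -
  note \<Omega>s = open_lebesgue[OF \<Omega>]
  define K where "K = (\<Union>i\<in>UNIV. support (\<lambda>x. \<psi> x $ i))"
  have K: "compact K" "K \<subseteq> \<Omega>"
    using vtestD[OF p] unfolding K_def by (auto simp: test_functions_def)
  have K0: "\<forall>x. x \<notin> K \<longrightarrow> \<psi> x = 0"
    using support_outside[of _ "\<lambda>x. \<psi> x $ _"] by (auto simp: K_def vec_eq_iff)
  have h': "sqint lebesgue (ext0 \<Omega> h)" using h unfolding sqint_lebesgue_on[OF \<Omega>s] .
  obtain r where r: "strict_mono r" "AE x in lebesgue. (\<lambda>n. Jn (r n) x) \<longlonglongrightarrow> H x" using Jn_AE by blast
  \<comment> \<open>The gradient of the transported test function seen in the reference
    configuration, times the determinant of the map. The inverse matrix is moved to the other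
    factor, transposed, only at the end. Determinant and inverse are each at most 2, which gives the
    bound 4 below.\<close>
  define M where "M A x = det (mat 1 + A) *\<^sub>R (cjac \<psi> x ** finv A)" for A x
  have Mb: "norm (M A x) \<le> 4 * norm (cjac \<psi> x)" if A: "norm A \<le> 1 / 10" for A x
  proof -
    have "norm (M A x) = det (mat 1 + A) * norm (cjac \<psi> x ** finv A)" using det_bounds(1)[OF A] by (simp add: M_def)
    also have "\<dots> \<le> 2 * (norm (cjac \<psi> x) * 2)"
      using det_bounds[OF A] finv_bounds(1)[OF A] norm_matrix_mult_le[of "cjac \<psi> x" "finv A"]
        mult_left_mono[OF finv_bounds(1)[OF A] norm_ge_zero[of "cjac \<psi> x"]]
      by (intro mult_mono) auto
    finally show ?thesis by simp
  qed
  note cs = vtest_sqint(2)[OF p]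
  have Mm: "(\<lambda>x. M (A x) x) \<in> borel_measurable lebesgue" if "A \<in> borel_measurable lebesgue" "\<And>x. norm (A x) \<le> 1 / 10" for A
    unfolding M_def
    by (intro borel_measurable_scaleR borel_measurable_det borel_measurable_matrix_mult finv_measurable borel_measurable_add that
        borel_measurable_const sqint_measurable[OF cs])
  have Jm: "Jn n \<in> borel_measurable lebesgue" for n by (intro borel_measurable_lebesgueI borel_measurable_continuous_onI Jn_continuous)
  note Mm1 = Mm[OF Jm Jn_10] and Mm2 = Mm[OF sqint_measurable[OF H_L2] H_10]
  have Ms: "sqint lebesgue (\<lambda>x. M (Jn n x) x)" "sqint lebesgue (\<lambda>x. M (H x) x)" for n
    by (rule sqint_bound(1)[OF cs Mm1, of _ 4], use Mb[OF Jn_10] in simp)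
      (rule sqint_bound(1)[OF cs Mm2, of 4], use Mb[OF H_10] in simp)
  have lim: "(\<lambda>n. LINT x|lebesgue. ext0 \<Omega> h (\<Phi>n (r n) x) \<bullet> M (Jn (r n) x) x) \<longlonglongrightarrow> (LINT x|lebesgue. ext0 \<Omega> h (\<Phi> x) \<bullet> M (H x) x)"
  proof (rule tendsto_inner_n2_both[OF compose_sqint(1)[OF \<Phi>n_expanding h'] compose_sqint(1)[OF \<Phi>_expanding h'] Ms])
    show "(\<lambda>n. n2 lebesgue (\<lambda>x. ext0 \<Omega> h (\<Phi>n (r n) x) - ext0 \<Omega> h (\<Phi> x))) \<longlonglongrightarrow> 0"
    proof (intro n2_tendsto_vec)
      show "sqint lebesgue (\<lambda>x. (ext0 \<Omega> h (\<Phi>n (r n) x) - ext0 \<Omega> h (\<Phi> x)) $ i)"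
        "sqint lebesgue (\<lambda>x. (ext0 \<Omega> h (\<Phi>n (r n) x) - ext0 \<Omega> h (\<Phi> x)) $ i $ j)" for n i j
        by (intro sqint_nth sqint_diff compose_sqint(1)[OF \<Phi>n_expanding h'] compose_sqint(1)[OF \<Phi>_expanding h'])+
      show "(\<lambda>n. n2 lebesgue (\<lambda>x. (ext0 \<Omega> h (\<Phi>n (r n) x) - ext0 \<Omega> h (\<Phi> x)) $ i $ j)) \<longlonglongrightarrow> 0" for i j
        using compose_tendsto[OF r(1) sqint_nth(1)[OF sqint_nth(1)[OF h', of i], of j]] by simp
    qed
    show "(\<lambda>n. n2 lebesgue (\<lambda>x. M (Jn (r n) x) x - M (H x) x)) \<longlonglongrightarrow> 0"
    proof (rule n2_dominated_convergence[OF cs Mm1 Mm2 Mb[OF Jn_10] Mb[OF H_10]])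
      show "AE x in lebesgue. (\<lambda>n. M (Jn (r n) x) x) \<longlonglongrightarrow> M (H x) x"
        using r(2)
      proof eventually_elim
        case (elim x)
        note t = finv_tendsto[OF Jn_10 H_10 elim]
        show ?case unfolding M_def by (intro tendsto_scaleR mm.tendsto tendsto_const t)
      qed
    qed
  qed
  have zero: "\<forall>\<^sub>F n in sequentially. (LINT x|lebesgue. ext0 \<Omega> h (\<Phi>n (r n) x) \<bullet> M (Jn (r n) x) x) = 0"
    using uniform_neighbourhood[OF \<Omega> map K r(1)]
  proof eventually_elim
    case (elim n)
    have "\<Phi>n (r n) ` K \<subseteq> \<Omega>" using elim by (force simp: image_subset_iff)
    note pb = pull_back_H10[OF \<Omega> p K(1) K0 this]
    define D where "D y = cjac \<psi> (\<Psi>n (r n) y) ** finv (Jn (r n) (\<Psi>n (r n) y))" for y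
    have "0 = (LINT x|lebesgue_on \<Omega>. h x \<bullet> weak_jacobian \<Omega> (\<lambda>y. \<psi> (\<Psi>n (r n) y)) x)"
      using eq[OF pb(1)] by simp
    also have "\<dots> = (LINT x|lebesgue_on \<Omega>. h x \<bullet> D x)"
    proof (rule integral_cong_AE)
      have "on_L2 \<Omega> D" unfolding D_def by (rule sqint_on_restrict(1)[OF \<Omega>s pb(3)])
      then show "(\<lambda>x. h x \<bullet> D x) \<in> borel_measurable (lebesgue_on \<Omega>)" using h by (intro borel_measurable_inner sqint_measurable)
      show "(\<lambda>x. h x \<bullet> weak_jacobian \<Omega> (\<lambda>y. \<psi> (\<Psi>n (r n) y)) x) \<in> borel_measurable (lebesgue_on \<Omega>)"
        using H1D(2)[OF \<Omega> H10_H1[OF pb(1)]] h by (intro borel_measurable_inner sqint_measurable)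
      show "AE x in lebesgue_on \<Omega>. h x \<bullet> weak_jacobian \<Omega> (\<lambda>y. \<psi> (\<Psi>n (r n) y)) x = h x \<bullet> D x"
        using weak_jacobian_AE[OF \<Omega> pb(2)] by eventually_elim (simp add: D_def)
    qed
    also have "\<dots> = (LINT x|lebesgue. ext0 \<Omega> h x \<bullet> D x)"
      unfolding integral_lebesgue_on[OF \<Omega>s] by simp
    also have "\<dots> = (LINT x|lebesgue. det (mat 1 + Jn (r n) x) * (ext0 \<Omega> h (\<Phi>n (r n) x) \<bullet> D (\<Phi>n (r n) x)))"
      by (rule change_of_variables[symmetric]) (rule sqint_inner[OF h' pb(3)[folded D_def]])
    also have "\<dots> = (LINT x|lebesgue. ext0 \<Omega> h (\<Phi>n (r n) x) \<bullet> M (Jn (r n) x) x)"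
      by (simp add: D_def M_def)
    finally show ?case by simp
  qed
  have "(LINT x|lebesgue. ext0 \<Omega> h (\<Phi> x) \<bullet> M (H x) x) = 0"
    by (rule LIMSEQ_unique[OF lim]) (rule tendsto_eventually[OF zero])
  moreover have "ext0 \<Omega> h (\<Phi> x) \<bullet> M (H x) x
      = ext0 \<Omega> (\<lambda>x. (det (mat 1 + H x) *\<^sub>R (h (\<Phi> x) ** transpose (finv (H x)))) \<bullet> cjac \<psi> x) x" for x
    using map vtest_outside(2)[OF p, of x]
    by (cases "x \<in> \<Omega>") (auto simp: image_subset_iff M_def inner_matrix_mult_right mm.zero_left)
  ultimately show ?thesis unfolding integral_lebesgue_on[OF \<Omega>s] by simp
qed

end

subsection \<open>Expansion of the pulled back tensor\<close>

definition pulled_tensor :: "(mat3 \<Rightarrow> mat3) \<Rightarrow> mat3 \<Rightarrow> mat3 \<Rightarrow> mat3" where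
  "pulled_tensor C B A = det (mat 1 + B) *\<^sub>R (C (A ** finv B) ** transpose (finv B))"

text \<open>The part of \<open>pulled_tensor\<close> that is linear in B: the determinant
  contributes the trace, the transposed inverse contributes minus the transpose of B, and the
  inverse inside C contributes the last term. With B the Jacobian of the field this is the tensor in
  braces in the claim.\<close>

definition tensor_derivative :: "(mat3 \<Rightarrow> mat3) \<Rightarrow> mat3 \<Rightarrow> mat3 \<Rightarrow> mat3" where
  "tensor_derivative C B A = C A ** (trace B *\<^sub>R mat 1 - transpose B) - C (A ** B)"

lemma transpose_linear: "transpose (A + B) = transpose A + transpose (B :: mat3)" "transpose (A - B) = transpose A - transpose (B :: mat3)"
  "transpose (c *\<^sub>R A) = c *\<^sub>R transpose (A :: mat3)"
  by (simp_all add: transpose_def vec_eq_iff)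

lemma tensor_derivative_scale:
  assumes "linear C" shows "tensor_derivative C (t *\<^sub>R B) A = t *\<^sub>R tensor_derivative C B A"
proof -
  have "trace (t *\<^sub>R B) = t * trace B" by (simp add: trace_def sum_distrib_left)
  then show ?thesis
    by (simp add: tensor_derivative_def transpose_linear mm.scaleR_right mm.diff_right linear_cmul[OF assms] algebra_simps)
qed

text \<open>With the inverse written as 1 + E, where E is close to -B, the tensor is the determinant
  times C A + R, and R collects the terms containing E. The constants are tallies: 14 = 4 + 2 * 5
  from the bounds on determinant and R, and 40 = 12 + 20 + 2 + 2 + 4 from the five summands of the
  second-order error.\<close>

lemma pulled_tensor_expansion:
  fixes C :: "mat3 \<Rightarrow> mat3"
  assumes C: "linear C" and K: "\<And>A. norm (C A) \<le> K * norm A" and B: "norm B \<le> 1 / 100"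
  shows "norm (pulled_tensor C B A - C A) \<le> 14 * K * norm B * norm A"
    and "norm (pulled_tensor C B A - C A - tensor_derivative C B A) \<le> 40 * K * (norm B)\<^sup>2 * norm A"
proof -
  define a where "a = norm B"
  define E where "E = finv B - mat 1"
  define \<delta> where "\<delta> = det (mat 1 + B)"
  define R where "R = C (A ** E) + C A ** transpose E + C (A ** E) ** transpose E"
  define m where "m = K * norm A"
  have a: "0 \<le> a" "a \<le> 1 / 100" using B by (simp_all add: a_def)
  have B10: "norm B \<le> 1 / 10" using B by simp
  have m0: "0 \<le> m" using K[of A] norm_ge_zero order_trans unfolding m_def by blast
  have K0: "0 \<le> K"
  proof -
    have "0 \<le> K * norm (mat 1 :: mat3)" using K norm_ge_zero order_trans by blast
    moreover have "(norm (mat 1 :: mat3))\<^sup>2 = 3" by (simp add: norm_vec_square sum_3 mat_def)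
    then have "0 < norm (mat 1 :: mat3)" by (cases "norm (mat 1 :: mat3) = 0") auto
    ultimately show ?thesis by (simp add: zero_le_mult_iff)
  qed
  have E: "norm E \<le> 2 * a" "norm (E + B) \<le> 2 * a\<^sup>2"
    using finv_bounds(2,3)[OF B10] by (simp_all add: E_def a_def)
  \<comment> \<open>The smallness of B trades a quadratic term for 1/100 of a linear one; this keeps
    the constants 4 and 5 in the first-order bounds.\<close>
  have aa: "a\<^sup>2 \<le> a / 100" using a mult_left_mono[of a "1 / 100" a] by (simp add: power2_eq_square)
  have \<delta>1: "\<bar>\<delta> - 1 - trace B\<bar> \<le> 12 * a\<^sup>2" unfolding \<delta>_def a_def by (rule det_expansion) (use B in simp)
  have \<delta>2: "\<bar>\<delta> - 1\<bar> \<le> 4 * a" using \<delta>1 trace_bound[of B] aa unfolding a_def[symmetric] by linarith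
  have CE: "norm (C (A ** X)) \<le> m * norm X" for X :: mat3
  proof -
    have "norm (C (A ** X)) \<le> K * (norm A * norm X)"
      by (rule order_trans[OF K mult_left_mono[OF norm_matrix_mult_le K0]])
    then show ?thesis by (simp add: m_def mult.assoc)
  qed
  have CT: "norm (C A ** transpose X) \<le> m * norm X" for X :: mat3
    using norm_matrix_mult_le[of "C A" "transpose X"] mult_right_mono[OF K[of A] norm_ge_zero[of X]]
    by (simp add: norm_transpose_eq m_def)
  have CET: "norm (C (A ** E) ** transpose E) \<le> 4 * a\<^sup>2 * m"
  proof -
    have "norm (C (A ** E) ** transpose E) \<le> norm (C (A ** E)) * norm E"
      using norm_matrix_mult_le[of "C (A ** E)" "transpose E"] by (simp add: norm_transpose_eq)
    also have "\<dots> \<le> (m * (2 * a)) * (2 * a)"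
      using E(1) m0 a(1) by (intro mult_mono order_trans[OF CE mult_left_mono]) auto
    finally show ?thesis by (simp add: power2_eq_square mult_ac)
  qed
  have mE: "m * norm E \<le> 2 * a * m" "m * norm (E + B) \<le> 2 * a\<^sup>2 * m"
    using mult_left_mono[OF E(1) m0] mult_left_mono[OF E(2) m0] by (simp_all add: mult_ac)
  have aam: "a\<^sup>2 * m \<le> a * m / 100" using mult_right_mono[OF aa m0] by simp
  have am0: "0 \<le> a * m" using a m0 by simp
  have Rb: "norm R \<le> 5 * a * m"
  proof -
    have "norm R \<le> norm (C (A ** E)) + norm (C A ** transpose E) + norm (C (A ** E) ** transpose E)"
      unfolding R_def by (intro order_trans[OF norm_triangle_ineq add_mono] norm_triangle_ineq order_refl)
    also have "\<dots> \<le> 2 * a * m + 2 * a * m + 4 * a\<^sup>2 * m"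
      by (intro add_mono order_trans[OF CE mE(1)] order_trans[OF CT mE(1)] CET)
    also have "\<dots> \<le> 5 * a * m" using aam am0 by (simp add: algebra_simps)
    finally show ?thesis .
  qed
  have F: "finv B = mat 1 + E" by (simp add: E_def)
  have main: "pulled_tensor C B A = \<delta> *\<^sub>R (C A + R)"
  proof -
    have "C (A ** finv B) = C A + C (A ** E)" unfolding F by (simp add: mm.add_right linear_add[OF C])
    moreover have "transpose (finv B) = mat 1 + transpose E" unfolding F by (simp add: transpose_linear)
    ultimately show ?thesis by (simp add: pulled_tensor_def \<delta>_def R_def mm.add_left mm.add_right algebra_simps)
  qed
  have CA: "norm (C A) \<le> m" using K by (simp add: m_def)
  have \<delta>R: "\<bar>\<delta>\<bar> \<le> 2" using \<delta>2 a by linarith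
  have "pulled_tensor C B A - C A = (\<delta> - 1) *\<^sub>R C A + \<delta> *\<^sub>R R"
    by (simp add: main algebra_simps)
  then have "norm (pulled_tensor C B A - C A) \<le> \<bar>\<delta> - 1\<bar> * norm (C A) + \<bar>\<delta>\<bar> * norm R"
    using norm_triangle_ineq[of "(\<delta> - 1) *\<^sub>R C A" "\<delta> *\<^sub>R R"] by simp
  also have "\<dots> \<le> 4 * a * m + 2 * (5 * a * m)"
    using CA \<delta>2 \<delta>R Rb m0 a by (intro add_mono mult_mono) auto
  finally show "norm (pulled_tensor C B A - C A) \<le> 14 * K * norm B * norm A" by (simp add: a_def m_def algebra_simps)
  have n1: "norm ((\<delta> - 1 - trace B) *\<^sub>R C A) \<le> 12 * a\<^sup>2 * m"
    unfolding norm_scaleR by (rule mult_mono[OF \<delta>1 CA]) simp_all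
  have n2: "norm ((\<delta> - 1) *\<^sub>R R) \<le> 4 * a * (5 * a * m)"
    unfolding norm_scaleR by (rule mult_mono[OF \<delta>2 Rb]) (use a in simp_all)
  \<comment> \<open>Subtracting the derivative replaces E by E + B in the two linear terms of R, and
    E + B is quadratic in B. The trace is absorbed by the determinant in the same way.\<close>
  have "pulled_tensor C B A - C A - tensor_derivative C B A
    = (\<delta> - 1 - trace B) *\<^sub>R C A + ((\<delta> - 1) *\<^sub>R R + (C (A ** (E + B)) + (C A ** transpose (E + B) + C (A ** E) ** transpose E)))"
    by (simp add: main tensor_derivative_def R_def mm.add_right mm.diff_right mm.scaleR_right transpose_linear linear_add[OF C] algebra_simps)
  also have "norm \<dots> \<le> norm ((\<delta> - 1 - trace B) *\<^sub>R C A) + (norm ((\<delta> - 1) *\<^sub>R R) + (norm (C (A ** (E + B))) + (norm (C A ** transpose (E + B)) + norm (C (A ** E) ** transpose E))))"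
    by (intro order_trans[OF norm_triangle_ineq add_left_mono] norm_triangle_ineq)
  also have "\<dots> \<le> 12 * a\<^sup>2 * m + (4 * a * (5 * a * m) + (2 * a\<^sup>2 * m + (2 * a\<^sup>2 * m + 4 * a\<^sup>2 * m)))"
    by (intro add_mono n1 n2 order_trans[OF CE mE(2)] order_trans[OF CT mE(2)] CET)
  finally show "norm (pulled_tensor C B A - C A - tensor_derivative C B A) \<le> 40 * K * (norm B)\<^sup>2 * norm A"
    by (simp add: a_def m_def power2_eq_square algebra_simps)
qed

subsection \<open>Completeness of \<open>H10\<close>\<close>

text \<open>Both sides of the defining identity are inner products with a fixed test function or its
  derivative, hence continuous in L2.\<close>

lemma weak_jacobian_closed:
  assumes \<Omega>: "open \<Omega>" and v: "\<And>k. has_weak_jacobian \<Omega> (v k) (W k)" and L: "\<And>k. on_L2 \<Omega> (v k)" "\<And>k. on_L2 \<Omega> (W k)"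
    and L': "on_L2 \<Omega> q" "on_L2 \<Omega> Q"
    and lim: "(\<lambda>k. norm_L2 \<Omega> (\<lambda>x. v k x - q x)) \<longlonglongrightarrow> 0" "(\<lambda>k. norm_L2 \<Omega> (\<lambda>x. W k x - Q x)) \<longlonglongrightarrow> 0"
  shows "has_weak_jacobian \<Omega> q Q"
  unfolding has_weak_jacobian_def
proof (intro conjI ballI allI)
  note \<Omega>s = open_lebesgue[OF \<Omega>]
  show "q locally_integrable_on \<Omega>" "Q locally_integrable_on \<Omega>" by (intro sqint_on_locally_integrable[OF \<Omega>s] L')+
  fix \<phi> i j assume p: "\<phi> \<in> test_functions \<Omega>"
  note ps = sqint_on_restrict(1)[OF \<Omega>s test_sqint[OF p]] and pps = sqint_on_restrict(1)[OF \<Omega>s test_sqint[OF test_partial[OF p, of j]]]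
  have n1: "(\<lambda>k. norm_L2 \<Omega> (\<lambda>x. v k x $ i - q x $ i)) \<longlonglongrightarrow> 0"
    by (rule Lim_null_comparison[OF _ lim(1)]) (use sqint_nth(2)[OF sqint_diff[OF L(1) L'(1)], of _ i] in auto)
  have n2: "(\<lambda>k. norm_L2 \<Omega> (\<lambda>x. W k x $ i $ j - Q x $ i $ j)) \<longlonglongrightarrow> 0"
  proof (rule Lim_null_comparison[OF _ lim(2)], intro always_eventually allI)
    fix k
    have d: "on_L2 \<Omega> (\<lambda>x. W k x - Q x)" by (rule sqint_diff[OF L(2) L'(2)])
    show "norm (norm_L2 \<Omega> (\<lambda>x. W k x $ i $ j - Q x $ i $ j)) \<le> norm_L2 \<Omega> (\<lambda>x. W k x - Q x)"
      using sqint_nth(2)[OF sqint_nth(1)[OF d, of i], of j] sqint_nth(2)[OF d, of i] by simp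
  qed
  have l1: "(\<lambda>k. LINT x|lebesgue_on \<Omega>. v k x $ i \<bullet> partial j \<phi> x) \<longlonglongrightarrow> (LINT x|lebesgue_on \<Omega>. q x $ i \<bullet> partial j \<phi> x)"
    by (rule tendsto_inner_n2[OF sqint_nth(1)[OF L(1)] sqint_nth(1)[OF L'(1)] pps n1])
  have l2: "(\<lambda>k. LINT x|lebesgue_on \<Omega>. W k x $ i $ j \<bullet> \<phi> x) \<longlonglongrightarrow> (LINT x|lebesgue_on \<Omega>. Q x $ i $ j \<bullet> \<phi> x)"
    by (rule tendsto_inner_n2[OF sqint_nth(1)[OF sqint_nth(1)[OF L(2)]] sqint_nth(1)[OF sqint_nth(1)[OF L'(2)]] ps n2])
  have "(LINT x|lebesgue_on \<Omega>. v k x $ i \<bullet> partial j \<phi> x) = - (LINT x|lebesgue_on \<Omega>. W k x $ i $ j \<bullet> \<phi> x)" for k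
    using v[of k] p unfolding has_weak_jacobian_def by simp
  then show "(LINT x|lebesgue_on \<Omega>. q x $ i * partial j \<phi> x) = - (LINT x|lebesgue_on \<Omega>. Q x $ i $ j * \<phi> x)"
    using LIMSEQ_unique[OF l1] tendsto_minus[OF l2] by simp
qed

text \<open>Functions and Jacobians are completed separately. Closedness of the weak Jacobian
  identifies the second limit as the Jacobian of the first, and closedness of \<open>H10\<close>
  keeps the boundary values.\<close>

lemma H10_complete:
  assumes \<Omega>: "open \<Omega>" and v: "\<And>k. v k \<in> H10 \<Omega>"
    and c1: "\<And>k m. k \<le> m \<Longrightarrow> norm_L2 \<Omega> (\<lambda>x. v m x - v k x) \<le> K / 4 ^ k"
    and c2: "\<And>k m. k \<le> m \<Longrightarrow> norm_L2 \<Omega> (\<lambda>x. weak_jacobian \<Omega> (v m) x - weak_jacobian \<Omega> (v k) x) \<le> K / 4 ^ k"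
  shows "\<exists>q\<in>H10 \<Omega>. (\<lambda>k. norm_L2 \<Omega> (\<lambda>x. weak_jacobian \<Omega> (v k) x - weak_jacobian \<Omega> q x)) \<longlonglongrightarrow> 0"
proof -
  note v1 = H10_H1[OF v]
  note vD = H1D[OF \<Omega> v1]
  obtain q where q: "on_L2 \<Omega> q" "(\<lambda>k. norm_L2 \<Omega> (\<lambda>x. v k x - q x)) \<longlonglongrightarrow> 0"
    using n2_complete[OF vD(1) c1] by blast
  obtain Q where Q: "on_L2 \<Omega> Q" "(\<lambda>k. norm_L2 \<Omega> (\<lambda>x. weak_jacobian \<Omega> (v k) x - Q x)) \<longlonglongrightarrow> 0"
    using n2_complete[OF vD(2) c2] by blast
  have j: "has_weak_jacobian \<Omega> q Q" by (rule weak_jacobian_closed[OF \<Omega> vD(3,1,2) q(1) Q(1) q(2) Q(2)])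
  have q1: "q \<in> H1 \<Omega>" by (rule H1I[OF q(1) Q(1) j])
  have "norm_L2 \<Omega> (\<lambda>x. weak_jacobian \<Omega> (v k) x - Q x) = norm_L2 \<Omega> (\<lambda>x. weak_jacobian \<Omega> (v k) x - weak_jacobian \<Omega> q x)" for k
  proof (rule n2_cong_AE)
    show "AE x in lebesgue_on \<Omega>. weak_jacobian \<Omega> (v k) x - Q x = weak_jacobian \<Omega> (v k) x - weak_jacobian \<Omega> q x"
      using weak_jacobian_AE[OF \<Omega> j] by eventually_elim simp
  qed (intro sqint_measurable sqint_diff vD H1D[OF \<Omega>] q1 Q(1))+
  with Q(2) have l: "(\<lambda>k. norm_L2 \<Omega> (\<lambda>x. weak_jacobian \<Omega> (v k) x - weak_jacobian \<Omega> q x)) \<longlonglongrightarrow> 0" by simp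
  have "(\<lambda>k. H1_norm \<Omega> (\<lambda>x. v k x - q x)) \<longlonglongrightarrow> 0"
    using q(2) l unfolding H1_norm_tendsto_iff[OF \<Omega> v1 q1] by blast
  then have "q \<in> H10 \<Omega>" by (rule H10_closed[OF \<Omega> v q1])
  with l show ?thesis by blast
qed

text \<open>The transformed equation is derived for test functions only; it extends to
  \<open>H10\<close> because pairing with X is continuous in L2.\<close>

lemma vtest_dense:
  assumes \<Omega>: "open \<Omega>" and X: "on_L2 \<Omega> X" and \<psi>: "\<psi> \<in> H10 \<Omega>"
    and zero: "\<And>\<phi>. \<phi> \<in> vector_test_functions \<Omega> \<Longrightarrow> (LINT x|lebesgue_on \<Omega>. X x \<bullet> cjac \<phi> x) = 0"
  shows "(LINT x|lebesgue_on \<Omega>. X x \<bullet> weak_jacobian \<Omega> \<psi> x) = 0"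
proof -
  obtain \<phi> :: "nat \<Rightarrow> real^3 \<Rightarrow> real^3" where p: "\<And>n. \<phi> n \<in> vector_test_functions \<Omega>"
     "(\<lambda>n. norm_L2 \<Omega> (\<lambda>x. cjac (\<phi> n) x - weak_jacobian \<Omega> \<psi> x)) \<longlonglongrightarrow> 0"
    using \<psi> unfolding H10_iff[OF \<Omega> H10_H1[OF \<psi>]] by blast
  have "(\<lambda>n. LINT x|lebesgue_on \<Omega>. cjac (\<phi> n) x \<bullet> X x) \<longlonglongrightarrow> (LINT x|lebesgue_on \<Omega>. weak_jacobian \<Omega> \<psi> x \<bullet> X x)"
    by (rule tendsto_inner_n2[OF vtest_H1(2)[OF \<Omega> p(1)] H1D(2)[OF \<Omega> H10_H1[OF \<psi>]] X p(2)])
  then show ?thesis using zero[OF p(1)] by (simp add: inner_commute LIMSEQ_const_iff)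
qed

subsection \<open>The perturbed problem\<close>

text \<open>The reference configuration in abstract form: C is the fixed coefficient and G the
  Jacobian of the field. The factor 2 in the coercivity assumption cancels the factor 2 of Korn's
  inequality and leaves \<alpha>. Coercivity is asked on \<Omega> only, since the elasticity tensor
  to which this is applied vanishes outside.\<close>

locale perturbed_problem =
  fixes \<Omega> :: "(real^3) set" and C :: "real^3 \<Rightarrow> mat3 \<Rightarrow> mat3" and G :: "real^3 \<Rightarrow> mat3" and K \<alpha> R \<Lambda> :: real
  assumes \<Omega>: "open \<Omega>" and R: "\<And>x. x \<in> \<Omega> \<Longrightarrow> \<bar>x $ 1\<bar> \<le> R" "R \<ge> 0"
    and C_lin: "\<And>x. linear (C x)" and C_bound: "\<And>x A. norm (C x A) \<le> K * norm A" and K: "K \<ge> 0"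
    and C_meas: "\<And>A. A \<in> borel_measurable (lebesgue_on \<Omega>) \<Longrightarrow> (\<lambda>x. C x (A x)) \<in> borel_measurable (lebesgue_on \<Omega>)"
    and \<alpha>: "\<alpha> > 0" and C_coercive: "\<And>x A. x \<in> \<Omega> \<Longrightarrow> 2 * \<alpha> * (norm (sym_part A))\<^sup>2 \<le> C x A \<bullet> A"
    and G_meas: "G \<in> borel_measurable lebesgue" and G_bound: "\<And>x. norm (G x) \<le> \<Lambda>" and \<Lambda>: "\<Lambda> > 0"
begin

lemma small: "0 < t \<Longrightarrow> t \<le> 1 / (100 * \<Lambda>) \<Longrightarrow> norm (t *\<^sub>R G x) \<le> 1 / 100"
  using mult_mono[of t "1 / (100 * \<Lambda>)" "norm (G x)" \<Lambda>] G_bound[of x] \<Lambda> by simp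

lemma G_meas_on: "G \<in> borel_measurable (lebesgue_on \<Omega>)"
  by (rule measurable_restrict_space1[OF G_meas])

lemma C_L2:
  assumes A: "on_L2 \<Omega> A"
  shows "on_L2 \<Omega> (\<lambda>x. C x (A x))" "norm_L2 \<Omega> (\<lambda>x. C x (A x)) \<le> K * norm_L2 \<Omega> A"
  using sqint_bound[OF A C_meas[OF sqint_measurable[OF A]], of K] C_bound K by auto

lemma derivative_L2:
  assumes A: "on_L2 \<Omega> A"
  shows "on_L2 \<Omega> (\<lambda>x. tensor_derivative (C x) (G x) (A x))"
proof (rule sqint_bound(1)[OF A])
  note Am = sqint_measurable[OF A]
  have tr: "(\<lambda>x. trace (G x)) \<in> borel_measurable (lebesgue_on \<Omega>)"
    unfolding trace_def by (intro borel_measurable_sum borel_measurable_nth G_meas_on)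
  show "(\<lambda>x. tensor_derivative (C x) (G x) (A x)) \<in> borel_measurable (lebesgue_on \<Omega>)"
    unfolding tensor_derivative_def
    by (intro borel_measurable_diff borel_measurable_matrix_mult C_meas Am G_meas_on borel_measurable_scaleR tr
        borel_measurable_const borel_measurable_transpose)
  \<comment> \<open>The trace is at most 3 \<Lambda> and the identity has norm at most 9/5, so the
    first term costs 27/5 + 1, rounded up to 7, and the second costs 1.\<close>
  show "AE x in lebesgue_on \<Omega>. norm (tensor_derivative (C x) (G x) (A x)) \<le> (K * (8 * \<Lambda>)) * norm (A x)"
  proof (rule AE_I2)
    fix x
    define m where "m = K * norm (A x)"
    have m0: "0 \<le> m" using K by (simp add: m_def)
    have "norm (trace (G x) *\<^sub>R mat 1 - transpose (G x)) \<le> \<bar>trace (G x)\<bar> * norm (mat 1 :: mat3) + norm (G x)"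
      using norm_triangle_ineq4[of "trace (G x) *\<^sub>R mat 1" "transpose (G x)"] by (simp add: norm_transpose_eq)
    also have "\<dots> \<le> 3 * \<Lambda> * (9 / 5) + \<Lambda>"
      using trace_bound[of "G x"] G_bound[of x] norm_mat_1 \<Lambda> by (intro add_mono mult_mono) auto
    also have "\<dots> \<le> 7 * \<Lambda>" using \<Lambda> by simp
    finally have 1: "norm (C x (A x) ** (trace (G x) *\<^sub>R mat 1 - transpose (G x))) \<le> m * (7 * \<Lambda>)"
      using C_bound[of x "A x"] m0 by (intro order_trans[OF norm_matrix_mult_le mult_mono]) (auto simp: m_def)
    have "norm (C x (A x ** G x)) \<le> K * (norm (A x) * norm (G x))"
      by (rule order_trans[OF C_bound mult_left_mono[OF norm_matrix_mult_le K]])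
    also have "\<dots> \<le> m * \<Lambda>" using G_bound[of x] m0 by (simp add: m_def mult.assoc[symmetric] mult_left_mono K)
    finally have 2: "norm (C x (A x ** G x)) \<le> m * \<Lambda>" .
    have "norm (tensor_derivative (C x) (G x) (A x)) \<le> m * (7 * \<Lambda>) + m * \<Lambda>"
      unfolding tensor_derivative_def by (rule order_trans[OF norm_triangle_ineq4 add_mono[OF 1 2]])
    then show "norm (tensor_derivative (C x) (G x) (A x)) \<le> (K * (8 * \<Lambda>)) * norm (A x)"
      by (simp add: m_def algebra_simps)
  qed
qed

lemma pulled_L2:
  assumes t: "0 < t" "t \<le> 1 / (100 * \<Lambda>)" and A: "on_L2 \<Omega> A"
  shows "on_L2 \<Omega> (\<lambda>x. pulled_tensor (C x) (t *\<^sub>R G x) (A x))"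
    and "norm_L2 \<Omega> (\<lambda>x. pulled_tensor (C x) (t *\<^sub>R G x) (A x) - C x (A x)) \<le> (14 * K * \<Lambda> * t) * norm_L2 \<Omega> A"
    and "norm_L2 \<Omega> (\<lambda>x. pulled_tensor (C x) (t *\<^sub>R G x) (A x) - C x (A x) - t *\<^sub>R tensor_derivative (C x) (G x) (A x)) \<le> (40 * K * \<Lambda>\<^sup>2 * t\<^sup>2) * norm_L2 \<Omega> A"
proof -
  note Am = sqint_measurable[OF A]
  have tG: "norm (t *\<^sub>R G x) \<le> t * \<Lambda>" for x using t(1) G_bound[of x] by simp
  have fm: "(\<lambda>x. finv (t *\<^sub>R G x)) \<in> borel_measurable (lebesgue_on \<Omega>)"
    by (intro finv_measurable borel_measurable_scaleR borel_measurable_const G_meas_on order_trans[OF small[OF t]]) simp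
  have pm: "(\<lambda>x. pulled_tensor (C x) (t *\<^sub>R G x) (A x)) \<in> borel_measurable (lebesgue_on \<Omega>)"
    unfolding pulled_tensor_def
    by (intro borel_measurable_scaleR borel_measurable_det borel_measurable_add borel_measurable_const G_meas_on
        borel_measurable_matrix_mult C_meas Am fm borel_measurable_transpose)
  note Cm = C_meas[OF Am]
  have e1: "norm (pulled_tensor (C x) (t *\<^sub>R G x) (A x) - C x (A x)) \<le> (14 * K * \<Lambda> * t) * norm (A x)" for x
  proof -
    have "norm (pulled_tensor (C x) (t *\<^sub>R G x) (A x) - C x (A x)) \<le> 14 * K * norm (t *\<^sub>R G x) * norm (A x)"
      by (rule pulled_tensor_expansion(1)[OF C_lin C_bound small[OF t]])
    also have "\<dots> \<le> 14 * K * (t * \<Lambda>) * norm (A x)" using tG[of x] K by (intro mult_right_mono mult_left_mono) auto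
    finally show ?thesis by (simp add: mult_ac)
  qed
  have e2: "norm (pulled_tensor (C x) (t *\<^sub>R G x) (A x) - C x (A x) - t *\<^sub>R tensor_derivative (C x) (G x) (A x)) \<le> (40 * K * \<Lambda>\<^sup>2 * t\<^sup>2) * norm (A x)" for x
  proof -
    have "norm (pulled_tensor (C x) (t *\<^sub>R G x) (A x) - C x (A x) - t *\<^sub>R tensor_derivative (C x) (G x) (A x)) \<le> 40 * K * (norm (t *\<^sub>R G x))\<^sup>2 * norm (A x)"
      using pulled_tensor_expansion(2)[OF C_lin C_bound small[OF t], of x x "A x"] by (simp only: tensor_derivative_scale[OF C_lin])
    also have "\<dots> \<le> 40 * K * (t * \<Lambda>)\<^sup>2 * norm (A x)" using tG[of x] K by (intro mult_right_mono mult_left_mono power_mono) auto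
    finally show ?thesis by (simp add: power_mult_distrib mult_ac)
  qed
  have b1: "on_L2 \<Omega> (\<lambda>x. pulled_tensor (C x) (t *\<^sub>R G x) (A x) - C x (A x))"
      "norm_L2 \<Omega> (\<lambda>x. pulled_tensor (C x) (t *\<^sub>R G x) (A x) - C x (A x)) \<le> (14 * K * \<Lambda> * t) * norm_L2 \<Omega> A"
    using sqint_bound[OF A borel_measurable_diff[OF pm Cm], of "14 * K * \<Lambda> * t"] e1 K \<Lambda> t by auto
  then show "norm_L2 \<Omega> (\<lambda>x. pulled_tensor (C x) (t *\<^sub>R G x) (A x) - C x (A x)) \<le> (14 * K * \<Lambda> * t) * norm_L2 \<Omega> A" by simp
  show "on_L2 \<Omega> (\<lambda>x. pulled_tensor (C x) (t *\<^sub>R G x) (A x))" using sqint_add[OF b1(1) C_L2(1)[OF A]] by simp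
  have "(\<lambda>x. pulled_tensor (C x) (t *\<^sub>R G x) (A x) - C x (A x) - t *\<^sub>R tensor_derivative (C x) (G x) (A x)) \<in> borel_measurable (lebesgue_on \<Omega>)"
    by (intro borel_measurable_diff pm Cm borel_measurable_scaleR borel_measurable_const sqint_measurable[OF derivative_L2[OF A]])
  from sqint_bound(2)[OF A this, of "40 * K * \<Lambda>\<^sup>2 * t\<^sup>2"] e2 K
  show "norm_L2 \<Omega> (\<lambda>x. pulled_tensor (C x) (t *\<^sub>R G x) (A x) - C x (A x) - t *\<^sub>R tensor_derivative (C x) (G x) (A x)) \<le> (40 * K * \<Lambda>\<^sup>2 * t\<^sup>2) * norm_L2 \<Omega> A"
    by simp
qed

text \<open>C controls only the symmetric part of the Jacobian; Korn's inequality recovers the full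
  Jacobian because w has zero boundary values.\<close>

lemma coercive:
  assumes w: "w \<in> H10 \<Omega>"
  shows "\<alpha> * (norm_L2 \<Omega> (weak_jacobian \<Omega> w))\<^sup>2 \<le> (LINT x|lebesgue_on \<Omega>. C x (weak_jacobian \<Omega> w x) \<bullet> weak_jacobian \<Omega> w x)"
proof -
  note W = H1D(2)[OF \<Omega> H10_H1[OF w]]
  have "\<alpha> * (norm_L2 \<Omega> (weak_jacobian \<Omega> w))\<^sup>2 \<le> \<alpha> * (2 * (norm_L2 \<Omega> (\<lambda>x. sym_part (weak_jacobian \<Omega> w x)))\<^sup>2)"
    using poincare_korn_H10(2)[OF \<Omega> R w] \<alpha> by (intro mult_left_mono) auto
  also have "\<dots> = (LINT x|lebesgue_on \<Omega>. 2 * \<alpha> * (norm (sym_part (weak_jacobian \<Omega> w x)))\<^sup>2)"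
    by (simp add: n2_sq)
  also have "\<dots> \<le> (LINT x|lebesgue_on \<Omega>. C x (weak_jacobian \<Omega> w x) \<bullet> weak_jacobian \<Omega> w x)"
    using sqint_integrable[OF sym_part_sqint(1)[OF W]] C_coercive
    by (intro integral_mono sqint_inner C_L2(1) W) auto
  finally show ?thesis .
qed

text \<open>The equation is needed only with w as its own test function. Coercivity and the
  Cauchy-Schwarz inequality then give a quadratic inequality from which one factor is
  cancelled.\<close>

lemma energy_estimate:
  assumes w: "w \<in> H10 \<Omega>" and F: "on_L2 \<Omega> F" "norm_L2 \<Omega> F \<le> c"
    and eq: "(LINT x|lebesgue_on \<Omega>. C x (weak_jacobian \<Omega> w x) \<bullet> weak_jacobian \<Omega> w x) = - (LINT x|lebesgue_on \<Omega>. F x \<bullet> weak_jacobian \<Omega> w x)"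
  shows "norm_L2 \<Omega> (weak_jacobian \<Omega> w) \<le> c / \<alpha>"
proof -
  let ?n = "norm_L2 \<Omega> (weak_jacobian \<Omega> w)"
  note W = H1D(2)[OF \<Omega> H10_H1[OF w]]
  have "\<alpha> * ?n\<^sup>2 \<le> norm_L2 \<Omega> F * ?n"
    using coercive[OF w] eq n2_Cauchy_Schwarz[OF F(1) W] by linarith
  also have "\<dots> \<le> c * ?n" using F(2) by (intro mult_right_mono) auto
  finally have "?n * (\<alpha> * ?n) \<le> ?n * c" by (simp add: power2_eq_square mult_ac)
  moreover have "0 \<le> c" using F(2) n2_nonneg order_trans by blast
  ultimately have "\<alpha> * ?n \<le> c"
    using n2_nonneg[of "lebesgue_on \<Omega>" "weak_jacobian \<Omega> w"] by (cases "?n = 0") (auto simp: mult_le_cancel_left)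
  then show ?thesis using \<alpha> by (simp add: field_simps)
qed

text \<open>Y is the gradient of the solution at time 0, and \<open>w t\<close> is the transported
  solution minus the one at time 0. As Y solves the unperturbed equation, \<open>w t\<close> is
  driven by the change of the tensor alone. The first-order bound on that change makes the Jacobian
  of \<open>w t\<close> of size O(t). Inserted into the second-order bound, this shows that
  \<open>w t\<close> divided by t solves the linearised equation up to a remainder O(t), and
  coercivity turns closeness of remainders into closeness of quotients.\<close>

lemma material_derivative:
  assumes Y: "on_L2 \<Omega> Y" and Y0: "\<And>\<psi>. \<psi> \<in> H10 \<Omega> \<Longrightarrow> (LINT x|lebesgue_on \<Omega>. C x (Y x) \<bullet> weak_jacobian \<Omega> \<psi> x) = 0"
    and t0: "0 < t0" "t0 \<le> 1 / (100 * \<Lambda>)" "28 * K * \<Lambda> * t0 \<le> \<alpha>"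
    and w: "\<And>t. 0 < t \<Longrightarrow> t \<le> t0 \<Longrightarrow> w t \<in> H10 \<Omega>"
    and eq: "\<And>t \<psi>. 0 < t \<Longrightarrow> t \<le> t0 \<Longrightarrow> \<psi> \<in> H10 \<Omega> \<Longrightarrow>
       (LINT x|lebesgue_on \<Omega>. pulled_tensor (C x) (t *\<^sub>R G x) (weak_jacobian \<Omega> (w t) x + Y x) \<bullet> weak_jacobian \<Omega> \<psi> x) = 0"
  shows "\<exists>q\<in>H10 \<Omega>.
     (\<forall>\<psi>\<in>H10 \<Omega>. (LINT x|lebesgue_on \<Omega>. C x (weak_jacobian \<Omega> q x) \<bullet> weak_jacobian \<Omega> \<psi> x)
        = - (LINT x|lebesgue_on \<Omega>. tensor_derivative (C x) (G x) (Y x) \<bullet> weak_jacobian \<Omega> \<psi> x)) \<and>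
     (\<exists>c. \<forall>t. 0 < t \<and> t \<le> t0 \<longrightarrow> H1_norm \<Omega> (\<lambda>x. (1 / t) *\<^sub>R w t x - q x) \<le> c * t)"
proof -
  define W where "W t = weak_jacobian \<Omega> (w t)" for t
  define P where "P t A x = pulled_tensor (C x) (t *\<^sub>R G x) (A x) - C x (A x)" for t A x
  define T where "T x = tensor_derivative (C x) (G x) (Y x)" for x
  define y where "y = norm_L2 \<Omega> Y"
  define k1 where "k1 = 14 * K * \<Lambda>"
  define k2 where "k2 = 40 * K * \<Lambda>\<^sup>2"
  have y0: "0 \<le> y" by (simp add: y_def)
  have k0: "0 \<le> k1" "0 \<le> k2" using K \<Lambda> by (simp_all add: k1_def k2_def)
  have TL: "on_L2 \<Omega> T" unfolding T_def by (rule derivative_L2[OF Y])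
  have J: "on_L2 \<Omega> (weak_jacobian \<Omega> \<psi>)" if "\<psi> \<in> H10 \<Omega>" for \<psi> by (rule H1D(2)[OF \<Omega> H10_H1[OF that]])
  have tt: "t \<le> 1 / (100 * \<Lambda>)" if "t \<le> t0" for t using that t0(2) by simp
  have WL: "on_L2 \<Omega> (W t)" if "0 < t" "t \<le> t0" for t unfolding W_def by (rule J[OF w[OF that]])
  have PL: "on_L2 \<Omega> (P t A)" "norm_L2 \<Omega> (P t A) \<le> k1 * t * norm_L2 \<Omega> A" if "0 < t" "t \<le> t0" "on_L2 \<Omega> A" for t A
    using sqint_diff[OF pulled_L2(1)[OF that(1) tt[OF that(2)] that(3)] C_L2(1)[OF that(3)]] pulled_L2(2)[OF that(1) tt[OF that(2)] that(3)]
    by (simp_all add: P_def[abs_def] k1_def)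
  have weak: "(LINT x|lebesgue_on \<Omega>. C x (W t x) \<bullet> weak_jacobian \<Omega> \<psi> x) = - (LINT x|lebesgue_on \<Omega>. P t (\<lambda>x. W t x + Y x) x \<bullet> weak_jacobian \<Omega> \<psi> x)"
    if t: "0 < t" "t \<le> t0" and \<psi>: "\<psi> \<in> H10 \<Omega>" for t \<psi>
  proof -
    have "C x (W t x) \<bullet> D = pulled_tensor (C x) (t *\<^sub>R G x) (W t x + Y x) \<bullet> D - P t (\<lambda>x. W t x + Y x) x \<bullet> D - C x (Y x) \<bullet> D" for x D
      by (simp add: P_def linear_add[OF C_lin] inner_diff_left inner_add_left)
    then have "(LINT x|lebesgue_on \<Omega>. C x (W t x) \<bullet> weak_jacobian \<Omega> \<psi> x)
      = (LINT x|lebesgue_on \<Omega>. pulled_tensor (C x) (t *\<^sub>R G x) (W t x + Y x) \<bullet> weak_jacobian \<Omega> \<psi> x - P t (\<lambda>x. W t x + Y x) x \<bullet> weak_jacobian \<Omega> \<psi> x - C x (Y x) \<bullet> weak_jacobian \<Omega> \<psi> x)"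
      by simp
    also have "\<dots> = (LINT x|lebesgue_on \<Omega>. pulled_tensor (C x) (t *\<^sub>R G x) (W t x + Y x) \<bullet> weak_jacobian \<Omega> \<psi> x)
        - (LINT x|lebesgue_on \<Omega>. P t (\<lambda>x. W t x + Y x) x \<bullet> weak_jacobian \<Omega> \<psi> x) - (LINT x|lebesgue_on \<Omega>. C x (Y x) \<bullet> weak_jacobian \<Omega> \<psi> x)"
      using sqint_inner[OF pulled_L2(1)[OF t(1) tt[OF t(2)] sqint_add[OF WL[OF t] Y]] J[OF \<psi>]]
        sqint_inner[OF PL(1)[OF t sqint_add[OF WL[OF t] Y]] J[OF \<psi>]] sqint_inner[OF C_L2(1)[OF Y] J[OF \<psi>]]
      by simp
    finally show ?thesis using eq[OF t \<psi>] Y0[OF \<psi>] by (simp add: W_def)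
  qed
  \<comment> \<open>The change of the tensor also acts on the unknown Jacobian. That part is
    absorbed on the left at the cost of half of \<alpha>, which the bound 28 K \<Lambda> t0 \<le>
    \<alpha> provides; 28 is twice the constant 14 of the tensor expansion.\<close>
  have Wsmall: "norm_L2 \<Omega> (W t) \<le> 2 * k1 * y / \<alpha> * t" if t: "0 < t" "t \<le> t0" for t
  proof -
    note s = sqint_add[OF WL[OF t] Y]
    have "norm_L2 \<Omega> (P t (\<lambda>x. W t x + Y x)) \<le> k1 * t * norm_L2 \<Omega> (\<lambda>x. W t x + Y x)" by (rule PL(2)[OF t s])
    also have "\<dots> \<le> k1 * t * (norm_L2 \<Omega> (W t) + y)"
      unfolding y_def using k0 t by (intro mult_left_mono n2_triangle WL[OF t] Y) auto
    finally have "norm_L2 \<Omega> (W t) \<le> k1 * t * (norm_L2 \<Omega> (W t) + y) / \<alpha>"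
      unfolding W_def by (rule energy_estimate[OF w[OF t] PL(1)[OF t s, unfolded W_def]]) (use weak[OF t w[OF t]] in \<open>simp add: W_def\<close>)
    then have a: "\<alpha> * norm_L2 \<Omega> (W t) \<le> k1 * t * norm_L2 \<Omega> (W t) + k1 * t * y"
      using \<alpha> by (simp add: field_simps)
    have "2 * k1 * t \<le> 2 * k1 * t0" using k0 t by (intro mult_left_mono) auto
    also have "\<dots> \<le> \<alpha>" using t0(3) by (simp add: k1_def)
    finally have "2 * k1 * t * norm_L2 \<Omega> (W t) \<le> \<alpha> * norm_L2 \<Omega> (W t)" by (rule mult_right_mono) simp
    with a have "\<alpha> * norm_L2 \<Omega> (W t) \<le> 2 * (k1 * t * y)" by linarith
    then show ?thesis using \<alpha> by (simp add: field_simps)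
  qed
  define r where "r t x = (1 / t) *\<^sub>R P t (\<lambda>x. W t x + Y x) x - T x" for t x
  \<comment> \<open>The first summand is the first-order error acting on the Jacobian of
    \<open>w t\<close>, itself O(t) by \<open>Wsmall\<close>; the second is the second-order error
    acting on Y.\<close>
  define k3 where "k3 = k1 * (2 * k1 * y / \<alpha>) + k2 * y"
  have k3: "0 \<le> k3" using k0 y0 \<alpha> by (simp add: k3_def)
  have rL: "on_L2 \<Omega> (r t)" if t: "0 < t" "t \<le> t0" for t
    unfolding r_def by (intro sqint_diff sqint_scale PL(1) sqint_add WL Y TL t)
  have rb: "norm_L2 \<Omega> (r t) \<le> k3 * t" if t: "0 < t" "t \<le> t0" for t
  proof -
    have lin: "pulled_tensor (C x) B (A + A') = pulled_tensor (C x) B A + pulled_tensor (C x) B A'" for x B A A'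
      by (simp add: pulled_tensor_def mm.add_left linear_add[OF C_lin] scaleR_add_right)
    have r: "r t x = (1 / t) *\<^sub>R P t (W t) x + (1 / t) *\<^sub>R (P t Y x - t *\<^sub>R T x)" for x
      using t by (simp add: r_def P_def lin linear_add[OF C_lin] algebra_simps)
    have d: "on_L2 \<Omega> (\<lambda>x. P t Y x - t *\<^sub>R T x)" by (intro sqint_diff PL(1) sqint_scale TL t Y)
    have "norm_L2 \<Omega> (r t) \<le> norm_L2 \<Omega> (\<lambda>x. (1 / t) *\<^sub>R P t (W t) x) + norm_L2 \<Omega> (\<lambda>x. (1 / t) *\<^sub>R (P t Y x - t *\<^sub>R T x))"
      unfolding r[abs_def] by (intro n2_triangle sqint_scale PL(1) WL t d)
    also have "\<dots> = (1 / t) * norm_L2 \<Omega> (P t (W t)) + (1 / t) * norm_L2 \<Omega> (\<lambda>x. P t Y x - t *\<^sub>R T x)"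
      using t by (simp only: n2_scale) simp
    also have "\<dots> \<le> (1 / t) * (k1 * t * (2 * k1 * y / \<alpha> * t)) + (1 / t) * (k2 * t\<^sup>2 * y)"
    proof (intro add_mono mult_left_mono)
      show "norm_L2 \<Omega> (P t (W t)) \<le> k1 * t * (2 * k1 * y / \<alpha> * t)"
        by (rule order_trans[OF PL(2)[OF t WL[OF t]] mult_left_mono[OF Wsmall[OF t]]]) (use k0 t in simp)
      show "norm_L2 \<Omega> (\<lambda>x. P t Y x - t *\<^sub>R T x) \<le> k2 * t\<^sup>2 * y"
        using pulled_L2(3)[OF t(1) tt[OF t(2)] Y] by (simp add: P_def T_def k2_def y_def)
    qed (use t in auto)
    also have "\<dots> = k3 * t" using t by (simp add: k3_def power2_eq_square field_simps)
    finally show ?thesis .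
  qed
  define v where "v t x = (1 / t) *\<^sub>R w t x" for t x
  have v: "v t \<in> H10 \<Omega>" if "0 < t" "t \<le> t0" for t
    using H10_lincomb[OF \<Omega> w[OF that] w[OF that], of "1 / t" 0] by (simp add: v_def[abs_def])
  have vJ: "AE x in lebesgue_on \<Omega>. weak_jacobian \<Omega> (v t) x = (1 / t) *\<^sub>R W t x" if t: "0 < t" "t \<le> t0" for t
    using H1_lincomb(2)[OF \<Omega> H10_H1[OF w[OF t]] H10_H1[OF w[OF t]], of "1 / t" 0] by (simp add: v_def[abs_def] W_def)
  have inner_cong: "(LINT x|lebesgue_on \<Omega>. C x (A x) \<bullet> D x) = (LINT x|lebesgue_on \<Omega>. C x (B x) \<bullet> D x)"
    if "AE x in lebesgue_on \<Omega>. A x = B x" "on_L2 \<Omega> A" "on_L2 \<Omega> B" "on_L2 \<Omega> D" for A B D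
  proof (rule integral_cong_AE)
    show "AE x in lebesgue_on \<Omega>. C x (A x) \<bullet> D x = C x (B x) \<bullet> D x" using that(1) by eventually_elim simp
  qed (intro borel_measurable_inner sqint_measurable C_L2(1) that)+
  have weak_v: "(LINT x|lebesgue_on \<Omega>. C x (weak_jacobian \<Omega> (v t) x) \<bullet> weak_jacobian \<Omega> \<psi> x)
      = - (LINT x|lebesgue_on \<Omega>. T x \<bullet> weak_jacobian \<Omega> \<psi> x) - (LINT x|lebesgue_on \<Omega>. r t x \<bullet> weak_jacobian \<Omega> \<psi> x)"
    if t: "0 < t" "t \<le> t0" and \<psi>: "\<psi> \<in> H10 \<Omega>" for t \<psi>
  proof -
    have "(LINT x|lebesgue_on \<Omega>. C x (weak_jacobian \<Omega> (v t) x) \<bullet> weak_jacobian \<Omega> \<psi> x)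
      = (LINT x|lebesgue_on \<Omega>. C x ((1 / t) *\<^sub>R W t x) \<bullet> weak_jacobian \<Omega> \<psi> x)"
      by (rule inner_cong[OF vJ[OF t] J[OF v[OF t]] sqint_scale[OF WL[OF t]] J[OF \<psi>]])
    also have "\<dots> = (1 / t) * (LINT x|lebesgue_on \<Omega>. C x (W t x) \<bullet> weak_jacobian \<Omega> \<psi> x)"
      by (simp add: linear_cmul[OF C_lin])
    also have "\<dots> = - (LINT x|lebesgue_on \<Omega>. (1 / t) *\<^sub>R P t (\<lambda>x. W t x + Y x) x \<bullet> weak_jacobian \<Omega> \<psi> x)"
      unfolding weak[OF t \<psi>] by simp
    also have "(LINT x|lebesgue_on \<Omega>. (1 / t) *\<^sub>R P t (\<lambda>x. W t x + Y x) x \<bullet> weak_jacobian \<Omega> \<psi> x)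
       = (LINT x|lebesgue_on \<Omega>. T x \<bullet> weak_jacobian \<Omega> \<psi> x + r t x \<bullet> weak_jacobian \<Omega> \<psi> x)"
      by (rule Bochner_Integration.integral_cong) (simp_all add: r_def inner_diff_left)
    also have "\<dots> = (LINT x|lebesgue_on \<Omega>. T x \<bullet> weak_jacobian \<Omega> \<psi> x) + (LINT x|lebesgue_on \<Omega>. r t x \<bullet> weak_jacobian \<Omega> \<psi> x)"
      by (intro Bochner_Integration.integral_add sqint_inner TL rL t J \<psi>)
    finally show ?thesis by simp
  qed
  \<comment> \<open>The datum T is common to both equations and cancels, so only the remainders
    enter. This serves for two difference quotients and, with remainder 0, for a quotient and its
    limit.\<close>
  have diff: "norm_L2 \<Omega> (\<lambda>x. weak_jacobian \<Omega> z x - weak_jacobian \<Omega> z' x) \<le> c / \<alpha>"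
    if z: "z \<in> H10 \<Omega>" "z' \<in> H10 \<Omega>" and F: "on_L2 \<Omega> F" "on_L2 \<Omega> F'" "norm_L2 \<Omega> (\<lambda>x. F x - F' x) \<le> c"
      and e: "\<And>\<psi>. \<psi> \<in> H10 \<Omega> \<Longrightarrow> (LINT x|lebesgue_on \<Omega>. C x (weak_jacobian \<Omega> z x) \<bullet> weak_jacobian \<Omega> \<psi> x) = - (LINT x|lebesgue_on \<Omega>. T x \<bullet> weak_jacobian \<Omega> \<psi> x) - (LINT x|lebesgue_on \<Omega>. F x \<bullet> weak_jacobian \<Omega> \<psi> x)"
        "\<And>\<psi>. \<psi> \<in> H10 \<Omega> \<Longrightarrow> (LINT x|lebesgue_on \<Omega>. C x (weak_jacobian \<Omega> z' x) \<bullet> weak_jacobian \<Omega> \<psi> x) = - (LINT x|lebesgue_on \<Omega>. T x \<bullet> weak_jacobian \<Omega> \<psi> x) - (LINT x|lebesgue_on \<Omega>. F' x \<bullet> weak_jacobian \<Omega> \<psi> x)"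
    for z z' F F' c
  proof -
    define d where "d x = z x - z' x" for x
    have dH: "d \<in> H10 \<Omega>" using H10_lincomb[OF \<Omega> z, of 1 "-1"] by (simp add: d_def[abs_def])
    note zJ = H1_diff(2)[OF \<Omega> H10_H1[OF z(1)] H10_H1[OF z(2)], folded d_def]
    have zL: "on_L2 \<Omega> (\<lambda>x. weak_jacobian \<Omega> z x - weak_jacobian \<Omega> z' x)" by (intro sqint_diff J z)
    have "(LINT x|lebesgue_on \<Omega>. C x (weak_jacobian \<Omega> d x) \<bullet> weak_jacobian \<Omega> d x)
       = (LINT x|lebesgue_on \<Omega>. C x (weak_jacobian \<Omega> z x - weak_jacobian \<Omega> z' x) \<bullet> weak_jacobian \<Omega> d x)"
      by (rule inner_cong[OF zJ J[OF dH] zL J[OF dH]])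
    also have "\<dots> = (LINT x|lebesgue_on \<Omega>. C x (weak_jacobian \<Omega> z x) \<bullet> weak_jacobian \<Omega> d x) - (LINT x|lebesgue_on \<Omega>. C x (weak_jacobian \<Omega> z' x) \<bullet> weak_jacobian \<Omega> d x)"
      unfolding linear_diff[OF C_lin] inner_diff_left
      by (intro Bochner_Integration.integral_diff sqint_inner C_L2(1) J z dH)
    also have "\<dots> = - ((LINT x|lebesgue_on \<Omega>. F x \<bullet> weak_jacobian \<Omega> d x) - (LINT x|lebesgue_on \<Omega>. F' x \<bullet> weak_jacobian \<Omega> d x))"
      unfolding e(1)[OF dH] e(2)[OF dH] by simp
    also have "\<dots> = - (LINT x|lebesgue_on \<Omega>. (F x - F' x) \<bullet> weak_jacobian \<Omega> d x)"
      unfolding inner_diff_left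
      by (subst Bochner_Integration.integral_diff) (intro sqint_inner F J dH refl)+
    finally have "norm_L2 \<Omega> (weak_jacobian \<Omega> d) \<le> c / \<alpha>"
      by (rule energy_estimate[OF dH sqint_diff[OF F(1,2)] F(3)])
    then show ?thesis using norm_L2_jacobian_diff[OF \<Omega> H10_H1[OF z(1)] H10_H1[OF z(2)]] by (simp add: d_def[abs_def])
  qed
  have poinc: "norm_L2 \<Omega> (\<lambda>x. z x - z' x) \<le> 2 * R * norm_L2 \<Omega> (\<lambda>x. weak_jacobian \<Omega> z x - weak_jacobian \<Omega> z' x)"
    if z: "z \<in> H10 \<Omega>" "z' \<in> H10 \<Omega>" for z z'
  proof -
    have "(\<lambda>x. z x - z' x) \<in> H10 \<Omega>" using H10_lincomb[OF \<Omega> z, of 1 "-1"] by simp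
    from poincare_korn_H10(1)[OF \<Omega> R this]
    show ?thesis by (simp add: norm_L2_jacobian_diff[OF \<Omega> H10_H1[OF z(1)] H10_H1[OF z(2)]])
  qed
  \<comment> \<open>Dividing the time by 4 in each step matches the rate 1 / 4^k that
    \<open>H10_complete\<close> asks for.\<close>
  define s where "s k = t0 / 4 ^ k" for k :: nat
  have s: "0 < s k" "s k \<le> t0" for k using t0(1) by (auto simp: s_def field_simps)
  have smono: "s m \<le> s k" if "k \<le> m" for k m
    unfolding s_def using t0(1) that by (intro divide_left_mono power_increasing) auto
  \<comment> \<open>One constant for both Cauchy estimates: 1 stands for the Jacobians, and 2 R is
    the Poincare factor that leads from Jacobians to functions.\<close>
  define k4 where "k4 = (2 * k3 * t0 / \<alpha>) * (1 + 2 * R)"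
  have c2: "norm_L2 \<Omega> (\<lambda>x. weak_jacobian \<Omega> (v (s m)) x - weak_jacobian \<Omega> (v (s k)) x) \<le> (2 * k3 * t0 / \<alpha>) / 4 ^ k" if "k \<le> m" for k m
  proof -
    have "norm_L2 \<Omega> (\<lambda>x. weak_jacobian \<Omega> (v (s m)) x - weak_jacobian \<Omega> (v (s k)) x) \<le> (k3 * s m + k3 * s k) / \<alpha>"
    proof (rule diff[OF v[OF s] v[OF s] rL[OF s] rL[OF s]])
      show "norm_L2 \<Omega> (\<lambda>x. r (s m) x - r (s k) x) \<le> k3 * s m + k3 * s k"
        by (rule order_trans[OF n2_triangle_diff[OF rL[OF s] rL[OF s]] add_mono[OF rb[OF s] rb[OF s]]])
    qed (rule weak_v[OF s], assumption)+
    also have "\<dots> \<le> (k3 * s k + k3 * s k) / \<alpha>"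
      using k3 smono[OF that] \<alpha> by (intro divide_right_mono add_right_mono mult_left_mono) auto
    finally show ?thesis by (simp add: s_def mult_ac)
  qed
  have c0: "0 \<le> (2 * k3 * t0 / \<alpha>) / 4 ^ k" for k :: nat using k3 t0(1) \<alpha> by simp
  have le4: "(2 * k3 * t0 / \<alpha>) / 4 ^ k \<le> k4 / 4 ^ k" "2 * R * ((2 * k3 * t0 / \<alpha>) / 4 ^ k) \<le> k4 / 4 ^ k" for k :: nat
  proof -
    have "k4 / 4 ^ k = (2 * k3 * t0 / \<alpha>) / 4 ^ k + 2 * R * ((2 * k3 * t0 / \<alpha>) / 4 ^ k)"
      by (simp add: k4_def algebra_simps add_divide_distrib)
    then show "(2 * k3 * t0 / \<alpha>) / 4 ^ k \<le> k4 / 4 ^ k" "2 * R * ((2 * k3 * t0 / \<alpha>) / 4 ^ k) \<le> k4 / 4 ^ k"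
      using c0[of k] mult_nonneg_nonneg[OF R(2) c0[of k]] by linarith+
  qed
  obtain q where q: "q \<in> H10 \<Omega>" "(\<lambda>k. norm_L2 \<Omega> (\<lambda>x. weak_jacobian \<Omega> (v (s k)) x - weak_jacobian \<Omega> q x)) \<longlonglongrightarrow> 0"
  proof -
    have "\<exists>q\<in>H10 \<Omega>. (\<lambda>k. norm_L2 \<Omega> (\<lambda>x. weak_jacobian \<Omega> (v (s k)) x - weak_jacobian \<Omega> q x)) \<longlonglongrightarrow> 0"
    proof (rule H10_complete[where K = k4 and v = "\<lambda>k. v (s k)", OF \<Omega> v[OF s]])
      fix k m :: nat assume km: "k \<le> m"
      show "norm_L2 \<Omega> (\<lambda>x. weak_jacobian \<Omega> (v (s m)) x - weak_jacobian \<Omega> (v (s k)) x) \<le> k4 / 4 ^ k"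
        by (rule order_trans[OF c2[OF km] le4(1)])
      show "norm_L2 \<Omega> (\<lambda>x. v (s m) x - v (s k) x) \<le> k4 / 4 ^ k"
        by (rule order_trans[OF poinc[OF v[OF s] v[OF s]] order_trans[OF mult_left_mono[OF c2[OF km]] le4(2)]]) (use R(2) in simp)
    qed
    then show ?thesis using that by blast
  qed
  \<comment> \<open>The equation of the quotients passes to the limit along s, where the remainders
    tend to 0.\<close>
  have weak_q: "(LINT x|lebesgue_on \<Omega>. C x (weak_jacobian \<Omega> q x) \<bullet> weak_jacobian \<Omega> \<psi> x) = - (LINT x|lebesgue_on \<Omega>. T x \<bullet> weak_jacobian \<Omega> \<psi> x)"
    if \<psi>: "\<psi> \<in> H10 \<Omega>" for \<psi>
  proof -
    note CL = C_L2[OF sqint_diff[OF J[OF v[OF s]] J[OF q(1)]]]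
    have l1: "(\<lambda>k. LINT x|lebesgue_on \<Omega>. C x (weak_jacobian \<Omega> (v (s k)) x) \<bullet> weak_jacobian \<Omega> \<psi> x) \<longlonglongrightarrow> (LINT x|lebesgue_on \<Omega>. C x (weak_jacobian \<Omega> q x) \<bullet> weak_jacobian \<Omega> \<psi> x)"
    proof (rule tendsto_inner_n2[OF C_L2(1)[OF J[OF v[OF s]]] C_L2(1)[OF J[OF q(1)]] J[OF \<psi>]])
      show "(\<lambda>k. norm_L2 \<Omega> (\<lambda>x. C x (weak_jacobian \<Omega> (v (s k)) x) - C x (weak_jacobian \<Omega> q x))) \<longlonglongrightarrow> 0"
        by (rule Lim_null_comparison[OF _ tendsto_mult_right_zero[OF q(2), of K]]) (use CL(2) in \<open>auto simp: linear_diff[OF C_lin]\<close>)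
    qed
    have s0: "s \<longlonglongrightarrow> 0"
    proof -
      have "(\<lambda>k. t0 * (1 / 4) ^ k) \<longlonglongrightarrow> 0" by (intro tendsto_mult_right_zero LIMSEQ_power_zero) auto
      then show ?thesis by (simp add: s_def[abs_def] power_divide)
    qed
    have l2: "(\<lambda>k. LINT x|lebesgue_on \<Omega>. r (s k) x \<bullet> weak_jacobian \<Omega> \<psi> x) \<longlonglongrightarrow> 0"
    proof (rule Lim_null_comparison)
      have "(\<lambda>k. k3 * s k * norm_L2 \<Omega> (weak_jacobian \<Omega> \<psi>)) \<longlonglongrightarrow> k3 * 0 * norm_L2 \<Omega> (weak_jacobian \<Omega> \<psi>)"
        by (intro tendsto_mult tendsto_const s0)
      then show "(\<lambda>k. k3 * s k * norm_L2 \<Omega> (weak_jacobian \<Omega> \<psi>)) \<longlonglongrightarrow> 0" by simp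
      show "\<forall>\<^sub>F k in sequentially. norm (LINT x|lebesgue_on \<Omega>. r (s k) x \<bullet> weak_jacobian \<Omega> \<psi> x) \<le> k3 * s k * norm_L2 \<Omega> (weak_jacobian \<Omega> \<psi>)"
        unfolding real_norm_def
        by (intro always_eventually allI order_trans[OF n2_Cauchy_Schwarz[OF rL[OF s] J[OF \<psi>]] mult_right_mono[OF rb[OF s] n2_nonneg]])
    qed
    have "(\<lambda>k. LINT x|lebesgue_on \<Omega>. C x (weak_jacobian \<Omega> (v (s k)) x) \<bullet> weak_jacobian \<Omega> \<psi> x) \<longlonglongrightarrow> - (LINT x|lebesgue_on \<Omega>. T x \<bullet> weak_jacobian \<Omega> \<psi> x) - 0"
      unfolding weak_v[OF s \<psi>] by (intro tendsto_diff tendsto_const l2)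
    from LIMSEQ_unique[OF l1 this] show ?thesis by simp
  qed
  show ?thesis
  proof (intro bexI[OF _ q(1)] conjI ballI exI allI impI)
    fix \<psi> assume "\<psi> \<in> H10 \<Omega>"
    from weak_q[OF this] show "(LINT x|lebesgue_on \<Omega>. C x (weak_jacobian \<Omega> q x) \<bullet> weak_jacobian \<Omega> \<psi> x)
        = - (LINT x|lebesgue_on \<Omega>. tensor_derivative (C x) (G x) (Y x) \<bullet> weak_jacobian \<Omega> \<psi> x)" by (simp add: T_def)
  next
    fix t assume "0 < t \<and> t \<le> t0"
    then have t: "0 < t" "t \<le> t0" by auto
    \<comment> \<open>Comparing with q, whose remainder is 0, upgrades convergence along s to a
      linear rate for all small t.\<close>
    have j: "norm_L2 \<Omega> (\<lambda>x. weak_jacobian \<Omega> (v t) x - weak_jacobian \<Omega> q x) \<le> k3 * t / \<alpha>"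
    proof (rule diff[OF v[OF t] q(1) rL[OF t] sqint_zero])
      show "norm_L2 \<Omega> (\<lambda>x. r t x - 0) \<le> k3 * t" using rb[OF t] by simp
    qed (use weak_v[OF t] weak_q in auto)
    have "H1_norm \<Omega> (\<lambda>x. v t x - q x) \<le> norm_L2 \<Omega> (\<lambda>x. v t x - q x) + norm_L2 \<Omega> (\<lambda>x. weak_jacobian \<Omega> (v t) x - weak_jacobian \<Omega> q x)"
      using H1_norm_le[of \<Omega> "\<lambda>x. v t x - q x"] norm_L2_jacobian_diff[OF \<Omega> H10_H1[OF v[OF t]] H10_H1[OF q(1)]] by simp
    also have "\<dots> \<le> 2 * R * (k3 * t / \<alpha>) + k3 * t / \<alpha>"
      by (intro add_mono j order_trans[OF poinc[OF v[OF t] q(1)] mult_left_mono[OF j]]) (use R(2) in simp)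
    also have "\<dots> = ((2 * R + 1) * k3 / \<alpha>) * t" by (simp add: algebra_simps add_divide_distrib)
    finally show "H1_norm \<Omega> (\<lambda>x. (1 / t) *\<^sub>R w t x - q x) \<le> ((2 * R + 1) * k3 / \<alpha>) * t" by (simp add: v_def)
  qed
qed

end

subsection \<open>The elasticity tensor\<close>

text \<open>Three times la + \<mu> is the sum of the positive numbers 2 \<mu> + 3 la and \<mu>. The
  denominator of the Poisson ratio is therefore positive, and the sign of the ratio is that of
  la.\<close>

lemma admissible_lameD:
  assumes "admissible_lame \<alpha> \<gamma> \<mu> la" "\<alpha> > 0" "\<gamma> > 0"
  shows "la \<ge> 0" "\<mu> \<ge> \<alpha>"
proof -
  note a = assms(1)[unfolded admissible_lame_def]
  show "\<mu> \<ge> \<alpha>" using a by simp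
  have "la + \<mu> > 0" using a assms(2,3) by linarith
  then show "la \<ge> 0" using a by (simp add: zero_le_divide_iff)
qed

lemma elasticity_linear: "linear (elasticity \<mu> la)"
  by (rule linearI) (simp_all add: elasticity_def sym_part_def transpose_def trace_def vec_eq_iff sum.distrib sum_distrib_left algebra_simps)

lemma trace_inner: "mat 1 \<bullet> A = trace A" for A :: mat3
  by (simp add: inner_vec_def trace_def mat_def if_distrib[of "\<lambda>x. x * _"] cong: if_cong)

text \<open>Paired with A, the tensor gives 2 \<mu> times the squared norm of the symmetric part
  plus la times the squared trace, and the last term is nonnegative.\<close>

lemma elasticity_coercive:
  assumes "la \<ge> 0"
  shows "2 * \<mu> * (norm (sym_part A))\<^sup>2 \<le> elasticity \<mu> la A \<bullet> A"
proof -
  have t: "transpose A \<bullet> A = (\<Sum>i\<in>UNIV. \<Sum>j\<in>UNIV. A $ i $ j * A $ j $ i)"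
    by (simp add: inner_vec_def transpose_def mult.commute)
  have "2 * (sym_part A \<bullet> A) = A \<bullet> A + transpose A \<bullet> A" by (simp add: sym_part_def inner_add_left)
  then have s: "sym_part A \<bullet> A = (norm (sym_part A))\<^sup>2"
    using norm_sym_part[of A] t by (simp add: power2_norm_eq_inner)
  have "elasticity \<mu> la A \<bullet> A = 2 * \<mu> * (norm (sym_part A))\<^sup>2 + la * (trace A)\<^sup>2"
    by (simp add: elasticity_def inner_add_left s trace_inner power2_eq_square)
  then show ?thesis using assms by simp
qed

text \<open>The inclusion is an arbitrary measurable set because both D0 and its images under the
  flow are needed.\<close>

lemma elasticity_field:
  assumes D: "D \<in> sets lebesgue" and \<Omega>: "\<Omega> \<in> sets lebesgue"
    and Ci: "linear Ci" and Ce: "linear Ce"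
  shows elasticity_field_linear: "linear (elasticity_field Ci Ce \<Omega> D x)"
    and elasticity_field_bound: "\<exists>K\<ge>0. \<forall>x A. norm (elasticity_field Ci Ce \<Omega> D x A) \<le> K * norm A"
    and elasticity_field_measurable: "A \<in> borel_measurable (lebesgue_on \<Omega>) \<Longrightarrow>
      (\<lambda>x. elasticity_field Ci Ce \<Omega> D x (A x)) \<in> borel_measurable (lebesgue_on \<Omega>)"
proof -
  show "linear (elasticity_field Ci Ce \<Omega> D x)"
    by (rule linearI) (simp_all add: elasticity_field_def linear_add[OF Ci] linear_add[OF Ce] linear_scale[OF Ci] linear_scale[OF Ce] algebra_simps)
  obtain k where k: "k > 0" "\<And>A. norm (Ci A) \<le> norm A * k" using bounded_linear.pos_bounded[OF linear_conv_bounded_linear[THEN iffD1, OF Ci]] by blast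
  obtain l where l: "l > 0" "\<And>A. norm (Ce A) \<le> norm A * l" using bounded_linear.pos_bounded[OF linear_conv_bounded_linear[THEN iffD1, OF Ce]] by blast
  have "norm (elasticity_field Ci Ce \<Omega> D x A) \<le> (k + l) * norm A" for x A
    using k(1) l(1) order_trans[OF k(2)[of A], of "norm A * k + norm A * l"] order_trans[OF l(2)[of A], of "norm A * k + norm A * l"]
    by (auto simp: elasticity_field_def indicator_def algebra_simps)
  then show "\<exists>K\<ge>0. \<forall>x A. norm (elasticity_field Ci Ce \<Omega> D x A) \<le> K * norm A"
    using k(1) l(1) by (intro exI[of _ "k + l"]) auto
  assume A: "A \<in> borel_measurable (lebesgue_on \<Omega>)"
  have m: "(\<lambda>x. T (A x)) \<in> borel_measurable (lebesgue_on \<Omega>)" if "linear T" for T :: "mat3 \<Rightarrow> mat3"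
    by (rule measurable_compose[OF A borel_measurable_continuous_onI[OF linear_continuous_on[OF linear_conv_bounded_linear[THEN iffD1, OF that]]]])
  have "E \<in> sets lebesgue \<Longrightarrow> indicat_real E \<in> borel_measurable (lebesgue_on \<Omega>)" for E :: "(real^3) set"
    by (intro measurable_restrict_space1 borel_measurable_indicator)
  then show "(\<lambda>x. elasticity_field Ci Ce \<Omega> D x (A x)) \<in> borel_measurable (lebesgue_on \<Omega>)"
    unfolding elasticity_field_def by (intro borel_measurable_add borel_measurable_scaleR m Ci Ce) (use D \<Omega> in auto)
qed

subsection \<open>The deformation field\<close>

text \<open>A segment from a point of D to a point outside \<Omega> meets the frontier of \<Omega>,
  so it is at least r long.\<close>

lemma compact_collar:
  fixes D \<Omega> :: "'a::euclidean_space set"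
  assumes \<Omega>: "open \<Omega>" and D: "compact D" "D \<noteq> {}" "D \<subseteq> \<Omega>" and r: "r > 0" "setdist D (frontier \<Omega>) \<ge> r"
  shows "compact {x. infdist x D \<le> r / 4}" "{x. infdist x D \<le> r / 4} \<subseteq> \<Omega>"
proof -
  show "compact {x. infdist x D \<le> r / 4}" using D(1,2) r(1) by (intro compact_infdist_le) auto
  show "{x. infdist x D \<le> r / 4} \<subseteq> \<Omega>"
  proof (intro subsetI, rule ccontr)
    fix x assume "x \<in> {x. infdist x D \<le> r / 4}" and x: "x \<notin> \<Omega>"
    then have i: "infdist x D \<le> r / 4" by simp
    obtain y where y: "y \<in> D" "infdist x D = dist x y"
      using infdist_attains_inf[OF compact_imp_closed[OF D(1)] D(2)] by blast
    have "closed_segment y x \<inter> frontier \<Omega> \<noteq> {}"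
      by (rule connected_Int_frontier) (use y(1) x D(3) in auto)
    then obtain z where z: "z \<in> closed_segment y x" "z \<in> frontier \<Omega>" by blast
    have "r \<le> dist y z" using r(2) setdist_le_dist[OF y(1) z(2)] by linarith
    also have "\<dots> \<le> dist x y" using dist_in_closed_segment[OF z(1)] by (simp add: dist_commute)
    finally show False using i y(2) r(1) by simp
  qed
qed

lemma locally_integrable_measurable:
  fixes f :: "real^3 \<Rightarrow> 'b::euclidean_space"
  assumes f: "f locally_integrable_on UNIV"
  shows "f \<in> borel_measurable lebesgue"
proof (rule borel_measurable_LIMSEQ_metric)
  show "(\<lambda>x. indicat_real (cball 0 (real n)) x *\<^sub>R f x) \<in> borel_measurable lebesgue" for n
    using f unfolding locally_integrable_on_def set_integrable_def by (intro borel_measurable_integrable) auto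
  fix x :: "real^3"
  show "(\<lambda>n. indicat_real (cball 0 (real n)) x *\<^sub>R f x) \<longlonglongrightarrow> f x"
  proof (rule tendsto_eventually)
    obtain N where "norm x \<le> real N" using real_arch_simple by blast
    then show "\<forall>\<^sub>F n in sequentially. indicat_real (cball 0 (real n)) x *\<^sub>R f x = f x"
      by (intro eventually_sequentiallyI[of N]) (auto simp: indicator_def)
  qed
qed

lemma has_weak_jacobian_cong_AE:
  assumes \<Omega>: "\<Omega> \<in> sets lebesgue" and G: "has_weak_jacobian \<Omega> u G" and G': "G' locally_integrable_on \<Omega>"
    and m: "G' \<in> borel_measurable (lebesgue_on \<Omega>)" "G \<in> borel_measurable (lebesgue_on \<Omega>)" and ae: "AE x in lebesgue_on \<Omega>. G x = G' x"
  shows "has_weak_jacobian \<Omega> u G'"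
  unfolding has_weak_jacobian_def
proof (intro conjI ballI allI)
  show "u locally_integrable_on \<Omega>" "G' locally_integrable_on \<Omega>" using G G' by (simp_all add: has_weak_jacobian_def)
  fix \<phi> i j assume p: "\<phi> \<in> test_functions \<Omega>"
  have pm: "\<phi> \<in> borel_measurable (lebesgue_on \<Omega>)" by (rule measurable_restrict_space1[OF sqint_measurable[OF test_sqint[OF p]]])
  have "(LINT x|lebesgue_on \<Omega>. G x $ i $ j * \<phi> x) = (LINT x|lebesgue_on \<Omega>. G' x $ i $ j * \<phi> x)"
    by (rule integral_cong_AE) (use ae in \<open>auto intro!: borel_measurable_times borel_measurable_nth m pm\<close>)
  then show "(LINT x|lebesgue_on \<Omega>. u x $ i * partial j \<phi> x) = - (LINT x|lebesgue_on \<Omega>. G' x $ i $ j * \<phi> x)"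
    using G p by (simp add: has_weak_jacobian_def)
qed

text \<open>On a null set the chosen weak Jacobian may exceed its essential bound or fail to vanish
  off S. The locales above ask for pointwise bounds, so G is this Jacobian with such points set to
  0.\<close>

lemma W1_inf_representative:
  assumes U: "U \<in> W1_inf" and S: "compact S" and zero: "\<And>x. x \<notin> S \<Longrightarrow> U x = 0"
  obtains G \<Lambda> where "\<Lambda> > 0" "G \<in> borel_measurable lebesgue" "\<And>x. norm (G x) \<le> \<Lambda>"
    "has_weak_jacobian UNIV U G" "sqint lebesgue G" "sqint lebesgue U" "AE x in lebesgue. weak_jacobian UNIV U x = G x"
    "weak_jacobian UNIV U \<in> borel_measurable lebesgue"
proof -
  define G0 where "G0 = weak_jacobian UNIV U"
  have cU: "continuous_on UNIV U" and ess: "esssup lebesgue (\<lambda>x. ereal (norm (G0 x))) < \<infinity>"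
    and J: "has_weak_jacobian UNIV U G0"
    using U weak_jacobian_has by (auto simp: W1_inf_def G0_def)
  have G0m: "G0 \<in> borel_measurable lebesgue"
    using J by (intro locally_integrable_measurable) (simp add: has_weak_jacobian_def)
  have "\<exists>\<Lambda>>0. AE x in lebesgue. norm (G0 x) \<le> \<Lambda>"
  proof -
    have ae: "AE x in lebesgue. ereal (norm (G0 x)) \<le> esssup lebesgue (\<lambda>x. ereal (norm (G0 x)))" by (rule esssup_AE)
    obtain \<Lambda> where \<Lambda>: "esssup lebesgue (\<lambda>x. ereal (norm (G0 x))) \<le> ereal \<Lambda>"
      using ess by (cases "esssup lebesgue (\<lambda>x. ereal (norm (G0 x)))") auto
    \<comment> \<open>The essential supremum may be 0, while the bound has to be positive to be
      divided by later.\<close>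
    have "AE x in lebesgue. norm (G0 x) \<le> max 1 \<Lambda>"
      using ae by eventually_elim (use \<Lambda> order_trans in \<open>fastforce simp: le_max_iff_disj\<close>)
    then show ?thesis by (intro exI[of _ "max 1 \<Lambda>"]) auto
  qed
  then obtain \<Lambda> where \<Lambda>: "\<Lambda> > 0" "AE x in lebesgue. norm (G0 x) \<le> \<Lambda>" by blast
  define G where "G x = (if x \<in> S \<and> norm (G0 x) \<le> \<Lambda> then G0 x else 0)" for x
  have Sm: "S \<in> sets lebesgue" using lmeasurable_compact[OF S] by (simp add: fmeasurable_def)
  have "AE x in lebesgue_on (UNIV - S). G0 x = 0"
    by (rule weak_jacobian_zero_outside[OF open_UNIV J compact_imp_closed[OF S]]) (use zero in auto)
  moreover have "UNIV - S \<in> sets lebesgue" by (rule sets.Diff[OF _ Sm]) auto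
  ultimately have "AE x in lebesgue. x \<in> UNIV - S \<longrightarrow> G0 x = 0" by (simp only: AE_lebesgue_on)
  then have ae: "AE x in lebesgue. G0 x = G x" using \<Lambda>(2) by eventually_elim (auto simp: G_def)
  have Gm: "G \<in> borel_measurable lebesgue" by (rule measurable_lebesgue_AE[OF G0m ae])
  have Gb: "norm (G x) \<le> \<Lambda>" for x using \<Lambda>(1) by (simp add: G_def)
  have bounded_sqint: "sqint lebesgue f" if fm: "f \<in> borel_measurable lebesgue" and b: "\<And>x. x \<in> S \<Longrightarrow> norm (f x) \<le> B" and z: "\<And>x. x \<notin> S \<Longrightarrow> f x = 0"
    for f :: "real^3 \<Rightarrow> 'z::euclidean_space" and B
  proof (rule sqint_bound(1)[OF _ fm])
    have "integrable lebesgue (indicat_real S)"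
      by (rule integrable_real_indicator[OF Sm]) (use lmeasurable_compact[OF S] in \<open>auto simp: fmeasurable_def\<close>)
    moreover have "(\<lambda>x. (norm (indicat_real S x))\<^sup>2) = indicat_real S" by (auto simp: indicator_def)
    ultimately show "sqint lebesgue (indicat_real S)" using Sm by (simp add: sqint_def)
    show "AE x in lebesgue. norm (f x) \<le> B * norm (indicat_real S x)" using b z by (intro AE_I2) (auto simp: indicator_def)
  qed
  have Gs: "sqint lebesgue G" by (rule bounded_sqint[OF Gm, of \<Lambda>]) (use \<Lambda>(1) in \<open>auto simp: G_def\<close>)
  obtain B where B: "\<And>x. x \<in> S \<Longrightarrow> norm (U x) \<le> B"
    using compact_imp_bounded[OF compact_continuous_image[OF continuous_on_subset[OF cU subset_UNIV] S]] by (auto simp: bounded_iff)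
  have Us: "sqint lebesgue U"
    by (rule bounded_sqint[of U B]) (use B zero cU in \<open>auto intro: borel_measurable_lebesgueI borel_measurable_continuous_onI\<close>)
  have "has_weak_jacobian UNIV U G"
    by (rule has_weak_jacobian_cong_AE[OF _ J sqint_locally_integrable[OF Gs], unfolded lebesgue_on_UNIV_eq, OF _ Gm G0m ae]) simp
  then show thesis using that[OF \<Lambda>(1) Gm Gb _ Gs Us] ae G0m by (simp add: G0_def)
qed

subsection \<open>The material derivative\<close>

text \<open>By the chain rule, the Jacobian of u at the moved point is the Jacobian of the
  composition times \<open>finv (H x)\<close>. The transformed stress is therefore the pulled back
  tensor applied to the Jacobian of the composition, written as that of the difference plus that of
  u0.\<close>

lemma (in small_field) pulled_equation:
  assumes \<Omega>: "open \<Omega>" and map: "\<Phi> ` \<Omega> \<subseteq> \<Omega>" and u: "u \<in> H1 \<Omega>" and u0: "u0 \<in> H1 \<Omega>"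
    and h: "on_L2 \<Omega> (\<lambda>x. Ct x (weak_jacobian \<Omega> u x))"
    and eq: "\<And>\<psi>. \<psi> \<in> H10 \<Omega> \<Longrightarrow> (LINT x|lebesgue_on \<Omega>. Ct x (weak_jacobian \<Omega> u x) \<bullet> weak_jacobian \<Omega> \<psi> x) = 0"
    and C0: "\<And>x. x \<in> \<Omega> \<Longrightarrow> Ct (\<Phi> x) = C0 x"
    and X: "on_L2 \<Omega> (\<lambda>x. pulled_tensor (C0 x) (H x) (weak_jacobian \<Omega> (\<lambda>x. u (\<Phi> x) - u0 x) x + weak_jacobian \<Omega> u0 x))"
    and \<psi>: "\<psi> \<in> H10 \<Omega>"
  shows "(LINT x|lebesgue_on \<Omega>. pulled_tensor (C0 x) (H x) (weak_jacobian \<Omega> (\<lambda>x. u (\<Phi> x) - u0 x) x + weak_jacobian \<Omega> u0 x)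
    \<bullet> weak_jacobian \<Omega> \<psi> x) = 0"
proof (rule vtest_dense[OF \<Omega> X \<psi>])
  fix \<phi> :: "real^3 \<Rightarrow> real^3" assume p: "\<phi> \<in> vector_test_functions \<Omega>"
  note \<Omega>s = open_lebesgue[OF \<Omega>]
  let ?X = "\<lambda>x. pulled_tensor (C0 x) (H x) (weak_jacobian \<Omega> (\<lambda>x. u (\<Phi> x) - u0 x) x + weak_jacobian \<Omega> u0 x)"
  let ?h = "\<lambda>x. Ct x (weak_jacobian \<Omega> u x)"
  let ?Z = "\<lambda>x. det (mat 1 + H x) *\<^sub>R (?h (\<Phi> x) ** transpose (finv (H x)))"
  have "AE x in lebesgue_on \<Omega>. x \<in> \<Omega>" using AE_space[of "lebesgue_on \<Omega>"] by simp
  then have ae: "AE x in lebesgue_on \<Omega>. ?X x = ?Z x"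
    using H1_diff(2)[OF \<Omega> chain_rule(1)[OF \<Omega> map u] u0] chain_rule(2)[OF \<Omega> map u]
  proof eventually_elim
    case (elim x)
    have "weak_jacobian \<Omega> (\<lambda>x. u (\<Phi> x) - u0 x) x + weak_jacobian \<Omega> u0 x = weak_jacobian \<Omega> u (\<Phi> x) ** (mat 1 + H x)"
      using elim by simp
    moreover have "weak_jacobian \<Omega> u (\<Phi> x) ** (mat 1 + H x) ** finv (H x) = weak_jacobian \<Omega> u (\<Phi> x)"
      by (simp add: matrix_mul_assoc[symmetric] finv(1)[OF H_10])
    ultimately show ?case by (simp add: pulled_tensor_def C0[OF elim(1)])
  qed
  have Xm: "?X \<in> borel_measurable (lebesgue_on \<Omega>)" by (rule sqint_measurable[OF X])
  have cm: "cjac \<phi> \<in> borel_measurable (lebesgue_on \<Omega>)" by (rule measurable_restrict_space1[OF sqint_measurable[OF vtest_sqint(2)[OF p]]])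
  have "(LINT x|lebesgue_on \<Omega>. ?X x \<bullet> cjac \<phi> x) = (LINT x|lebesgue_on \<Omega>. ?Z x \<bullet> cjac \<phi> x)"
    by (intro integral_cong_AE borel_measurable_inner cm Xm measurable_lebesgue_on_AE[OF \<Omega>s Xm ae]) (use ae in auto)
  also have "\<dots> = 0" by (rule transformed_equation[OF \<Omega> map h eq p])
  finally show "(LINT x|lebesgue_on \<Omega>. ?X x \<bullet> cjac \<phi> x) = 0" .
qed

section \<open>Boundary values and the concluding argument\<close>

lemma zero_H10: "open \<Omega> \<Longrightarrow> u \<in> H1 \<Omega> \<Longrightarrow> (\<lambda>x. u x - u x) \<in> H10 \<Omega>"
  by (rule compact_support_H10[of _ _ "{}"]) (simp_all only: H1_diff, simp_all)

text \<open>A function lies in its own trace class, so equality of the classes puts u into the class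
  of v.\<close>

lemma weak_solution_diff_H10:
  assumes \<Omega>: "open \<Omega>" and u: "weak_solution \<Omega> C f u" and v: "weak_solution \<Omega> C' f v"
  shows "(\<lambda>x. u x - v x) \<in> H10 \<Omega>"
proof -
  have "u \<in> boundary_trace \<Omega> u" using u zero_H10[OF \<Omega>, of u] unfolding boundary_trace_def weak_solution_def by blast
  then have "u \<in> boundary_trace \<Omega> v" using u v by (simp add: weak_solution_def)
  then show ?thesis by (simp add: boundary_trace_def)
qed

lemma material_derivative_exists:
  fixes \<Omega> D0 D1 :: "(real^3) set" and U :: "real^3 \<Rightarrow> real^3" and C :: "real \<Rightarrow> real^3 \<Rightarrow> mat3 \<Rightarrow> mat3"
  assumes r0: "r0 > 0" and \<Omega>: "open \<Omega>" "bounded \<Omega>" and pos: "\<alpha>0 > 0" "\<gamma>0 > 0"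
    and lame: "admissible_lame \<alpha>0 \<gamma>0 \<mu>i la_i" "admissible_lame \<alpha>0 \<gamma>0 \<mu>e la_e"
    and P: "class_P r0 M0 \<theta>0 \<Omega> D0 \<F>0" and U: "deformation_field r0 Ctil \<Omega> D0 \<F>0 D1 \<F>1 U"
    and C: "\<And>t. C t = elasticity_field (elasticity \<mu>i la_i) (elasticity \<mu>e la_e) \<Omega> (flow U t ` D0)"
    and u: "\<And>t. t \<in> {0..1} \<Longrightarrow> weak_solution \<Omega> (C t) f (u t)"
  shows "\<exists>u_dot\<in>H10 \<Omega>.
     tendsto_H1 \<Omega> (\<lambda>t x. (1 / t) *\<^sub>R ((u t \<circ> flow U t) x - u 0 x)) u_dot (at 0 within {0..1}) \<and>
     (\<forall>\<psi>\<in>H10 \<Omega>.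
        (LINT x|lebesgue_on \<Omega>. C 0 x (weak_jacobian \<Omega> u_dot x) \<bullet> weak_jacobian \<Omega> \<psi> x) =
        - (LINT x|lebesgue_on \<Omega>. tensor_derivative (C 0 x) (weak_jacobian UNIV U x) (weak_jacobian \<Omega> (u 0) x) \<bullet> weak_jacobian \<Omega> \<psi> x))"
proof -
  note \<Omega>s = open_lebesgue[OF \<Omega>(1)]
  have D: "closed D0" "D0 \<noteq> {}" "D0 \<subseteq> \<Omega>" "setdist D0 (frontier \<Omega>) \<ge> r0"
    using P by (auto simp: class_P_def polyhedron_with_faces_def homeomorphic_empty)
  have Dc: "compact D0" using D(1,3) bounded_subset[OF \<Omega>(2)] by (simp add: compact_eq_bounded_closed)
  define S where "S = {x. infdist x D0 \<le> r0 / 4}"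
  have S: "compact S" "S \<subseteq> \<Omega>" unfolding S_def by (intro compact_collar[OF \<Omega>(1) Dc D(2,3) r0 D(4)])+
  have U0: "U x = 0" if "x \<notin> S" for x
  proof -
    have "support U \<subseteq> S" using U by (simp add: deformation_field_def S_def)
    then show ?thesis using that closure_subset[of "{x. U x \<noteq> 0}"] unfolding support_def by blast
  qed
  have UW: "U \<in> W1_inf" using U by (simp add: deformation_field_def)
  then have cU: "continuous_on UNIV U" by (simp add: W1_inf_def)
  obtain G \<Lambda> where \<Lambda>: "\<Lambda> > 0" and Gm: "G \<in> borel_measurable lebesgue" and Gb: "\<And>x. norm (G x) \<le> \<Lambda>"
    and GJ: "has_weak_jacobian UNIV U G" and Gs: "sqint lebesgue G" and Us: "sqint lebesgue U"
    and Gae: "AE x in lebesgue. weak_jacobian UNIV U x = G x"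
    by (rule W1_inf_representative[OF UW S(1)]) (rule U0, assumption, blast)
  have bij: "bij_betw (flow U t) \<Omega> \<Omega>" if "t \<in> {0..1}" for t
    using U that by (simp add: deformation_field_def bilipschitz_self_map_def)
  have flow0: "flow U 0 ` D0 = D0" by (simp add: flow_def)
  have Ds: "D0 \<in> sets lebesgue" using lmeasurable_compact[OF Dc] by (simp add: fmeasurable_def)
  note lin = elasticity_linear[of \<mu>i la_i] elasticity_linear[of \<mu>e la_e]
  obtain K where K: "K \<ge> 0" "\<And>x A. norm (C 0 x A) \<le> K * norm A"
    using elasticity_field_bound[OF Ds \<Omega>s lin] unfolding C flow0 by blast
  obtain R where R: "\<And>x. x \<in> \<Omega> \<Longrightarrow> norm x \<le> R" "R > 0" using \<Omega>(2) bounded_pos by blast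
  interpret perturbed_problem \<Omega> "C 0" G K \<alpha>0 R \<Lambda>
  proof (rule perturbed_problem.intro)
    show "\<bar>x $ 1\<bar> \<le> R" if "x \<in> \<Omega>" for x using R(1)[OF that] component_le_norm_cart[of x 1] by linarith
    show "linear (C 0 x)" for x unfolding C flow0 by (rule elasticity_field_linear[OF Ds \<Omega>s lin])
    show "(\<lambda>x. C 0 x (A x)) \<in> borel_measurable (lebesgue_on \<Omega>)" if "A \<in> borel_measurable (lebesgue_on \<Omega>)" for A
      unfolding C flow0 by (rule elasticity_field_measurable[OF Ds \<Omega>s lin that])
    show "2 * \<alpha>0 * (norm (sym_part A))\<^sup>2 \<le> C 0 x A \<bullet> A" if "x \<in> \<Omega>" for x A
    proof -
      have "2 * \<alpha>0 * (norm (sym_part A))\<^sup>2 \<le> elasticity \<mu> la A \<bullet> A" if "admissible_lame \<alpha>0 \<gamma>0 \<mu> la" for \<mu> la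
        using admissible_lameD(2)[OF that pos] by (intro order_trans[OF mult_right_mono elasticity_coercive[OF admissible_lameD(1)[OF that pos]]]) auto
      then show ?thesis using lame that by (cases "x \<in> D0") (auto simp: C flow0 elasticity_field_def)
    qed
  qed (use \<Omega> R(2) K pos Gm Gb \<Lambda> in auto)
  \<comment> \<open>The three terms keep t in the unit interval, make t G small enough for the
    tensor expansion, and permit the absorption in the energy estimate. The summand 1 keeps the last
    denominator positive even if K = 0.\<close>
  define t0 where "t0 = min 1 (min (1 / (100 * \<Lambda>)) (\<alpha>0 / (28 * K * \<Lambda> + 1)))"
  have KL: "0 < 28 * K * \<Lambda> + 1" using K(1) \<Lambda> by (simp add: add_nonneg_pos)
  have t0: "0 < t0" "t0 \<le> 1" "t0 \<le> 1 / (100 * \<Lambda>)" using \<Lambda> pos KL by (auto simp: t0_def)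
  have "t0 \<le> \<alpha>0 / (28 * K * \<Lambda> + 1)" by (simp add: t0_def)
  then have "t0 * (28 * K * \<Lambda> + 1) \<le> \<alpha>0" using KL by (simp only: pos_le_divide_eq)
  then have t0': "28 * K * \<Lambda> * t0 \<le> \<alpha>0" using t0(1) by (simp add: algebra_simps)
  have uH: "u t \<in> H1 \<Omega>" if "t \<in> {0..1}" for t using u[OF that] by (simp add: weak_solution_def)
  have u0H: "u 0 \<in> H1 \<Omega>" by (rule uH) simp
  define w where "w t x = u t (flow U t x) - u 0 x" for t x
  have step: "w t \<in> H10 \<Omega> \<and> (\<forall>\<psi>\<in>H10 \<Omega>. (LINT x|lebesgue_on \<Omega>. pulled_tensor (C 0 x) (t *\<^sub>R G x)
      (weak_jacobian \<Omega> (w t) x + weak_jacobian \<Omega> (u 0) x) \<bullet> weak_jacobian \<Omega> \<psi> x) = 0)" if t: "0 < t" "t \<le> t0" for t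
  proof -
    have t1: "t \<in> {0..1}" and t2: "t \<le> 1 / (100 * \<Lambda>)" using t t0 by auto
    interpret small: small_field "\<lambda>x. t *\<^sub>R U x" "\<lambda>x. t *\<^sub>R G x"
    proof
      have "has_weak_gradient UNIV (\<lambda>x. t * U x $ i + 0 * U x $ i) (\<lambda>x. t *\<^sub>R G x $ i + 0 *\<^sub>R G x $ i)" for i
        using GJ unfolding weak_jacobian_iff_gradient by (intro has_weak_gradient_lincomb[OF open_UNIV]) auto
      then show "has_weak_jacobian UNIV (\<lambda>x. t *\<^sub>R U x) (\<lambda>x. t *\<^sub>R G x)"
        unfolding weak_jacobian_iff_gradient by simp
    qed (use small[OF t(1) t2] in \<open>auto intro!: continuous_intros continuous_on_subset[OF cU] sqint_scale Us Gs\<close>)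
    have \<Phi>: "small.\<Phi> = flow U t" by (simp add: fun_eq_iff small.\<Phi>_def flow_def)
    have map: "flow U t ` \<Omega> \<subseteq> \<Omega>" using bij[OF t1] by (simp add: bij_betw_def)
    note uc = small.chain_rule(1)[OF \<Omega>(1) _ uH[OF t1], unfolded \<Phi>, OF map]
    \<comment> \<open>The flow is the identity off S, so this difference has compact support in
      \<Omega>. Adding \<open>u t - u 0\<close>, which has zero trace, gives
      \<open>w t\<close>.\<close>
    have "(\<lambda>x. u t (flow U t x) - u t x) \<in> H10 \<Omega>"
      by (rule compact_support_H10[OF \<Omega>(1) H1_diff(1)[OF \<Omega>(1) uc uH[OF t1]] S]) (simp add: flow_def U0)
    from H10_lincomb[OF \<Omega>(1) this weak_solution_diff_H10[OF \<Omega>(1) u[OF t1] u[of 0]], of 1 1]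
    have w: "w t \<in> H10 \<Omega>" by (simp add: w_def[abs_def])
    have ft: "flow U t ` D0 \<in> sets lebesgue"
    proof -
      have "continuous_on D0 (flow U t)" unfolding flow_def[abs_def] by (intro continuous_intros continuous_on_subset[OF cU]) auto
      from lmeasurable_compact[OF compact_continuous_image[OF this Dc]] show ?thesis by (simp add: fmeasurable_def)
    qed
    \<comment> \<open>Injectivity of the flow on \<Omega> puts the moved point into the moved
      inclusion exactly when the original point lies in D0.\<close>
    have Ct: "C t (flow U t x) = C 0 x" if x: "x \<in> \<Omega>" for x
    proof -
      have "flow U t x \<in> flow U t ` D0 \<longleftrightarrow> x \<in> D0"
        using inj_on_image_mem_iff[OF bij_betw_imp_inj_on[OF bij[OF t1]] x D(3)] .
      then show ?thesis using x map by (auto simp: C flow0 elasticity_field_def indicator_def fun_eq_iff)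
    qed
    have jL: "on_L2 \<Omega> (weak_jacobian \<Omega> v)" if "v \<in> H1 \<Omega>" for v by (rule H1D(2)[OF \<Omega>(1) that])
    have hL: "on_L2 \<Omega> (\<lambda>x. C t x (weak_jacobian \<Omega> (u t) x))"
    proof -
      obtain k where "k \<ge> 0" "\<And>x A. norm (C t x A) \<le> k * norm A"
        using elasticity_field_bound[OF ft \<Omega>s lin] unfolding C by blast
      then show ?thesis unfolding C
        by (intro sqint_bound(1)[OF jL[OF uH[OF t1]] elasticity_field_measurable[OF ft \<Omega>s lin sqint_measurable[OF jL[OF uH[OF t1]]]], of k]) auto
    qed
    have X: "on_L2 \<Omega> (\<lambda>x. pulled_tensor (C 0 x) (t *\<^sub>R G x) (weak_jacobian \<Omega> (\<lambda>x. u t (flow U t x) - u 0 x) x + weak_jacobian \<Omega> (u 0) x))"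
      using pulled_L2(1)[OF t(1) t2 sqint_add[OF jL[OF H10_H1[OF w]] jL[OF u0H]]] by (simp add: w_def[abs_def])
    have "(LINT x|lebesgue_on \<Omega>. C t x (weak_jacobian \<Omega> (u t) x) \<bullet> weak_jacobian \<Omega> \<psi> x) = 0" if "\<psi> \<in> H10 \<Omega>" for \<psi>
      using u[OF t1] that by (simp add: weak_solution_def)
    from small.pulled_equation[unfolded \<Phi>, OF \<Omega>(1) map uH[OF t1] u0H hL this Ct X]
    show ?thesis using w by (simp add: w_def[abs_def])
  qed
  have Y0: "(LINT x|lebesgue_on \<Omega>. C 0 x (weak_jacobian \<Omega> (u 0) x) \<bullet> weak_jacobian \<Omega> \<psi> x) = 0" if "\<psi> \<in> H10 \<Omega>" for \<psi>
    using u[of 0] that by (simp add: weak_solution_def)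
  note YL = H1D(2)[OF \<Omega>(1) u0H]
  obtain q c where q: "q \<in> H10 \<Omega>"
    and qe: "\<And>\<psi>. \<psi> \<in> H10 \<Omega> \<Longrightarrow> (LINT x|lebesgue_on \<Omega>. C 0 x (weak_jacobian \<Omega> q x) \<bullet> weak_jacobian \<Omega> \<psi> x)
        = - (LINT x|lebesgue_on \<Omega>. tensor_derivative (C 0 x) (G x) (weak_jacobian \<Omega> (u 0) x) \<bullet> weak_jacobian \<Omega> \<psi> x)"
    and qc: "\<And>t. 0 < t \<Longrightarrow> t \<le> t0 \<Longrightarrow> H1_norm \<Omega> (\<lambda>x. (1 / t) *\<^sub>R w t x - q x) \<le> c * t"
    using material_derivative[OF YL Y0 t0(1,3) t0', of w] step by blast
  \<comment> \<open>The filter excludes t = 0 and admits no negative t, so positivity holds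
    eventually.\<close>
  have ev: "\<forall>\<^sub>F t in at 0 within {0..1}. 0 < t \<and> t \<le> t0"
    unfolding eventually_at using t0(1) by (intro exI[of _ t0]) (auto simp: dist_real_def)
  have "tendsto_H1 \<Omega> (\<lambda>t x. (1 / t) *\<^sub>R w t x) q (at 0 within {0..1})"
    unfolding tendsto_H1_def
  proof (intro conjI)
    show "q \<in> H1 \<Omega>" by (rule H10_H1[OF q])
    show "\<forall>\<^sub>F t in at 0 within {0..1}. (\<lambda>x. (1 / t) *\<^sub>R w t x) \<in> H1 \<Omega>"
      using ev
    proof eventually_elim
      case (elim t)
      then have w: "w t \<in> H10 \<Omega>" using step by blast
      show ?case using H1_lincomb(1)[OF \<Omega>(1) H10_H1[OF w] H10_H1[OF w], of "1 / t" 0] by simp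
    qed
    show "((\<lambda>t. H1_norm \<Omega> (\<lambda>x. (1 / t) *\<^sub>R w t x - q x)) \<longlongrightarrow> 0) (at 0 within {0..1})"
    proof (rule Lim_null_comparison)
      show "\<forall>\<^sub>F t in at 0 within {0..1}. norm (H1_norm \<Omega> (\<lambda>x. (1 / t) *\<^sub>R w t x - q x)) \<le> c * t"
        using ev by eventually_elim (use qc H1_norm_nonneg in auto)
      show "((\<lambda>t. c * t) \<longlongrightarrow> 0) (at 0 within {0..1})" by (auto intro!: tendsto_eq_intros)
    qed
  qed
  \<comment> \<open>The bounded representative is exchanged for the chosen weak Jacobian of the
    field, from which it differs on a null set only.\<close>
  moreover have "(LINT x|lebesgue_on \<Omega>. tensor_derivative (C 0 x) (G x) (weak_jacobian \<Omega> (u 0) x) \<bullet> weak_jacobian \<Omega> \<psi> x)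
    = (LINT x|lebesgue_on \<Omega>. tensor_derivative (C 0 x) (weak_jacobian UNIV U x) (weak_jacobian \<Omega> (u 0) x) \<bullet> weak_jacobian \<Omega> \<psi> x)"
    if \<psi>: "\<psi> \<in> H10 \<Omega>" for \<psi>
  proof -
    have ae: "AE x in lebesgue_on \<Omega>. tensor_derivative (C 0 x) (G x) (weak_jacobian \<Omega> (u 0) x)
      = tensor_derivative (C 0 x) (weak_jacobian UNIV U x) (weak_jacobian \<Omega> (u 0) x)"
      unfolding AE_lebesgue_on[OF \<Omega>s] using Gae by eventually_elim simp
    note m = sqint_measurable[OF derivative_L2[OF YL]] and m' = sqint_measurable[OF H1D(2)[OF \<Omega>(1) H10_H1[OF \<psi>]]]
    show ?thesis
      by (intro integral_cong_AE borel_measurable_inner m m' measurable_lebesgue_on_AE[OF \<Omega>s m ae]) (use ae in auto)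
  qed
  ultimately show ?thesis using q qe by (intro bexI[of _ q]) (auto simp: w_def o_def)
qed

theorem proposition6p5:
  fixes M0 M1 \<theta>0 Ctil :: real
  assumes "M0 \<ge> 1" and "M1 > 1" and "0 < \<theta>0" and "\<theta>0 < pi / 2" and "Ctil > 0"
  shows "\<exists>\<delta>>0. \<forall>r0 \<alpha>0 \<gamma>0 \<eta>0 \<mu>i la_i \<mu>e la_e :: real. \<forall>\<Omega> D0 D1 :: (real^3) set.
    \<forall>\<F>0 \<F>1 :: (real^3) set set. \<forall>U :: real^3 \<Rightarrow> real^3.
    \<forall>f :: (real^3 \<Rightarrow> real^3) set. \<forall>u :: real \<Rightarrow> real^3 \<Rightarrow> real^3. \<forall>C :: real \<Rightarrow> real^3 \<Rightarrow> real^3^3 \<Rightarrow> real^3^3.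
      r0 > 0 \<and>
      open \<Omega> \<and> connected \<Omega> \<and> \<Omega> \<noteq> {} \<and> bounded \<Omega> \<and> diameter \<Omega> \<le> M1 * r0 \<and>
      \<alpha>0 > 0 \<and> \<gamma>0 > 0 \<and> \<eta>0 > 0 \<and>
      admissible_lame \<alpha>0 \<gamma>0 \<mu>i la_i \<and> admissible_lame \<alpha>0 \<gamma>0 \<mu>e la_e \<and>
      (la_i - la_e)\<^sup>2 + (\<mu>i - \<mu>e)\<^sup>2 \<ge> \<eta>0 \<and>
      class_P r0 M0 \<theta>0 \<Omega> D0 \<F>0 \<and> class_P r0 M0 \<theta>0 \<Omega> D1 \<F>1 \<and>
      hausdorff_dist (frontier D0) (frontier D1) \<le> \<delta> * r0 \<and>
      deformation_field r0 Ctil \<Omega> D0 \<F>0 D1 \<F>1 U \<and>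
      (\<forall>t. C t = elasticity_field (elasticity \<mu>i la_i) (elasticity \<mu>e la_e) \<Omega> (flow U t ` D0)) \<and>
      f \<in> H_half_boundary \<Omega> \<and>
      (\<forall>t\<in>{0..1}. weak_solution \<Omega> (C t) f (u t))
      \<longrightarrow>
      (\<exists>u_dot\<in>H10 \<Omega>.
         tendsto_H1 \<Omega> (\<lambda>t x. (1 / t) *\<^sub>R ((u t \<circ> flow U t) x - u 0 x)) u_dot (at 0 within {0..1}) \<and>
         (\<forall>\<psi>\<in>H10 \<Omega>.
            (LINT x|lebesgue_on \<Omega>. C 0 x (weak_jacobian \<Omega> u_dot x) \<bullet> weak_jacobian \<Omega> \<psi> x) =
            - (LINT x|lebesgue_on \<Omega>.
                 (C 0 x (weak_jacobian \<Omega> (u 0) x) **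
                    (trace (weak_jacobian UNIV U x) *\<^sub>R mat 1 - transpose (weak_jacobian UNIV U x))
                  - C 0 x (weak_jacobian \<Omega> (u 0) x ** weak_jacobian UNIV U x))
                 \<bullet> weak_jacobian \<Omega> \<psi> x)))"
proof (intro exI[of _ 1] conjI allI impI, goal_cases)
  case (2 r0 \<alpha>0 \<gamma>0 \<eta>0 \<mu>i la_i \<mu>e la_e \<Omega> D0 D1 \<F>0 \<F>1 U f u C)
  then have h: "r0 > 0" "open \<Omega>" "bounded \<Omega>" "\<alpha>0 > 0" "\<gamma>0 > 0" "admissible_lame \<alpha>0 \<gamma>0 \<mu>i la_i"
    "admissible_lame \<alpha>0 \<gamma>0 \<mu>e la_e" "class_P r0 M0 \<theta>0 \<Omega> D0 \<F>0" "deformation_field r0 Ctil \<Omega> D0 \<F>0 D1 \<F>1 U"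
    and C: "\<And>t. C t = elasticity_field (elasticity \<mu>i la_i) (elasticity \<mu>e la_e) \<Omega> (flow U t ` D0)"
    and u: "\<forall>t\<in>{0..1}. weak_solution \<Omega> (C t) f (u t)"
    by blast+
  show ?case by (rule material_derivative_exists[unfolded tensor_derivative_def, OF h C bspec[OF u]])
qed simp

end
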